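(* Let $n\ge1$ and let $W=G(2,1,n)$ or $W=G(2,2,n)$. Let $\tau$ be either a simple $G(2,1,n)$-module (when $W=G(2,1,n)$), or a simple $G(2,2,n)$-module corresponding to a bipartition $(\lambda,\mu)$ of $n$ with $\lambda\neq\mu$ (when $W=G(2,2,n)$). Then $$M_c(\tau)_{\mathcal F}^{\phi}\cong\underline M_{\underline c}(\underline\tau)$$ as modules over the negative braided Cherednik algebra $\underline{\mathcal H}=\underline H_{1,\underline c}(\mu(W))$, where $c=-\underline c$.
   Context: Groups. $C_k\subset\mathbb C^\times$ is the group of $k$-th roots of unity. $B_n=G(2,1,n)$ is the group of $n\times n$ monomial matrices with non-zero entries $\pm1$; $D_n=G(2,2,n)$ is the subgroup where the product of the non-zero entries is $1$. $\mu(G(2,1,n))=G(2,1,n)$, and $\mu(G(2,2,n))$ is the subgroup of $B_n$ of matrices of determinant $1$. These act on $V$ with basis $x_1,\dots,x_n$; $y_1,\dots,y_n$ is the dual basis of $V^*$. For $\epsilon=\pm1$, $i\neq j$: $s_{ij}^{(\epsilon)}$ sends $x_i\mapsto\epsilon^{-1}x_j$, $x_j\mapsto\epsilon x_i$ and $\sigma_{ij}^{(\epsilon)}$ sends $x_i\mapsto\epsilon^{-1}x_j$, $x_j\mapsto-\epsilon x_i$, both fixing the other $x_k$; $t_i$ sends $x_i\mapsto-x_i$ and fixes the other $x_k$. $s_i=s_{i,i+1}^{(1)}$, $\bar s_i=s_{i,i+1}^{(-1)}$, $\sigma_i=\sigma_{i,i+1}^{(1)}$. $T=\langle t_1,\dots,t_n\rangle\cong(C_2)^n$.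 Algebras. Let $W=G(2,p,n)$, $p\in\{1,2\}$. $\mathcal H=H_c(W)$ is the rational Cherednik algebra with $t=1$: the unital $\mathbb C$-algebra generated by the $x_i,y_i$ and $\mathbb CW$ with relations (for $i\ne j$, $g\in W$) $x_ix_j=x_jx_i$, $y_iy_j=y_jy_i$, $gx_i=g(x_i)g$, $gy_i=g(y_i)g$, $y_ix_j-x_jy_i=c_1\sum_{\epsilon\in C_2}\epsilon s_{ij}^{(\epsilon)}$, $y_ix_i-x_iy_i=1-c_1\sum_{j\neq i}\sum_{\epsilon\in C_2}s_{ij}^{(\epsilon)}-\delta_{p,1}c_{-1}t_i$. $\underline{\mathcal H}=\underline H_{1,\underline c}(\mu(W))$ is the unital $\mathbb C$-algebra generated by $x_i,y_i$ and $\mathbb C\mu(W)$ with relations (for $i\ne j$, $g\in\mu(W)$) $x_ix_j=-x_jx_i$, $y_iy_j=-y_jy_i$, $gx_i=g(x_i)g$, $gy_i=g(y_i)g$, $y_ix_j+x_jy_i=\underline c_1\sum_{\epsilon\in C_2}\epsilon\sigma_{ij}^{(\epsilon)}$, $y_ix_i-x_iy_i=1+\underline c_1\sum_{j\ne i}\sum_{\epsilon\in C_2}\sigma_{ij}^{(\epsilon)}+\delta_{p,1}\underline c_{-1}t_i$. The complex parameters satisfy $c_1=-\underline c_1$ and, if $p=1$, $c_{-1}=-\underline c_{-1}$. Twist. $\mathcal H$ is a $\mathbb CT$-module algebra via $t_i\rhd g=t_igt_i$, $t_i\rhd x_j=(-1)^{\delta_{ij}}x_j$, $t_i\rhd y_j=(-1)^{\delta_{ij}}y_j$.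 Let $\mathcal F=\mathcal F^{-1}=\prod_{1\le j<i\le n}\frac12(1\otimes1+t_i\otimes1+1\otimes t_j-t_i\otimes t_j)\in\mathbb CT\otimes\mathbb CT$, a $2$-cocycle. $\mathcal H_{\mathcal F}$ is the space $\mathcal H$ with product $m\circ(\mathcal F^{-1}\rhd)$, $m$ the product of $\mathcal H$. It is known that there is an algebra isomorphism $\phi\colon\underline{\mathcal H}\to\mathcal H_{\mathcal F}$ with $\phi(\sigma_i)=\bar s_i$, $\phi(g)=g$ for diagonal $g\in\mu(W)$, $\phi(x_j)=x_j$, $\phi(y_j)=y_j$. If $M$ is both an $\mathcal H$-module and a $T$-module with $h\rhd(a\rhd v)=(h\rhd a)\rhd(h\rhd v)$ for $h\in T$, $a\in\mathcal H$, $v\in M$, then $M_{\mathcal F}$ denotes its Giaquinto–Zhang twist: the space $M$ with $\mathcal H_{\mathcal F}$-action $\rhd\circ(\mathcal F^{-1}\rhd)$. $M_{\mathcal F}^\phi$ is the $\underline{\mathcal H}$-module obtained by pulling back $M_{\mathcal F}$ along $\phi$. Standard modules. For a simple $\mathbb CW$-module $\tau$, $M_c(\tau)=\mathcal H\otimes_{S(V)\rtimes W}\tau$, where $S(V)$ acts on $\tau$ through evaluation of polynomials at $0$ (so $V$ acts by zero). For a simple $\mathbb C\mu(W)$-module $\tau'$, $\underline M_{\underline c}(\tau')=\underline{\mathcal H}\otimes_{S_{-1}(V)\rtimes\mu(W)}\tau'$, with $V$ acting on $\tau'$ by zero; here $S_{-1}(V)$ is the subalgebra generated by the anticommuting $x_1,\dots,x_n$.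 $T$-action on $M_c(\tau)$. As a vector space $M_c(\tau)=S(V^* )\otimes\tau$, and $T$ acts by $h\rhd(a\otimes v)=(h\rhd a)\otimes(h\rhd v)$, where $T$ acts on $\tau$ as follows. If $W=B_n$, restrict the $B_n$-action to $T\subset B_n$. If $W=D_n$ and $\tau=\tau^D_{(\lambda,\mu)}$ with $\lambda\ne\mu$, i.e. $\tau$ is the restriction to $D_n$ of the simple $B_n$-module $\tau^B_{(\lambda,\mu)}$ (and also of $\tau^B_{(\mu,\lambda)}$), extend $\tau$ to one (either one) of these two $B_n$-modules and restrict to $T$. Here $\tau^B_{(\lambda,\mu)}$ ($\lambda\vdash a$, $\mu\vdash b$, $a+b=n$) is the simple module with character $\mathrm{Ind}_{B_a\times B_b}^{B_n}(\tilde\chi_\lambda\boxtimes(\epsilon'_b\otimes\tilde\chi_\mu))$, where tilde denotes pullback of an irreducible symmetric group character along $B_a\to S_a$ (resp. $B_b\to S_b$) and $\epsilon'_b$ is the linear character with $t_i\mapsto-1$, $s_i\mapsto1$. The module $\underline\tau$. With $\mathbf i^2=-1$, let $J_{-\mathbf i}$ be the algebra automorphism of $\mathbb CB_n$ with $t_i\mapsto t_i$, $s_i\mapsto\frac12s_i((1-\mathbf i)t_i+(1+\mathbf i)t_{i+1})$; it restricts to an isomorphism $\mathbb C\mu(W)\to\mathbb CW$. $\underline\tau$ is the $\mathbb C\mu(W)$-module obtained by pulling back $\tau$ along $J_{-\mathbf i}$. *)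

theory Defs
  imports
    "HOL-Algebra.Algebra"
    "HOL-Library.Poly_Mapping"
    "HOL-Combinatorics.Permutations"
    "Jordan_Normal_Form.VS_Connect"
    "Jordan_Normal_Form.Determinant"
begin

section \<open>Complex algebras and their modules\<close>

text \<open>
  The record type \<open>(complex, 'a) module\<close> carries both a multiplication and a scalar multiplication,
  so it serves for unital \<open>\<complex>\<close>-algebras. It also serves for bare complex vector spaces, in which case
  the fields \<open>mult\<close> and \<open>one\<close> are irrelevant. \<open>class_ring\<close> is here the field of complex numbers.
\<close>

definition monoid_alg :: "('g, 'm) monoid_scheme \<Rightarrow> (complex, 'g \<Rightarrow>\<^sub>0 complex) module" where
  "monoid_alg G = \<lparr>
     carrier = {f. Poly_Mapping.keys f \<subseteq> carrier G},
     monoid.mult = (\<lambda>f g. \<Sum>u\<in>Poly_Mapping.keys f. \<Sum>v\<in>Poly_Mapping.keys g.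
               Poly_Mapping.single (u \<otimes>\<^bsub>G\<^esub> v) (Poly_Mapping.lookup f u * Poly_Mapping.lookup g v)),
     monoid.one = Poly_Mapping.single \<one>\<^bsub>G\<^esub> 1,
     ring.zero = 0,
     ring.add = (+),
     module.smult = (\<lambda>c. Poly_Mapping.map ((*) c))\<rparr>"

definition free_monoid :: "'s set \<Rightarrow> 's list monoid" where
  "free_monoid S = \<lparr>carrier = lists S, monoid.mult = (@), monoid.one = []\<rparr>"

definition free_alg :: "'s set \<Rightarrow> (complex, 's list \<Rightarrow>\<^sub>0 complex) module" where
  "free_alg S = monoid_alg (free_monoid S)"

abbreviation word :: "'s list \<Rightarrow> 's list \<Rightarrow>\<^sub>0 complex" where
  "word w \<equiv> Poly_Mapping.single w 1"

definition alg_iso ::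
    "(complex, 'a) module \<Rightarrow> (complex, 'b) module \<Rightarrow> ('a \<Rightarrow> 'b) set" where
  "alg_iso A B = {\<phi> \<in> ring_iso A B. \<forall>c. \<forall>a\<in>carrier A. \<phi> (c \<odot>\<^bsub>A\<^esub> a) = c \<odot>\<^bsub>B\<^esub> \<phi> a}"

definition coset_smult ::
    "(complex, 'a) module \<Rightarrow> 'a set \<Rightarrow> complex \<Rightarrow> 'a set \<Rightarrow> 'a set" where
  "coset_smult V N c Z = (\<Union>v\<in>Z. N +>\<^bsub>V\<^esub> (c \<odot>\<^bsub>V\<^esub> v))"

definition quot_space ::
    "(complex, 'a) module \<Rightarrow> 'a set \<Rightarrow> (complex, 'a set) module" where
  "quot_space V N = \<lparr>
     carrier = a_rcosets\<^bsub>V\<^esub> N, monoid.mult = undefined, monoid.one = undefined,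
     ring.zero = N, ring.add = set_add V, module.smult = coset_smult V N\<rparr>"

definition quot_alg ::
    "(complex, 'a) module \<Rightarrow> 'a set \<Rightarrow> (complex, 'a set) module" where
  "quot_alg A I = ring.extend (A Quot I) (module.fields (coset_smult A I))"

text \<open>The unital algebra with generators \<open>S\<close> and relators \<open>R\<close>; \<open>genideal\<close> is two-sided.\<close>

definition presented ::
    "'s set \<Rightarrow> ('s list \<Rightarrow>\<^sub>0 complex) set \<Rightarrow> (complex, ('s list \<Rightarrow>\<^sub>0 complex) set) module" where
  "presented S R = quot_alg (free_alg S) (genideal (free_alg S) R)"

definition presented_gen ::
    "'s set \<Rightarrow> ('s list \<Rightarrow>\<^sub>0 complex) set \<Rightarrow> 's \<Rightarrow> ('s list \<Rightarrow>\<^sub>0 complex) set" where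
  "presented_gen S R s = genideal (free_alg S) R +>\<^bsub>free_alg S\<^esub> word [s]"

definition free_ext ::
    "(complex, 'b) module \<Rightarrow> ('s \<Rightarrow> 'b) \<Rightarrow> ('s list \<Rightarrow>\<^sub>0 complex) \<Rightarrow> 'b" where
  "free_ext B f F = (\<Oplus>\<^bsub>B\<^esub>w\<in>Poly_Mapping.keys F.
     Poly_Mapping.lookup F w \<odot>\<^bsub>B\<^esub> foldr (\<lambda>s b. f s \<otimes>\<^bsub>B\<^esub> b) w \<one>\<^bsub>B\<^esub>)"

text \<open>
  The homomorphism from a presented algebra to \<open>B\<close> that takes the values \<open>f\<close> on the generators
  (meaningful when \<open>f\<close> respects the relations); elements of a presented algebra are cosets.
\<close>

definition presented_hom ::
    "(complex, 'b) module \<Rightarrow> ('s \<Rightarrow> 'b) \<Rightarrow> ('s list \<Rightarrow>\<^sub>0 complex) set \<Rightarrow> 'b" where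
  "presented_hom B f Z = (THE b. \<forall>F\<in>Z. free_ext B f F = b)"

definition alg_module ::
    "(complex, 'a) module \<Rightarrow> (complex, 'v) module \<Rightarrow> ('a \<Rightarrow> 'v \<Rightarrow> 'v) \<Rightarrow> bool" where
  "alg_module A V act \<longleftrightarrow>
     vectorspace class_ring V \<and>
     (\<forall>a\<in>carrier A. linear_map class_ring V V (act a)) \<and>
     (\<forall>a\<in>carrier A. \<forall>b\<in>carrier A. \<forall>v\<in>carrier V.
        act (a \<oplus>\<^bsub>A\<^esub> b) v = act a v \<oplus>\<^bsub>V\<^esub> act b v \<and>
        act (a \<otimes>\<^bsub>A\<^esub> b) v = act a (act b v)) \<and>
     (\<forall>c. \<forall>a\<in>carrier A. \<forall>v\<in>carrier V. act (c \<odot>\<^bsub>A\<^esub> a) v = c \<odot>\<^bsub>V\<^esub> act a v) \<and>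
     (\<forall>v\<in>carrier V. act \<one>\<^bsub>A\<^esub> v = v)"

definition simple_alg_module ::
    "(complex, 'a) module \<Rightarrow> (complex, 'v) module \<Rightarrow> ('a \<Rightarrow> 'v \<Rightarrow> 'v) \<Rightarrow> bool" where
  "simple_alg_module A V act \<longleftrightarrow>
     alg_module A V act \<and> carrier V \<noteq> {\<zero>\<^bsub>V\<^esub>} \<and>
     (\<forall>U. subspace class_ring U V \<and> (\<forall>a\<in>carrier A. \<forall>u\<in>U. act a u \<in> U)
        \<longrightarrow> U = {\<zero>\<^bsub>V\<^esub>} \<or> U = carrier V)"

definition alg_module_isomorphic ::
    "(complex, 'a) module \<Rightarrow> (complex, 'v) module \<Rightarrow> ('a \<Rightarrow> 'v \<Rightarrow> 'v)
       \<Rightarrow> (complex, 'w) module \<Rightarrow> ('a \<Rightarrow> 'w \<Rightarrow> 'w) \<Rightarrow> bool" where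
  "alg_module_isomorphic A V act W act' \<longleftrightarrow>
     alg_module A V act \<and> alg_module A W act' \<and>
     (\<exists>f. linear_map class_ring V W f \<and> bij_betw f (carrier V) (carrier W) \<and>
          (\<forall>a\<in>carrier A. \<forall>v\<in>carrier V. f (act a v) = act' a (f v)))"

section \<open>Induced modules\<close>

text \<open>
  A module over a subalgebra \<open>B\<close> of \<open>A\<close> is given by the operators by which generators of \<open>B\<close> act;
  \<open>subalg_action A V \<Gamma>\<close> is the resulting set of all pairs \<open>(b, action of b)\<close> with \<open>b \<in> B\<close>.
\<close>

inductive_set subalg_action ::
    "(complex, 'a) module \<Rightarrow> (complex, 'v) module \<Rightarrow> ('a \<times> ('v \<Rightarrow> 'v)) set \<Rightarrow> ('a \<times> ('v \<Rightarrow> 'v)) set"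
  for A :: "(complex, 'a) module" and V :: "(complex, 'v) module" and \<Gamma> :: "('a \<times> ('v \<Rightarrow> 'v)) set"
where
  base: "(b, \<beta>) \<in> \<Gamma> \<Longrightarrow> (b, \<beta>) \<in> subalg_action A V \<Gamma>"
| one: "(\<one>\<^bsub>A\<^esub>, \<lambda>v. v) \<in> subalg_action A V \<Gamma>"
| add: "(b, \<beta>) \<in> subalg_action A V \<Gamma> \<Longrightarrow> (b', \<beta>') \<in> subalg_action A V \<Gamma> \<Longrightarrow>
    (b \<oplus>\<^bsub>A\<^esub> b', \<lambda>v. \<beta> v \<oplus>\<^bsub>V\<^esub> \<beta>' v) \<in> subalg_action A V \<Gamma>"
| mult: "(b, \<beta>) \<in> subalg_action A V \<Gamma> \<Longrightarrow> (b', \<beta>') \<in> subalg_action A V \<Gamma> \<Longrightarrow>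
    (b \<otimes>\<^bsub>A\<^esub> b', \<lambda>v. \<beta> (\<beta>' v)) \<in> subalg_action A V \<Gamma>"
| smult: "(b, \<beta>) \<in> subalg_action A V \<Gamma> \<Longrightarrow>
    (c \<odot>\<^bsub>A\<^esub> b, \<lambda>v. c \<odot>\<^bsub>V\<^esub> \<beta> v) \<in> subalg_action A V \<Gamma>"

definition free_space :: "'b set \<Rightarrow> (complex, 'b \<Rightarrow>\<^sub>0 complex) module" where
  "free_space S = \<lparr>
     carrier = {f. Poly_Mapping.keys f \<subseteq> S}, monoid.mult = undefined, monoid.one = undefined,
     ring.zero = 0, ring.add = (+), module.smult = (\<lambda>c. Poly_Mapping.map ((*) c))\<rparr>"

definition map_basis :: "('b \<Rightarrow> 'c) \<Rightarrow> ('b \<Rightarrow>\<^sub>0 complex) \<Rightarrow> ('c \<Rightarrow>\<^sub>0 complex)" where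
  "map_basis h F = (\<Sum>b\<in>Poly_Mapping.keys F. Poly_Mapping.single (h b) (Poly_Mapping.lookup F b))"

abbreviation pure :: "'a \<Rightarrow> 'v \<Rightarrow> ('a \<times> 'v) \<Rightarrow>\<^sub>0 complex" where
  "pure a v \<equiv> Poly_Mapping.single (a, v) 1"

definition tensor_relators ::
    "(complex, 'a) module \<Rightarrow> (complex, 'v) module \<Rightarrow> ('a \<times> ('v \<Rightarrow> 'v)) set \<Rightarrow> (('a \<times> 'v) \<Rightarrow>\<^sub>0 complex) set"
where
  "tensor_relators A V \<Theta> =
     {pure (a \<oplus>\<^bsub>A\<^esub> b) v - pure a v - pure b v | a b v.
        a \<in> carrier A \<and> b \<in> carrier A \<and> v \<in> carrier V} \<union>
     {pure a (v \<oplus>\<^bsub>V\<^esub> w) - pure a v - pure a w | a v w.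
        a \<in> carrier A \<and> v \<in> carrier V \<and> w \<in> carrier V} \<union>
     {pure (c \<odot>\<^bsub>A\<^esub> a) v - Poly_Mapping.single (a, v) c | c a v.
        a \<in> carrier A \<and> v \<in> carrier V} \<union>
     {pure a (c \<odot>\<^bsub>V\<^esub> v) - Poly_Mapping.single (a, v) c | c a v.
        a \<in> carrier A \<and> v \<in> carrier V} \<union>
     {pure (a \<otimes>\<^bsub>A\<^esub> b) v - pure a (\<beta> v) | a b \<beta> v.
        a \<in> carrier A \<and> (b, \<beta>) \<in> \<Theta> \<and> v \<in> carrier V}"

definition tensor_kernel ::
    "(complex, 'a) module \<Rightarrow> (complex, 'v) module \<Rightarrow> ('a \<times> ('v \<Rightarrow> 'v)) set \<Rightarrow> (('a \<times> 'v) \<Rightarrow>\<^sub>0 complex) set"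
where
  "tensor_kernel A V \<Theta> = LinearCombinations.module.span class_ring
     (free_space (carrier A \<times> carrier V)) (tensor_relators A V \<Theta>)"

text \<open>
  \<open>A \<otimes>\<^sub>B V\<close> as a quotient of the free vector space on \<open>A \<times> V\<close>, where \<open>\<Theta>\<close> is the set of pairs
  \<open>(b, action of b on V)\<close>, \<open>b \<in> B\<close>.
\<close>

definition tensor_space ::
    "(complex, 'a) module \<Rightarrow> (complex, 'v) module \<Rightarrow> ('a \<times> ('v \<Rightarrow> 'v)) set
       \<Rightarrow> (complex, (('a \<times> 'v) \<Rightarrow>\<^sub>0 complex) set) module" where
  "tensor_space A V \<Theta> = quot_space (free_space (carrier A \<times> carrier V)) (tensor_kernel A V \<Theta>)"

definition tensor_map ::
    "(complex, 'a) module \<Rightarrow> (complex, 'v) module \<Rightarrow> ('a \<times> ('v \<Rightarrow> 'v)) set \<Rightarrow>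
       ('a \<Rightarrow> 'a) \<Rightarrow> ('v \<Rightarrow> 'v) \<Rightarrow>
       (('a \<times> 'v) \<Rightarrow>\<^sub>0 complex) set \<Rightarrow> (('a \<times> 'v) \<Rightarrow>\<^sub>0 complex) set" where
  "tensor_map A V \<Theta> f g Z =
     (\<Union>F\<in>Z. tensor_kernel A V \<Theta> +>\<^bsub>free_space (carrier A \<times> carrier V)\<^esub>
        map_basis (\<lambda>(a, v). (f a, g v)) F)"

definition tensor_act ::
    "(complex, 'a) module \<Rightarrow> (complex, 'v) module \<Rightarrow> ('a \<times> ('v \<Rightarrow> 'v)) set \<Rightarrow> 'a \<Rightarrow>
       (('a \<times> 'v) \<Rightarrow>\<^sub>0 complex) set \<Rightarrow> (('a \<times> 'v) \<Rightarrow>\<^sub>0 complex) set" where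
  "tensor_act A V \<Theta> a = tensor_map A V \<Theta> (\<lambda>b. a \<otimes>\<^bsub>A\<^esub> b) (\<lambda>v. v)"

section \<open>The monomial groups\<close>

text \<open>
  Indices run over \<open>{0..<n}\<close> instead of \<open>{1..n}\<close>. A matrix \<open>g\<close> acts by \<open>x\<^sub>j \<mapsto> \<Sum>\<^sub>i g\<^sub>i\<^sub>j x\<^sub>i\<close>.
\<close>

definition roots_of_unity :: "nat \<Rightarrow> complex set" where
  "roots_of_unity k = {z. z ^ k = 1}"

definition monomial_mat :: "nat \<Rightarrow> complex mat \<Rightarrow> bool" where
  "monomial_mat n g \<longleftrightarrow> g \<in> carrier_mat n n \<and>
     (\<forall>i<n. \<exists>!j. j < n \<and> g $$ (i, j) \<noteq> 0) \<and>
     (\<forall>j<n. \<exists>!i. i < n \<and> g $$ (i, j) \<noteq> 0)"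

definition entry_prod :: "nat \<Rightarrow> complex mat \<Rightarrow> complex" where
  "entry_prod n g =
     (\<Prod>(i, j)\<in>{(i, j). i < n \<and> j < n \<and> g $$ (i, j) \<noteq> 0}. g $$ (i, j))"

definition Gmpn :: "nat \<Rightarrow> nat \<Rightarrow> nat \<Rightarrow> complex mat set" where
  "Gmpn m p n = {g. monomial_mat n g \<and>
     (\<forall>i<n. \<forall>j<n. g $$ (i, j) \<noteq> 0 \<longrightarrow> g $$ (i, j) \<in> roots_of_unity m) \<and>
     entry_prod n g \<in> roots_of_unity (m div p)}"

text \<open>The group \<open>\<mu>(G(2,p,n))\<close> for \<open>p \<in> {1, 2}\<close>.\<close>

definition mu :: "nat \<Rightarrow> nat \<Rightarrow> complex mat set" where
  "mu p n = (if p = 1 then Gmpn 2 1 n else {g \<in> Gmpn 2 1 n. Determinant.det g = 1})"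

definition mat_group :: "nat \<Rightarrow> complex mat set \<Rightarrow> complex mat monoid" where
  "mat_group n W = \<lparr>carrier = W, monoid.mult = (*), monoid.one = 1\<^sub>m n\<rparr>"

definition B_group :: "nat \<Rightarrow> complex mat monoid" where
  "B_group n = mat_group n (Gmpn 2 1 n)"

definition s_refl :: "nat \<Rightarrow> nat \<Rightarrow> nat \<Rightarrow> complex \<Rightarrow> complex mat" where
  "s_refl n i j \<epsilon> = mat n n (\<lambda>(a, b).
     if b = i then (if a = j then inverse \<epsilon> else 0)
     else if b = j then (if a = i then \<epsilon> else 0)
     else if a = b then 1 else 0)"

definition sigma_refl :: "nat \<Rightarrow> nat \<Rightarrow> nat \<Rightarrow> complex \<Rightarrow> complex mat" where
  "sigma_refl n i j \<epsilon> = mat n n (\<lambda>(a, b).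
     if b = i then (if a = j then inverse \<epsilon> else 0)
     else if b = j then (if a = i then - \<epsilon> else 0)
     else if a = b then 1 else 0)"

definition t_refl :: "nat \<Rightarrow> nat \<Rightarrow> complex mat" where
  "t_refl n i = mat n n (\<lambda>(a, b). if a = b then (if a = i then - 1 else 1) else 0)"

definition T_group :: "nat \<Rightarrow> complex mat monoid" where
  "T_group n = (B_group n)\<lparr>carrier := generate (B_group n) (t_refl n ` {..<n})\<rparr>"

abbreviation grp :: "'g \<Rightarrow> 'g \<Rightarrow>\<^sub>0 complex" where
  "grp g \<equiv> Poly_Mapping.single g 1"

section \<open>Cherednik algebras\<close>

datatype gen = X_gen nat | Y_gen nat | G_gen "complex mat"

definition gens :: "nat \<Rightarrow> complex mat set \<Rightarrow> gen set" where
  "gens n W = X_gen ` {..<n} \<union> Y_gen ` {..<n} \<union> G_gen ` W"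

text \<open>
  Relators of the group algebra of \<open>W\<close> and the commutation of \<open>W\<close> with the \<open>x\<^sub>i\<close> and \<open>y\<^sub>i\<close>. On the
  dual basis, \<open>(g y\<^sub>i)(x\<^sub>k) = y\<^sub>i(g\<^sup>-\<^sup>1 x\<^sub>k)\<close>, so \<open>g y\<^sub>i = \<Sum>\<^sub>k (g\<^sup>-\<^sup>1)\<^sub>i\<^sub>k y\<^sub>k\<close>.
\<close>

definition group_relators :: "nat \<Rightarrow> complex mat set \<Rightarrow> (gen list \<Rightarrow>\<^sub>0 complex) set" where
  "group_relators n W =
     {word [G_gen g, G_gen h] - word [G_gen (g * h)] | g h. g \<in> W \<and> h \<in> W} \<union>
     {word [G_gen (1\<^sub>m n)] - word []} \<union>
     {word [G_gen g, X_gen i]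
        - (\<Sum>k<n. Poly_Mapping.single [X_gen k, G_gen g] (g $$ (k, i))) | g i. g \<in> W \<and> i < n} \<union>
     {word [G_gen g, Y_gen i]
        - (\<Sum>k<n. Poly_Mapping.single [Y_gen k, G_gen g] ((inv\<^bsub>mat_group n W\<^esub> g) $$ (i, k))) | g i.
        g \<in> W \<and> i < n}"

definition rca_relators :: "nat \<Rightarrow> nat \<Rightarrow> complex \<Rightarrow> complex \<Rightarrow> (gen list \<Rightarrow>\<^sub>0 complex) set" where
  "rca_relators p n c1 cm1 =
     group_relators n (Gmpn 2 p n) \<union>
     {word [X_gen i, X_gen j] - word [X_gen j, X_gen i] | i j. i < n \<and> j < n \<and> i \<noteq> j} \<union>
     {word [Y_gen i, Y_gen j] - word [Y_gen j, Y_gen i] | i j. i < n \<and> j < n \<and> i \<noteq> j} \<union>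
     {word [Y_gen i, X_gen j] - word [X_gen j, Y_gen i]
        - (\<Sum>\<epsilon>\<in>roots_of_unity 2. Poly_Mapping.single [G_gen (s_refl n i j \<epsilon>)] (c1 * \<epsilon>)) | i j.
        i < n \<and> j < n \<and> i \<noteq> j} \<union>
     {word [Y_gen i, X_gen i] - word [X_gen i, Y_gen i]
        - (word []
           - (\<Sum>j\<in>{..<n} - {i}. \<Sum>\<epsilon>\<in>roots_of_unity 2.
                Poly_Mapping.single [G_gen (s_refl n i j \<epsilon>)] c1)
           - (if p = 1 then Poly_Mapping.single [G_gen (t_refl n i)] cm1 else 0)) | i. i < n}"

definition nbca_relators :: "nat \<Rightarrow> nat \<Rightarrow> complex \<Rightarrow> complex \<Rightarrow> (gen list \<Rightarrow>\<^sub>0 complex) set" where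
  "nbca_relators p n c1 cm1 =
     group_relators n (mu p n) \<union>
     {word [X_gen i, X_gen j] + word [X_gen j, X_gen i] | i j. i < n \<and> j < n \<and> i \<noteq> j} \<union>
     {word [Y_gen i, Y_gen j] + word [Y_gen j, Y_gen i] | i j. i < n \<and> j < n \<and> i \<noteq> j} \<union>
     {word [Y_gen i, X_gen j] + word [X_gen j, Y_gen i]
        - (\<Sum>\<epsilon>\<in>roots_of_unity 2. Poly_Mapping.single [G_gen (sigma_refl n i j \<epsilon>)] (c1 * \<epsilon>)) | i j.
        i < n \<and> j < n \<and> i \<noteq> j} \<union>
     {word [Y_gen i, X_gen i] - word [X_gen i, Y_gen i]
        - (word []
           + (\<Sum>j\<in>{..<n} - {i}. \<Sum>\<epsilon>\<in>roots_of_unity 2.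
                Poly_Mapping.single [G_gen (sigma_refl n i j \<epsilon>)] c1)
           + (if p = 1 then Poly_Mapping.single [G_gen (t_refl n i)] cm1 else 0)) | i. i < n}"

type_synonym pres = "(gen list \<Rightarrow>\<^sub>0 complex) set"

text \<open>The rational Cherednik algebra \<open>H\<^sub>c(G(2,p,n))\<close> with \<open>t = 1\<close>, \<open>c = (c1, cm1)\<close>.\<close>

definition rca :: "nat \<Rightarrow> nat \<Rightarrow> complex \<Rightarrow> complex \<Rightarrow> (complex, pres) module" where
  "rca p n c1 cm1 = presented (gens n (Gmpn 2 p n)) (rca_relators p n c1 cm1)"

definition rca_gen :: "nat \<Rightarrow> nat \<Rightarrow> complex \<Rightarrow> complex \<Rightarrow> gen \<Rightarrow> pres" where
  "rca_gen p n c1 cm1 = presented_gen (gens n (Gmpn 2 p n)) (rca_relators p n c1 cm1)"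

text \<open>The negative braided Cherednik algebra of \<open>\<mu>(G(2,p,n))\<close>.\<close>

definition nbca :: "nat \<Rightarrow> nat \<Rightarrow> complex \<Rightarrow> complex \<Rightarrow> (complex, pres) module" where
  "nbca p n c1 cm1 = presented (gens n (mu p n)) (nbca_relators p n c1 cm1)"

definition nbca_gen :: "nat \<Rightarrow> nat \<Rightarrow> complex \<Rightarrow> complex \<Rightarrow> gen \<Rightarrow> pres" where
  "nbca_gen p n c1 cm1 = presented_gen (gens n (mu p n)) (nbca_relators p n c1 cm1)"

section \<open>Standard modules\<close>

text \<open>
  The generators \<open>x\<^sub>i\<close> of \<open>S(V)\<close> (resp. \<open>S\<^sub>-\<^sub>1(V)\<close>) act by zero and \<open>g \<in> W\<close> acts as on the given
  \<open>\<complex>W\<close>-module \<open>(V, \<tau>)\<close>; \<open>\<iota>\<close> embeds the generators into the ambient algebra.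
\<close>

definition std_action ::
    "(complex, 'a) module \<Rightarrow> (gen \<Rightarrow> 'a) \<Rightarrow> nat \<Rightarrow> complex mat set \<Rightarrow> (complex, 'v) module \<Rightarrow>
       ((complex mat \<Rightarrow>\<^sub>0 complex) \<Rightarrow> 'v \<Rightarrow> 'v) \<Rightarrow> ('a \<times> ('v \<Rightarrow> 'v)) set" where
  "std_action A \<iota> n W V \<tau> = subalg_action A V
     ({(\<iota> (X_gen i), \<lambda>v. \<zero>\<^bsub>V\<^esub>) | i. i < n} \<union> {(\<iota> (G_gen g), \<tau> (grp g)) | g. g \<in> W})"

type_synonym 'v std = "((pres \<times> 'v) \<Rightarrow>\<^sub>0 complex) set"

definition rca_std_action ::
    "nat \<Rightarrow> nat \<Rightarrow> complex \<Rightarrow> complex \<Rightarrow> (complex, 'v) module \<Rightarrow>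
       ((complex mat \<Rightarrow>\<^sub>0 complex) \<Rightarrow> 'v \<Rightarrow> 'v) \<Rightarrow> (pres \<times> ('v \<Rightarrow> 'v)) set" where
  "rca_std_action p n c1 cm1 V \<tau> =
     std_action (rca p n c1 cm1) (rca_gen p n c1 cm1) n (Gmpn 2 p n) V \<tau>"

definition rca_std ::
    "nat \<Rightarrow> nat \<Rightarrow> complex \<Rightarrow> complex \<Rightarrow> (complex, 'v) module \<Rightarrow>
       ((complex mat \<Rightarrow>\<^sub>0 complex) \<Rightarrow> 'v \<Rightarrow> 'v) \<Rightarrow> (complex, 'v std) module" where
  "rca_std p n c1 cm1 V \<tau> =
     tensor_space (rca p n c1 cm1) V (rca_std_action p n c1 cm1 V \<tau>)"

definition rca_std_act ::
    "nat \<Rightarrow> nat \<Rightarrow> complex \<Rightarrow> complex \<Rightarrow> (complex, 'v) module \<Rightarrow>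
       ((complex mat \<Rightarrow>\<^sub>0 complex) \<Rightarrow> 'v \<Rightarrow> 'v) \<Rightarrow> pres \<Rightarrow> 'v std \<Rightarrow> 'v std" where
  "rca_std_act p n c1 cm1 V \<tau> =
     tensor_act (rca p n c1 cm1) V (rca_std_action p n c1 cm1 V \<tau>)"

definition nbca_std_action ::
    "nat \<Rightarrow> nat \<Rightarrow> complex \<Rightarrow> complex \<Rightarrow> (complex, 'v) module \<Rightarrow>
       ((complex mat \<Rightarrow>\<^sub>0 complex) \<Rightarrow> 'v \<Rightarrow> 'v) \<Rightarrow> (pres \<times> ('v \<Rightarrow> 'v)) set" where
  "nbca_std_action p n c1 cm1 V \<tau> =
     std_action (nbca p n c1 cm1) (nbca_gen p n c1 cm1) n (mu p n) V \<tau>"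

definition nbca_std ::
    "nat \<Rightarrow> nat \<Rightarrow> complex \<Rightarrow> complex \<Rightarrow> (complex, 'v) module \<Rightarrow>
       ((complex mat \<Rightarrow>\<^sub>0 complex) \<Rightarrow> 'v \<Rightarrow> 'v) \<Rightarrow> (complex, 'v std) module" where
  "nbca_std p n c1 cm1 V \<tau> =
     tensor_space (nbca p n c1 cm1) V (nbca_std_action p n c1 cm1 V \<tau>)"

definition nbca_std_act ::
    "nat \<Rightarrow> nat \<Rightarrow> complex \<Rightarrow> complex \<Rightarrow> (complex, 'v) module \<Rightarrow>
       ((complex mat \<Rightarrow>\<^sub>0 complex) \<Rightarrow> 'v \<Rightarrow> 'v) \<Rightarrow> pres \<Rightarrow> 'v std \<Rightarrow> 'v std" where
  "nbca_std_act p n c1 cm1 V \<tau> =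
     tensor_act (nbca p n c1 cm1) V (nbca_std_action p n c1 cm1 V \<tau>)"

section \<open>The twist\<close>

text \<open>
  \<open>h \<in> T\<close> acts on the algebra by the automorphism \<open>g \<mapsto> h g h\<^sup>-\<^sup>1\<close>, \<open>x\<^sub>j \<mapsto> h\<^sub>j\<^sub>j x\<^sub>j\<close>, \<open>y\<^sub>j \<mapsto> h\<^sub>j\<^sub>j y\<^sub>j\<close>,
  which for \<open>h = t\<^sub>i = t\<^sub>i\<^sup>-\<^sup>1\<close> is \<open>g \<mapsto> t\<^sub>i g t\<^sub>i\<close>, \<open>x\<^sub>j \<mapsto> (-1)\<^bsup>\<delta>\<^esup> x\<^sub>j\<close>, \<open>y\<^sub>j \<mapsto> (-1)\<^bsup>\<delta>\<^esup> y\<^sub>j\<close> with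
  \<open>\<delta> = \<delta>\<^sub>i\<^sub>j\<close>.
\<close>

fun T_on_gen :: "nat \<Rightarrow> nat \<Rightarrow> complex \<Rightarrow> complex \<Rightarrow> complex mat \<Rightarrow> gen \<Rightarrow> pres" where
  "T_on_gen p n c1 cm1 h (X_gen j) = h $$ (j, j) \<odot>\<^bsub>rca p n c1 cm1\<^esub> rca_gen p n c1 cm1 (X_gen j)"
| "T_on_gen p n c1 cm1 h (Y_gen j) = h $$ (j, j) \<odot>\<^bsub>rca p n c1 cm1\<^esub> rca_gen p n c1 cm1 (Y_gen j)"
| "T_on_gen p n c1 cm1 h (G_gen g) = rca_gen p n c1 cm1 (G_gen (h * g * inv\<^bsub>B_group n\<^esub> h))"

definition T_on_rca :: "nat \<Rightarrow> nat \<Rightarrow> complex \<Rightarrow> complex \<Rightarrow> complex mat \<Rightarrow> pres \<Rightarrow> pres" where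
  "T_on_rca p n c1 cm1 h = presented_hom (rca p n c1 cm1) (T_on_gen p n c1 cm1 h)"

text \<open>\<open>h \<rhd> (a \<otimes> v) = (h \<rhd> a) \<otimes> (h \<rhd> v)\<close>, with \<open>T\<close> acting on \<open>V\<close> through the \<open>\<complex>B\<^sub>n\<close>-module \<open>\<rho>\<close>.\<close>

definition T_on_rca_std ::
    "nat \<Rightarrow> nat \<Rightarrow> complex \<Rightarrow> complex \<Rightarrow> (complex, 'v) module \<Rightarrow>
       ((complex mat \<Rightarrow>\<^sub>0 complex) \<Rightarrow> 'v \<Rightarrow> 'v) \<Rightarrow> ((complex mat \<Rightarrow>\<^sub>0 complex) \<Rightarrow> 'v \<Rightarrow> 'v) \<Rightarrow>
       complex mat \<Rightarrow> 'v std \<Rightarrow> 'v std" where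
  "T_on_rca_std p n c1 cm1 V \<tau> \<rho> h =
     tensor_map (rca p n c1 cm1) V (rca_std_action p n c1 cm1 V \<tau>)
       (T_on_rca p n c1 cm1 h) (\<rho> (grp h))"

text \<open>The element \<open>\<F> = \<F>\<^sup>-\<^sup>1\<close>, with \<open>\<complex>T \<otimes> \<complex>T\<close> identified with the group algebra of \<open>T \<times> T\<close>.\<close>

definition twist :: "nat \<Rightarrow> (complex mat \<times> complex mat) \<Rightarrow>\<^sub>0 complex" where
  "twist n = finprod (monoid_alg (T_group n \<times>\<times> T_group n))
     (\<lambda>(i, j).
        Poly_Mapping.single (1\<^sub>m n, 1\<^sub>m n) (1/2) + Poly_Mapping.single (t_refl n i, 1\<^sub>m n) (1/2)
        + Poly_Mapping.single (1\<^sub>m n, t_refl n j) (1/2)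
        - Poly_Mapping.single (t_refl n i, t_refl n j) (1/2))
     {(i, j). j < i \<and> i < n}"

definition twisted_alg ::
    "nat \<Rightarrow> (complex, 'a) module \<Rightarrow> (complex mat \<Rightarrow> 'a \<Rightarrow> 'a) \<Rightarrow> (complex, 'a) module" where
  "twisted_alg n A tA = A\<lparr>monoid.mult := (\<lambda>a b. \<Oplus>\<^bsub>A\<^esub>z\<in>Poly_Mapping.keys (twist n).
     Poly_Mapping.lookup (twist n) z \<odot>\<^bsub>A\<^esub> (tA (fst z) a \<otimes>\<^bsub>A\<^esub> tA (snd z) b))\<rparr>"

definition twisted_act ::
    "nat \<Rightarrow> (complex mat \<Rightarrow> 'a \<Rightarrow> 'a) \<Rightarrow> (complex, 'v) module \<Rightarrow> (complex mat \<Rightarrow> 'v \<Rightarrow> 'v) \<Rightarrow>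
       ('a \<Rightarrow> 'v \<Rightarrow> 'v) \<Rightarrow> 'a \<Rightarrow> 'v \<Rightarrow> 'v" where
  "twisted_act n tA V tV act a v = (\<Oplus>\<^bsub>V\<^esub>z\<in>Poly_Mapping.keys (twist n).
     Poly_Mapping.lookup (twist n) z \<odot>\<^bsub>V\<^esub> act (tA (fst z) a) (tV (snd z) v))"

definition rca_twisted :: "nat \<Rightarrow> nat \<Rightarrow> complex \<Rightarrow> complex \<Rightarrow> (complex, pres) module" where
  "rca_twisted p n c1 cm1 = twisted_alg n (rca p n c1 cm1) (T_on_rca p n c1 cm1)"

section \<open>Characters of the simple modules of \<open>B\<^sub>n\<close>\<close>

definition is_partition :: "nat \<Rightarrow> nat list \<Rightarrow> bool" where
  "is_partition a \<alpha> \<longleftrightarrow> sorted_wrt (\<ge>) \<alpha> \<and> (\<forall>k\<in>set \<alpha>. 0 < k) \<and> sum_list \<alpha> = a"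

definition has_trace :: "(complex, 'v) module \<Rightarrow> ('v \<Rightarrow> 'v) \<Rightarrow> complex \<Rightarrow> bool" where
  "has_trace V f c \<longleftrightarrow> (\<exists>E R. finite E \<and> vectorspace.basis class_ring V E \<and>
     (\<forall>b\<in>E. f b = LinearCombinations.module.lincomb V (R b) E) \<and> c = (\<Sum>b\<in>E. R b b))"

definition has_character ::
    "('g, 'm) monoid_scheme \<Rightarrow> (complex, 'v) module \<Rightarrow> (('g \<Rightarrow>\<^sub>0 complex) \<Rightarrow> 'v \<Rightarrow> 'v) \<Rightarrow>
       ('g \<Rightarrow> complex) \<Rightarrow> bool" where
  "has_character G V act \<chi> \<longleftrightarrow> (\<forall>g\<in>carrier G. has_trace V (act (grp g)) (\<chi> g))"

text \<open>
  The cells of the Young diagram of \<open>\<alpha>\<close> are numbered \<open>1, \<dots>, a\<close> row by row. The irreducible module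
  \<open>\<complex>S\<^sub>a c\<^sub>\<alpha>\<close> is generated by the Young symmetrizer \<open>c\<^sub>\<alpha>\<close> of this standard tableau; in particular
  \<open>(a)\<close> gives the trivial character and \<open>(1,\<dots>,1)\<close> the sign character.
\<close>

definition cell_row :: "nat list \<Rightarrow> nat \<Rightarrow> nat" where
  "cell_row \<alpha> k = (LEAST r. k \<le> sum_list (take (Suc r) \<alpha>))"

definition cell_col :: "nat list \<Rightarrow> nat \<Rightarrow> nat" where
  "cell_col \<alpha> k = k - sum_list (take (cell_row \<alpha> k) \<alpha>)"

definition young_symmetrizer :: "nat \<Rightarrow> nat list \<Rightarrow> (nat \<Rightarrow> nat) \<Rightarrow>\<^sub>0 complex" where
  "young_symmetrizer a \<alpha> =
     (\<Sum>q\<in>{q \<in> carrier (sym_group a). \<forall>k\<in>{1..a}. cell_row \<alpha> (q k) = cell_row \<alpha> k}. grp q)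
     \<otimes>\<^bsub>monoid_alg (sym_group a)\<^esub>
     (\<Sum>q\<in>{q \<in> carrier (sym_group a). \<forall>k\<in>{1..a}. cell_col \<alpha> (q k) = cell_col \<alpha> k}.
        Poly_Mapping.single q (of_int (sign q)))"

definition specht :: "nat \<Rightarrow> nat list \<Rightarrow> (complex, (nat \<Rightarrow> nat) \<Rightarrow>\<^sub>0 complex) module" where
  "specht a \<alpha> = (monoid_alg (sym_group a))\<lparr>carrier :=
     {f \<otimes>\<^bsub>monoid_alg (sym_group a)\<^esub> young_symmetrizer a \<alpha> | f. f \<in> carrier (monoid_alg (sym_group a))}\<rparr>"

definition sym_char :: "nat \<Rightarrow> nat list \<Rightarrow> (nat \<Rightarrow> nat) \<Rightarrow> complex" where
  "sym_char a \<alpha> q =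
     (THE c. has_trace (specht a \<alpha>) (\<lambda>f. grp q \<otimes>\<^bsub>monoid_alg (sym_group a)\<^esub> f) c)"

text \<open>The quotient map \<open>B\<^sub>a \<rightarrow> S\<^sub>a\<close>; \<open>sym_group a\<close> acts on \<open>{1..a}\<close>, matrix indices start at \<open>0\<close>.\<close>

definition underlying_perm :: "nat \<Rightarrow> complex mat \<Rightarrow> nat \<Rightarrow> nat" where
  "underlying_perm a g k =
     (if k \<in> {1..a} then THE i. i \<in> {1..a} \<and> g $$ (i - 1, k - 1) \<noteq> 0 else k)"

definition block_sum :: "nat \<Rightarrow> nat \<Rightarrow> complex mat \<Rightarrow> complex mat \<Rightarrow> complex mat" where
  "block_sum a b g h = four_block_mat g (0\<^sub>m a b) (0\<^sub>m b a) h"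

definition induced_char ::
    "('g, 'm) monoid_scheme \<Rightarrow> 'g set \<Rightarrow> ('g \<Rightarrow> complex) \<Rightarrow> 'g \<Rightarrow> complex" where
  "induced_char G K \<chi> g =
     (\<Sum>x\<in>{x \<in> carrier G. inv\<^bsub>G\<^esub> x \<otimes>\<^bsub>G\<^esub> g \<otimes>\<^bsub>G\<^esub> x \<in> K}. \<chi> (inv\<^bsub>G\<^esub> x \<otimes>\<^bsub>G\<^esub> g \<otimes>\<^bsub>G\<^esub> x))
     / of_nat (card K)"

text \<open>
  The character of \<open>\<tau>\<^sup>B\<close> for the bipartition \<open>(\<alpha>, \<beta>)\<close>. The linear character of \<open>B\<^sub>b\<close> with
  \<open>t\<^sub>i \<mapsto> -1\<close>, \<open>s\<^sub>i \<mapsto> 1\<close> is the product of the nonzero entries.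
\<close>

definition B_char :: "nat \<Rightarrow> nat \<Rightarrow> nat list \<Rightarrow> nat list \<Rightarrow> complex mat \<Rightarrow> complex" where
  "B_char a b \<alpha> \<beta> = induced_char (B_group (a + b))
     {block_sum a b g h | g h. g \<in> Gmpn 2 1 a \<and> h \<in> Gmpn 2 1 b}
     (\<lambda>k. let g = mat a a (\<lambda>(i, j). k $$ (i, j)); h = mat b b (\<lambda>(i, j). k $$ (a + i, a + j)) in
        sym_char a \<alpha> (underlying_perm a g) * (entry_prod b h * sym_char b \<beta> (underlying_perm b h)))"

end

theory Submission
  imports Defs
begin

text \<open>
  The torus \<open>T\<close> grades everything in sight. Its characters are indexed by subsets \<open>\<alpha>\<close> of the set of
  coordinates, and if \<open>a\<close> has weight \<open>\<alpha>\<close>, then every factor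
  \<open>\<onehalf>(1 \<otimes> 1 + t\<^sub>i \<otimes> 1 + 1 \<otimes> t\<^sub>j - t\<^sub>i \<otimes> t\<^sub>j)\<close> of \<open>\<F>\<close> acts on \<open>a \<otimes> m\<close> as \<open>1 \<otimes> t\<^sub>j\<close> or as the
  identity, according to whether \<open>i \<in> \<alpha>\<close>. Hence \<open>\<F>\<close> acts as \<open>1 \<otimes> t\<^sub>\<alpha>\<close> for a single element \<open>t\<^sub>\<alpha>\<close>
  of \<open>T\<close> (\<open>twisted_weight_vec\<close>): the twisted product is \<open>a (t\<^sub>\<alpha> \<rhd> b)\<close> and the twisted action is
  \<open>a (t\<^sub>\<alpha> m)\<close>. Moreover \<open>t\<^sub>\<alpha> t\<^sub>\<beta> = t\<^sub>\<gamma>\<close> for the symmetric difference \<open>\<gamma>\<close> of \<open>\<alpha>\<close> and \<open>\<beta>\<close>. The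
  rational Cherednik algebra \<open>\<H>\<close> is spanned by homogeneous elements (\<open>weight_span\<close>), because its
  generators are sums of such: writing \<open>\<sigma>\<close> for the reflection \<open>s\<^sub>i\<close> with \<open>\<epsilon> = -1\<close>, the elements
  \<open>u\<^sub>+ = (\<sigma> + s\<^sub>i)/2\<close> and \<open>u\<^sub>- = (\<sigma> - s\<^sub>i)/2\<close> have weights \<open>{}\<close> and \<open>{i, i+1}\<close>.

  Both sides of the claimed isomorphism are tensor products over a subalgebra, so linear maps out of
  them are obtained from balanced bilinear maps. For an invertible \<open>\<theta> \<in> \<complex>T\<close> put
  \<^item> \<open>\<Xi>(a \<otimes> v) = \<phi>\<^sup>-\<^sup>1(a) \<otimes> \<theta>\<^sup>-\<^sup>1 t\<^sub>\<alpha> v\<close> for \<open>a\<close> of weight \<open>\<alpha>\<close>,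
  \<^item> \<open>\<Psi>(a' \<otimes> v) = \<phi>(a') \<rhd> (1 \<otimes> \<theta> v)\<close>, with the twisted action on the right.

  On homogeneous elements these are mutually inverse and \<open>\<Xi>\<close> is equivariant, both because
  \<open>t\<^sub>\<alpha> t\<^sub>\<beta>\<close> is the element attached to the weight of a product (\<open>twisted_tensor_isomorphic\<close>). What remains is
  that they are balanced, and this can be checked on generators of the subalgebras, a single
  homogeneous one at a time (\<open>homogeneous_balanced\<close>).

  For \<open>x\<^sub>i\<close> both operators are zero and for diagonal group elements everything commutes. For \<open>\<sigma>\<^sub>i\<close>
  the choice of \<open>\<theta>\<close> matters. Under \<open>\<phi>\<close> it corresponds to \<open>\<sigma> = u\<^sub>+ + u\<^sub>-\<close>, whose twisted action on the
  lowest degree part \<open>1 \<otimes> V\<close> is \<open>u\<^sub>+ + u\<^sub>- t\<^sub>i\<close>, since \<open>t\<^sub>\<alpha> = t\<^sub>i\<close> for \<open>\<alpha> = {i, i+1}\<close>. On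
  the other side \<open>\<sigma>\<^sub>i\<close> acts by \<open>J(\<sigma>\<^sub>i) = u\<^sub>+ - \<i> u\<^sub>-\<close>. The element \<open>\<theta>\<close> that multiplies the eigenvalue \<open>-1\<close> of
  each \<open>t\<^sub>j\<close> by \<open>(-\<i>)\<^sup>j\<close> conjugates the one operator into the other (\<open>refl_elt_twist_prod\<close>): \<open>u\<^sub>+\<close> lives where
  the eigenvalues of \<open>t\<^sub>i\<close> and \<open>t\<^sub>i\<^sub>+\<^sub>1\<close> agree and commutes with \<open>\<theta>\<close>, while \<open>u\<^sub>-\<close> lives where
  they differ and moves the eigenvalue \<open>-1\<close> to the neighbouring place.

  Finally the diagonal elements of \<open>W\<close> or \<open>\<mu>(W)\<close> together with one representative of each adjacent
  transposition generate the group (\<open>monomial_group_generated\<close>), and balancedness is stable under products.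
\<close>

section \<open>Linear extension in complex vector spaces\<close>

abbreviation cvs :: "(complex, 'v) module \<Rightarrow> bool" where
  "cvs U \<equiv> vectorspace class_ring U"

lemma cvs_zero: "cvs U \<Longrightarrow> \<zero>\<^bsub>U\<^esub> \<in> carrier U"
  and cvs_add: "cvs U \<Longrightarrow> x \<in> carrier U \<Longrightarrow> y \<in> carrier U \<Longrightarrow> x \<oplus>\<^bsub>U\<^esub> y \<in> carrier U"
  and cvs_smult: "cvs U \<Longrightarrow> x \<in> carrier U \<Longrightarrow> c \<odot>\<^bsub>U\<^esub> x \<in> carrier U"
  and cvs_assoc: "cvs U \<Longrightarrow> x \<in> carrier U \<Longrightarrow> y \<in> carrier U \<Longrightarrow> z \<in> carrier U \<Longrightarrow>
     (x \<oplus>\<^bsub>U\<^esub> y) \<oplus>\<^bsub>U\<^esub> z = x \<oplus>\<^bsub>U\<^esub> (y \<oplus>\<^bsub>U\<^esub> z)"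
  and cvs_comm: "cvs U \<Longrightarrow> x \<in> carrier U \<Longrightarrow> y \<in> carrier U \<Longrightarrow> x \<oplus>\<^bsub>U\<^esub> y = y \<oplus>\<^bsub>U\<^esub> x"
  and cvs_lcomm: "cvs U \<Longrightarrow> x \<in> carrier U \<Longrightarrow> y \<in> carrier U \<Longrightarrow> z \<in> carrier U \<Longrightarrow>
     x \<oplus>\<^bsub>U\<^esub> (y \<oplus>\<^bsub>U\<^esub> z) = y \<oplus>\<^bsub>U\<^esub> (x \<oplus>\<^bsub>U\<^esub> z)"
  and cvs_lzero: "cvs U \<Longrightarrow> x \<in> carrier U \<Longrightarrow> \<zero>\<^bsub>U\<^esub> \<oplus>\<^bsub>U\<^esub> x = x"
  and cvs_rzero: "cvs U \<Longrightarrow> x \<in> carrier U \<Longrightarrow> x \<oplus>\<^bsub>U\<^esub> \<zero>\<^bsub>U\<^esub> = x"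
  and cvs_smult_add: "cvs U \<Longrightarrow> x \<in> carrier U \<Longrightarrow> y \<in> carrier U \<Longrightarrow>
     c \<odot>\<^bsub>U\<^esub> (x \<oplus>\<^bsub>U\<^esub> y) = c \<odot>\<^bsub>U\<^esub> x \<oplus>\<^bsub>U\<^esub> c \<odot>\<^bsub>U\<^esub> y"
  and cvs_add_smult: "cvs U \<Longrightarrow> x \<in> carrier U \<Longrightarrow> (c + d) \<odot>\<^bsub>U\<^esub> x = c \<odot>\<^bsub>U\<^esub> x \<oplus>\<^bsub>U\<^esub> d \<odot>\<^bsub>U\<^esub> x"
  and cvs_smult_smult: "cvs U \<Longrightarrow> x \<in> carrier U \<Longrightarrow> c \<odot>\<^bsub>U\<^esub> (d \<odot>\<^bsub>U\<^esub> x) = (c * d) \<odot>\<^bsub>U\<^esub> x"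
  and cvs_one_smult: "cvs U \<Longrightarrow> x \<in> carrier U \<Longrightarrow> 1 \<odot>\<^bsub>U\<^esub> x = x"
  and cvs_zero_smult: "cvs U \<Longrightarrow> x \<in> carrier U \<Longrightarrow> 0 \<odot>\<^bsub>U\<^esub> x = \<zero>\<^bsub>U\<^esub>"
  and cvs_smult_zero: "cvs U \<Longrightarrow> c \<odot>\<^bsub>U\<^esub> \<zero>\<^bsub>U\<^esub> = \<zero>\<^bsub>U\<^esub>"
proof -
  assume U: "cvs U"
  interpret vectorspace class_ring U by (rule U)
  show "\<zero>\<^bsub>U\<^esub> \<in> carrier U" by simp
  show "c \<odot>\<^bsub>U\<^esub> \<zero>\<^bsub>U\<^esub> = \<zero>\<^bsub>U\<^esub>" using smult_r_null by simp
  assume x: "x \<in> carrier U"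
  show "c \<odot>\<^bsub>U\<^esub> x \<in> carrier U" using x by simp
  show "\<zero>\<^bsub>U\<^esub> \<oplus>\<^bsub>U\<^esub> x = x" "x \<oplus>\<^bsub>U\<^esub> \<zero>\<^bsub>U\<^esub> = x" using x by auto
  show "(c + d) \<odot>\<^bsub>U\<^esub> x = c \<odot>\<^bsub>U\<^esub> x \<oplus>\<^bsub>U\<^esub> d \<odot>\<^bsub>U\<^esub> x" using smult_l_distr[of c d x] x by simp
  show "c \<odot>\<^bsub>U\<^esub> (d \<odot>\<^bsub>U\<^esub> x) = (c * d) \<odot>\<^bsub>U\<^esub> x" using smult_assoc1[of c d x] x by simp
  show "1 \<odot>\<^bsub>U\<^esub> x = x" using smult_one[of x] x by simp
  show "0 \<odot>\<^bsub>U\<^esub> x = \<zero>\<^bsub>U\<^esub>" using smult_l_null[of x] x by simp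
  assume y: "y \<in> carrier U"
  show "x \<oplus>\<^bsub>U\<^esub> y \<in> carrier U" using x y by simp
  show "x \<oplus>\<^bsub>U\<^esub> y = y \<oplus>\<^bsub>U\<^esub> x" using x y by (rule M.a_comm)
  show "c \<odot>\<^bsub>U\<^esub> (x \<oplus>\<^bsub>U\<^esub> y) = c \<odot>\<^bsub>U\<^esub> x \<oplus>\<^bsub>U\<^esub> c \<odot>\<^bsub>U\<^esub> y" using smult_r_distr[of c x y] x y by simp
  assume z: "z \<in> carrier U"
  show "(x \<oplus>\<^bsub>U\<^esub> y) \<oplus>\<^bsub>U\<^esub> z = x \<oplus>\<^bsub>U\<^esub> (y \<oplus>\<^bsub>U\<^esub> z)" using x y z by (rule M.a_assoc)
  show "x \<oplus>\<^bsub>U\<^esub> (y \<oplus>\<^bsub>U\<^esub> z) = y \<oplus>\<^bsub>U\<^esub> (x \<oplus>\<^bsub>U\<^esub> z)" using x y z by (rule M.a_lcomm)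
qed

lemmas cvs_closed = cvs_zero cvs_add cvs_smult
lemmas cvs_simps = cvs_zero cvs_add cvs_smult cvs_lzero cvs_rzero cvs_smult_add cvs_add_smult
  cvs_smult_smult cvs_one_smult cvs_zero_smult cvs_smult_zero
lemmas cvs_ac = cvs_assoc cvs_comm cvs_lcomm

text \<open>
  Additive inverses are the multiples by \<open>- 1\<close>, which is why they do not occur among the conditions.
\<close>

lemma cvsI:
  fixes U :: "(complex, 'v) module"
  assumes z: "\<zero>\<^bsub>U\<^esub> \<in> carrier U"
    and add: "\<And>x y. x \<in> carrier U \<Longrightarrow> y \<in> carrier U \<Longrightarrow> x \<oplus>\<^bsub>U\<^esub> y \<in> carrier U"
    and smult: "\<And>c x. x \<in> carrier U \<Longrightarrow> c \<odot>\<^bsub>U\<^esub> x \<in> carrier U"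
    and assoc: "\<And>x y z. x \<in> carrier U \<Longrightarrow> y \<in> carrier U \<Longrightarrow> z \<in> carrier U \<Longrightarrow>
     (x \<oplus>\<^bsub>U\<^esub> y) \<oplus>\<^bsub>U\<^esub> z = x \<oplus>\<^bsub>U\<^esub> (y \<oplus>\<^bsub>U\<^esub> z)"
    and comm: "\<And>x y. x \<in> carrier U \<Longrightarrow> y \<in> carrier U \<Longrightarrow> x \<oplus>\<^bsub>U\<^esub> y = y \<oplus>\<^bsub>U\<^esub> x"
    and lzero: "\<And>x. x \<in> carrier U \<Longrightarrow> \<zero>\<^bsub>U\<^esub> \<oplus>\<^bsub>U\<^esub> x = x"
    and smult_add: "\<And>c x y. x \<in> carrier U \<Longrightarrow> y \<in> carrier U \<Longrightarrow>
       c \<odot>\<^bsub>U\<^esub> (x \<oplus>\<^bsub>U\<^esub> y) = c \<odot>\<^bsub>U\<^esub> x \<oplus>\<^bsub>U\<^esub> c \<odot>\<^bsub>U\<^esub> y"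
    and add_smult: "\<And>c d x. x \<in> carrier U \<Longrightarrow> (c + d) \<odot>\<^bsub>U\<^esub> x = c \<odot>\<^bsub>U\<^esub> x \<oplus>\<^bsub>U\<^esub> d \<odot>\<^bsub>U\<^esub> x"
    and smult_smult: "\<And>c d x. x \<in> carrier U \<Longrightarrow> c \<odot>\<^bsub>U\<^esub> (d \<odot>\<^bsub>U\<^esub> x) = (c * d) \<odot>\<^bsub>U\<^esub> x"
    and one: "\<And>x. x \<in> carrier U \<Longrightarrow> 1 \<odot>\<^bsub>U\<^esub> x = x"
    and zsm: "\<And>x. x \<in> carrier U \<Longrightarrow> 0 \<odot>\<^bsub>U\<^esub> x = \<zero>\<^bsub>U\<^esub>"
  shows "cvs U"
proof -
  have inv: "\<exists>y\<in>carrier U. y \<oplus>\<^bsub>U\<^esub> x = \<zero>\<^bsub>U\<^esub>" if "x \<in> carrier U" for x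
  proof (rule bexI)
    show "(- 1) \<odot>\<^bsub>U\<^esub> x \<in> carrier U" using that smult by simp
    have "(- 1) \<odot>\<^bsub>U\<^esub> x \<oplus>\<^bsub>U\<^esub> x = (- 1) \<odot>\<^bsub>U\<^esub> x \<oplus>\<^bsub>U\<^esub> 1 \<odot>\<^bsub>U\<^esub> x" using one that by simp
    also have "\<dots> = (- 1 + 1) \<odot>\<^bsub>U\<^esub> x" using add_smult[of x "- 1" 1] that by simp
    finally show "(- 1) \<odot>\<^bsub>U\<^esub> x \<oplus>\<^bsub>U\<^esub> x = \<zero>\<^bsub>U\<^esub>" using zsm that by simp
  qed
  have "abelian_group U"
    by (rule abelian_groupI) (use z add assoc comm lzero inv in auto)
  then have "Module.module class_ring U"
    by (intro Module.module.intro module_axioms.intro class_cring.is_cring)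
      (use smult smult_add add_smult smult_smult one in auto)
  then show ?thesis by (simp add: vectorspace_def class_field.field_axioms)
qed

definition lin :: "(complex, 'v) module \<Rightarrow> (complex, 'w) module \<Rightarrow> ('v \<Rightarrow> 'w) \<Rightarrow> bool" where
  "lin U W f \<longleftrightarrow> (\<forall>u\<in>carrier U. f u \<in> carrier W) \<and>
     (\<forall>u\<in>carrier U. \<forall>u'\<in>carrier U. f (u \<oplus>\<^bsub>U\<^esub> u') = f u \<oplus>\<^bsub>W\<^esub> f u') \<and>
     (\<forall>c. \<forall>u\<in>carrier U. f (c \<odot>\<^bsub>U\<^esub> u) = c \<odot>\<^bsub>W\<^esub> f u)"

lemma linI:
  assumes "\<And>u. u \<in> carrier U \<Longrightarrow> f u \<in> carrier W"
    and "\<And>u u'. u \<in> carrier U \<Longrightarrow> u' \<in> carrier U \<Longrightarrow> f (u \<oplus>\<^bsub>U\<^esub> u') = f u \<oplus>\<^bsub>W\<^esub> f u'"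
    and "\<And>c u. u \<in> carrier U \<Longrightarrow> f (c \<odot>\<^bsub>U\<^esub> u) = c \<odot>\<^bsub>W\<^esub> f u"
  shows "lin U W f"
  using assms by (auto simp: lin_def)

lemma lin_closed: "lin U W f \<Longrightarrow> u \<in> carrier U \<Longrightarrow> f u \<in> carrier W"
  and lin_add: "lin U W f \<Longrightarrow> u \<in> carrier U \<Longrightarrow> u' \<in> carrier U \<Longrightarrow> f (u \<oplus>\<^bsub>U\<^esub> u') = f u \<oplus>\<^bsub>W\<^esub> f u'"
  and lin_smult: "lin U W f \<Longrightarrow> u \<in> carrier U \<Longrightarrow> f (c \<odot>\<^bsub>U\<^esub> u) = c \<odot>\<^bsub>W\<^esub> f u"
  by (auto simp: lin_def)

lemma lin_zero: "lin U W f \<Longrightarrow> cvs U \<Longrightarrow> cvs W \<Longrightarrow> f \<zero>\<^bsub>U\<^esub> = \<zero>\<^bsub>W\<^esub>"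
  by (metis cvs_zero cvs_zero_smult lin_closed lin_smult)

lemma linear_map_iff_lin: "linear_map class_ring U W f \<longleftrightarrow> cvs U \<and> cvs W \<and> lin U W f"
  by (auto simp: linear_map_def mod_hom_def mod_hom_axioms_def vectorspace_def
      LinearCombinations.module_hom_def lin_def)

lemma lin_comp: "lin U W f \<Longrightarrow> lin W Z g \<Longrightarrow> lin U Z (\<lambda>u. g (f u))"
  by (simp add: lin_def)

lemma lin_ident: "lin U U (\<lambda>u. u)"
  by (simp add: lin_def)

text \<open>
  The linear span, in inductive form: a statement about all of a spanned space then follows by rule
  induction from its linearity.
\<close>

inductive_set lspan :: "(complex, 'v) module \<Rightarrow> 'v set \<Rightarrow> 'v set" for U H where
  zero: "\<zero>\<^bsub>U\<^esub> \<in> lspan U H"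
| base: "h \<in> H \<Longrightarrow> h \<in> lspan U H"
| add: "u \<in> lspan U H \<Longrightarrow> u' \<in> lspan U H \<Longrightarrow> u \<oplus>\<^bsub>U\<^esub> u' \<in> lspan U H"
| smult: "u \<in> lspan U H \<Longrightarrow> c \<odot>\<^bsub>U\<^esub> u \<in> lspan U H"

lemma lspan_closed:
  assumes "cvs U" "H \<subseteq> carrier U" "u \<in> lspan U H" shows "u \<in> carrier U"
  using assms(3) by induct (use assms(1,2) in \<open>auto simp: cvs_closed\<close>)

lemma lspan_lspan: "H \<subseteq> lspan U K \<Longrightarrow> u \<in> lspan U H \<Longrightarrow> u \<in> lspan U K"
  by (erule lspan.induct) (auto intro: lspan.intros)

lemma lin_lspan:
  assumes "cvs U" "cvs W" "lin U W f" "H \<subseteq> carrier U" "u \<in> lspan U H"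
  shows "f u \<in> lspan W (f ` H)"
  using assms(5)
  by induct (use assms(1-4) in \<open>auto simp: lin_add lin_smult lin_zero lspan_closed intro: lspan.intros\<close>)

lemma lin_eq_on_lspan:
  assumes "cvs U" "cvs W" "lin U W f" "lin U W g" "H \<subseteq> carrier U"
    and "\<And>h. h \<in> H \<Longrightarrow> f h = g h" and "u \<in> lspan U H"
  shows "f u = g u"
  using assms(7)
  by induct (use assms(1-6) in \<open>auto simp: lin_add lin_smult lin_zero lspan_closed\<close>)

text \<open>
  The value at \<open>F\<close> of the linear map on finitely supported functions that sends the basis vector \<open>z\<close>
  to \<open>B z\<close>.
\<close>

definition linext ::
    "(complex, 'v) module \<Rightarrow> ('b \<Rightarrow> 'v) \<Rightarrow> ('b \<Rightarrow>\<^sub>0 complex) \<Rightarrow> 'v" where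
  "linext U B F = (\<Oplus>\<^bsub>U\<^esub>z\<in>Poly_Mapping.keys F. Poly_Mapping.lookup F z \<odot>\<^bsub>U\<^esub> B z)"

abbreviation pscale :: "complex \<Rightarrow> ('b \<Rightarrow>\<^sub>0 complex) \<Rightarrow> ('b \<Rightarrow>\<^sub>0 complex)" where
  "pscale c \<equiv> Poly_Mapping.map ((*) c)"

lemma lookup_pscale: "Poly_Mapping.lookup (pscale c F) z = c * Poly_Mapping.lookup F z"
  by (simp add: Poly_Mapping.map.rep_eq when_def)

lemma keys_pscale: "Poly_Mapping.keys (pscale c F) \<subseteq> Poly_Mapping.keys F"
  by (auto simp: lookup_pscale in_keys_iff)

lemma pscale_single: "pscale c (Poly_Mapping.single z d) = Poly_Mapping.single z (c * d)"
  by (rule poly_mapping_eqI) (simp add: lookup_pscale lookup_single when_def)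

lemma pscale_add: "pscale c (F + G) = pscale c F + pscale c G"
  by (rule poly_mapping_eqI) (simp add: lookup_pscale lookup_add algebra_simps)

lemma pscale_add_left: "pscale (c + d) F = pscale c F + pscale d F"
  by (rule poly_mapping_eqI) (simp add: lookup_pscale lookup_add algebra_simps)

lemma pscale_pscale: "pscale c (pscale d F) = pscale (c * d) F"
  by (rule poly_mapping_eqI) (simp add: lookup_pscale)

lemma pscale_1: "pscale 1 F = F" and pscale_0: "pscale 0 F = 0" and pscale_zero: "pscale c 0 = 0"
  by (auto intro!: poly_mapping_eqI simp: lookup_pscale)

lemma pscale_minus1: "pscale (- 1) F = - F"
  by (rule poly_mapping_eqI) (simp add: lookup_pscale)

lemma sum_singles:
  fixes F :: "'b \<Rightarrow>\<^sub>0 complex"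
  shows "(\<Sum>z\<in>Poly_Mapping.keys F. Poly_Mapping.single z (Poly_Mapping.lookup F z)) = F"
proof (rule poly_mapping_eqI)
  fix w
  have "(\<Sum>z\<in>Poly_Mapping.keys F. Poly_Mapping.lookup F z when z = w) =
     (\<Sum>z\<in>Poly_Mapping.keys F. if z = w then Poly_Mapping.lookup F w else 0)"
    by (rule sum.cong) (auto simp: when_def)
  also have "\<dots> = Poly_Mapping.lookup F w" by (simp add: in_keys_iff)
  finally show "Poly_Mapping.lookup (\<Sum>z\<in>Poly_Mapping.keys F.
      Poly_Mapping.single z (Poly_Mapping.lookup F z)) w = Poly_Mapping.lookup F w"
    by (simp add: lookup_sum lookup_single)
qed

lemma poly_mapping_keys_induct [consumes 1, case_names zero single]:
  fixes F :: "'b \<Rightarrow>\<^sub>0 complex"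
  assumes "Poly_Mapping.keys F \<subseteq> S" and "P 0"
    and "\<And>z c F. z \<in> S \<Longrightarrow> Poly_Mapping.keys F \<subseteq> S \<Longrightarrow> P F \<Longrightarrow> P (Poly_Mapping.single z c + F)"
  shows "P F"
proof -
  have "P (\<Sum>z\<in>K. Poly_Mapping.single z (Poly_Mapping.lookup F z)) \<and>
      Poly_Mapping.keys (\<Sum>z\<in>K. Poly_Mapping.single z (Poly_Mapping.lookup F z)) \<subseteq> S"
    if "finite K" "K \<subseteq> S" for K
    using that
  proof induct
    case empty
    then show ?case using assms(2) by simp
  next
    case (insert z K)
    then show ?case
      using assms(3) keys_add[of "Poly_Mapping.single z (Poly_Mapping.lookup F z)"
          "\<Sum>z\<in>K. Poly_Mapping.single z (Poly_Mapping.lookup F z)"]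
      by (auto split: if_splits)
  qed
  from this[of "Poly_Mapping.keys F"] show ?thesis using assms(1) by (simp add: sum_singles)
qed

lemma linext_superset:
  assumes U: "cvs U" and "finite S" "Poly_Mapping.keys F \<subseteq> S" and B: "\<And>z. z \<in> S \<Longrightarrow> B z \<in> carrier U"
  shows "linext U B F = (\<Oplus>\<^bsub>U\<^esub>z\<in>S. Poly_Mapping.lookup F z \<odot>\<^bsub>U\<^esub> B z)"
proof -
  interpret vectorspace class_ring U by (rule U)
  show ?thesis unfolding linext_def
    by (rule M.add.finprod_mono_neutral_cong_left)
      (use assms in \<open>auto simp: in_keys_iff cvs_simps\<close>)
qed

lemma linext_closed:
  assumes U: "cvs U" and B: "\<And>z. z \<in> Poly_Mapping.keys F \<Longrightarrow> B z \<in> carrier U"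
  shows "linext U B F \<in> carrier U"
proof -
  interpret vectorspace class_ring U by (rule U)
  show ?thesis unfolding linext_def
    by (rule M.finsum_closed) (use assms in \<open>auto simp: cvs_simps\<close>)
qed

lemma linext_add:
  assumes U: "cvs U"
    and B: "\<And>z. z \<in> Poly_Mapping.keys F \<Longrightarrow> B z \<in> carrier U" "\<And>z. z \<in> Poly_Mapping.keys G \<Longrightarrow> B z \<in> carrier U"
  shows "linext U B (F + G) = linext U B F \<oplus>\<^bsub>U\<^esub> linext U B G"
proof -
  interpret vectorspace class_ring U by (rule U)
  let ?S = "Poly_Mapping.keys F \<union> Poly_Mapping.keys G"
  have B': "B z \<in> carrier U" if "z \<in> ?S" for z using that B by auto
  have 1: "linext U B F = (\<Oplus>\<^bsub>U\<^esub>z\<in>?S. Poly_Mapping.lookup F z \<odot>\<^bsub>U\<^esub> B z)"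
    by (rule linext_superset[OF U _ _ B']) auto
  have 2: "linext U B G = (\<Oplus>\<^bsub>U\<^esub>z\<in>?S. Poly_Mapping.lookup G z \<odot>\<^bsub>U\<^esub> B z)"
    by (rule linext_superset[OF U _ _ B']) auto
  have 3: "linext U B (F + G) = (\<Oplus>\<^bsub>U\<^esub>z\<in>?S. Poly_Mapping.lookup (F + G) z \<odot>\<^bsub>U\<^esub> B z)"
    by (rule linext_superset[OF U _ _ B']) (use keys_add[of F G] in auto)
  have "\<dots> = (\<Oplus>\<^bsub>U\<^esub>z\<in>?S. Poly_Mapping.lookup F z \<odot>\<^bsub>U\<^esub> B z \<oplus>\<^bsub>U\<^esub> Poly_Mapping.lookup G z \<odot>\<^bsub>U\<^esub> B z)"
    by (rule M.finsum_cong') (use B' U in \<open>auto simp: lookup_add cvs_simps\<close>)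
  also have "\<dots> = (\<Oplus>\<^bsub>U\<^esub>z\<in>?S. Poly_Mapping.lookup F z \<odot>\<^bsub>U\<^esub> B z) \<oplus>\<^bsub>U\<^esub> (\<Oplus>\<^bsub>U\<^esub>z\<in>?S. Poly_Mapping.lookup G z \<odot>\<^bsub>U\<^esub> B z)"
    by (rule M.finsum_addf) (use B' U in \<open>auto simp: cvs_simps\<close>)
  finally show ?thesis using 1 2 3 by simp
qed

lemma linext_zero [simp]: "cvs U \<Longrightarrow> linext U B 0 = \<zero>\<^bsub>U\<^esub>"
  by (simp add: linext_def vectorspace_def Module.module_def abelian_group_def
      abelian_monoid.finsum_empty)

lemma linext_single:
  assumes U: "cvs U" and B: "B z \<in> carrier U"
  shows "linext U B (Poly_Mapping.single z c) = c \<odot>\<^bsub>U\<^esub> B z"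
proof -
  interpret vectorspace class_ring U by (rule U)
  have "linext U B (Poly_Mapping.single z c) =
     (\<Oplus>\<^bsub>U\<^esub>y\<in>{z}. Poly_Mapping.lookup (Poly_Mapping.single z c) y \<odot>\<^bsub>U\<^esub> B y)"
    by (rule linext_superset[OF U]) (use B in \<open>auto split: if_splits\<close>)
  then show ?thesis using B U by (simp add: cvs_simps)
qed

lemma linext_pscale:
  assumes U: "cvs U" and B: "\<And>z. z \<in> Poly_Mapping.keys F \<Longrightarrow> B z \<in> carrier U"
  shows "linext U B (pscale c F) = c \<odot>\<^bsub>U\<^esub> linext U B F"
proof -
  have "Poly_Mapping.keys F \<subseteq> {z. B z \<in> carrier U}" using B by auto
  then show ?thesis
  proof (induct rule: poly_mapping_keys_induct)
    case zero
    then show ?case using U by (simp add: pscale_zero cvs_simps)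
  next
    case (single z d F)
    have c: "linext U B F \<in> carrier U" by (rule linext_closed) (use U single in auto)
    have k: "y \<in> Poly_Mapping.keys (pscale c F) \<Longrightarrow> B y \<in> carrier U" for y
      using keys_pscale[of c F] single(2) by auto
    show ?case
      using U single c k
      by (subst pscale_add, subst (1 2) linext_add)
        (auto simp: pscale_single linext_single cvs_simps split: if_splits)
  qed
qed

section \<open>Complex algebras\<close>

definition calg :: "(complex, 'a) module \<Rightarrow> bool" where
  "calg A \<longleftrightarrow> cvs A \<and> ring A \<and> (\<forall>c. \<forall>a\<in>carrier A. \<forall>b\<in>carrier A.
     (c \<odot>\<^bsub>A\<^esub> a) \<otimes>\<^bsub>A\<^esub> b = c \<odot>\<^bsub>A\<^esub> (a \<otimes>\<^bsub>A\<^esub> b) \<and> a \<otimes>\<^bsub>A\<^esub> (c \<odot>\<^bsub>A\<^esub> b) = c \<odot>\<^bsub>A\<^esub> (a \<otimes>\<^bsub>A\<^esub> b))"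

lemma calg_cvs: "calg A \<Longrightarrow> cvs A" and calg_ring: "calg A \<Longrightarrow> ring A"
  by (auto simp: calg_def)

lemma calg_one: "calg A \<Longrightarrow> \<one>\<^bsub>A\<^esub> \<in> carrier A"
  and calg_mult: "calg A \<Longrightarrow> a \<in> carrier A \<Longrightarrow> b \<in> carrier A \<Longrightarrow> a \<otimes>\<^bsub>A\<^esub> b \<in> carrier A"
  and calg_assoc: "calg A \<Longrightarrow> a \<in> carrier A \<Longrightarrow> b \<in> carrier A \<Longrightarrow> d \<in> carrier A \<Longrightarrow>
     (a \<otimes>\<^bsub>A\<^esub> b) \<otimes>\<^bsub>A\<^esub> d = a \<otimes>\<^bsub>A\<^esub> (b \<otimes>\<^bsub>A\<^esub> d)"
  and calg_l_one: "calg A \<Longrightarrow> a \<in> carrier A \<Longrightarrow> \<one>\<^bsub>A\<^esub> \<otimes>\<^bsub>A\<^esub> a = a"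
  and calg_r_one: "calg A \<Longrightarrow> a \<in> carrier A \<Longrightarrow> a \<otimes>\<^bsub>A\<^esub> \<one>\<^bsub>A\<^esub> = a"
  and calg_l_distr: "calg A \<Longrightarrow> a \<in> carrier A \<Longrightarrow> b \<in> carrier A \<Longrightarrow> d \<in> carrier A \<Longrightarrow>
     (a \<oplus>\<^bsub>A\<^esub> b) \<otimes>\<^bsub>A\<^esub> d = a \<otimes>\<^bsub>A\<^esub> d \<oplus>\<^bsub>A\<^esub> b \<otimes>\<^bsub>A\<^esub> d"
  and calg_r_distr: "calg A \<Longrightarrow> a \<in> carrier A \<Longrightarrow> b \<in> carrier A \<Longrightarrow> d \<in> carrier A \<Longrightarrow>
     d \<otimes>\<^bsub>A\<^esub> (a \<oplus>\<^bsub>A\<^esub> b) = d \<otimes>\<^bsub>A\<^esub> a \<oplus>\<^bsub>A\<^esub> d \<otimes>\<^bsub>A\<^esub> b"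
  and calg_smult_l: "calg A \<Longrightarrow> a \<in> carrier A \<Longrightarrow> b \<in> carrier A \<Longrightarrow> (c \<odot>\<^bsub>A\<^esub> a) \<otimes>\<^bsub>A\<^esub> b = c \<odot>\<^bsub>A\<^esub> (a \<otimes>\<^bsub>A\<^esub> b)"
  and calg_smult_r: "calg A \<Longrightarrow> a \<in> carrier A \<Longrightarrow> b \<in> carrier A \<Longrightarrow> a \<otimes>\<^bsub>A\<^esub> (c \<odot>\<^bsub>A\<^esub> b) = c \<odot>\<^bsub>A\<^esub> (a \<otimes>\<^bsub>A\<^esub> b)"
  and calg_l_null: "calg A \<Longrightarrow> a \<in> carrier A \<Longrightarrow> \<zero>\<^bsub>A\<^esub> \<otimes>\<^bsub>A\<^esub> a = \<zero>\<^bsub>A\<^esub>"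
  and calg_r_null: "calg A \<Longrightarrow> a \<in> carrier A \<Longrightarrow> a \<otimes>\<^bsub>A\<^esub> \<zero>\<^bsub>A\<^esub> = \<zero>\<^bsub>A\<^esub>"
proof -
  assume A: "calg A"
  interpret ring A using A by (rule calg_ring)
  show "\<one>\<^bsub>A\<^esub> \<in> carrier A" by simp
  assume a: "a \<in> carrier A"
  show "\<one>\<^bsub>A\<^esub> \<otimes>\<^bsub>A\<^esub> a = a" "a \<otimes>\<^bsub>A\<^esub> \<one>\<^bsub>A\<^esub> = a" "\<zero>\<^bsub>A\<^esub> \<otimes>\<^bsub>A\<^esub> a = \<zero>\<^bsub>A\<^esub>" "a \<otimes>\<^bsub>A\<^esub> \<zero>\<^bsub>A\<^esub> = \<zero>\<^bsub>A\<^esub>"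
    using a by simp_all
  assume b: "b \<in> carrier A"
  show "a \<otimes>\<^bsub>A\<^esub> b \<in> carrier A" using a b by simp
  show "(c \<odot>\<^bsub>A\<^esub> a) \<otimes>\<^bsub>A\<^esub> b = c \<odot>\<^bsub>A\<^esub> (a \<otimes>\<^bsub>A\<^esub> b)" "a \<otimes>\<^bsub>A\<^esub> (c \<odot>\<^bsub>A\<^esub> b) = c \<odot>\<^bsub>A\<^esub> (a \<otimes>\<^bsub>A\<^esub> b)"
    using A a b by (simp_all add: calg_def)
  assume d: "d \<in> carrier A"
  show "(a \<otimes>\<^bsub>A\<^esub> b) \<otimes>\<^bsub>A\<^esub> d = a \<otimes>\<^bsub>A\<^esub> (b \<otimes>\<^bsub>A\<^esub> d)" using a b d by (rule m_assoc)
  show "(a \<oplus>\<^bsub>A\<^esub> b) \<otimes>\<^bsub>A\<^esub> d = a \<otimes>\<^bsub>A\<^esub> d \<oplus>\<^bsub>A\<^esub> b \<otimes>\<^bsub>A\<^esub> d" using a b d by (rule l_distr)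
  show "d \<otimes>\<^bsub>A\<^esub> (a \<oplus>\<^bsub>A\<^esub> b) = d \<otimes>\<^bsub>A\<^esub> a \<oplus>\<^bsub>A\<^esub> d \<otimes>\<^bsub>A\<^esub> b" using a b d by (rule r_distr)
qed

lemma calg_zero: "calg A \<Longrightarrow> \<zero>\<^bsub>A\<^esub> \<in> carrier A"
  and calg_add: "calg A \<Longrightarrow> a \<in> carrier A \<Longrightarrow> b \<in> carrier A \<Longrightarrow> a \<oplus>\<^bsub>A\<^esub> b \<in> carrier A"
  and calg_smult: "calg A \<Longrightarrow> a \<in> carrier A \<Longrightarrow> c \<odot>\<^bsub>A\<^esub> a \<in> carrier A"
  by (auto simp: calg_cvs cvs_closed)

lemmas calg_closed = calg_zero calg_one calg_add calg_mult calg_smult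

lemma calgI:
  assumes A: "cvs A"
    and "\<one>\<^bsub>A\<^esub> \<in> carrier A"
    and "\<And>a b. a \<in> carrier A \<Longrightarrow> b \<in> carrier A \<Longrightarrow> a \<otimes>\<^bsub>A\<^esub> b \<in> carrier A"
    and "\<And>a b d. a \<in> carrier A \<Longrightarrow> b \<in> carrier A \<Longrightarrow> d \<in> carrier A \<Longrightarrow>
     (a \<otimes>\<^bsub>A\<^esub> b) \<otimes>\<^bsub>A\<^esub> d = a \<otimes>\<^bsub>A\<^esub> (b \<otimes>\<^bsub>A\<^esub> d)"
    and "\<And>a. a \<in> carrier A \<Longrightarrow> \<one>\<^bsub>A\<^esub> \<otimes>\<^bsub>A\<^esub> a = a" "\<And>a. a \<in> carrier A \<Longrightarrow> a \<otimes>\<^bsub>A\<^esub> \<one>\<^bsub>A\<^esub> = a"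
    and "\<And>a b d. a \<in> carrier A \<Longrightarrow> b \<in> carrier A \<Longrightarrow> d \<in> carrier A \<Longrightarrow>
     (a \<oplus>\<^bsub>A\<^esub> b) \<otimes>\<^bsub>A\<^esub> d = a \<otimes>\<^bsub>A\<^esub> d \<oplus>\<^bsub>A\<^esub> b \<otimes>\<^bsub>A\<^esub> d"
    and "\<And>a b d. a \<in> carrier A \<Longrightarrow> b \<in> carrier A \<Longrightarrow> d \<in> carrier A \<Longrightarrow>
     d \<otimes>\<^bsub>A\<^esub> (a \<oplus>\<^bsub>A\<^esub> b) = d \<otimes>\<^bsub>A\<^esub> a \<oplus>\<^bsub>A\<^esub> d \<otimes>\<^bsub>A\<^esub> b"
    and "\<And>c a b. a \<in> carrier A \<Longrightarrow> b \<in> carrier A \<Longrightarrow> (c \<odot>\<^bsub>A\<^esub> a) \<otimes>\<^bsub>A\<^esub> b = c \<odot>\<^bsub>A\<^esub> (a \<otimes>\<^bsub>A\<^esub> b)"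
    and "\<And>c a b. a \<in> carrier A \<Longrightarrow> b \<in> carrier A \<Longrightarrow> a \<otimes>\<^bsub>A\<^esub> (c \<odot>\<^bsub>A\<^esub> b) = c \<odot>\<^bsub>A\<^esub> (a \<otimes>\<^bsub>A\<^esub> b)"
  shows "calg A"
proof -
  have "abelian_group A" using A by (simp add: vectorspace_def Module.module_def)
  moreover have "Group.monoid A" by (rule monoidI) (use assms in auto)
  ultimately have "ring A" by (rule ringI) (use assms in auto)
  then show ?thesis using assms by (simp add: calg_def)
qed

lemma cvs_image:
  assumes A: "cvs A" and q: "\<pi> ` carrier A = carrier Q"
    and add: "\<And>a b. a \<in> carrier A \<Longrightarrow> b \<in> carrier A \<Longrightarrow> \<pi> a \<oplus>\<^bsub>Q\<^esub> \<pi> b = \<pi> (a \<oplus>\<^bsub>A\<^esub> b)"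
    and smult: "\<And>c a. a \<in> carrier A \<Longrightarrow> c \<odot>\<^bsub>Q\<^esub> \<pi> a = \<pi> (c \<odot>\<^bsub>A\<^esub> a)"
    and zero: "\<zero>\<^bsub>Q\<^esub> = \<pi> \<zero>\<^bsub>A\<^esub>"
  shows "cvs Q"
  by (rule cvsI, unfold q[symmetric])
    (auto simp: add smult zero A cvs_simps cvs_assoc intro!: imageI arg_cong[of _ _ \<pi>] cvs_comm[OF A])

text \<open>
  The operations of \<open>Q\<close> are constrained only through \<open>\<pi>\<close>, so that the laws are inherited along any
  surjection; quotient algebras are the application.
\<close>

lemma calg_image:
  assumes A: "calg A" and q: "\<pi> ` carrier A = carrier Q"
    and add: "\<And>a b. a \<in> carrier A \<Longrightarrow> b \<in> carrier A \<Longrightarrow> \<pi> a \<oplus>\<^bsub>Q\<^esub> \<pi> b = \<pi> (a \<oplus>\<^bsub>A\<^esub> b)"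
    and smult: "\<And>c a. a \<in> carrier A \<Longrightarrow> c \<odot>\<^bsub>Q\<^esub> \<pi> a = \<pi> (c \<odot>\<^bsub>A\<^esub> a)"
    and zero: "\<zero>\<^bsub>Q\<^esub> = \<pi> \<zero>\<^bsub>A\<^esub>"
    and mult: "\<And>a b. a \<in> carrier A \<Longrightarrow> b \<in> carrier A \<Longrightarrow> \<pi> a \<otimes>\<^bsub>Q\<^esub> \<pi> b = \<pi> (a \<otimes>\<^bsub>A\<^esub> b)"
    and one: "\<one>\<^bsub>Q\<^esub> = \<pi> \<one>\<^bsub>A\<^esub>"
  shows "calg Q"
proof (rule calgI)
  show "cvs Q" by (rule cvs_image[OF calg_cvs[OF A] q add smult zero])
qed (unfold q[symmetric], auto simp: add smult mult one A calg_closed calg_assoc calg_l_one calg_r_one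
    calg_l_distr calg_r_distr calg_smult_l calg_smult_r intro!: imageI)

definition alg_hom :: "(complex, 'a) module \<Rightarrow> (complex, 'b) module \<Rightarrow> ('a \<Rightarrow> 'b) \<Rightarrow> bool" where
  "alg_hom A B f \<longleftrightarrow> lin A B f \<and> f \<one>\<^bsub>A\<^esub> = \<one>\<^bsub>B\<^esub> \<and>
     (\<forall>a\<in>carrier A. \<forall>b\<in>carrier A. f (a \<otimes>\<^bsub>A\<^esub> b) = f a \<otimes>\<^bsub>B\<^esub> f b)"

lemma alg_hom_lin: "alg_hom A B f \<Longrightarrow> lin A B f"
  and alg_hom_one: "alg_hom A B f \<Longrightarrow> f \<one>\<^bsub>A\<^esub> = \<one>\<^bsub>B\<^esub>"
  and alg_hom_mult: "alg_hom A B f \<Longrightarrow> a \<in> carrier A \<Longrightarrow> b \<in> carrier A \<Longrightarrow> f (a \<otimes>\<^bsub>A\<^esub> b) = f a \<otimes>\<^bsub>B\<^esub> f b"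
  by (auto simp: alg_hom_def)

lemma alg_hom_comp: "alg_hom A B f \<Longrightarrow> alg_hom B D g \<Longrightarrow> alg_hom A D (\<lambda>a. g (f a))"
  by (auto simp: alg_hom_def lin_def)

lemma alg_hom_ident: "alg_hom A A (\<lambda>a. a)"
  by (auto simp: alg_hom_def lin_ident)

text \<open>
  The unital subalgebra generated by \<open>S\<close>.
\<close>

inductive_set agen :: "(complex, 'a) module \<Rightarrow> 'a set \<Rightarrow> 'a set" for A S where
  one: "\<one>\<^bsub>A\<^esub> \<in> agen A S"
| base: "s \<in> S \<Longrightarrow> s \<in> agen A S"
| add: "a \<in> agen A S \<Longrightarrow> b \<in> agen A S \<Longrightarrow> a \<oplus>\<^bsub>A\<^esub> b \<in> agen A S"
| mult: "a \<in> agen A S \<Longrightarrow> b \<in> agen A S \<Longrightarrow> a \<otimes>\<^bsub>A\<^esub> b \<in> agen A S"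
| smult: "a \<in> agen A S \<Longrightarrow> c \<odot>\<^bsub>A\<^esub> a \<in> agen A S"

lemma agen_closed:
  assumes "calg A" "S \<subseteq> carrier A" "a \<in> agen A S" shows "a \<in> carrier A"
  using assms(3) by induct (use assms(1,2) in \<open>auto simp: calg_closed\<close>)

lemma alg_hom_eq_on_agen:
  assumes "calg A" "S \<subseteq> carrier A" "alg_hom A B f" "alg_hom A B g"
    and "\<And>s. s \<in> S \<Longrightarrow> f s = g s" and "a \<in> agen A S"
  shows "f a = g a"
  using assms(6)
  by induct (use assms(1-5) in \<open>auto simp: alg_hom_lin[THEN lin_add] alg_hom_lin[THEN lin_smult]
      alg_hom_one alg_hom_mult agen_closed\<close>)

text \<open>
  Bilinearity reduces the product of two elements of the span to products of spanning elements.
  With \<open>agen_lspan\<close> this shows that an algebra with homogeneous generators is spanned by homogeneous elements.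
\<close>

lemma lspan_mult:
  assumes A: "calg A" and H: "H \<subseteq> carrier A"
    and mult: "\<And>g h. g \<in> H \<Longrightarrow> h \<in> H \<Longrightarrow> g \<otimes>\<^bsub>A\<^esub> h \<in> lspan A H"
    and a: "a \<in> lspan A H" and b: "b \<in> lspan A H"
  shows "a \<otimes>\<^bsub>A\<^esub> b \<in> lspan A H"
proof -
  note cl = lspan_closed[OF calg_cvs[OF A] H]
  have 1: "g \<otimes>\<^bsub>A\<^esub> b \<in> lspan A H" if g: "g \<in> H" for g
  proof -
    from g H have g': "g \<in> carrier A" by auto
    from b show ?thesis
    proof induct
      case zero
      then show ?case using A g' by (auto simp: calg_r_null intro: lspan.zero)
    next
      case (base h)
      then show ?case using mult g by auto
    next
      case (add u u')
      then show ?case using A g' cl by (auto simp: calg_r_distr intro: lspan.add)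
    next
      case (smult u c)
      then show ?case using A g' cl by (auto simp: calg_smult_r intro: lspan.smult)
    qed
  qed
  from a show ?thesis
  proof induct
    case zero
    then show ?case using A cl[OF b] by (auto simp: calg_l_null intro: lspan.zero)
  next
    case (base h)
    then show ?case using 1 by auto
  next
    case (add u u')
    then show ?case using A H b cl by (auto simp: calg_l_distr intro: lspan.add)
  next
    case (smult u c)
    then show ?case using A H b cl by (auto simp: calg_smult_l intro: lspan.smult)
  qed
qed

lemma agen_lspan:
  assumes A: "calg A" and H: "H \<subseteq> carrier A"
    and mult: "\<And>g h. g \<in> H \<Longrightarrow> h \<in> H \<Longrightarrow> g \<otimes>\<^bsub>A\<^esub> h \<in> lspan A H"
    and one: "\<one>\<^bsub>A\<^esub> \<in> lspan A H" and S: "S \<subseteq> lspan A H" and a: "a \<in> agen A S"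
  shows "a \<in> lspan A H"
  using a by induct (use S one lspan_mult[OF A H mult] in \<open>auto intro: lspan.intros\<close>)

section \<open>Monoid algebras\<close>

lemma monoid_alg_simps [simp]:
  "carrier (monoid_alg G) = {f. Poly_Mapping.keys f \<subseteq> carrier G}"
  "\<one>\<^bsub>monoid_alg G\<^esub> = Poly_Mapping.single \<one>\<^bsub>G\<^esub> 1"
  "\<zero>\<^bsub>monoid_alg G\<^esub> = 0"
  "F \<oplus>\<^bsub>monoid_alg G\<^esub> H = F + H"
  "c \<odot>\<^bsub>monoid_alg G\<^esub> F = pscale c F"
  by (auto simp: monoid_alg_def)

lemma monoid_alg_mult: "F \<otimes>\<^bsub>monoid_alg G\<^esub> H =
    (\<Sum>u\<in>Poly_Mapping.keys F. \<Sum>v\<in>Poly_Mapping.keys H.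
       Poly_Mapping.single (u \<otimes>\<^bsub>G\<^esub> v) (Poly_Mapping.lookup F u * Poly_Mapping.lookup H v))"
  by (simp add: monoid_alg_def)

lemma monoid_alg_mult_superset:
  assumes "finite S" "finite S'" "Poly_Mapping.keys F \<subseteq> S" "Poly_Mapping.keys H \<subseteq> S'"
  shows "F \<otimes>\<^bsub>monoid_alg G\<^esub> H = (\<Sum>u\<in>S. \<Sum>v\<in>S'.
       Poly_Mapping.single (u \<otimes>\<^bsub>G\<^esub> v) (Poly_Mapping.lookup F u * Poly_Mapping.lookup H v))"
  unfolding monoid_alg_mult
  by (rule sum.mono_neutral_cong_left)
    (use assms in \<open>auto simp: in_keys_iff intro!: sum.mono_neutral_cong_left\<close>)

lemma monoid_alg_l_distr:
  "(F + F') \<otimes>\<^bsub>monoid_alg G\<^esub> H = F \<otimes>\<^bsub>monoid_alg G\<^esub> H + F' \<otimes>\<^bsub>monoid_alg G\<^esub> H"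
proof -
  let ?S = "Poly_Mapping.keys F \<union> Poly_Mapping.keys F'"
  note s = monoid_alg_mult_superset[of ?S "Poly_Mapping.keys H" _ H G]
  have k: "Poly_Mapping.keys (F + F') \<subseteq> ?S" by (rule keys_add)
  show ?thesis
    by (subst (1 2 3) s) (use k in \<open>auto simp: lookup_add algebra_simps single_add sum.distrib\<close>)
qed

lemma monoid_alg_r_distr:
  "H \<otimes>\<^bsub>monoid_alg G\<^esub> (F + F') = H \<otimes>\<^bsub>monoid_alg G\<^esub> F + H \<otimes>\<^bsub>monoid_alg G\<^esub> F'"
proof -
  let ?S = "Poly_Mapping.keys F \<union> Poly_Mapping.keys F'"
  note s = monoid_alg_mult_superset[of "Poly_Mapping.keys H" ?S H _ G]
  have k: "Poly_Mapping.keys (F + F') \<subseteq> ?S" by (rule keys_add)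
  show ?thesis
    by (subst (1 2 3) s) (use k in \<open>auto simp: lookup_add algebra_simps single_add sum.distrib\<close>)
qed

lemma monoid_alg_zero_mult: "0 \<otimes>\<^bsub>monoid_alg G\<^esub> H = 0" "H \<otimes>\<^bsub>monoid_alg G\<^esub> 0 = 0"
  by (simp_all add: monoid_alg_mult)

lemma pscale_sum: "pscale c (sum f S) = (\<Sum>s\<in>S. pscale c (f s))"
  by (induct S rule: infinite_finite_induct) (auto simp: pscale_zero pscale_add)

lemma monoid_alg_smult_l: "pscale c F \<otimes>\<^bsub>monoid_alg G\<^esub> H = pscale c (F \<otimes>\<^bsub>monoid_alg G\<^esub> H)"
  by (subst monoid_alg_mult_superset[of "Poly_Mapping.keys F" "Poly_Mapping.keys H"])
    (auto simp: keys_pscale monoid_alg_mult pscale_sum pscale_single lookup_pscale mult.assoc)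

lemma monoid_alg_smult_r: "H \<otimes>\<^bsub>monoid_alg G\<^esub> pscale c F = pscale c (H \<otimes>\<^bsub>monoid_alg G\<^esub> F)"
  by (subst monoid_alg_mult_superset[of "Poly_Mapping.keys H" "Poly_Mapping.keys F"])
    (auto simp: keys_pscale monoid_alg_mult pscale_sum pscale_single lookup_pscale mult.left_commute)

lemma monoid_alg_single_mult:
  "Poly_Mapping.single u a \<otimes>\<^bsub>monoid_alg G\<^esub> Poly_Mapping.single v b = Poly_Mapping.single (u \<otimes>\<^bsub>G\<^esub> v) (a * b)"
  by (subst monoid_alg_mult_superset[of "{u}" "{v}"]) auto

lemmas monoid_alg_bilinear = monoid_alg_l_distr monoid_alg_r_distr monoid_alg_zero_mult
  monoid_alg_smult_l monoid_alg_smult_r monoid_alg_single_mult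

lemma monoid_alg_keys_mult:
  assumes G: "Group.monoid G" and "Poly_Mapping.keys F \<subseteq> carrier G" "Poly_Mapping.keys H \<subseteq> carrier G"
  shows "Poly_Mapping.keys (F \<otimes>\<^bsub>monoid_alg G\<^esub> H) \<subseteq> carrier G"
proof -
  have "Poly_Mapping.keys (F \<otimes>\<^bsub>monoid_alg G\<^esub> H) \<subseteq>
     (\<Union>u\<in>Poly_Mapping.keys F. \<Union>v\<in>Poly_Mapping.keys H. {u \<otimes>\<^bsub>G\<^esub> v})"
    unfolding monoid_alg_mult
    by (rule order_trans[OF keys_sum] UN_mono order_refl)+ auto
  also have "\<dots> \<subseteq> carrier G" using assms by (auto intro!: monoid.m_closed[OF G])
  finally show ?thesis .
qed

lemma pm_cvs:
  fixes U :: "(complex, 'b \<Rightarrow>\<^sub>0 complex) module"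
  assumes "carrier U = {f. Poly_Mapping.keys f \<subseteq> S}" "\<zero>\<^bsub>U\<^esub> = 0" "add U = (+)" "\<And>c F. c \<odot>\<^bsub>U\<^esub> F = pscale c F"
  shows "cvs U"
proof (rule cvsI)
  show "x \<oplus>\<^bsub>U\<^esub> y \<in> carrier U" if "x \<in> carrier U" "y \<in> carrier U" for x y
    using that keys_add[of x y] by (auto simp: assms)
  show "c \<odot>\<^bsub>U\<^esub> x \<in> carrier U" if "x \<in> carrier U" for c x
    using that keys_pscale[of c x] by (auto simp: assms)
qed (simp_all add: assms pscale_add pscale_add_left pscale_pscale pscale_1 pscale_0 algebra_simps)

lemma calg_monoid_alg:
  fixes G :: "('g, 'm) monoid_scheme"
  assumes G: "Group.monoid G"
  shows "calg (monoid_alg G)"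
proof (rule calgI)
  show "cvs (monoid_alg G)" by (rule pm_cvs[of _ "carrier G"]) (auto simp: monoid_alg_def)
next
  fix a b d assume "a \<in> carrier (monoid_alg G)" "b \<in> carrier (monoid_alg G)" "d \<in> carrier (monoid_alg G)"
  then have a: "Poly_Mapping.keys a \<subseteq> carrier G" and b: "Poly_Mapping.keys b \<subseteq> carrier G"
    and d: "Poly_Mapping.keys d \<subseteq> carrier G" by auto
  from a show "(a \<otimes>\<^bsub>monoid_alg G\<^esub> b) \<otimes>\<^bsub>monoid_alg G\<^esub> d = a \<otimes>\<^bsub>monoid_alg G\<^esub> (b \<otimes>\<^bsub>monoid_alg G\<^esub> d)"
  proof (induct rule: poly_mapping_keys_induct)
    case (single u c F)
    from b have "(Poly_Mapping.single u c \<otimes>\<^bsub>monoid_alg G\<^esub> b) \<otimes>\<^bsub>monoid_alg G\<^esub> d =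
       Poly_Mapping.single u c \<otimes>\<^bsub>monoid_alg G\<^esub> (b \<otimes>\<^bsub>monoid_alg G\<^esub> d)"
    proof (induct rule: poly_mapping_keys_induct)
      case (single v e F)
      from d have "(Poly_Mapping.single u c \<otimes>\<^bsub>monoid_alg G\<^esub> Poly_Mapping.single v e) \<otimes>\<^bsub>monoid_alg G\<^esub> d =
         Poly_Mapping.single u c \<otimes>\<^bsub>monoid_alg G\<^esub> (Poly_Mapping.single v e \<otimes>\<^bsub>monoid_alg G\<^esub> d)"
        by (induct rule: poly_mapping_keys_induct)
          (use \<open>u \<in> carrier G\<close> \<open>v \<in> carrier G\<close> in
            \<open>auto simp: monoid_alg_bilinear monoid.m_assoc[OF G] mult.assoc\<close>)
      then show ?case using single by (simp add: monoid_alg_bilinear)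
    qed (simp add: monoid_alg_bilinear)
    then show ?case using single by (simp add: monoid_alg_bilinear)
  qed (simp add: monoid_alg_bilinear)
next
  fix a assume "a \<in> carrier (monoid_alg G)"
  then have a: "Poly_Mapping.keys a \<subseteq> carrier G" by auto
  then show "\<one>\<^bsub>monoid_alg G\<^esub> \<otimes>\<^bsub>monoid_alg G\<^esub> a = a"
    by (induct rule: poly_mapping_keys_induct) (auto simp: monoid_alg_bilinear monoid.l_one[OF G])
  from a show "a \<otimes>\<^bsub>monoid_alg G\<^esub> \<one>\<^bsub>monoid_alg G\<^esub> = a"
    by (induct rule: poly_mapping_keys_induct) (auto simp: monoid_alg_bilinear monoid.r_one[OF G])
qed (use monoid_alg_keys_mult[OF G] in
    \<open>auto simp: monoid_alg_l_distr monoid_alg_r_distr monoid_alg_smult_l monoid_alg_smult_r monoid.one_closed[OF G]\<close>)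

lemma alg_hom_linext:
  assumes A: "calg A" and G: "Group.monoid G"
    and B: "\<And>g. g \<in> carrier G \<Longrightarrow> B g \<in> carrier A"
    and mult: "\<And>g h. g \<in> carrier G \<Longrightarrow> h \<in> carrier G \<Longrightarrow> B (g \<otimes>\<^bsub>G\<^esub> h) = B g \<otimes>\<^bsub>A\<^esub> B h"
    and one: "B \<one>\<^bsub>G\<^esub> = \<one>\<^bsub>A\<^esub>"
  shows "alg_hom (monoid_alg G) A (linext A B)"
proof -
  note AV = calg_cvs[OF A]
  have cl: "linext A B F \<in> carrier A" if "Poly_Mapping.keys F \<subseteq> carrier G" for F
    using that B by (intro linext_closed[OF AV]) auto
  have add: "linext A B (F + H) = linext A B F \<oplus>\<^bsub>A\<^esub> linext A B H"
    if "Poly_Mapping.keys F \<subseteq> carrier G" "Poly_Mapping.keys H \<subseteq> carrier G" for F H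
    using that B by (intro linext_add[OF AV]) auto
  have sg: "Poly_Mapping.keys (Poly_Mapping.single u c) \<subseteq> carrier G" if "u \<in> carrier G" for u and c :: complex
    using that by auto
  have ls: "linext A B (Poly_Mapping.single u c) = c \<odot>\<^bsub>A\<^esub> B u" if "u \<in> carrier G" for u c
    using that B by (intro linext_single[OF AV]) auto
  have km: "Poly_Mapping.keys (F \<otimes>\<^bsub>monoid_alg G\<^esub> H) \<subseteq> carrier G"
    if "Poly_Mapping.keys F \<subseteq> carrier G" "Poly_Mapping.keys H \<subseteq> carrier G" for F H
    by (rule monoid_alg_keys_mult[OF G that])
  have "lin (monoid_alg G) A (linext A B)"
    by (rule linI) (use B in \<open>auto simp: cl add intro!: linext_pscale[OF AV]\<close>)
  moreover have "linext A B (F \<otimes>\<^bsub>monoid_alg G\<^esub> H) = linext A B F \<otimes>\<^bsub>A\<^esub> linext A B H"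
    if F: "Poly_Mapping.keys F \<subseteq> carrier G" and H: "Poly_Mapping.keys H \<subseteq> carrier G" for F H
    using F
  proof (induct rule: poly_mapping_keys_induct)
    case zero
    show ?case using cl[OF H] A AV by (simp add: monoid_alg_bilinear calg_l_null)
  next
    case (single u c F)
    from H have "linext A B (Poly_Mapping.single u c \<otimes>\<^bsub>monoid_alg G\<^esub> H) =
       linext A B (Poly_Mapping.single u c) \<otimes>\<^bsub>A\<^esub> linext A B H"
    proof (induct rule: poly_mapping_keys_induct)
      case zero
      show ?case using cl[OF sg[OF \<open>u \<in> carrier G\<close>]] A AV by (simp add: monoid_alg_bilinear calg_r_null)
    next
      case (single v d H)
      then show ?case
        using \<open>u \<in> carrier G\<close> A AV B
        by (simp add: monoid_alg_bilinear add km sg ls calg_r_distr cl calg_closed mult monoid.m_closed[OF G]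
            calg_smult_l calg_smult_r cvs_smult_smult mult.commute)
    qed
    then show ?case using single H A
      by (simp add: monoid_alg_bilinear add km sg calg_l_distr cl)
  qed
  ultimately show ?thesis
    using ls[OF monoid.one_closed[OF G], of 1] one A AV by (auto simp: alg_hom_def cvs_one_smult calg_one)
qed

section \<open>Quotients\<close>

definition lsub :: "(complex, 'v) module \<Rightarrow> 'v set \<Rightarrow> bool" where
  "lsub V N \<longleftrightarrow> N \<subseteq> carrier V \<and> \<zero>\<^bsub>V\<^esub> \<in> N \<and> (\<forall>u\<in>N. \<forall>v\<in>N. u \<oplus>\<^bsub>V\<^esub> v \<in> N) \<and> (\<forall>c. \<forall>u\<in>N. c \<odot>\<^bsub>V\<^esub> u \<in> N)"

text \<open>
  Cosets of subspaces are compared through representatives that differ by an element of the subspace.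
\<close>

lemma coset_eqI:
  assumes V: "cvs V" and N: "lsub V N" and b: "b \<in> carrier V" and h: "h \<in> N" and a: "a = h \<oplus>\<^bsub>V\<^esub> b"
  shows "N +>\<^bsub>V\<^esub> a = N +>\<^bsub>V\<^esub> b"
proof -
  have hV: "k \<in> carrier V" if "k \<in> N" for k using that N by (auto simp: lsub_def)
  have 1: "N +>\<^bsub>V\<^esub> a \<subseteq> N +>\<^bsub>V\<^esub> b" unfolding a_r_coset_def'
  proof safe
    fix k assume k: "k \<in> N"
    have "k \<oplus>\<^bsub>V\<^esub> a = (k \<oplus>\<^bsub>V\<^esub> h) \<oplus>\<^bsub>V\<^esub> b" using a k h hV V b by (simp add: cvs_assoc)
    moreover have "k \<oplus>\<^bsub>V\<^esub> h \<in> N" using k h N by (auto simp: lsub_def)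
    ultimately show "k \<oplus>\<^bsub>V\<^esub> a \<in> (\<Union>h\<in>N. {h \<oplus>\<^bsub>V\<^esub> b})" by auto
  qed
  have "N +>\<^bsub>V\<^esub> b \<subseteq> N +>\<^bsub>V\<^esub> a" unfolding a_r_coset_def'
  proof safe
    fix k assume k: "k \<in> N"
    have h': "(- 1) \<odot>\<^bsub>V\<^esub> h \<in> N" using h N by (auto simp: lsub_def)
    have hh: "(- 1) \<odot>\<^bsub>V\<^esub> h \<oplus>\<^bsub>V\<^esub> h = \<zero>\<^bsub>V\<^esub>"
      using cvs_add_smult[OF V hV[OF h], of "- 1" 1] V hV[OF h] by (simp add: cvs_simps)
    have "(k \<oplus>\<^bsub>V\<^esub> (- 1) \<odot>\<^bsub>V\<^esub> h) \<oplus>\<^bsub>V\<^esub> a = k \<oplus>\<^bsub>V\<^esub> (((- 1) \<odot>\<^bsub>V\<^esub> h \<oplus>\<^bsub>V\<^esub> h) \<oplus>\<^bsub>V\<^esub> b)"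
      using a k h h' hV V b by (simp add: cvs_assoc cvs_closed)
    also have "\<dots> = k \<oplus>\<^bsub>V\<^esub> b" using hh V b by (simp add: cvs_simps)
    finally have "k \<oplus>\<^bsub>V\<^esub> b = (k \<oplus>\<^bsub>V\<^esub> (- 1) \<odot>\<^bsub>V\<^esub> h) \<oplus>\<^bsub>V\<^esub> a" by simp
    moreover have "k \<oplus>\<^bsub>V\<^esub> (- 1) \<odot>\<^bsub>V\<^esub> h \<in> N" using k h' N by (auto simp: lsub_def)
    ultimately show "k \<oplus>\<^bsub>V\<^esub> b \<in> (\<Union>h\<in>N. {h \<oplus>\<^bsub>V\<^esub> a})" by auto
  qed
  with 1 show ?thesis by auto
qed

lemma coset_self:
  assumes V: "cvs V" and N: "lsub V N" and a: "a \<in> carrier V"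
  shows "a \<in> N +>\<^bsub>V\<^esub> a"
  using cvs_lzero[OF V a] N by (force simp: a_r_coset_def' lsub_def)

lemma coset_zero:
  assumes V: "cvs V" and N: "lsub V N"
  shows "N +>\<^bsub>V\<^esub> \<zero>\<^bsub>V\<^esub> = N"
proof -
  have "h \<oplus>\<^bsub>V\<^esub> \<zero>\<^bsub>V\<^esub> = h" if "h \<in> N" for h using that V N by (auto simp: lsub_def cvs_rzero)
  then show ?thesis by (auto simp: a_r_coset_def')
qed

lemma coset_add:
  assumes V: "cvs V" and N: "lsub V N" and a: "a \<in> carrier V" and b: "b \<in> carrier V"
  shows "(N +>\<^bsub>V\<^esub> a) <+>\<^bsub>V\<^esub> (N +>\<^bsub>V\<^esub> b) = N +>\<^bsub>V\<^esub> (a \<oplus>\<^bsub>V\<^esub> b)"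
proof -
  have hV: "k \<in> carrier V" if "k \<in> N" for k using that N by (auto simp: lsub_def)
  show ?thesis
  proof
    show "(N +>\<^bsub>V\<^esub> a) <+>\<^bsub>V\<^esub> (N +>\<^bsub>V\<^esub> b) \<subseteq> N +>\<^bsub>V\<^esub> (a \<oplus>\<^bsub>V\<^esub> b)"
    proof
      fix x assume "x \<in> (N +>\<^bsub>V\<^esub> a) <+>\<^bsub>V\<^esub> (N +>\<^bsub>V\<^esub> b)"
      then obtain h k where hk: "h \<in> N" "k \<in> N" and x: "x = (h \<oplus>\<^bsub>V\<^esub> a) \<oplus>\<^bsub>V\<^esub> (k \<oplus>\<^bsub>V\<^esub> b)"
        unfolding set_add_def' a_r_coset_def' by force
      have "x = (h \<oplus>\<^bsub>V\<^esub> k) \<oplus>\<^bsub>V\<^esub> (a \<oplus>\<^bsub>V\<^esub> b)"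
        unfolding x using hV[OF hk(1)] hV[OF hk(2)] a b V by (simp add: cvs_ac cvs_closed)
      moreover have "h \<oplus>\<^bsub>V\<^esub> k \<in> N" using hk N by (simp add: lsub_def)
      ultimately show "x \<in> N +>\<^bsub>V\<^esub> (a \<oplus>\<^bsub>V\<^esub> b)" unfolding a_r_coset_def' by force
    qed
    show "N +>\<^bsub>V\<^esub> (a \<oplus>\<^bsub>V\<^esub> b) \<subseteq> (N +>\<^bsub>V\<^esub> a) <+>\<^bsub>V\<^esub> (N +>\<^bsub>V\<^esub> b)"
    proof
      fix x assume "x \<in> N +>\<^bsub>V\<^esub> (a \<oplus>\<^bsub>V\<^esub> b)"
      then obtain k where k: "k \<in> N" and x: "x = k \<oplus>\<^bsub>V\<^esub> (a \<oplus>\<^bsub>V\<^esub> b)"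
        unfolding a_r_coset_def' by force
      have "x = (k \<oplus>\<^bsub>V\<^esub> a) \<oplus>\<^bsub>V\<^esub> b"
        unfolding x using hV[OF k] a b V by (simp add: cvs_assoc)
      moreover have ka: "k \<oplus>\<^bsub>V\<^esub> a \<in> N +>\<^bsub>V\<^esub> a" using k unfolding a_r_coset_def' by blast
      ultimately show "x \<in> (N +>\<^bsub>V\<^esub> a) <+>\<^bsub>V\<^esub> (N +>\<^bsub>V\<^esub> b)"
        using coset_self[OF V N b] ka unfolding set_add_def' by blast
    qed
  qed
qed

lemma coset_smult_coset:
  assumes V: "cvs V" and N: "lsub V N" and a: "a \<in> carrier V"
  shows "coset_smult V N c (N +>\<^bsub>V\<^esub> a) = N +>\<^bsub>V\<^esub> (c \<odot>\<^bsub>V\<^esub> a)"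
proof -
  have e: "N +>\<^bsub>V\<^esub> (c \<odot>\<^bsub>V\<^esub> v) = N +>\<^bsub>V\<^esub> (c \<odot>\<^bsub>V\<^esub> a)" if "v \<in> N +>\<^bsub>V\<^esub> a" for v
  proof -
    from that obtain h where h: "h \<in> N" "v = h \<oplus>\<^bsub>V\<^esub> a" by (auto simp: a_r_coset_def')
    have hV: "h \<in> carrier V" and "c \<odot>\<^bsub>V\<^esub> h \<in> N" using h(1) N unfolding lsub_def by blast+
    then show ?thesis
      by (intro coset_eqI[OF V N, of _ "c \<odot>\<^bsub>V\<^esub> h"]) (simp_all add: h(2) V a cvs_simps)
  qed
  have "coset_smult V N c (N +>\<^bsub>V\<^esub> a) = (\<Union>v\<in>N +>\<^bsub>V\<^esub> a. N +>\<^bsub>V\<^esub> (c \<odot>\<^bsub>V\<^esub> a))"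
    unfolding coset_smult_def by (rule SUP_cong[OF refl]) (rule e)
  also have "\<dots> = N +>\<^bsub>V\<^esub> (c \<odot>\<^bsub>V\<^esub> a)" using coset_self[OF V N a] by blast
  finally show ?thesis .
qed

lemma quot_space_simps:
  "carrier (quot_space V N) = (\<lambda>a. N +>\<^bsub>V\<^esub> a) ` carrier V"
  "\<zero>\<^bsub>quot_space V N\<^esub> = N" "add (quot_space V N) = set_add V" "smult (quot_space V N) = coset_smult V N"
  by (auto simp: quot_space_def A_RCOSETS_def')

lemma cvs_quot_space: "cvs V \<Longrightarrow> lsub V N \<Longrightarrow> cvs (quot_space V N)"
  by (rule cvs_image[of V "\<lambda>a. N +>\<^bsub>V\<^esub> a"])
    (auto simp: quot_space_simps coset_add coset_smult_coset coset_zero)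

lemma lin_quot_space: "cvs V \<Longrightarrow> lsub V N \<Longrightarrow> lin V (quot_space V N) (\<lambda>a. N +>\<^bsub>V\<^esub> a)"
  by (rule linI) (auto simp: quot_space_simps coset_add coset_smult_coset)

lemma quot_alg_simps:
  "carrier (quot_alg A N) = (\<lambda>a. N +>\<^bsub>A\<^esub> a) ` carrier A"
  "\<zero>\<^bsub>quot_alg A N\<^esub> = N" "add (quot_alg A N) = set_add A" "smult (quot_alg A N) = coset_smult A N"
  "\<one>\<^bsub>quot_alg A N\<^esub> = N +>\<^bsub>A\<^esub> \<one>\<^bsub>A\<^esub>" "monoid.mult (quot_alg A N) = rcoset_mult A N"
  by (auto simp: quot_alg_def A_RCOSETS_def' ring.extend_def module.fields_def FactRing_def)

text \<open>
  An ideal of a unital algebra is a subspace, because scalars can be moved into \<open>c \<odot> \<one>\<close>.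
\<close>

lemma ideal_lsub:
  assumes A: "calg A" and N: "ideal N A"
  shows "lsub A N"
proof -
  interpret ideal N A by (rule N)
  have "c \<odot>\<^bsub>A\<^esub> u \<in> N" if u: "u \<in> N" for c u
  proof -
    have "c \<odot>\<^bsub>A\<^esub> u = (c \<odot>\<^bsub>A\<^esub> \<one>\<^bsub>A\<^esub>) \<otimes>\<^bsub>A\<^esub> u" using A u by (simp add: calg_smult_l calg_closed calg_l_one)
    then show ?thesis using u A by (simp add: calg_smult I_l_closed)
  qed
  then show ?thesis by (auto simp: lsub_def)
qed

lemma calg_quot_alg:
  assumes A: "calg A" and N: "ideal N A"
  shows "calg (quot_alg A N)" and "alg_hom A (quot_alg A N) (\<lambda>a. N +>\<^bsub>A\<^esub> a)"
proof -
  note V = calg_cvs[OF A] ideal_lsub[OF A N]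
  show "calg (quot_alg A N)"
    by (rule calg_image[OF A, of "\<lambda>a. N +>\<^bsub>A\<^esub> a"])
      (auto simp: quot_alg_simps coset_add[OF V] coset_smult_coset[OF V] coset_zero[OF V]
        ideal.rcoset_mult_add[OF N])
  show "alg_hom A (quot_alg A N) (\<lambda>a. N +>\<^bsub>A\<^esub> a)"
    by (auto simp: alg_hom_def quot_alg_simps coset_add[OF V] coset_smult_coset[OF V]
        ideal.rcoset_mult_add[OF N] intro!: linI)
qed

section \<open>Presented algebras\<close>

lemma monoid_free_monoid: "Group.monoid (free_monoid S)"
  by (rule monoidI) (auto simp: free_monoid_def)

lemma free_monoid_simps [simp]:
  "carrier (free_monoid S) = lists S" "\<one>\<^bsub>free_monoid S\<^esub> = []" "w \<otimes>\<^bsub>free_monoid S\<^esub> w' = w @ w'"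
  by (auto simp: free_monoid_def)

lemma calg_free_alg: "calg (free_alg S)"
  unfolding free_alg_def by (rule calg_monoid_alg[OF monoid_free_monoid])

lemma free_alg_simps [simp]:
  "carrier (free_alg S) = {F. Poly_Mapping.keys F \<subseteq> lists S}"
  "\<one>\<^bsub>free_alg S\<^esub> = word []" "\<zero>\<^bsub>free_alg S\<^esub> = 0" "F \<oplus>\<^bsub>free_alg S\<^esub> H = F + H" "c \<odot>\<^bsub>free_alg S\<^esub> F = pscale c F"
  by (simp_all add: free_alg_def)

definition word_eval :: "(complex, 'b) module \<Rightarrow> ('s \<Rightarrow> 'b) \<Rightarrow> 's list \<Rightarrow> 'b" where
  "word_eval B f w = foldr (\<lambda>s b. f s \<otimes>\<^bsub>B\<^esub> b) w \<one>\<^bsub>B\<^esub>"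

lemma free_ext_linext: "free_ext B f = linext B (word_eval B f)"
  by (simp add: free_ext_def linext_def word_eval_def fun_eq_iff)

lemma word_eval_simps [simp]: "word_eval B f [] = \<one>\<^bsub>B\<^esub>" "word_eval B f (s # w) = f s \<otimes>\<^bsub>B\<^esub> word_eval B f w"
  by (simp_all add: word_eval_def)

lemma word_eval_closed: "calg B \<Longrightarrow> f ` S \<subseteq> carrier B \<Longrightarrow> w \<in> lists S \<Longrightarrow> word_eval B f w \<in> carrier B"
  by (induct w) (auto simp: calg_closed)

lemma word_eval_append: "calg B \<Longrightarrow> f ` S \<subseteq> carrier B \<Longrightarrow> w \<in> lists S \<Longrightarrow> w' \<in> lists S \<Longrightarrow>
    word_eval B f (w @ w') = word_eval B f w \<otimes>\<^bsub>B\<^esub> word_eval B f w'"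
proof (induct w)
  case Nil
  then show ?case using word_eval_closed[of B f S w'] by (simp add: calg_l_one)
next
  case (Cons s w)
  then show ?case using word_eval_closed[of B f S w'] word_eval_closed[of B f S w]
    by (auto simp: calg_assoc)
qed

lemma alg_hom_free_ext:
  assumes B: "calg B" and f: "f ` S \<subseteq> carrier B"
  shows "alg_hom (free_alg S) B (free_ext B f)"
  unfolding free_ext_linext free_alg_def
  by (rule alg_hom_linext[OF B monoid_free_monoid])
    (use word_eval_closed[OF B f] word_eval_append[OF B f] in auto)

lemma free_ext_word:
  assumes B: "calg B" and f: "f ` S \<subseteq> carrier B" and w: "w \<in> lists S"
  shows "free_ext B f (Poly_Mapping.single w c) = c \<odot>\<^bsub>B\<^esub> word_eval B f w"
  unfolding free_ext_linext
  by (rule linext_single[OF calg_cvs[OF B]]) (rule word_eval_closed[OF B f w])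

text \<open>
  Relators are words in the generators, so that they lie in the free algebra on \<open>S\<close> and generate an
  ideal there.
\<close>

locale presentation =
  fixes S :: "'s set" and R :: "('s list \<Rightarrow>\<^sub>0 complex) set"
  assumes R: "\<And>r. r \<in> R \<Longrightarrow> Poly_Mapping.keys r \<subseteq> lists S"
begin

abbreviation "P \<equiv> presented S R"
abbreviation "gen \<equiv> presented_gen S R"
definition "proj F = genideal (free_alg S) R +>\<^bsub>free_alg S\<^esub> F"

lemma R_carrier: "R \<subseteq> carrier (free_alg S)"
  using R by auto

lemma genideal_R: "ideal (genideal (free_alg S) R) (free_alg S)"
  by (rule ring.genideal_ideal[OF calg_ring[OF calg_free_alg] R_carrier])

lemma calg_P: "calg P" and alg_hom_proj: "alg_hom (free_alg S) P proj"
  using calg_quot_alg[OF calg_free_alg genideal_R] by (simp_all add: presented_def proj_def[abs_def])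

lemma carrier_P: "carrier P = proj ` carrier (free_alg S)"
  by (simp add: presented_def quot_alg_simps proj_def)

lemma gen_proj: "gen s = proj (word [s])"
  by (simp add: presented_gen_def proj_def)

lemma gen_closed: "s \<in> S \<Longrightarrow> gen s \<in> carrier P"
  unfolding carrier_P gen_proj by auto

lemma gen_image: "gen ` S \<subseteq> carrier P"
  by (auto simp: gen_closed)

lemma proj_relator: "r \<in> R \<Longrightarrow> proj r = \<zero>\<^bsub>P\<^esub>"
proof -
  assume r: "r \<in> R"
  note V = calg_cvs[OF calg_free_alg] ideal_lsub[OF calg_free_alg genideal_R]
  have "r \<in> genideal (free_alg S) R"
    using ring.genideal_self[OF calg_ring[OF calg_free_alg] R_carrier] r by auto
  then have "proj r = proj \<zero>\<^bsub>free_alg S\<^esub>" unfolding proj_def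
    by (intro coset_eqI[OF V, of _ r]) (auto simp: free_alg_simps)
  also have "\<dots> = \<zero>\<^bsub>P\<^esub>"
    using coset_zero[OF V] by (simp add: proj_def presented_def quot_alg_simps)
  finally show ?thesis .
qed

lemma free_ext_gen: "Poly_Mapping.keys F \<subseteq> lists S \<Longrightarrow> free_ext P gen F = proj F"
proof (induct rule: poly_mapping_keys_induct)
  case zero
  have "proj 0 = \<zero>\<^bsub>P\<^esub>"
    using lin_zero[OF alg_hom_lin[OF alg_hom_proj] calg_cvs[OF calg_free_alg] calg_cvs[OF calg_P]] by simp
  then show ?case using calg_cvs[OF calg_P] by (simp add: free_ext_linext)
next
  case (single w c F)
  note h = alg_hom_free_ext[OF calg_P gen_image]
  have w: "word_eval P gen w = proj (word w)" if "w \<in> lists S" for w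
    using that
  proof induct
    case Nil
    then show ?case using alg_hom_one[OF alg_hom_proj] by simp
  next
    case (Cons s w)
    then show ?case using alg_hom_mult[OF alg_hom_proj, of "word [s]" "word w"]
      by (simp add: gen_proj free_alg_def monoid_alg_single_mult)
  qed
  have "free_ext P gen (Poly_Mapping.single w c) = proj (Poly_Mapping.single w c)"
    using free_ext_word[OF calg_P gen_image, of w c] w[of w] single(1)
      lin_smult[OF alg_hom_lin[OF alg_hom_proj], of "word w" c] by (simp add: pscale_single)
  then show ?case
    using lin_add[OF alg_hom_lin[OF h], of "Poly_Mapping.single w c" F]
      lin_add[OF alg_hom_lin[OF alg_hom_proj], of "Poly_Mapping.single w c" F] single by simp
qed

lemma relation: "r \<in> R \<Longrightarrow> free_ext P gen r = \<zero>\<^bsub>P\<^esub>"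
  using free_ext_gen[OF R] proj_relator by simp

text \<open>
  The free algebra is spanned by words, and a word evaluates to a product of generators.
\<close>

lemma carrier_agen: "a \<in> carrier P \<Longrightarrow> a \<in> agen P (gen ` S)"
proof -
  assume "a \<in> carrier P"
  then obtain F where F: "Poly_Mapping.keys F \<subseteq> lists S" "a = proj F" unfolding carrier_P by auto
  have w: "word_eval P gen w \<in> agen P (gen ` S)" if "w \<in> lists S" for w
    using that by induct (simp_all add: agen.one agen.mult agen.base)
  from F(1) have "free_ext P gen F \<in> agen P (gen ` S)"
  proof (induct rule: poly_mapping_keys_induct)
    case zero
    have "0 \<odot>\<^bsub>P\<^esub> \<one>\<^bsub>P\<^esub> \<in> agen P (gen ` S)" by (rule agen.smult[OF agen.one])
    then show ?case using calg_cvs[OF calg_P] by (simp add: free_ext_linext cvs_zero_smult calg_one[OF calg_P])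
  next
    case (single w c F)
    have e: "free_ext P gen (Poly_Mapping.single w c \<oplus>\<^bsub>free_alg S\<^esub> F) =
        c \<odot>\<^bsub>P\<^esub> word_eval P gen w \<oplus>\<^bsub>P\<^esub> free_ext P gen F"
      unfolding free_ext_word[OF calg_P gen_image single(1), symmetric]
      by (rule lin_add[OF alg_hom_lin[OF alg_hom_free_ext[OF calg_P gen_image]]])
        (simp_all add: single(1,2))
    have "free_ext P gen (Poly_Mapping.single w c \<oplus>\<^bsub>free_alg S\<^esub> F) \<in> agen P (gen ` S)"
      unfolding e by (rule agen.add[OF agen.smult[OF w[OF single(1)]] single(3)])
    then show ?case by (simp only: free_alg_simps)
  qed
  then show ?thesis unfolding free_ext_gen[OF F(1)] F(2) .
qed

text \<open>
  The kernel of the extension of \<open>f\<close> to the free algebra is an ideal that contains the relators, hence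
  contains the ideal generated by them. So the extension is constant on cosets, which is what makes the
  definite description in \<open>presented_hom\<close> meaningful.
\<close>

lemma presented_hom:
  assumes B: "calg B" and f: "f ` S \<subseteq> carrier B" and rel: "\<And>r. r \<in> R \<Longrightarrow> free_ext B f r = \<zero>\<^bsub>B\<^esub>"
  shows "alg_hom P B (presented_hom B f)" and "s \<in> S \<Longrightarrow> presented_hom B f (gen s) = f s"
proof -
  note h = alg_hom_free_ext[OF B f]
  note FV = calg_cvs[OF calg_free_alg]
  define K where "K = a_kernel (free_alg S) B (free_ext B f)"
  have "ring_hom_ring (free_alg S) B (free_ext B f)"
    by (intro ring_hom_ringI calg_ring[OF calg_free_alg] calg_ring[OF B])
      (use h in \<open>auto simp: alg_hom_def lin_def\<close>)
  then have "ideal K (free_alg S)" unfolding K_def by (rule ring_hom_ring.kernel_is_ideal)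
  moreover have "R \<subseteq> K" using rel R_carrier by (auto simp: K_def a_kernel_def')
  ultimately have K: "genideal (free_alg S) R \<subseteq> K"
    by (rule ring.genideal_minimal[OF calg_ring[OF calg_free_alg]])
  have pr: "presented_hom B f (proj F) = free_ext B f F" if F: "F \<in> carrier (free_alg S)" for F
  proof -
    have 1: "free_ext B f G = free_ext B f F" if "G \<in> proj F" for G
    proof -
      from that obtain k where k: "k \<in> genideal (free_alg S) R" and G: "G = k + F"
        unfolding proj_def a_r_coset_def' by auto
      from k K have "k \<in> carrier (free_alg S)" and k0: "free_ext B f k = \<zero>\<^bsub>B\<^esub>"
        unfolding K_def a_kernel_def' by blast+
      then have "free_ext B f (k \<oplus>\<^bsub>free_alg S\<^esub> F) = free_ext B f k \<oplus>\<^bsub>B\<^esub> free_ext B f F"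
        by (intro lin_add[OF alg_hom_lin[OF h]] F)
      also have "\<dots> = free_ext B f F"
        unfolding k0 by (rule cvs_lzero[OF calg_cvs[OF B] lin_closed[OF alg_hom_lin[OF h] F]])
      finally show ?thesis using G by simp
    qed
    have 2: "F \<in> proj F" unfolding proj_def
      by (rule coset_self[OF FV ideal_lsub[OF calg_free_alg genideal_R] F])
    show ?thesis unfolding presented_hom_def
    proof (rule the_equality)
      show "\<forall>G\<in>proj F. free_ext B f G = free_ext B f F" by (intro ballI 1)
      show "b = free_ext B f F" if "\<forall>G\<in>proj F. free_ext B f G = b" for b
        using that[rule_format, OF 2] by (rule sym)
    qed
  qed
  note q = alg_hom_proj and l = alg_hom_lin[OF alg_hom_proj] and l' = alg_hom_lin[OF h]
  note cl = calg_add[OF calg_free_alg] calg_mult[OF calg_free_alg] calg_smult[OF calg_free_alg]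
    calg_one[OF calg_free_alg]
  have "lin P B (presented_hom B f)"
  proof (rule linI)
    fix u u' c assume "u \<in> carrier P" "u' \<in> carrier P"
    then obtain F G where F: "F \<in> carrier (free_alg S)" "u = proj F"
      and G: "G \<in> carrier (free_alg S)" "u' = proj G" unfolding carrier_P by blast
    show "presented_hom B f (u \<oplus>\<^bsub>P\<^esub> u') = presented_hom B f u \<oplus>\<^bsub>B\<^esub> presented_hom B f u'"
      unfolding F(2) G(2) lin_add[OF l F(1) G(1), symmetric]
      by (simp only: pr cl F(1) G(1) lin_add[OF l' F(1) G(1)])
  next
    fix u c assume "u \<in> carrier P"
    then obtain F where F: "F \<in> carrier (free_alg S)" "u = proj F" unfolding carrier_P by blast
    show "presented_hom B f u \<in> carrier B" unfolding F(2) pr[OF F(1)] by (rule lin_closed[OF l' F(1)])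
    show "presented_hom B f (c \<odot>\<^bsub>P\<^esub> u) = c \<odot>\<^bsub>B\<^esub> presented_hom B f u"
      unfolding F(2) lin_smult[OF l F(1), symmetric]
      by (simp only: pr cl F(1) lin_smult[OF l' F(1)])
  qed
  moreover have "presented_hom B f (u \<otimes>\<^bsub>P\<^esub> u') = presented_hom B f u \<otimes>\<^bsub>B\<^esub> presented_hom B f u'"
    if "u \<in> carrier P" "u' \<in> carrier P" for u u'
  proof -
    from that obtain F G where F: "F \<in> carrier (free_alg S)" "u = proj F"
      and G: "G \<in> carrier (free_alg S)" "u' = proj G" unfolding carrier_P by blast
    show ?thesis
      unfolding F(2) G(2) alg_hom_mult[OF q F(1) G(1), symmetric]
      by (simp only: pr cl F(1) G(1) alg_hom_mult[OF h F(1) G(1)])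
  qed
  moreover have "presented_hom B f \<one>\<^bsub>P\<^esub> = \<one>\<^bsub>B\<^esub>"
    unfolding alg_hom_one[OF q, symmetric] pr[OF cl(4)] by (rule alg_hom_one[OF h])
  ultimately show "alg_hom P B (presented_hom B f)" by (simp add: alg_hom_def)
  assume s: "s \<in> S"
  have fs: "f s \<in> carrier B" using f s by blast
  have "presented_hom B f (gen s) = free_ext B f (word [s])"
    unfolding gen_proj by (rule pr) (simp add: s)
  also have "\<dots> = 1 \<odot>\<^bsub>B\<^esub> word_eval B f [s]" by (rule free_ext_word[OF B f]) (simp add: s)
  also have "\<dots> = f s" using B fs by (simp add: calg_r_one cvs_one_smult[OF calg_cvs[OF B]])
  finally show "presented_hom B f (gen s) = f s" .
qed

end

section \<open>Tensor products over a subalgebra\<close>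

lemma free_space_simps [simp]:
  "carrier (free_space S) = {f. Poly_Mapping.keys f \<subseteq> S}" "\<zero>\<^bsub>free_space S\<^esub> = 0"
  "F \<oplus>\<^bsub>free_space S\<^esub> H = F + H" "c \<odot>\<^bsub>free_space S\<^esub> F = pscale c F"
  by (simp_all add: free_space_def)

lemma cvs_free_space: "cvs (free_space S)"
  by (rule pm_cvs[of _ S]) (simp_all add: free_space_def fun_eq_iff)

lemma lin_linext_free_space:
  assumes U: "cvs U" and B: "\<And>z. z \<in> S \<Longrightarrow> B z \<in> carrier U"
  shows "lin (free_space S) U (linext U B)"
proof (rule linI)
  fix F G assume "F \<in> carrier (free_space S)" "G \<in> carrier (free_space S)"
  then have k: "\<And>z. z \<in> Poly_Mapping.keys F \<Longrightarrow> B z \<in> carrier U" "\<And>z. z \<in> Poly_Mapping.keys G \<Longrightarrow> B z \<in> carrier U"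
    using B by auto
  show "linext U B (F \<oplus>\<^bsub>free_space S\<^esub> G) = linext U B F \<oplus>\<^bsub>U\<^esub> linext U B G"
    using linext_add[OF U k] by simp
next
  fix F c assume "F \<in> carrier (free_space S)"
  then have k: "\<And>z. z \<in> Poly_Mapping.keys F \<Longrightarrow> B z \<in> carrier U" using B by auto
  show "linext U B F \<in> carrier U" by (rule linext_closed[OF U k])
  show "linext U B (c \<odot>\<^bsub>free_space S\<^esub> F) = c \<odot>\<^bsub>U\<^esub> linext U B F"
    using linext_pscale[OF U k, where c=c] by simp
qed

lemma map_basis_superset:
  assumes "finite S" "Poly_Mapping.keys F \<subseteq> S"
  shows "map_basis h F = (\<Sum>b\<in>S. Poly_Mapping.single (h b) (Poly_Mapping.lookup F b))"
  unfolding map_basis_def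
  by (rule sum.mono_neutral_left) (use assms in \<open>auto simp: in_keys_iff\<close>)

lemma map_basis_add: "map_basis h (F + G) = map_basis h F + map_basis h G"
proof -
  let ?S = "Poly_Mapping.keys F \<union> Poly_Mapping.keys G"
  have "Poly_Mapping.keys (F + G) \<subseteq> ?S" by (rule keys_add)
  then show ?thesis
    by (simp add: map_basis_superset[of ?S] lookup_add single_add sum.distrib)
qed

lemma map_basis_single: "map_basis h (Poly_Mapping.single z c) = Poly_Mapping.single (h z) c"
  by (subst map_basis_superset[of "{z}"]) auto

lemma map_basis_0: "map_basis h 0 = 0"
  by (simp add: map_basis_def)

definition bilin ::
  "(complex, 'a) module \<Rightarrow> (complex, 'v) module \<Rightarrow> (complex, 'w) module \<Rightarrow> ('a \<Rightarrow> 'v \<Rightarrow> 'w) \<Rightarrow> bool" where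
  "bilin A V U g \<longleftrightarrow> (\<forall>a\<in>carrier A. lin V U (g a)) \<and> (\<forall>v\<in>carrier V. lin A U (\<lambda>a. g a v))"

text \<open>
  The condition under which a bilinear map descends to the tensor product over a subalgebra whose
  element \<open>b\<close> acts on \<open>V\<close> by \<open>\<beta>\<close>.
\<close>

definition balanced ::
  "(complex, 'a) module \<Rightarrow> (complex, 'v) module \<Rightarrow> ('a \<Rightarrow> 'v \<Rightarrow> 'w) \<Rightarrow> 'a \<Rightarrow> ('v \<Rightarrow> 'v) \<Rightarrow> bool" where
  "balanced A V g b \<beta> \<longleftrightarrow> (\<forall>a\<in>carrier A. \<forall>v\<in>carrier V. g (a \<otimes>\<^bsub>A\<^esub> b) v = g a (\<beta> v))"

lemma bilin_lin_r: "bilin A V U g \<Longrightarrow> a \<in> carrier A \<Longrightarrow> lin V U (g a)"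
  and bilin_lin_l: "bilin A V U g \<Longrightarrow> v \<in> carrier V \<Longrightarrow> lin A U (\<lambda>a. g a v)"
  by (auto simp: bilin_def)

lemma bilinI:
  assumes "\<And>a v. a \<in> carrier A \<Longrightarrow> v \<in> carrier V \<Longrightarrow> g a v \<in> carrier U"
    and "\<And>a b v. a \<in> carrier A \<Longrightarrow> b \<in> carrier A \<Longrightarrow> v \<in> carrier V \<Longrightarrow> g (a \<oplus>\<^bsub>A\<^esub> b) v = g a v \<oplus>\<^bsub>U\<^esub> g b v"
    and "\<And>a v w. a \<in> carrier A \<Longrightarrow> v \<in> carrier V \<Longrightarrow> w \<in> carrier V \<Longrightarrow> g a (v \<oplus>\<^bsub>V\<^esub> w) = g a v \<oplus>\<^bsub>U\<^esub> g a w"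
    and "\<And>c a v. a \<in> carrier A \<Longrightarrow> v \<in> carrier V \<Longrightarrow> g (c \<odot>\<^bsub>A\<^esub> a) v = c \<odot>\<^bsub>U\<^esub> g a v"
    and "\<And>c a v. a \<in> carrier A \<Longrightarrow> v \<in> carrier V \<Longrightarrow> g a (c \<odot>\<^bsub>V\<^esub> v) = c \<odot>\<^bsub>U\<^esub> g a v"
  shows "bilin A V U g"
  using assms by (simp add: bilin_def lin_def)

lemma bilin_closed: "bilin A V U g \<Longrightarrow> a \<in> carrier A \<Longrightarrow> v \<in> carrier V \<Longrightarrow> g a v \<in> carrier U"
  by (simp add: bilin_def lin_def)

lemma bilin_comp:
  "bilin A V U g \<Longrightarrow> lin A' A f \<Longrightarrow> lin V' V h \<Longrightarrow> lin U U' k \<Longrightarrow> bilin A' V' U' (\<lambda>a v. k (g (f a) (h v)))"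
  by (simp add: bilin_def lin_def)

lemma balanced_one: "calg A \<Longrightarrow> balanced A V g \<one>\<^bsub>A\<^esub> (\<lambda>v. v)"
  by (simp add: balanced_def calg_r_one)

lemma balanced_mult:
  assumes "calg A" "b \<in> carrier A" "b' \<in> carrier A" "\<And>v. v \<in> carrier V \<Longrightarrow> \<beta>' v \<in> carrier V"
    and "balanced A V g b \<beta>" "balanced A V g b' \<beta>'"
  shows "balanced A V g (b \<otimes>\<^bsub>A\<^esub> b') (\<lambda>v. \<beta> (\<beta>' v))"
  using assms by (simp add: balanced_def calg_assoc[symmetric] calg_closed)

lemma balanced_add:
  assumes "calg A" "bilin A V U g" "b \<in> carrier A" "b' \<in> carrier A"
    and "\<And>v. v \<in> carrier V \<Longrightarrow> \<beta> v \<in> carrier V" "\<And>v. v \<in> carrier V \<Longrightarrow> \<beta>' v \<in> carrier V"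
    and "balanced A V g b \<beta>" "balanced A V g b' \<beta>'"
  shows "balanced A V g (b \<oplus>\<^bsub>A\<^esub> b') (\<lambda>v. \<beta> v \<oplus>\<^bsub>V\<^esub> \<beta>' v)"
  using assms bilin_lin_l[OF assms(2)] bilin_lin_r[OF assms(2)]
  by (simp add: balanced_def calg_r_distr calg_closed lin_add[of V U] lin_add[of A U "\<lambda>a. g a v" for v])

lemma balanced_smult:
  assumes "calg A" "bilin A V U g" "b \<in> carrier A" "\<And>v. v \<in> carrier V \<Longrightarrow> \<beta> v \<in> carrier V"
    and "balanced A V g b \<beta>"
  shows "balanced A V g (c \<odot>\<^bsub>A\<^esub> b) (\<lambda>v. c \<odot>\<^bsub>V\<^esub> \<beta> v)"
  using assms bilin_lin_l[OF assms(2)] bilin_lin_r[OF assms(2)]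
  by (simp add: balanced_def calg_smult_r calg_closed lin_smult[of V U] lin_smult[of A U "\<lambda>a. g a v" for v])

lemma balanced_cong:
  "balanced A V g b \<beta> \<Longrightarrow> (\<And>v. v \<in> carrier V \<Longrightarrow> \<beta> v = \<beta>' v) \<Longrightarrow> balanced A V g b \<beta>'"
  by (simp add: balanced_def)

text \<open>
  The pairs in \<open>\<Gamma>\<close> give the operators on \<open>V\<close> of generators of a subalgebra of \<open>A\<close>. Their closure
  \<open>\<Theta>\<close> is a relation between elements and operators and not a function, since an element may be expressed
  through the generators in several ways.
\<close>

locale tensor_product =
  fixes A :: "(complex, 'a) module" and V :: "(complex, 'v) module" and \<Gamma> :: "('a \<times> ('v \<Rightarrow> 'v)) set"
  assumes A: "calg A" and V: "cvs V"
    and \<Gamma>_closed: "\<And>b \<beta>. (b, \<beta>) \<in> \<Gamma> \<Longrightarrow> b \<in> carrier A"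
    and \<Gamma>_lin: "\<And>b \<beta> v. (b, \<beta>) \<in> \<Gamma> \<Longrightarrow> v \<in> carrier V \<Longrightarrow> \<beta> v \<in> carrier V"
begin

abbreviation "\<Theta> \<equiv> subalg_action A V \<Gamma>"
abbreviation "FS \<equiv> free_space (carrier A \<times> carrier V)"
abbreviation "M \<equiv> tensor_space A V \<Theta>"
definition "tens a v = tensor_kernel A V \<Theta> +>\<^bsub>FS\<^esub> pure a v"

lemma \<Theta>_closed: "(b, \<beta>) \<in> \<Theta> \<Longrightarrow> b \<in> carrier A \<and> (\<forall>v\<in>carrier V. \<beta> v \<in> carrier V)"
  by (induct rule: subalg_action.induct)
    (use A V \<Gamma>_closed \<Gamma>_lin in \<open>auto simp: calg_closed cvs_closed\<close>)

text \<open>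
  The pairs for which a bilinear map is balanced are closed under the algebra operations, so it is
  enough to test generators.
\<close>

lemma balanced_\<Theta>:
  assumes g: "bilin A V U g" and U: "cvs U"
    and bal: "\<forall>(b, \<beta>)\<in>\<Gamma>. balanced A V g b \<beta>" and b: "(b, \<beta>) \<in> \<Theta>"
  shows "balanced A V g b \<beta>"
  using b
proof induct
  case (base b \<beta>)
  then show ?case using bal by auto
next
  case one
  show ?case by (rule balanced_one[OF A])
next
  case (add b \<beta> b' \<beta>')
  then show ?case using \<Theta>_closed[OF add(1)] \<Theta>_closed[OF add(3)] by (intro balanced_add[OF A g]) auto
next
  case (mult b \<beta> b' \<beta>')
  then show ?case using \<Theta>_closed[OF mult(1)] \<Theta>_closed[OF mult(3)] by (intro balanced_mult[OF A]) auto
next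
  case (smult b \<beta> c)
  then show ?case using \<Theta>_closed[OF smult(1)] by (intro balanced_smult[OF A g]) auto
qed

lemma relators_carrier: "tensor_relators A V \<Theta> \<subseteq> carrier FS"
proof -
  have k: "Poly_Mapping.keys (F - G) \<subseteq> carrier A \<times> carrier V"
    if "Poly_Mapping.keys F \<subseteq> carrier A \<times> carrier V" "Poly_Mapping.keys G \<subseteq> carrier A \<times> carrier V"
    for F G :: "('a \<times> 'v) \<Rightarrow>\<^sub>0 complex"
    using keys_diff[of F G] that by blast
  have s: "Poly_Mapping.keys (Poly_Mapping.single (a, v) c) \<subseteq> carrier A \<times> carrier V"
    if "a \<in> carrier A" "v \<in> carrier V" for a v and c :: complex
    using that by simp
  show ?thesis
  proof
    fix r assume "r \<in> tensor_relators A V \<Theta>"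
    then have "Poly_Mapping.keys r \<subseteq> carrier A \<times> carrier V"
      unfolding tensor_relators_def
      by (elim UnE CollectE exE conjE; hypsubst)
        (intro k s; simp add: A V \<Theta>_closed calg_closed cvs_closed)+
    then show "r \<in> carrier FS" by simp
  qed
qed

lemma module_FS: "Module.module class_ring FS"
  using cvs_free_space[of "carrier A \<times> carrier V"] by (simp add: vectorspace_def)

lemma kernel_submodule: "LinearCombinations.submodule class_ring (tensor_kernel A V \<Theta>) FS"
  unfolding tensor_kernel_def
  by (rule LinearCombinations.module.span_is_submodule[OF module_FS relators_carrier])

lemma submodule_iff_lsub: "LinearCombinations.submodule class_ring N FS \<longleftrightarrow> lsub FS N"
  using module_FS by (auto simp: LinearCombinations.submodule_def lsub_def)

lemma kernel_lsub: "lsub FS (tensor_kernel A V \<Theta>)"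
  using kernel_submodule by (simp only: submodule_iff_lsub)

lemma kernel_minimal:
  assumes "lsub FS N" "tensor_relators A V \<Theta> \<subseteq> N" shows "tensor_kernel A V \<Theta> \<subseteq> N"
  unfolding tensor_kernel_def
  by (rule LinearCombinations.module.span_is_subset[OF module_FS assms(2)])
    (simp only: submodule_iff_lsub assms(1))

lemma relators_kernel: "tensor_relators A V \<Theta> \<subseteq> tensor_kernel A V \<Theta>"
  unfolding tensor_kernel_def
  by (rule LinearCombinations.module.in_own_span[OF module_FS relators_carrier])

lemma cvs_M: "cvs M"
  unfolding tensor_space_def by (rule cvs_quot_space[OF cvs_free_space kernel_lsub])

lemma lin_coset: "lin FS M (\<lambda>F. tensor_kernel A V \<Theta> +>\<^bsub>FS\<^esub> F)"
  unfolding tensor_space_def by (rule lin_quot_space[OF cvs_free_space kernel_lsub])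

lemma carrier_M: "carrier M = (\<lambda>F. tensor_kernel A V \<Theta> +>\<^bsub>FS\<^esub> F) ` carrier FS"
  by (simp only: tensor_space_def quot_space_simps)

lemma tens_closed: "a \<in> carrier A \<Longrightarrow> v \<in> carrier V \<Longrightarrow> tens a v \<in> carrier M"
  unfolding tens_def by (rule lin_closed[OF lin_coset]) simp

lemma tens_eqI:
  assumes "F - G \<in> tensor_relators A V \<Theta>" "G \<in> carrier FS"
  shows "tensor_kernel A V \<Theta> +>\<^bsub>FS\<^esub> F = tensor_kernel A V \<Theta> +>\<^bsub>FS\<^esub> G"
  by (rule coset_eqI[OF cvs_free_space kernel_lsub assms(2), of "F - G"])
    (use assms relators_kernel in auto)

lemma coset_single:
  "a \<in> carrier A \<Longrightarrow> v \<in> carrier V \<Longrightarrow> tensor_kernel A V \<Theta> +>\<^bsub>FS\<^esub> Poly_Mapping.single (a, v) c = c \<odot>\<^bsub>M\<^esub> tens a v"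
  using lin_smult[OF lin_coset, of "pure a v" c] by (simp add: tens_def pscale_single)

lemma bilin_tens: "bilin A V M tens"
proof (rule bilinI)
  fix a b v assume h: "a \<in> carrier A" "b \<in> carrier A" "v \<in> carrier V"
  then have c: "pure a v \<in> carrier FS" "pure b v \<in> carrier FS" "pure a v + pure b v \<in> carrier FS"
    using keys_add[of "pure a v" "pure b v"] by auto
  have "tens (a \<oplus>\<^bsub>A\<^esub> b) v = tensor_kernel A V \<Theta> +>\<^bsub>FS\<^esub> (pure a v + pure b v)"
    unfolding tens_def
    by (rule tens_eqI[OF _ c(3)], unfold tensor_relators_def)
      (use h in \<open>auto simp: diff_diff_eq[symmetric]\<close>)
  then show "tens (a \<oplus>\<^bsub>A\<^esub> b) v = tens a v \<oplus>\<^bsub>M\<^esub> tens b v"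
    using lin_add[OF lin_coset c(1,2)] by (simp add: tens_def)
next
  fix a v w assume h: "a \<in> carrier A" "v \<in> carrier V" "w \<in> carrier V"
  then have c: "pure a v \<in> carrier FS" "pure a w \<in> carrier FS" "pure a v + pure a w \<in> carrier FS"
    using keys_add[of "pure a v" "pure a w"] by auto
  have "tens a (v \<oplus>\<^bsub>V\<^esub> w) = tensor_kernel A V \<Theta> +>\<^bsub>FS\<^esub> (pure a v + pure a w)"
    unfolding tens_def
    by (rule tens_eqI[OF _ c(3)], unfold tensor_relators_def)
      (use h in \<open>auto simp: diff_diff_eq[symmetric]\<close>)
  then show "tens a (v \<oplus>\<^bsub>V\<^esub> w) = tens a v \<oplus>\<^bsub>M\<^esub> tens a w"
    using lin_add[OF lin_coset c(1,2)] by (simp add: tens_def)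
next
  fix c a v assume h: "a \<in> carrier A" "v \<in> carrier V"
  have k: "Poly_Mapping.single (a, v) c \<in> carrier FS" using h by simp
  have "tens (c \<odot>\<^bsub>A\<^esub> a) v = tensor_kernel A V \<Theta> +>\<^bsub>FS\<^esub> Poly_Mapping.single (a, v) c"
    unfolding tens_def by (rule tens_eqI[OF _ k], unfold tensor_relators_def) (use h in blast)
  then show "tens (c \<odot>\<^bsub>A\<^esub> a) v = c \<odot>\<^bsub>M\<^esub> tens a v" using h by (simp add: coset_single)
  have "tens a (c \<odot>\<^bsub>V\<^esub> v) = tensor_kernel A V \<Theta> +>\<^bsub>FS\<^esub> Poly_Mapping.single (a, v) c"
    unfolding tens_def by (rule tens_eqI[OF _ k], unfold tensor_relators_def) (use h in blast)
  then show "tens a (c \<odot>\<^bsub>V\<^esub> v) = c \<odot>\<^bsub>M\<^esub> tens a v" using h by (simp add: coset_single)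
qed (rule tens_closed)

lemma tens_balanced:
  assumes "(b, \<beta>) \<in> \<Theta>" shows "balanced A V tens b \<beta>"
  unfolding balanced_def
proof (intro ballI)
  fix a v assume h: "a \<in> carrier A" "v \<in> carrier V"
  have k: "pure a (\<beta> v) \<in> carrier FS" using h \<Theta>_closed[OF assms] by simp
  show "tens (a \<otimes>\<^bsub>A\<^esub> b) v = tens a (\<beta> v)"
    unfolding tens_def by (rule tens_eqI[OF _ k], unfold tensor_relators_def) (use h assms in blast)
qed

lemma carrier_M_lspan:
  assumes H: "H \<subseteq> carrier A" "carrier A \<subseteq> lspan A H" and m: "m \<in> carrier M"
  shows "m \<in> lspan M {tens a v | a v. a \<in> H \<and> v \<in> carrier V}" (is "_ \<in> lspan M ?T")
proof -
  have t: "tens a v \<in> lspan M ?T" if a: "a \<in> carrier A" and v: "v \<in> carrier V" for a v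
  proof -
    have "tens a v \<in> lspan M ((\<lambda>a. tens a v) ` H)"
      by (rule lin_lspan[OF calg_cvs[OF A] cvs_M bilin_lin_l[OF bilin_tens v] H(1)]) (use a H(2) in blast)
    then show ?thesis by (rule lspan_lspan[rotated]) (use v in \<open>auto intro: lspan.base\<close>)
  qed
  from m obtain F where F: "Poly_Mapping.keys F \<subseteq> carrier A \<times> carrier V"
    and m: "m = tensor_kernel A V \<Theta> +>\<^bsub>FS\<^esub> F" unfolding carrier_M by auto
  from F have "tensor_kernel A V \<Theta> +>\<^bsub>FS\<^esub> F \<in> lspan M ?T"
  proof (induct rule: poly_mapping_keys_induct)
    case zero
    show ?case using lin_zero[OF lin_coset cvs_free_space cvs_M] by (simp add: lspan.zero)
  next
    case (single z c F)
    obtain a v where z: "z = (a, v)" "a \<in> carrier A" "v \<in> carrier V" using single(1) by auto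
    have "tensor_kernel A V \<Theta> +>\<^bsub>FS\<^esub> (Poly_Mapping.single z c \<oplus>\<^bsub>FS\<^esub> F) =
       c \<odot>\<^bsub>M\<^esub> tens a v \<oplus>\<^bsub>M\<^esub> (tensor_kernel A V \<Theta> +>\<^bsub>FS\<^esub> F)"
      unfolding z(1) coset_single[OF z(2,3), symmetric]
      by (rule lin_add[OF lin_coset]) (use z single(2) in simp_all)
    then show ?case using lspan.add[OF lspan.smult[OF t[OF z(2,3)]] single(3)] by simp
  qed
  then show ?thesis using m by simp
qed

lemma lin_eq_on_tens:
  assumes U: "cvs U" and f: "lin M U f" and g: "lin M U g"
    and H: "H \<subseteq> carrier A" "carrier A \<subseteq> lspan A H"
    and eq: "\<And>a v. a \<in> H \<Longrightarrow> v \<in> carrier V \<Longrightarrow> f (tens a v) = g (tens a v)" and m: "m \<in> carrier M"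
  shows "f m = g m"
  by (rule lin_eq_on_lspan[OF cvs_M U f g _ _ carrier_M_lspan[OF H m]])
    (use tens_closed H eq in auto)

text \<open>
  The elements of the free vector space that the extension of \<open>g\<close> kills form a subspace, and this
  subspace contains every relator of the tensor product.
\<close>

lemma linext_kernel:
  assumes U: "cvs U" and g: "bilin A V U g" and bal: "\<forall>(b, \<beta>)\<in>\<Gamma>. balanced A V g b \<beta>"
    and k: "k \<in> tensor_kernel A V \<Theta>"
  shows "linext U (\<lambda>(a, v). g a v) k = \<zero>\<^bsub>U\<^esub>"
proof -
  let ?L = "linext U (\<lambda>(a, v). g a v)"
  have L: "lin FS U ?L" by (rule lin_linext_free_space[OF U]) (use bilin_closed[OF g] in auto)
  let ?N = "{F \<in> carrier FS. ?L F = \<zero>\<^bsub>U\<^esub>}"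
  have "lsub FS ?N" unfolding lsub_def
  proof (intro conjI ballI allI)
    show "\<zero>\<^bsub>FS\<^esub> \<in> ?N" using lin_zero[OF L cvs_free_space U] by simp
    show "F \<oplus>\<^bsub>FS\<^esub> G \<in> ?N" if "F \<in> ?N" "G \<in> ?N" for F G
      using that lin_add[OF L, of F G] cvs_add[OF cvs_free_space, of F _ G] U by (simp add: cvs_simps del: free_space_simps)
    show "c \<odot>\<^bsub>FS\<^esub> F \<in> ?N" if "F \<in> ?N" for c F
      using that lin_smult[OF L, of F c] cvs_smult[OF cvs_free_space, of F _ c] U by (simp add: cvs_simps del: free_space_simps)
  qed auto
  moreover have "tensor_relators A V \<Theta> \<subseteq> ?N"
  proof
    fix r assume r: "r \<in> tensor_relators A V \<Theta>"
    have diff: "?L (F - G) = \<zero>\<^bsub>U\<^esub>" if F: "F \<in> carrier FS" and G: "G \<in> carrier FS" and e: "?L F = ?L G" for F G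
    proof -
      have "F - G = F \<oplus>\<^bsub>FS\<^esub> ((- 1) \<odot>\<^bsub>FS\<^esub> G)" by (simp add: pscale_minus1)
      then have "?L (F - G) = ?L F \<oplus>\<^bsub>U\<^esub> (- 1) \<odot>\<^bsub>U\<^esub> ?L G"
        using lin_add[OF L F cvs_smult[OF cvs_free_space G], of "- 1"] lin_smult[OF L G, of "- 1"] by (simp only:)
      also have "\<dots> = (1 + (- 1)) \<odot>\<^bsub>U\<^esub> ?L G"
        unfolding e using lin_closed[OF L G] U by (simp only: cvs_add_smult cvs_one_smult)
      finally show ?thesis using lin_closed[OF L G] U by (simp add: cvs_simps)
    qed
    have s: "?L (Poly_Mapping.single (a, v) c) = c \<odot>\<^bsub>U\<^esub> g a v" if "a \<in> carrier A" "v \<in> carrier V" for a v c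
      using linext_single[OF U, of "\<lambda>(a, v). g a v" "(a, v)" c] bilin_closed[OF g that] by simp
    have p: "?L (pure a v) = g a v" if "a \<in> carrier A" "v \<in> carrier V" for a v
      using s[OF that, of 1] bilin_closed[OF g that] U by (simp add: cvs_one_smult)
    have pp: "?L (pure a v + pure b w) = g a v \<oplus>\<^bsub>U\<^esub> g b w"
      if "a \<in> carrier A" "v \<in> carrier V" "b \<in> carrier A" "w \<in> carrier V" for a v b w
      using lin_add[OF L, of "pure a v" "pure b w"] that p by simp
    have pf: "pure a v + pure b w \<in> carrier FS"
      if "a \<in> carrier A" "v \<in> carrier V" "b \<in> carrier A" "w \<in> carrier V" for a v b w
      using cvs_add[OF cvs_free_space, of "pure a v" "carrier A \<times> carrier V" "pure b w"] that by simp
    have sf: "Poly_Mapping.single (a, v) c \<in> carrier FS" if "a \<in> carrier A" "v \<in> carrier V" for a v c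
      using that by simp
    have rc: "r \<in> carrier FS" using r relators_carrier by blast
    from r have "?L r = \<zero>\<^bsub>U\<^esub>" unfolding tensor_relators_def
    proof (elim UnE CollectE exE conjE, goal_cases)
      case (1 a b v)
      have "?L (pure (a \<oplus>\<^bsub>A\<^esub> b) v - (pure a v + pure b v)) = \<zero>\<^bsub>U\<^esub>"
        using 1 calg_add[OF A] by (intro diff sf pf) (simp_all add: p pp lin_add[OF bilin_lin_l[OF g]])
      then show ?case using 1 by (simp add: diff_diff_eq)
    next
      case (2 a v w)
      have "?L (pure a (v \<oplus>\<^bsub>V\<^esub> w) - (pure a v + pure a w)) = \<zero>\<^bsub>U\<^esub>"
        using 2 cvs_add[OF V] by (intro diff sf pf) (simp_all add: p pp lin_add[OF bilin_lin_r[OF g]])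
      then show ?case using 2 by (simp add: diff_diff_eq)
    next
      case (3 c a v)
      show ?case unfolding 3(1)
        using 3 calg_smult[OF A] by (intro diff sf) (simp_all add: s lin_smult[OF bilin_lin_l[OF g]] bilin_closed[OF g] U cvs_smult_smult)
    next
      case (4 c a v)
      show ?case unfolding 4(1)
        using 4 cvs_smult[OF V] by (intro diff sf) (simp_all add: s lin_smult[OF bilin_lin_r[OF g]] bilin_closed[OF g] U cvs_smult_smult)
    next
      case (5 a b \<beta> v)
      have "g (a \<otimes>\<^bsub>A\<^esub> b) v = g a (\<beta> v)"
        using balanced_\<Theta>[OF g U bal 5(3)] 5 by (simp add: balanced_def)
      then show ?case unfolding 5(1)
        using 5 calg_mult[OF A] \<Theta>_closed[OF 5(3)] by (intro diff sf) (simp_all add: p)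
    qed
    then show "r \<in> ?N" using rc by blast
  qed
  ultimately have "tensor_kernel A V \<Theta> \<subseteq> ?N" by (rule kernel_minimal)
  then show ?thesis using k by blast
qed

definition lift :: "(complex, 'w) module \<Rightarrow> ('a \<Rightarrow> 'v \<Rightarrow> 'w) \<Rightarrow> (('a \<times> 'v) \<Rightarrow>\<^sub>0 complex) set \<Rightarrow> 'w" where
  "lift U g Z = linext U (\<lambda>(a, v). g a v) (SOME F. F \<in> Z)"

text \<open>
  Independence of the representative that \<open>lift\<close> picks.
\<close>

lemma linext_coset:
  assumes U: "cvs U" and g: "bilin A V U g" and bal: "\<forall>(b, \<beta>)\<in>\<Gamma>. balanced A V g b \<beta>"
    and F: "F \<in> carrier FS" and G: "G \<in> tensor_kernel A V \<Theta> +>\<^bsub>FS\<^esub> F"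
  shows "linext U (\<lambda>(a, v). g a v) G = linext U (\<lambda>(a, v). g a v) F" and "G \<in> carrier FS"
proof -
  let ?L = "linext U (\<lambda>(a, v). g a v)"
  have L: "lin FS U ?L" by (rule lin_linext_free_space[OF U]) (use bilin_closed[OF g] in auto)
  obtain k where k: "k \<in> tensor_kernel A V \<Theta>" and G: "G = k \<oplus>\<^bsub>FS\<^esub> F"
    using G unfolding a_r_coset_def' by blast
  have kc: "k \<in> carrier FS" using k kernel_lsub unfolding lsub_def by blast
  have "?L G = ?L k \<oplus>\<^bsub>U\<^esub> ?L F" unfolding G by (rule lin_add[OF L kc F])
  then show "?L G = ?L F"
    by (simp only: linext_kernel[OF U g bal k] cvs_lzero[OF U lin_closed[OF L F]])
  show "G \<in> carrier FS" unfolding G by (rule cvs_add[OF cvs_free_space kc F])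
qed

lemma lift_coset:
  assumes U: "cvs U" and g: "bilin A V U g" and bal: "\<forall>(b, \<beta>)\<in>\<Gamma>. balanced A V g b \<beta>"
    and F: "F \<in> carrier FS"
  shows "lift U g (tensor_kernel A V \<Theta> +>\<^bsub>FS\<^esub> F) = linext U (\<lambda>(a, v). g a v) F"
proof -
  have "(SOME G. G \<in> tensor_kernel A V \<Theta> +>\<^bsub>FS\<^esub> F) \<in> tensor_kernel A V \<Theta> +>\<^bsub>FS\<^esub> F"
    by (rule someI[of _ F]) (rule coset_self[OF cvs_free_space kernel_lsub F])
  then show ?thesis unfolding lift_def by (rule linext_coset(1)[OF U g bal F])
qed

lemma lift:
  assumes U: "cvs U" and g: "bilin A V U g" and bal: "\<forall>(b, \<beta>)\<in>\<Gamma>. balanced A V g b \<beta>"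
  shows "lin M U (lift U g)" and "a \<in> carrier A \<Longrightarrow> v \<in> carrier V \<Longrightarrow> lift U g (tens a v) = g a v"
proof -
  let ?L = "linext U (\<lambda>(a, v). g a v)"
  have L: "lin FS U ?L" by (rule lin_linext_free_space[OF U]) (use bilin_closed[OF g] in auto)
  note lc = lift_coset[OF U g bal]
  note cl = cvs_add[OF cvs_free_space] cvs_smult[OF cvs_free_space]
  show "lin M U (lift U g)"
  proof (rule linI)
    fix u u' assume "u \<in> carrier M" "u' \<in> carrier M"
    then obtain F G where F: "F \<in> carrier FS" "u = tensor_kernel A V \<Theta> +>\<^bsub>FS\<^esub> F"
      and G: "G \<in> carrier FS" "u' = tensor_kernel A V \<Theta> +>\<^bsub>FS\<^esub> G" unfolding carrier_M by blast
    show "lift U g (u \<oplus>\<^bsub>M\<^esub> u') = lift U g u \<oplus>\<^bsub>U\<^esub> lift U g u'"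
      unfolding F(2) G(2) lin_add[OF lin_coset F(1) G(1), symmetric] lc[OF F(1)] lc[OF G(1)]
        lc[OF cl(1)[OF F(1) G(1)]] by (rule lin_add[OF L F(1) G(1)])
  next
    fix u c assume "u \<in> carrier M"
    then obtain F where F: "F \<in> carrier FS" "u = tensor_kernel A V \<Theta> +>\<^bsub>FS\<^esub> F" unfolding carrier_M by blast
    show "lift U g u \<in> carrier U" unfolding F(2) lc[OF F(1)] by (rule lin_closed[OF L F(1)])
    show "lift U g (c \<odot>\<^bsub>M\<^esub> u) = c \<odot>\<^bsub>U\<^esub> lift U g u"
      unfolding F(2) lin_smult[OF lin_coset F(1), symmetric] lc[OF F(1)] lc[OF cl(2)[OF F(1)]]
      by (rule lin_smult[OF L F(1)])
  qed
  assume h: "a \<in> carrier A" "v \<in> carrier V"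
  then have "lift U g (tens a v) = 1 \<odot>\<^bsub>U\<^esub> g a v"
    unfolding tens_def
    using lc[of "pure a v"] linext_single[OF U, of "\<lambda>(a, v). g a v" "(a, v)" 1] bilin_closed[OF g h] by simp
  then show "lift U g (tens a v) = g a v" using bilin_closed[OF g h] U by (simp add: cvs_one_smult)
qed

text \<open>
  The map induced by a pair of maps is defined as a union over representatives; under the balancedness
  condition it is an instance of the universal property.
\<close>

lemma tensor_map_lift:
  assumes f: "\<And>a. a \<in> carrier A \<Longrightarrow> f a \<in> carrier A" and h: "\<And>v. v \<in> carrier V \<Longrightarrow> h v \<in> carrier V"
    and g: "bilin A V M (\<lambda>a v. tens (f a) (h v))"
    and bal: "\<forall>(b, \<beta>)\<in>\<Gamma>. balanced A V (\<lambda>a v. tens (f a) (h v)) b \<beta>"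
    and m: "m \<in> carrier M"
  shows "tensor_map A V \<Theta> f h m = lift M (\<lambda>a v. tens (f a) (h v)) m"
proof -
  let ?g = "\<lambda>a v. tens (f a) (h v)"
  let ?h = "\<lambda>(a, v). (f a, h v)"
  have mb: "tensor_kernel A V \<Theta> +>\<^bsub>FS\<^esub> map_basis ?h F = linext M (\<lambda>(a, v). ?g a v) F \<and> map_basis ?h F \<in> carrier FS"
    if "Poly_Mapping.keys F \<subseteq> carrier A \<times> carrier V" for F
    using that
  proof (induct rule: poly_mapping_keys_induct)
    case zero
    show ?case using lin_zero[OF lin_coset cvs_free_space cvs_M] cvs_M by (simp add: map_basis_0)
  next
    case (single z c F)
    obtain a v where z: "z = (a, v)" "a \<in> carrier A" "v \<in> carrier V" using single(1) by auto
    have L: "lin FS M (linext M (\<lambda>(a, v). ?g a v))"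
      by (rule lin_linext_free_space[OF cvs_M]) (use bilin_closed[OF g] in auto)
    have s: "Poly_Mapping.single (f a, h v) c \<in> carrier FS" using f[OF z(2)] h[OF z(3)] by simp
    have "tensor_kernel A V \<Theta> +>\<^bsub>FS\<^esub> (Poly_Mapping.single (f a, h v) c \<oplus>\<^bsub>FS\<^esub> map_basis ?h F) =
        c \<odot>\<^bsub>M\<^esub> ?g a v \<oplus>\<^bsub>M\<^esub> linext M (\<lambda>(a, v). ?g a v) F"
      using lin_add[OF lin_coset s, of "map_basis ?h F"] single(3)
      by (simp only: coset_single[OF f[OF z(2)] h[OF z(3)]])
    also have "\<dots> = linext M (\<lambda>(a, v). ?g a v) (Poly_Mapping.single (a, v) c \<oplus>\<^bsub>FS\<^esub> F)"
      using lin_add[OF L, of "Poly_Mapping.single (a, v) c" F] single(2) z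
        linext_single[OF cvs_M, of "\<lambda>(a, v). ?g a v" "(a, v)" c] bilin_closed[OF g z(2,3)] by simp
    finally show ?case
      using cvs_add[OF cvs_free_space s, of "map_basis ?h F"] single(3)
      by (simp add: map_basis_add map_basis_single z(1))
  qed
  obtain F where F: "F \<in> carrier FS" and mF: "m = tensor_kernel A V \<Theta> +>\<^bsub>FS\<^esub> F"
    using m unfolding carrier_M by blast
  have e: "tensor_kernel A V \<Theta> +>\<^bsub>FS\<^esub> map_basis ?h G = linext M (\<lambda>(a, v). ?g a v) F" if "G \<in> m" for G
  proof -
    note c = linext_coset[OF cvs_M g bal F that[unfolded mF]]
    have "Poly_Mapping.keys G \<subseteq> carrier A \<times> carrier V" using c(2) by simp
    with mb c(1) show ?thesis by simp
  qed
  have "tensor_map A V \<Theta> f h m = (\<Union>G\<in>m. linext M (\<lambda>(a, v). ?g a v) F)"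
    unfolding tensor_map_def by (rule SUP_cong[OF refl]) (rule e)
  also have "\<dots> = linext M (\<lambda>(a, v). ?g a v) F"
    using coset_self[OF cvs_free_space kernel_lsub F] unfolding mF by blast
  finally show ?thesis unfolding mF lift_coset[OF cvs_M g bal F] .
qed

lemma lin_cong: "lin M U f \<Longrightarrow> (\<And>m. m \<in> carrier M \<Longrightarrow> f' m = f m) \<Longrightarrow> lin M U f'"
  by (auto simp: lin_def cvs_closed[OF cvs_M])

lemma tensor_map:
  assumes f: "\<And>a. a \<in> carrier A \<Longrightarrow> f a \<in> carrier A" and h: "\<And>v. v \<in> carrier V \<Longrightarrow> h v \<in> carrier V"
    and g: "bilin A V M (\<lambda>a v. tens (f a) (h v))"
    and bal: "\<forall>(b, \<beta>)\<in>\<Gamma>. balanced A V (\<lambda>a v. tens (f a) (h v)) b \<beta>"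
  shows "lin M M (tensor_map A V \<Theta> f h)"
    and "a \<in> carrier A \<Longrightarrow> v \<in> carrier V \<Longrightarrow> tensor_map A V \<Theta> f h (tens a v) = tens (f a) (h v)"
  by (rule lin_cong[OF lift(1)[OF cvs_M g bal] tensor_map_lift[OF f h g bal]]; assumption)
    (simp add: tensor_map_lift[OF f h g bal] lift(2)[OF cvs_M g bal] tens_closed)

lemma lin_mult_l: "a \<in> carrier A \<Longrightarrow> lin A A (\<lambda>b. a \<otimes>\<^bsub>A\<^esub> b)"
  and lin_mult_r: "a \<in> carrier A \<Longrightarrow> lin A A (\<lambda>b. b \<otimes>\<^bsub>A\<^esub> a)"
  using A by (auto intro!: linI simp: calg_closed calg_l_distr calg_r_distr calg_smult_l calg_smult_r)

text \<open>
  Left multiplication is balanced because the subalgebra acts on \<open>A\<close> from the right.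
\<close>

lemma tensor_act:
  assumes a: "a \<in> carrier A"
  shows "lin M M (tensor_act A V \<Theta> a)"
    and "b \<in> carrier A \<Longrightarrow> v \<in> carrier V \<Longrightarrow> tensor_act A V \<Theta> a (tens b v) = tens (a \<otimes>\<^bsub>A\<^esub> b) v"
proof -
  have g: "bilin A V M (\<lambda>b v. tens (a \<otimes>\<^bsub>A\<^esub> b) v)"
    by (rule bilin_comp[OF bilin_tens lin_mult_l[OF a] lin_ident lin_ident])
  have "balanced A V (\<lambda>b v. tens (a \<otimes>\<^bsub>A\<^esub> b) v) b \<beta>" if "(b, \<beta>) \<in> \<Gamma>" for b \<beta>
    using tens_balanced[OF subalg_action.base[OF that]] \<Gamma>_closed[OF that] A a
    by (simp add: balanced_def calg_assoc[symmetric] calg_closed)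
  then have bal: "\<forall>(b, \<beta>)\<in>\<Gamma>. balanced A V (\<lambda>b v. tens (a \<otimes>\<^bsub>A\<^esub> b) v) b \<beta>" by auto
  note t = tensor_map[of "\<lambda>b. a \<otimes>\<^bsub>A\<^esub> b" "\<lambda>v. v", OF _ _ g bal, folded tensor_act_def]
  show "lin M M (tensor_act A V \<Theta> a)" by (rule t(1)) (use A a in \<open>auto simp: calg_closed\<close>)
  show "b \<in> carrier A \<Longrightarrow> v \<in> carrier V \<Longrightarrow> tensor_act A V \<Theta> a (tens b v) = tens (a \<otimes>\<^bsub>A\<^esub> b) v"
    by (rule t(2)) (use A a in \<open>auto simp: calg_closed\<close>)
qed

lemma carrier_A_lspan: "carrier A \<subseteq> lspan A (carrier A)"
  by (auto intro: lspan.base)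

lemma bilin_tensor_act: "bilin A M M (tensor_act A V \<Theta>)"
proof -
  note ta = tensor_act
  have tl: "lin A M (\<lambda>b. tens b v)" if "v \<in> carrier V" for v by (rule bilin_lin_l[OF bilin_tens that])
  have l2: "lin M M (\<lambda>m. tensor_act A V \<Theta> a m \<oplus>\<^bsub>M\<^esub> tensor_act A V \<Theta> b m)"
    if ab: "a \<in> carrier A" "b \<in> carrier A" for a b
    by (rule linI)
      (simp_all add: lin_closed[OF ta(1)] lin_add[OF ta(1)] lin_smult[OF ta(1)] ab cvs_M cvs_simps cvs_ac)
  have l3: "lin M M (\<lambda>m. c \<odot>\<^bsub>M\<^esub> tensor_act A V \<Theta> a m)" if a: "a \<in> carrier A" for a c
    by (rule linI)
      (simp_all add: lin_closed[OF ta(1)] lin_add[OF ta(1)] lin_smult[OF ta(1)] a cvs_M cvs_simps mult.commute)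
  show ?thesis
  proof (rule bilinI)
    fix a b m assume h: "a \<in> carrier A" "b \<in> carrier A" "m \<in> carrier M"
    show "tensor_act A V \<Theta> (a \<oplus>\<^bsub>A\<^esub> b) m = tensor_act A V \<Theta> a m \<oplus>\<^bsub>M\<^esub> tensor_act A V \<Theta> b m"
      by (rule lin_eq_on_tens[OF cvs_M ta(1) l2 order_refl carrier_A_lspan _ h(3)])
        (use h A in \<open>simp_all add: ta(2) calg_closed calg_l_distr lin_add[OF tl]\<close>)
  next
    fix c a m assume h: "a \<in> carrier A" "m \<in> carrier M"
    show "tensor_act A V \<Theta> (c \<odot>\<^bsub>A\<^esub> a) m = c \<odot>\<^bsub>M\<^esub> tensor_act A V \<Theta> a m"
      by (rule lin_eq_on_tens[OF cvs_M ta(1) l3 order_refl carrier_A_lspan _ h(2)])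
        (use h A in \<open>simp_all add: ta(2) calg_closed calg_smult_l lin_smult[OF tl]\<close>)
  qed (simp_all add: lin_closed[OF ta(1)] lin_add[OF ta(1)] lin_smult[OF ta(1)])
qed

lemma tensor_act_mult:
  assumes h: "a \<in> carrier A" "b \<in> carrier A" "m \<in> carrier M"
  shows "tensor_act A V \<Theta> (a \<otimes>\<^bsub>A\<^esub> b) m = tensor_act A V \<Theta> a (tensor_act A V \<Theta> b m)"
  by (rule lin_eq_on_tens[OF cvs_M tensor_act(1) lin_comp[OF tensor_act(1) tensor_act(1)] order_refl carrier_A_lspan _ h(3)])
    (use h A in \<open>simp_all add: tensor_act(2) calg_closed calg_assoc\<close>)

lemma tensor_act_one:
  assumes m: "m \<in> carrier M" shows "tensor_act A V \<Theta> \<one>\<^bsub>A\<^esub> m = m"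
  by (rule lin_eq_on_tens[OF cvs_M tensor_act(1) lin_ident order_refl carrier_A_lspan _ m])
    (use A in \<open>simp_all add: tensor_act(2) calg_closed calg_l_one\<close>)

end

lemma alg_module_iff:
  "alg_module A U act \<longleftrightarrow> cvs U \<and> bilin A U U act \<and>
     (\<forall>a\<in>carrier A. \<forall>b\<in>carrier A. \<forall>u\<in>carrier U. act (a \<otimes>\<^bsub>A\<^esub> b) u = act a (act b u)) \<and>
     (\<forall>u\<in>carrier U. act \<one>\<^bsub>A\<^esub> u = u)"
  unfolding alg_module_def linear_map_iff_lin bilin_def lin_def by (safe; (blast | metis)?)

lemma (in tensor_product) alg_module_tensor_act: "alg_module A M (tensor_act A V \<Theta>)"
  by (simp add: alg_module_iff cvs_M bilin_tensor_act tensor_act_mult tensor_act_one)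

section \<open>The torus and its grading\<close>

definition dmat :: "nat \<Rightarrow> (nat \<Rightarrow> complex) \<Rightarrow> complex mat" where
  "dmat n d = mat n n (\<lambda>(a, b). if a = b then d a else 0)"

text \<open>
  The diagonal matrices with entries \<open>\<plusminus>1\<close>. They contain the torus \<open>T\<close> generated by the reflections
  \<open>t\<^sub>i\<close>, and their entrywise description is what makes calculations with \<open>T\<close> possible.
\<close>

definition sign_diag :: "nat \<Rightarrow> complex mat set" where
  "sign_diag n = {dmat n d | d. \<forall>i<n. d i = 1 \<or> d i = - 1}"

lemma dmat_carrier [simp]: "dmat n d \<in> carrier_mat n n" "dim_row (dmat n d) = n" "dim_col (dmat n d) = n"
  by (auto simp: dmat_def)

lemma dmat_index [simp]: "i < n \<Longrightarrow> j < n \<Longrightarrow> dmat n d $$ (i, j) = (if i = j then d i else 0)"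
  by (simp add: dmat_def)

lemma dmat_mult_mat: "A \<in> carrier_mat n n \<Longrightarrow> dmat n d * A = mat n n (\<lambda>(i, j). d i * A $$ (i, j))"
  by (rule eq_matI) (auto simp: scalar_prod_def dmat_def if_distrib[of "\<lambda>x. x * _"] cong: if_cong)

lemma mat_mult_dmat: "A \<in> carrier_mat n n \<Longrightarrow> A * dmat n d = mat n n (\<lambda>(i, j). A $$ (i, j) * d j)"
  by (rule eq_matI) (auto simp: scalar_prod_def dmat_def if_distrib[of "\<lambda>x. _ * x"] cong: if_cong)

lemma dmat_mult: "dmat n d * dmat n e = dmat n (\<lambda>i. d i * e i)"
  by (subst dmat_mult_mat) (auto simp: dmat_def intro!: eq_matI)

lemma dmat_one: "1\<^sub>m n = dmat n (\<lambda>_. 1)"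
  by (auto simp: dmat_def intro!: eq_matI)

lemma dmat_t: "t_refl n i = dmat n (\<lambda>a. if a = i then - 1 else 1)"
  by (auto simp: dmat_def t_refl_def intro!: eq_matI)

lemma dmat_cong: "(\<And>i. i < n \<Longrightarrow> d i = e i) \<Longrightarrow> dmat n d = dmat n e"
  by (auto simp: dmat_def intro!: eq_matI)

lemma sign_diagI: "(\<And>i. i < n \<Longrightarrow> d i = 1 \<or> d i = - 1) \<Longrightarrow> dmat n d \<in> sign_diag n"
  by (auto simp: sign_diag_def)

lemma sign_diag_one: "1\<^sub>m n \<in> sign_diag n" and sign_diag_t: "t_refl n i \<in> sign_diag n"
  unfolding dmat_one dmat_t by (rule sign_diagI; simp)+

lemma sign_diag_mult: "h \<in> sign_diag n \<Longrightarrow> k \<in> sign_diag n \<Longrightarrow> h * k \<in> sign_diag n"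
  by (force simp: sign_diag_def dmat_mult)

lemma sign_diag_comm: "h \<in> sign_diag n \<Longrightarrow> k \<in> sign_diag n \<Longrightarrow> h * k = k * h"
  by (auto simp: sign_diag_def dmat_mult mult.commute)

lemma sign_diag_sq: "h \<in> sign_diag n \<Longrightarrow> h * h = 1\<^sub>m n"
  by (auto simp: sign_diag_def dmat_mult dmat_one intro!: dmat_cong) (metis mult_1 minus_mult_minus)

lemma sign_diag_carrier: "h \<in> sign_diag n \<Longrightarrow> h \<in> carrier_mat n n"
  by (auto simp: sign_diag_def)

text \<open>
  The character of the torus given by a set of coordinates; these sets are the degrees of the grading.
\<close>

definition wt :: "nat set \<Rightarrow> complex mat \<Rightarrow> complex" where
  "wt \<alpha> h = (\<Prod>i\<in>\<alpha>. h $$ (i, i))"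

lemma sign_diag_index: "h \<in> sign_diag n \<Longrightarrow> i < n \<Longrightarrow> h $$ (i, i) = 1 \<or> h $$ (i, i) = - 1"
  by (auto simp: sign_diag_def)

lemma sign_diag_index_sq: "h \<in> sign_diag n \<Longrightarrow> i < n \<Longrightarrow> h $$ (i, i) * h $$ (i, i) = 1"
  using sign_diag_index[of h n i] by auto

lemma wt_mult: "\<alpha> \<subseteq> {..<n} \<Longrightarrow> h \<in> sign_diag n \<Longrightarrow> k \<in> sign_diag n \<Longrightarrow> wt \<alpha> (h * k) = wt \<alpha> h * wt \<alpha> k"
  unfolding wt_def prod.distrib[symmetric]
  by (rule prod.cong[OF refl]) (auto simp: sign_diag_def dmat_mult subset_iff)

lemma wt_one: "\<alpha> \<subseteq> {..<n} \<Longrightarrow> wt \<alpha> (1\<^sub>m n) = 1"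
  by (auto simp: wt_def intro!: prod.neutral)

lemma wt_sq: "\<alpha> \<subseteq> {..<n} \<Longrightarrow> h \<in> sign_diag n \<Longrightarrow> wt \<alpha> h * wt \<alpha> h = 1"
  using wt_mult[of \<alpha> n h h] wt_one[of \<alpha> n] by (simp add: sign_diag_sq)

lemma wt_t: "\<alpha> \<subseteq> {..<n} \<Longrightarrow> i < n \<Longrightarrow> wt \<alpha> (t_refl n i) = (if i \<in> \<alpha> then - 1 else 1)"
proof -
  assume a: "\<alpha> \<subseteq> {..<n}" "i < n"
  then have "finite \<alpha>" by (meson finite_lessThan finite_subset)
  moreover have "wt \<alpha> (t_refl n i) = (\<Prod>j\<in>\<alpha>. if j = i then - 1 else 1)"
    unfolding wt_def by (rule prod.cong) (use a in \<open>auto simp: dmat_t\<close>)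
  ultimately show ?thesis by simp
qed

definition symdiff :: "'a set \<Rightarrow> 'a set \<Rightarrow> 'a set" where
  "symdiff \<alpha> \<beta> = (\<alpha> - \<beta>) \<union> (\<beta> - \<alpha>)"

text \<open>
  The coordinates common to both sets contribute squares of signs.
\<close>

lemma wt_symdiff:
  assumes "\<alpha> \<subseteq> {..<n}" "\<beta> \<subseteq> {..<n}" "h \<in> sign_diag n"
  shows "wt (symdiff \<alpha> \<beta>) h = wt \<alpha> h * wt \<beta> h"
proof -
  have fin: "finite \<alpha>" "finite \<beta>" using assms by (meson finite_lessThan finite_subset)+
  have 1: "wt \<alpha> h = wt (\<alpha> - \<beta>) h * wt (\<alpha> \<inter> \<beta>) h" "wt \<beta> h = wt (\<beta> - \<alpha>) h * wt (\<alpha> \<inter> \<beta>) h"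
    unfolding wt_def using fin
    by (subst prod.union_disjoint[symmetric]; auto intro!: prod.cong)+
  have 2: "wt (symdiff \<alpha> \<beta>) h = wt (\<alpha> - \<beta>) h * wt (\<beta> - \<alpha>) h"
    unfolding wt_def symdiff_def by (rule prod.union_disjoint) (use fin in auto)
  have "wt (\<alpha> \<inter> \<beta>) h * wt (\<alpha> \<inter> \<beta>) h = 1" by (rule wt_sq) (use assms in auto)
  then show ?thesis using 1 2 by (simp add: algebra_simps)
qed

lemma symdiff_subset: "\<alpha> \<subseteq> S \<Longrightarrow> \<beta> \<subseteq> S \<Longrightarrow> symdiff \<alpha> \<beta> \<subseteq> S"
  by (auto simp: symdiff_def)

section \<open>Monomial matrices\<close>

text \<open>
  The normal form of the elements of \<open>B\<^sub>n\<close>, with a permutation \<open>\<pi>\<close> and a vector \<open>s\<close> of signs.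
\<close>

definition mono_mat :: "nat \<Rightarrow> (nat \<Rightarrow> nat) \<Rightarrow> (nat \<Rightarrow> complex) \<Rightarrow> complex mat" where
  "mono_mat n \<pi> s = mat n n (\<lambda>(a, b). if a = \<pi> b then s b else 0)"

lemma mono_mat_carrier [simp]: "mono_mat n \<pi> s \<in> carrier_mat n n" "dim_row (mono_mat n \<pi> s) = n" "dim_col (mono_mat n \<pi> s) = n"
  by (auto simp: mono_mat_def)

lemma mono_mat_index [simp]: "a < n \<Longrightarrow> b < n \<Longrightarrow> mono_mat n \<pi> s $$ (a, b) = (if a = \<pi> b then s b else 0)"
  by (simp add: mono_mat_def)

lemma dmat_monom: "dmat n d = mono_mat n id d"
  by (auto simp: dmat_def mono_mat_def intro!: eq_matI)

lemma mono_mat_cong: "(\<And>b. b < n \<Longrightarrow> \<pi> b = \<pi>' b) \<Longrightarrow> (\<And>b. b < n \<Longrightarrow> s b = s' b) \<Longrightarrow> mono_mat n \<pi> s = mono_mat n \<pi>' s'"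
  by (auto simp: mono_mat_def intro!: eq_matI)

lemma mono_mat_mult:
  assumes "\<pi>' permutes {..<n}"
  shows "mono_mat n \<pi> s * mono_mat n \<pi>' s' = mono_mat n (\<pi> \<circ> \<pi>') (\<lambda>b. s (\<pi>' b) * s' b)"
proof (rule eq_matI)
  fix a c assume ac: "a < dim_row (mono_mat n (\<pi> \<circ> \<pi>') (\<lambda>b. s (\<pi>' b) * s' b))"
    "c < dim_col (mono_mat n (\<pi> \<circ> \<pi>') (\<lambda>b. s (\<pi>' b) * s' b))"
  then have a: "a < n" and c: "c < n" by auto
  have p: "\<pi>' c < n" using permutes_in_image[OF assms, of c] c by simp
  have "(mono_mat n \<pi> s * mono_mat n \<pi>' s') $$ (a, c) =
     (\<Sum>b = 0..<n. (if a = \<pi> b then s b else 0) * (if b = \<pi>' c then s' c else 0))"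
    using a c by (simp add: scalar_prod_def)
  also have "\<dots> = (\<Sum>b = 0..<n. if b = \<pi>' c then (if a = \<pi> b then s b * s' c else 0) else 0)"
    by (rule sum.cong) auto
  also have "\<dots> = (if a = \<pi> (\<pi>' c) then s (\<pi>' c) * s' c else 0)" using p by simp
  finally show "(mono_mat n \<pi> s * mono_mat n \<pi>' s') $$ (a, c) = mono_mat n (\<pi> \<circ> \<pi>') (\<lambda>b. s (\<pi>' b) * s' b) $$ (a, c)"
    using a c by simp
qed auto

definition sign_vec :: "nat \<Rightarrow> (nat \<Rightarrow> complex) set" where
  "sign_vec n = {s. \<forall>i<n. s i = 1 \<or> s i = - 1}"

lemma sign_vec_nz: "s \<in> sign_vec n \<Longrightarrow> i < n \<Longrightarrow> s i \<noteq> 0"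
  by (auto simp: sign_vec_def)

lemma mono_mat_support:
  assumes "\<pi> permutes {..<n}" "s \<in> sign_vec n"
  shows "{(i, j). i < n \<and> j < n \<and> mono_mat n \<pi> s $$ (i, j) \<noteq> 0} = (\<lambda>j. (\<pi> j, j)) ` {..<n}"
proof -
  have "\<pi> j < n" if "j < n" for j using permutes_in_image[OF assms(1), of j] that by simp
  then show ?thesis using sign_vec_nz[OF assms(2)] by (auto split: if_splits)
qed

lemma entry_prod_monom:
  assumes "\<pi> permutes {..<n}" "s \<in> sign_vec n"
  shows "entry_prod n (mono_mat n \<pi> s) = (\<Prod>j<n. s j)"
proof -
  have p: "\<pi> j < n" if "j < n" for j using permutes_in_image[OF assms(1), of j] that by simp
  have "entry_prod n (mono_mat n \<pi> s) = (\<Prod>j<n. mono_mat n \<pi> s $$ (\<pi> j, j))"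
    unfolding entry_prod_def mono_mat_support[OF assms] by (subst prod.reindex) (auto simp: inj_on_def)
  then show ?thesis using p by simp
qed

lemma prod_sign: "s \<in> sign_vec n \<Longrightarrow> (\<Prod>j<n. s j) ^ 2 = 1"
  unfolding prod_power_distrib by (rule prod.neutral) (auto simp: sign_vec_def)

lemma mono_mat_monomial:
  assumes "\<pi> permutes {..<n}" "s \<in> sign_vec n"
  shows "mono_mat n \<pi> s \<in> Gmpn 2 1 n"
proof -
  have p: "\<pi> j < n" if "j < n" for j using permutes_in_image[OF assms(1), of j] that by simp
  have q: "inv_into UNIV \<pi> j < n" if "j < n" for j using permutes_in_image[OF permutes_inv[OF assms(1)], of j] that by simp
  have "\<exists>!j. j < n \<and> mono_mat n \<pi> s $$ (i, j) \<noteq> 0" if i: "i < n" for i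
  proof (rule ex1I[of _ "inv_into UNIV \<pi> i"])
    show "inv_into UNIV \<pi> i < n \<and> mono_mat n \<pi> s $$ (i, inv_into UNIV \<pi> i) \<noteq> 0"
      using q[OF i] i sign_vec_nz[OF assms(2)] by (simp add: permutes_inverses[OF assms(1)])
    show "j = inv_into UNIV \<pi> i" if "j < n \<and> mono_mat n \<pi> s $$ (i, j) \<noteq> 0" for j
      using that i by (auto simp: permutes_inverses[OF assms(1)] split: if_splits)
  qed
  moreover have "\<exists>!i. i < n \<and> mono_mat n \<pi> s $$ (i, j) \<noteq> 0" if j: "j < n" for j
    by (rule ex1I[of _ "\<pi> j"]) (use p[OF j] j sign_vec_nz[OF assms(2) j] in \<open>auto split: if_splits\<close>)
  moreover have "s i ^ 2 = 1" if "i < n" for i using assms(2) that by (auto simp: sign_vec_def)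
  ultimately show ?thesis
    using prod_sign[OF assms(2)] entry_prod_monom[OF assms]
    by (auto simp: Gmpn_def monomial_mat_def roots_of_unity_def split: if_splits)
qed

text \<open>
  The permutation sends a column to the row of its only non-zero entry; injectivity on a finite set
  makes it a permutation.
\<close>

lemma monomialE:
  assumes "g \<in> Gmpn 2 1 n"
  obtains \<pi> s where "g = mono_mat n \<pi> s" "\<pi> permutes {..<n}" "s \<in> sign_vec n"
proof -
  from assms have g: "g \<in> carrier_mat n n"
    and row: "\<And>i. i < n \<Longrightarrow> \<exists>!j. j < n \<and> g $$ (i, j) \<noteq> 0"
    and col: "\<And>j. j < n \<Longrightarrow> \<exists>!i. i < n \<and> g $$ (i, j) \<noteq> 0"
    and e: "\<And>i j. i < n \<Longrightarrow> j < n \<Longrightarrow> g $$ (i, j) \<noteq> 0 \<Longrightarrow> g $$ (i, j) ^ 2 = 1"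
    by (auto simp: Gmpn_def monomial_mat_def roots_of_unity_def)
  define \<pi> where "\<pi> j = (if j < n then (THE i. i < n \<and> g $$ (i, j) \<noteq> 0) else j)" for j
  have \<pi>: "\<pi> j < n \<and> g $$ (\<pi> j, j) \<noteq> 0" if "j < n" for j
    using theI'[OF col[OF that]] that by (simp add: \<pi>_def)
  have u: "i = \<pi> j" if "i < n" "j < n" "g $$ (i, j) \<noteq> 0" for i j
    using col[OF that(2)] \<pi>[OF that(2)] that by blast
  have inj: "inj_on \<pi> {..<n}"
  proof (rule inj_onI)
    fix j j' assume "j \<in> {..<n}" "j' \<in> {..<n}" "\<pi> j = \<pi> j'"
    then show "j = j'" using row[of "\<pi> j"] \<pi>[of j] \<pi>[of j'] by auto
  qed
  have "\<pi> ` {..<n} = {..<n}"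
    by (rule card_subset_eq) (use \<pi> card_image[OF inj] in auto)
  then have perm: "\<pi> permutes {..<n}"
    using inj by (intro bij_imp_permutes) (auto simp: bij_betw_def \<pi>_def)
  show ?thesis
  proof
    show "g = mono_mat n \<pi> (\<lambda>j. g $$ (\<pi> j, j))"
      by (rule eq_matI) (use g u in auto)
    show "(\<lambda>j. g $$ (\<pi> j, j)) \<in> sign_vec n"
      using e \<pi> by (auto simp: sign_vec_def power2_eq_1_iff)
  qed (rule perm)
qed

lemma sign_vec_comp: "\<pi> permutes {..<n} \<Longrightarrow> s \<in> sign_vec n \<Longrightarrow> s' \<in> sign_vec n \<Longrightarrow> (\<lambda>b. s (\<pi> b) * s' b) \<in> sign_vec n"
proof -
  assume p: "\<pi> permutes {..<n}" and s: "s \<in> sign_vec n" "s' \<in> sign_vec n"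
  have "s (\<pi> i) * s' i = 1 \<or> s (\<pi> i) * s' i = - 1" if i: "i < n" for i
  proof -
    have "\<pi> i < n" using permutes_in_image[OF p, of i] i by simp
    then have "s (\<pi> i) = 1 \<or> s (\<pi> i) = - 1" "s' i = 1 \<or> s' i = - 1" using s i by (simp_all add: sign_vec_def)
    then show ?thesis by auto
  qed
  then show ?thesis by (simp add: sign_vec_def)
qed

lemma B_mult: "g \<in> Gmpn 2 1 n \<Longrightarrow> h \<in> Gmpn 2 1 n \<Longrightarrow> g * h \<in> Gmpn 2 1 n"
  by (elim monomialE, hypsubst, subst mono_mat_mult) (simp_all del: One_nat_def add: mono_mat_monomial permutes_compose sign_vec_comp)

lemma B_carrier: "g \<in> Gmpn 2 1 n \<Longrightarrow> g \<in> carrier_mat n n"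
  by (auto simp: Gmpn_def monomial_mat_def)

lemma sign_diag_B: "sign_diag n \<subseteq> Gmpn 2 1 n"
  by (auto simp del: One_nat_def simp: sign_diag_def dmat_monom sign_vec_def intro!: mono_mat_monomial permutes_id)

lemma B_one: "1\<^sub>m n \<in> Gmpn 2 1 n"
  using sign_diag_B sign_diag_one by blast

lemma B_inverse:
  assumes "g \<in> Gmpn 2 1 n" shows "\<exists>k\<in>Gmpn 2 1 n. k * g = 1\<^sub>m n \<and> g * k = 1\<^sub>m n"
proof -
  obtain \<pi> s where g: "g = mono_mat n \<pi> s" and p: "\<pi> permutes {..<n}" and s: "s \<in> sign_vec n"
    using assms by (rule monomialE)
  note q = permutes_inv[OF p] and pi = permutes_inverses[OF p]
  have ip: "inv_into UNIV \<pi> a < n" if "a < n" for a using permutes_in_image[OF q, of a] that by simp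
  let ?k = "mono_mat n (inv_into UNIV \<pi>) (\<lambda>a. s (inv_into UNIV \<pi> a))"
  have s': "(\<lambda>a. s (inv_into UNIV \<pi> a)) \<in> sign_vec n" using s ip by (auto simp: sign_vec_def)
  have sq: "s i * s i = 1" if "i < n" for i using s that by (auto simp: sign_vec_def)
  have "?k * g = 1\<^sub>m n" "g * ?k = 1\<^sub>m n"
    unfolding g mono_mat_mult[OF p] mono_mat_mult[OF q] dmat_one dmat_monom
    by (rule mono_mat_cong; simp add: pi sq ip)+
  then show ?thesis using mono_mat_monomial[OF q s'] by blast
qed

lemma entry_prod_mult:
  assumes "g \<in> Gmpn 2 1 n" "h \<in> Gmpn 2 1 n"
  shows "entry_prod n (g * h) = entry_prod n g * entry_prod n h"
proof -
  obtain \<pi> s where g: "g = mono_mat n \<pi> s" and p: "\<pi> permutes {..<n}" and s: "s \<in> sign_vec n"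
    using assms(1) by (rule monomialE)
  obtain \<pi>' s' where h: "h = mono_mat n \<pi>' s'" and p': "\<pi>' permutes {..<n}" and s': "s' \<in> sign_vec n"
    using assms(2) by (rule monomialE)
  have "entry_prod n (g * h) = (\<Prod>j<n. s (\<pi>' j) * s' j)"
    unfolding g h mono_mat_mult[OF p'] by (rule entry_prod_monom[OF permutes_compose[OF p' p] sign_vec_comp[OF p' s s']])
  also have "\<dots> = (\<Prod>j<n. s (\<pi>' j)) * (\<Prod>j<n. s' j)" by (rule prod.distrib)
  also have "(\<Prod>j<n. s (\<pi>' j)) = (\<Prod>j<n. s j)" using prod.permute[OF p', of s] by (simp add: comp_def)
  finally show ?thesis unfolding g h entry_prod_monom[OF p s] entry_prod_monom[OF p' s'] .
qed

lemma entry_prod_dmat: "d \<in> sign_vec n \<Longrightarrow> entry_prod n (dmat n d) = (\<Prod>j<n. d j)"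
  unfolding dmat_monom by (rule entry_prod_monom[OF permutes_id])

text \<open>
  Only the inverse of \<open>\<pi>\<close> contributes to the Leibniz expansion.
\<close>

lemma det_monom:
  assumes p: "\<pi> permutes {..<n}"
  shows "Determinant.det (mono_mat n \<pi> s) = signof \<pi> * (\<Prod>j<n. s j)"
proof -
  have p0: "\<pi> permutes {0..<n}" using p by (simp add: atLeast0LessThan)
  note q = permutes_inv[OF p0] and pi = permutes_inverses[OF p0]
  let ?f = "\<lambda>\<sigma>. signof \<sigma> * (\<Prod>i = 0..<n. mono_mat n \<pi> s $$ (i, \<sigma> i))"
  have "Determinant.det (mono_mat n \<pi> s) = (\<Sum>\<sigma>\<in>{\<sigma>. \<sigma> permutes {0..<n}}. ?f \<sigma>)"
    by (simp add: Determinant.det_def)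
  also have "\<dots> = (\<Sum>\<sigma>\<in>{inv_into UNIV \<pi>}. ?f \<sigma>)"
  proof (rule sum.mono_neutral_right)
    show "\<forall>\<sigma>\<in>{\<sigma>. \<sigma> permutes {0..<n}} - {inv_into UNIV \<pi>}. ?f \<sigma> = 0"
    proof
      fix \<sigma> assume "\<sigma> \<in> {\<sigma>. \<sigma> permutes {0..<n}} - {inv_into UNIV \<pi>}"
      then have \<sigma>: "\<sigma> permutes {0..<n}" and ne: "\<sigma> \<noteq> inv_into UNIV \<pi>" by auto
      have sl: "\<sigma> i < n" if "i < n" for i using permutes_in_image[OF \<sigma>, of i] that by simp
      have "\<exists>i<n. i \<noteq> \<pi> (\<sigma> i)"
      proof (rule ccontr)
        assume "\<not> (\<exists>i<n. i \<noteq> \<pi> (\<sigma> i))"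
        then have "\<sigma> i = inv_into UNIV \<pi> i" for i
          using permutes_not_in[OF \<sigma>, of i] permutes_not_in[OF q, of i] pi(2)[of "\<sigma> i"]
          by (cases "i < n") auto
        then show False using ne by auto
      qed
      then obtain i where "i < n" "i \<noteq> \<pi> (\<sigma> i)" by blast
      then have "mono_mat n \<pi> s $$ (i, \<sigma> i) = 0" "i \<in> {0..<n}" using sl by auto
      then have "(\<Prod>i = 0..<n. mono_mat n \<pi> s $$ (i, \<sigma> i)) = 0" by (intro prod_zero) auto
      then show "?f \<sigma> = 0" by simp
    qed
  qed (use q in \<open>auto simp: finite_permutations\<close>)
  also have "\<dots> = signof (inv_into UNIV \<pi>) * (\<Prod>i = 0..<n. s (inv_into UNIV \<pi> i))"
  proof -
    have "inv_into UNIV \<pi> i < n" if "i < n" for i using permutes_in_image[OF q, of i] that by simp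
    then show ?thesis by (simp add: pi)
  qed
  also have "(\<Prod>i = 0..<n. s (inv_into UNIV \<pi> i)) = (\<Prod>i = 0..<n. s i)" using prod.permute[OF q, of s] by (simp add: comp_def)
  also have "signof (inv_into UNIV \<pi>) = (signof \<pi> :: complex)"
    using signof_inv[OF _ p0] by (metis finite_atLeastLessThan)
  finally show ?thesis by (simp add: atLeast0LessThan)
qed

text \<open>
  A subgroup of the hyperoctahedral group. The groups \<open>W\<close> and \<open>\<mu>(W)\<close> are the instances of
  interest, and both are treated through this common interface.
\<close>

locale monomial_group =
  fixes n :: nat and K :: "complex mat set"
  assumes K_B: "K \<subseteq> Gmpn 2 1 n"
    and K_one: "1\<^sub>m n \<in> K"
    and K_mult: "\<And>g h. g \<in> K \<Longrightarrow> h \<in> K \<Longrightarrow> g * h \<in> K"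
    and K_inverse: "\<And>g. g \<in> K \<Longrightarrow> \<exists>k\<in>K. k * g = 1\<^sub>m n \<and> g * k = 1\<^sub>m n"
begin

lemma K_carrier: "g \<in> K \<Longrightarrow> g \<in> carrier_mat n n"
  using K_B B_carrier by blast

lemma mat_group_simps:
  "carrier (mat_group n K) = K" "monoid.mult (mat_group n K) = (*)" "\<one>\<^bsub>mat_group n K\<^esub> = 1\<^sub>m n"
  by (simp_all add: mat_group_def)

lemma group_mat_group: "Group.group (mat_group n K)"
  by (rule groupI; unfold mat_group_simps)
    (use K_one K_mult K_carrier K_inverse in \<open>auto intro: assoc_mult_mat left_mult_one_mat\<close>, meson)

lemma inv_mat_group:
  assumes "g \<in> K" "k \<in> K" "k * g = 1\<^sub>m n" shows "inv\<^bsub>mat_group n K\<^esub> g = k"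
  using group.inv_equality[OF group_mat_group, of k g] assms by (simp add: mat_group_simps)

text \<open>
  Adjacent transpositions generate the symmetric group. Hence products of the given representatives
  realise every permutation, and an arbitrary element of \<open>K\<close> differs from such a product by a diagonal one.
\<close>

lemma monomial_group_generated:
  assumes r: "\<And>i. Suc i < n \<Longrightarrow> \<exists>s\<in>sign_vec n. mono_mat n (Transposition.transpose i (Suc i)) s \<in> Z \<inter> K"
    and mult: "\<And>g h. g \<in> Z \<Longrightarrow> h \<in> Z \<Longrightarrow> g \<in> K \<Longrightarrow> h \<in> K \<Longrightarrow> g * h \<in> Z"
    and diag: "K \<inter> sign_diag n \<subseteq> Z"
  shows "K \<subseteq> Z"
proof -
  define Y where "Y = {\<pi>. \<pi> permutes {..<n} \<and> (\<exists>s\<in>sign_vec n. mono_mat n \<pi> s \<in> Z \<inter> K)}"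
  have id: "id \<in> Y"
  proof -
    have "mono_mat n id (\<lambda>_. 1) \<in> Z \<inter> K"
      unfolding dmat_monom[symmetric] dmat_one[symmetric] using diag K_one sign_diag_one by blast
    moreover have "(\<lambda>_. 1) \<in> sign_vec n" by (simp add: sign_vec_def)
    ultimately show ?thesis using permutes_id unfolding Y_def by blast
  qed
  have comp: "\<pi> \<circ> \<pi>' \<in> Y" if "\<pi> \<in> Y" "\<pi>' \<in> Y" for \<pi> \<pi>'
  proof -
    from that obtain s s' where s: "s \<in> sign_vec n" "mono_mat n \<pi> s \<in> Z \<inter> K" "\<pi> permutes {..<n}"
      and s': "s' \<in> sign_vec n" "mono_mat n \<pi>' s' \<in> Z \<inter> K" "\<pi>' permutes {..<n}" unfolding Y_def by blast
    have "mono_mat n \<pi> s * mono_mat n \<pi>' s' \<in> Z \<inter> K" using s s' mult K_mult by blast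
    then show ?thesis unfolding mono_mat_mult[OF s'(3)]
      using sign_vec_comp[OF s'(3) s(1) s'(1)] permutes_compose[OF s'(3) s(3)] unfolding Y_def by blast
  qed
  have adj: "Transposition.transpose i (Suc i) \<in> Y" if "Suc i < n" for i
  proof -
    have "Transposition.transpose i (Suc i) permutes {..<n}" by (rule permutes_swap_id) (use that in auto)
    then show ?thesis using r[OF that] unfolding Y_def by blast
  qed
  have tr: "Transposition.transpose a (Suc (a + m)) \<in> Y" if "Suc (a + m) < n" for a m
    using that
  proof (induct m)
    case 0
    then show ?case using adj by simp
  next
    case (Suc m)
    let ?b = "Suc (a + m)"
    have e: "Transposition.transpose a (Suc (a + Suc m)) =
      Transposition.transpose ?b (Suc ?b) \<circ> Transposition.transpose a ?b \<circ> Transposition.transpose ?b (Suc ?b)"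
      by (auto simp: Transposition.transpose_def fun_eq_iff)
    show ?case unfolding e using Suc by (intro comp adj) auto
  qed
  have tr': "Transposition.transpose a b \<in> Y" if "a < n" "b < n" "a \<noteq> b" for a b
  proof (cases "a < b")
    case True
    then obtain m where b: "b = Suc (a + m)" using less_imp_Suc_add[of a b] by blast
    show ?thesis unfolding b by (rule tr) (use that b in simp)
  next
    case False
    then have "b < a" using that by simp
    then obtain m where a: "a = Suc (b + m)" using less_imp_Suc_add[of b a] by blast
    show ?thesis unfolding a transpose_commute[of "Suc (b + m)"] by (rule tr) (use that a in simp)
  qed
  have all: "\<pi> \<in> Y" if "\<pi> permutes {..<n}" for \<pi>
  proof (rule permutes_induct[OF that])
    show "Transposition.transpose a b \<circ> q \<in> Y" if "a \<in> {..<n}" "b \<in> {..<n}" "a \<noteq> b" "q \<in> Y" for a b q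
      by (rule comp[OF tr' that(4)]) (use that in auto)
  qed (simp, rule id)
  show ?thesis
  proof
    fix g assume g: "g \<in> K"
    obtain \<pi> s where gm: "g = mono_mat n \<pi> s" and p: "\<pi> permutes {..<n}" and s: "s \<in> sign_vec n"
      by (rule monomialE[OF subsetD[OF K_B g]])
    from all[OF p] obtain s' where s': "s' \<in> sign_vec n" and r: "mono_mat n \<pi> s' \<in> Z" "mono_mat n \<pi> s' \<in> K"
      unfolding Y_def by blast
    obtain k where k: "k \<in> K" "k * mono_mat n \<pi> s' = 1\<^sub>m n" "mono_mat n \<pi> s' * k = 1\<^sub>m n" using K_inverse[OF r(2)] by blast
    obtain \<rho> u where km: "k = mono_mat n \<rho> u" and q: "\<rho> permutes {..<n}" and u: "u \<in> sign_vec n"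
      by (rule monomialE[OF subsetD[OF K_B k(1)]])
    have pl: "\<pi> b < n" if "b < n" for b using permutes_in_image[OF p, of b] that by simp
    have ql: "\<rho> b < n" if "b < n" for b using permutes_in_image[OF q, of b] that by simp
    have "\<rho> (\<pi> b) = b" if b: "b < n" for b
    proof -
      have "mono_mat n (\<rho> \<circ> \<pi>) (\<lambda>b. u (\<pi> b) * s' b) $$ (\<rho> (\<pi> b), b) = 1\<^sub>m n $$ (\<rho> (\<pi> b), b)"
        using k(2) unfolding km mono_mat_mult[OF p] by simp
      then have "u (\<pi> b) * s' b = (if \<rho> (\<pi> b) = b then 1 else 0)"
        using b ql[OF pl[OF b]] by simp
      then show ?thesis using sign_vec_nz[OF u pl[OF b]] sign_vec_nz[OF s' b] by (metis mult_eq_0_iff)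
    qed
    then have "k * g = dmat n (\<lambda>b. u (\<pi> b) * s b)"
      unfolding km gm mono_mat_mult[OF p] dmat_monom by (intro mono_mat_cong) auto
    also have "\<dots> \<in> sign_diag n"
      by (rule sign_diagI) (use sign_vec_comp[OF p u s] in \<open>auto simp: sign_vec_def\<close>)
    finally have kg: "k * g \<in> Z" "k * g \<in> K" using diag K_mult[OF k(1) g] by blast+
    have "mono_mat n \<pi> s' * (k * g) \<in> Z" by (rule mult[OF r(1) kg(1) r(2) kg(2)])
    moreover have "mono_mat n \<pi> s' * (k * g) = g"
      using k(3) K_carrier[OF k(1)] K_carrier[OF g] K_carrier[OF r(2)]
      by (simp add: assoc_mult_mat[symmetric, of _ n n _ n _ n])
    ultimately show "g \<in> Z" by simp
  qed
qed

end

text \<open>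
  Both the product of the entries and the determinant are multiplicative on \<open>B\<^sub>n\<close>, so the subgroups
  \<open>D\<^sub>n\<close> and \<open>\<mu>(D\<^sub>n)\<close> are of this form.
\<close>

lemma monomial_groupI:
  fixes f :: "complex mat \<Rightarrow> complex"
  assumes "\<And>g h. g \<in> Gmpn 2 1 n \<Longrightarrow> h \<in> Gmpn 2 1 n \<Longrightarrow> f (g * h) = f g * f h" and "f (1\<^sub>m n) = 1"
  shows "monomial_group n {g \<in> Gmpn 2 1 n. f g = 1}"
proof
  fix g assume g: "g \<in> {g \<in> Gmpn 2 1 n. f g = 1}"
  then obtain k where k: "k \<in> Gmpn 2 1 n" "k * g = 1\<^sub>m n" "g * k = 1\<^sub>m n" using B_inverse by blast
  have "f k = 1" using assms(1)[OF k(1), of g] g k assms(2) by simp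
  then show "\<exists>k\<in>{g \<in> Gmpn 2 1 n. f g = 1}. k * g = 1\<^sub>m n \<and> g * k = 1\<^sub>m n" using k by blast
qed (use assms B_mult B_one in auto)

lemma Gmpn_2: "Gmpn 2 2 n = {g \<in> Gmpn 2 1 n. entry_prod n g = 1}"
  by (auto simp: Gmpn_def roots_of_unity_def)

lemma entry_prod_one: "entry_prod n (1\<^sub>m n) = 1"
  unfolding dmat_one by (subst entry_prod_dmat) (auto simp: sign_vec_def)

lemma monomial_group_B: "monomial_group n (Gmpn 2 1 n)"
  using monomial_groupI[of n "\<lambda>_. 1"] by simp

lemma monomial_group_W: "p \<in> {1, 2} \<Longrightarrow> monomial_group n (Gmpn 2 p n)"
  using monomial_group_B monomial_groupI[of n "entry_prod n", OF entry_prod_mult entry_prod_one] by (auto simp: Gmpn_2)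

lemma monomial_group_mu: "p \<in> {1, 2} \<Longrightarrow> monomial_group n (mu p n)"
  using monomial_group_B monomial_groupI[of n Determinant.det] B_carrier
  by (auto simp: mu_def det_mult[of _ n])

section \<open>The twist\<close>

text \<open>
  The index set of the product that defines \<open>\<F>\<close>.
\<close>

definition twist_pairs :: "nat \<Rightarrow> (nat \<times> nat) set" where
  "twist_pairs n = {(i, j). j < i \<and> i < n}"

text \<open>
  The diagonal entry at \<open>k\<close> of the contribution \<open>t\<^sub>j\<close> or \<open>1\<close> of the factor with index \<open>p = (i, j)\<close>
  to \<open>t\<^sub>\<alpha>\<close>: it is \<open>t\<^sub>j\<close> exactly if \<open>i \<in> \<alpha>\<close>.
\<close>

definition flip :: "nat set \<Rightarrow> nat \<times> nat \<Rightarrow> nat \<Rightarrow> complex" where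
  "flip \<alpha> p k = (if fst p \<in> \<alpha> \<and> snd p = k then - 1 else 1)"

text \<open>
  The element \<open>t\<^sub>\<alpha>\<close> by which \<open>\<F>\<close> acts on the second tensor factor if the first one has weight
  \<open>\<alpha>\<close>.
\<close>

definition twist_elt :: "nat \<Rightarrow> nat set \<Rightarrow> complex mat" where
  "twist_elt n \<alpha> = dmat n (\<lambda>k. \<Prod>p\<in>twist_pairs n. flip \<alpha> p k)"

lemma prod_flip: "(\<Prod>p\<in>S. flip \<alpha> p k) = 1 \<or> (\<Prod>p\<in>S. flip \<alpha> p k) = - 1"
  by (induct S rule: infinite_finite_induct) (auto simp: flip_def)

lemma twist_elt_sign_diag: "twist_elt n \<alpha> \<in> sign_diag n"
  unfolding twist_elt_def by (rule sign_diagI) (rule prod_flip)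

lemma twist_elt_symdiff: "twist_elt n (symdiff \<alpha> \<beta>) = twist_elt n \<alpha> * twist_elt n \<beta>"
  unfolding twist_elt_def dmat_mult prod.distrib[symmetric]
  by (rule dmat_cong, rule prod.cong) (auto simp: flip_def symdiff_def)

lemma twist_elt_empty: "twist_elt n {} = 1\<^sub>m n"
  by (simp add: twist_elt_def dmat_one flip_def)

lemma finite_twist_pairs: "finite (twist_pairs n)"
  by (rule finite_subset[of _ "{..<n} \<times> {..<n}"]) (auto simp: twist_pairs_def)

text \<open>
  For \<open>k < i\<close> the factors with indices \<open>(i, k)\<close> and \<open>(i + 1, k)\<close> both contribute \<open>t\<^sub>k\<close> and cancel.
  Only the factor with index \<open>(i + 1, i)\<close> is left.
\<close>

lemma twist_elt_adjacent:
  assumes i: "Suc i < n" shows "twist_elt n {i, Suc i} = t_refl n i"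
  unfolding twist_elt_def dmat_t
proof (rule dmat_cong)
  fix k assume k: "k < n"
  have "(\<Prod>p\<in>twist_pairs n. flip {i, Suc i} p k) = (\<Prod>p\<in>twist_pairs n \<inter> {(i, k), (Suc i, k)}. - 1)"
    by (rule prod.mono_neutral_cong_right) (auto simp: flip_def finite_twist_pairs)
  also have "twist_pairs n \<inter> {(i, k), (Suc i, k)} =
      (if k < i then {(i, k), (Suc i, k)} else if k = i then {(Suc i, k)} else {})"
    using i by (auto simp: twist_pairs_def)
  also have "(\<Prod>p\<in>\<dots>. - 1 :: complex) = (if k = i then - 1 else 1)" by auto
  finally show "(\<Prod>p\<in>twist_pairs n. flip {i, Suc i} p k) = (if k = i then - 1 else 1 :: complex)" .
qed

lemma B_group_simps: "carrier (B_group n) = Gmpn 2 1 n" "monoid.mult (B_group n) = (*)" "\<one>\<^bsub>B_group n\<^esub> = 1\<^sub>m n"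
  by (simp_all add: B_group_def mat_group_def)

lemma group_B_group: "Group.group (B_group n)"
  unfolding B_group_def by (rule monomial_group.group_mat_group[OF monomial_group_B])

lemma T_group_simps: "monoid.mult (T_group n) = (*)" "\<one>\<^bsub>T_group n\<^esub> = 1\<^sub>m n"
  "carrier (T_group n) = generate (B_group n) (t_refl n ` {..<n})"
  by (simp_all add: T_group_def B_group_def mat_group_def)

lemma sign_diag_inv: "h \<in> sign_diag n \<Longrightarrow> inv\<^bsub>B_group n\<^esub> h = h"
  unfolding B_group_def
  by (rule monomial_group.inv_mat_group[OF monomial_group_B]) (use sign_diag_B sign_diag_sq in auto)

lemma T_group_sign_diag: "carrier (T_group n) \<subseteq> sign_diag n"
proof
  fix h assume "h \<in> carrier (T_group n)"
  then have "h \<in> generate (B_group n) (t_refl n ` {..<n})" by (simp add: T_group_simps)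
  then show "h \<in> sign_diag n"
    by induct (auto simp: B_group_simps sign_diag_one sign_diag_t sign_diag_inv sign_diag_mult)
qed

lemma comm_monoid_T_T: "Group.comm_monoid (T_group n \<times>\<times> T_group n)" and monoid_T: "Group.monoid (T_group n)"
  and t_T: "i < n \<Longrightarrow> t_refl n i \<in> carrier (T_group n)"
proof -
  have sub: "t_refl n ` {..<n} \<subseteq> carrier (B_group n)"
    using sign_diag_B sign_diag_t by (auto simp: B_group_simps)
  have "subgroup (carrier (T_group n)) (B_group n)"
    unfolding T_group_simps by (rule group.generate_is_subgroup[OF group_B_group sub])
  then have g: "Group.group (T_group n)"
    unfolding T_group_simps using group_B_group
    by (simp add: T_group_def subgroup.subgroup_is_group)
  then show m: "Group.monoid (T_group n)" by (simp add: Group.group_def)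
  show "Group.comm_monoid (T_group n \<times>\<times> T_group n)"
  proof (rule monoid.monoid_comm_monoidI[OF DirProd_monoid[OF m m]])
    fix x y assume "x \<in> carrier (T_group n \<times>\<times> T_group n)" "y \<in> carrier (T_group n \<times>\<times> T_group n)"
    then show "x \<otimes>\<^bsub>T_group n \<times>\<times> T_group n\<^esub> y = y \<otimes>\<^bsub>T_group n \<times>\<times> T_group n\<^esub> x"
      using T_group_sign_diag[of n] by (auto simp: DirProd_def T_group_simps intro!: sign_diag_comm)
  qed
  show "i < n \<Longrightarrow> t_refl n i \<in> carrier (T_group n)"
    unfolding T_group_simps by (rule generate.incl) auto
qed

section \<open>Twisting bilinear maps\<close>

definition torus_rep :: "nat \<Rightarrow> (complex, 'v) module \<Rightarrow> (complex mat \<Rightarrow> 'v \<Rightarrow> 'v) \<Rightarrow> bool" where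
  "torus_rep n U tU \<longleftrightarrow> cvs U \<and> (\<forall>h\<in>sign_diag n. lin U U (tU h)) \<and>
     (\<forall>h\<in>sign_diag n. \<forall>k\<in>sign_diag n. \<forall>u\<in>carrier U. tU (h * k) u = tU h (tU k u)) \<and>
     (\<forall>u\<in>carrier U. tU (1\<^sub>m n) u = u)"

lemma torus_rep_cvs: "torus_rep n U tU \<Longrightarrow> cvs U"
  and torus_rep_lin: "torus_rep n U tU \<Longrightarrow> h \<in> sign_diag n \<Longrightarrow> lin U U (tU h)"
  and torus_rep_mult: "torus_rep n U tU \<Longrightarrow> h \<in> sign_diag n \<Longrightarrow> k \<in> sign_diag n \<Longrightarrow> u \<in> carrier U \<Longrightarrow>
     tU (h * k) u = tU h (tU k u)"
  and torus_rep_one: "torus_rep n U tU \<Longrightarrow> u \<in> carrier U \<Longrightarrow> tU (1\<^sub>m n) u = u"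
  by (auto simp: torus_rep_def)

lemma torus_rep_closed: "torus_rep n U tU \<Longrightarrow> h \<in> sign_diag n \<Longrightarrow> u \<in> carrier U \<Longrightarrow> tU h u \<in> carrier U"
  by (rule lin_closed[OF torus_rep_lin])

lemma torus_rep_comm: "torus_rep n U tU \<Longrightarrow> h \<in> sign_diag n \<Longrightarrow> k \<in> sign_diag n \<Longrightarrow> u \<in> carrier U \<Longrightarrow>
     tU h (tU k u) = tU k (tU h u)"
  using torus_rep_mult[of n U tU h k u] torus_rep_mult[of n U tU k h u] sign_diag_comm[of h n k] by simp

lemma torus_rep_invol: "torus_rep n U tU \<Longrightarrow> h \<in> sign_diag n \<Longrightarrow> u \<in> carrier U \<Longrightarrow> tU h (tU h u) = u"
  using torus_rep_mult[of n U tU h h u] torus_rep_one[of n U tU u] sign_diag_sq[of h n] by simp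

text \<open>
  Homogeneous vectors of degree \<open>\<alpha>\<close>.
\<close>

definition weight_vec :: "nat \<Rightarrow> (complex, 'v) module \<Rightarrow> (complex mat \<Rightarrow> 'v \<Rightarrow> 'v) \<Rightarrow> nat set \<Rightarrow> 'v \<Rightarrow> bool" where
  "weight_vec n U tU \<alpha> u \<longleftrightarrow> \<alpha> \<subseteq> {..<n} \<and> u \<in> carrier U \<and> (\<forall>h\<in>sign_diag n. tU h u = wt \<alpha> h \<odot>\<^bsub>U\<^esub> u)"

lemma weight_vecD: "weight_vec n U tU \<alpha> u \<Longrightarrow> \<alpha> \<subseteq> {..<n}" "weight_vec n U tU \<alpha> u \<Longrightarrow> u \<in> carrier U"
  "weight_vec n U tU \<alpha> u \<Longrightarrow> h \<in> sign_diag n \<Longrightarrow> tU h u = wt \<alpha> h \<odot>\<^bsub>U\<^esub> u"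
  by (auto simp: weight_vec_def)

lemma weight_vec_product:
  assumes A: "calg A"
    and mult: "\<And>h a b. h \<in> sign_diag n \<Longrightarrow> a \<in> carrier A \<Longrightarrow> b \<in> carrier A \<Longrightarrow> tA h (a \<otimes>\<^bsub>A\<^esub> b) = tA h a \<otimes>\<^bsub>A\<^esub> tA h b"
    and a: "weight_vec n A tA \<alpha> a" and b: "weight_vec n A tA \<beta> b"
  shows "weight_vec n A tA (symdiff \<alpha> \<beta>) (a \<otimes>\<^bsub>A\<^esub> b)"
  unfolding weight_vec_def
  using weight_vecD[OF a] weight_vecD[OF b] A
  by (simp add: symdiff_subset calg_closed mult wt_symdiff[of _ n] calg_smult_l calg_smult_r
      cvs_smult_smult[OF calg_cvs[OF A]] mult.commute)

lemma weight_vec_unit: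
  "calg A \<Longrightarrow> (\<And>h. h \<in> sign_diag n \<Longrightarrow> tA h \<one>\<^bsub>A\<^esub> = \<one>\<^bsub>A\<^esub>) \<Longrightarrow> weight_vec n A tA {} \<one>\<^bsub>A\<^esub>"
  by (simp add: weight_vec_def wt_def calg_one cvs_one_smult[OF calg_cvs])

text \<open>
  A bilinear map precomposed with \<open>\<F>\<close>. The twisted product of an algebra and the twisted action on a
  module are both of this kind, which is why the main computation is done at this generality.
\<close>

definition twisted ::
  "nat \<Rightarrow> (complex mat \<Rightarrow> 'a \<Rightarrow> 'a) \<Rightarrow> (complex mat \<Rightarrow> 'v \<Rightarrow> 'v) \<Rightarrow> (complex, 'w) module \<Rightarrow>
     ('a \<Rightarrow> 'v \<Rightarrow> 'w) \<Rightarrow> 'a \<Rightarrow> 'v \<Rightarrow> 'w" where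
  "twisted n tA tM U b a v = linext U (\<lambda>z. b (tA (fst z) a) (tM (snd z) v)) (twist n)"

lemma twisted_act_twisted: "twisted_act n tA U tU act = twisted n tA tU U act"
  by (simp add: twisted_act_def twisted_def linext_def fun_eq_iff)

lemma twisted_alg_simps:
  "carrier (twisted_alg n A tA) = carrier A" "\<one>\<^bsub>twisted_alg n A tA\<^esub> = \<one>\<^bsub>A\<^esub>" "\<zero>\<^bsub>twisted_alg n A tA\<^esub> = \<zero>\<^bsub>A\<^esub>"
  "add (twisted_alg n A tA) = add A" "smult (twisted_alg n A tA) = smult A"
  "monoid.mult (twisted_alg n A tA) = twisted n tA tA A (monoid.mult A)"
  by (simp_all add: twisted_alg_def twisted_def linext_def fun_eq_iff)

definition twist_factor :: "nat \<Rightarrow> nat \<times> nat \<Rightarrow> (complex mat \<times> complex mat) \<Rightarrow>\<^sub>0 complex" where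
  "twist_factor n = (\<lambda>(i, j).
        Poly_Mapping.single (1\<^sub>m n, 1\<^sub>m n) (1/2) + Poly_Mapping.single (t_refl n i, 1\<^sub>m n) (1/2)
        + Poly_Mapping.single (1\<^sub>m n, t_refl n j) (1/2)
        - Poly_Mapping.single (t_refl n i, t_refl n j) (1/2))"

lemma twist_finprod: "twist n = finprod (monoid_alg (T_group n \<times>\<times> T_group n)) (twist_factor n) (twist_pairs n)"
  by (simp add: twist_def twist_factor_def twist_pairs_def)

abbreviation TT :: "nat \<Rightarrow> (complex mat \<times> complex mat) monoid" where
  "TT n \<equiv> T_group n \<times>\<times> T_group n"

lemma monoid_TT: "Group.monoid (TT n)"
  using comm_monoid_T_T by (simp add: Group.comm_monoid_def)

lemma TT_simps: "carrier (TT n) = carrier (T_group n) \<times> carrier (T_group n)"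
  "z \<otimes>\<^bsub>TT n\<^esub> z' = (fst z * fst z', snd z * snd z')" "\<one>\<^bsub>TT n\<^esub> = (1\<^sub>m n, 1\<^sub>m n)"
  by (auto simp: DirProd_def T_group_simps split: prod.splits)

lemma TT_sign_diag: "z \<in> carrier (TT n) \<Longrightarrow> fst z \<in> sign_diag n \<and> snd z \<in> sign_diag n"
  using T_group_sign_diag[of n] by (auto simp: TT_simps)

lemma one_T: "1\<^sub>m n \<in> carrier (T_group n)"
  using monoid.one_closed[OF monoid_T, of n] by (simp add: T_group_simps)

lemma comm_monoid_monoid_alg:
  fixes G :: "('g, 'm) monoid_scheme"
  assumes G: "Group.comm_monoid G" shows "Group.comm_monoid (monoid_alg G)"
proof (rule monoid.monoid_comm_monoidI)
  have m: "Group.monoid G" using G by (simp add: Group.comm_monoid_def)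
  show "Group.monoid (monoid_alg G)" using calg_ring[OF calg_monoid_alg[OF m]] by (simp add: ring_def)
  fix x y assume "x \<in> carrier (monoid_alg G)" "y \<in> carrier (monoid_alg G)"
  then have x: "Poly_Mapping.keys x \<subseteq> carrier G" and y: "Poly_Mapping.keys y \<subseteq> carrier G" by auto
  have 1: "Poly_Mapping.single u c \<otimes>\<^bsub>monoid_alg G\<^esub> y = y \<otimes>\<^bsub>monoid_alg G\<^esub> Poly_Mapping.single u c"
    if u: "u \<in> carrier G" for u c
    using y by (induct rule: poly_mapping_keys_induct)
      (simp_all add: monoid_alg_bilinear comm_monoid.m_comm[OF G _ u] mult.commute)
  from x show "x \<otimes>\<^bsub>monoid_alg G\<^esub> y = y \<otimes>\<^bsub>monoid_alg G\<^esub> x"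
    by (induct rule: poly_mapping_keys_induct) (simp_all add: monoid_alg_bilinear 1)
qed

lemma keys_twist_factor:
  assumes "p \<in> twist_pairs n" shows "Poly_Mapping.keys (twist_factor n p) \<subseteq> carrier (TT n)"
proof -
  obtain i j where p: "p = (i, j)" "i < n" "j < n" using assms by (auto simp: twist_pairs_def)
  have s: "Poly_Mapping.keys (Poly_Mapping.single z c) \<subseteq> carrier (TT n)"
    if "fst z \<in> carrier (T_group n)" "snd z \<in> carrier (T_group n)" for z and c :: complex
    using that by (auto simp: TT_simps mem_Times_iff)
  show ?thesis unfolding p twist_factor_def prod.case
    by (intro order_trans[OF keys_diff] order_trans[OF keys_add] Un_least s)
      (simp_all add: one_T t_T p)
qed

text \<open>
  With \<open>\<chi> = wt \<alpha> t\<^sub>i\<close>, the factor of \<open>\<F>\<close> with index \<open>(i, j)\<close> acts on \<open>a \<otimes> v\<close> as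
  \<open>1 \<otimes> \<onehalf>(1 + \<chi> + t\<^sub>j - \<chi> t\<^sub>j)\<close>. This is the identity for \<open>\<chi> = 1\<close> and \<open>1 \<otimes> t\<^sub>j\<close> for
  \<open>\<chi> = - 1\<close>, that is, for \<open>i \<in> \<alpha>\<close>.
\<close>

lemma twisted_weight_vec:
  assumes tA: "torus_rep n A tA" and tM: "torus_rep n M tM" and U: "cvs U" and b: "bilin A M U b"
    and a: "weight_vec n A tA \<alpha> a" and v: "v \<in> carrier M"
  shows "twisted n tA tM U b a v = b a (tM (twist_elt n \<alpha>) v)"
proof -
  let ?R = "monoid_alg (TT n)"
  let ?E = "\<lambda>F v. linext U (\<lambda>z. b (tA (fst z) a) (tM (snd z) v)) F"
  let ?d = "\<lambda>S. dmat n (\<lambda>k. \<Prod>p\<in>S. flip \<alpha> p k)"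
  interpret R: comm_monoid ?R by (rule comm_monoid_monoid_alg[OF comm_monoid_T_T])
  note aD = weight_vecD[OF a]
  have cl: "b (tA (fst z) a) (tM (snd z) v) \<in> carrier U" if "z \<in> carrier (TT n)" "v \<in> carrier M" for z v
    using TT_sign_diag[OF that(1)] that(2)
    by (intro bilin_closed[OF b] torus_rep_closed[OF tA] torus_rep_closed[OF tM] aD) auto
  have Ecl: "?E F v \<in> carrier U" if "Poly_Mapping.keys F \<subseteq> carrier (TT n)" "v \<in> carrier M" for F v
    by (rule linext_closed[OF U]) (use that cl in blast)
  have Eadd: "?E (F + G) v = ?E F v \<oplus>\<^bsub>U\<^esub> ?E G v"
    if "Poly_Mapping.keys F \<subseteq> carrier (TT n)" "Poly_Mapping.keys G \<subseteq> carrier (TT n)" "v \<in> carrier M" for F G v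
    by (rule linext_add[OF U]) (use that cl in blast)+
  have km: "Poly_Mapping.keys (F \<otimes>\<^bsub>?R\<^esub> G) \<subseteq> carrier (TT n)"
    if "Poly_Mapping.keys F \<subseteq> carrier (TT n)" "Poly_Mapping.keys G \<subseteq> carrier (TT n)" for F G
    by (rule monoid_alg_keys_mult[OF monoid_TT that])
  have ks: "Poly_Mapping.keys (Poly_Mapping.single z c) \<subseteq> carrier (TT n)" if "z \<in> carrier (TT n)" for z and c :: complex
    using that by simp
  have Els: "?E (Poly_Mapping.single z c) v = c \<odot>\<^bsub>U\<^esub> b (tA (fst z) a) (tM (snd z) v)"
    if "z \<in> carrier (TT n)" "v \<in> carrier M" for z c v
    by (rule linext_single[OF U, of "\<lambda>z. b (tA (fst z) a) (tM (snd z) v)"]) (rule cl[OF that])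
  have kadd: "Poly_Mapping.keys (F + G) \<subseteq> carrier (TT n)"
    if "Poly_Mapping.keys F \<subseteq> carrier (TT n)" "Poly_Mapping.keys G \<subseteq> carrier (TT n)"
    for F G :: "(complex mat \<times> complex mat) \<Rightarrow>\<^sub>0 complex"
    using keys_add[of F G] that by blast
  \<comment> \<open>Multiplying by a basis element of the group algebra first moves the vector \<open>v\<close> and scales by
    the weight of \<open>a\<close>.\<close>
  have Es: "?E (Poly_Mapping.single z c \<otimes>\<^bsub>?R\<^esub> F) v = (c * wt \<alpha> (fst z)) \<odot>\<^bsub>U\<^esub> ?E F (tM (snd z) v)"
    if z: "z \<in> carrier (TT n)" and F: "Poly_Mapping.keys F \<subseteq> carrier (TT n)" and v: "v \<in> carrier M" for z c F v
    using F
  proof (induct rule: poly_mapping_keys_induct)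
    case zero
    then show ?case using U by (simp add: monoid_alg_bilinear cvs_smult_zero)
  next
    case (single y d F)
    note zz = TT_sign_diag[OF z] and yy = TT_sign_diag[OF single(1)]
    have zv: "tM (snd z) v \<in> carrier M" using torus_rep_closed[OF tM] zz v by blast
    have zy: "z \<otimes>\<^bsub>TT n\<^esub> y \<in> carrier (TT n)" by (rule monoid.m_closed[OF monoid_TT z single(1)])
    have "?E (Poly_Mapping.single (z \<otimes>\<^bsub>TT n\<^esub> y) (c * d)) v =
      (c * d) \<odot>\<^bsub>U\<^esub> b (tA (fst (z \<otimes>\<^bsub>TT n\<^esub> y)) a) (tM (snd (z \<otimes>\<^bsub>TT n\<^esub> y)) v)"
      by (rule Els[OF zy v])
    also have "tA (fst (z \<otimes>\<^bsub>TT n\<^esub> y)) a = wt \<alpha> (fst z) \<odot>\<^bsub>A\<^esub> tA (fst y) a"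
      using aD(3)[of "fst y"] aD(3)[of "fst z * fst y"] zz yy aD(1,2) torus_rep_cvs[OF tA]
      by (simp add: TT_simps sign_diag_mult wt_mult[of _ n] cvs_smult_smult)
    also have "tM (snd (z \<otimes>\<^bsub>TT n\<^esub> y)) v = tM (snd y) (tM (snd z) v)"
      using zz yy v torus_rep_comm[OF tM] by (simp add: TT_simps torus_rep_mult[OF tM])
    also have "b (wt \<alpha> (fst z) \<odot>\<^bsub>A\<^esub> tA (fst y) a) (tM (snd y) (tM (snd z) v)) =
        wt \<alpha> (fst z) \<odot>\<^bsub>U\<^esub> b (tA (fst y) a) (tM (snd y) (tM (snd z) v))"
      by (rule lin_smult[OF bilin_lin_l[OF b]])
        (use yy zv aD(2) torus_rep_closed[OF tM] torus_rep_closed[OF tA] in auto)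
    also have "(c * d) \<odot>\<^bsub>U\<^esub> (wt \<alpha> (fst z) \<odot>\<^bsub>U\<^esub> b (tA (fst y) a) (tM (snd y) (tM (snd z) v))) =
        (c * wt \<alpha> (fst z)) \<odot>\<^bsub>U\<^esub> ?E (Poly_Mapping.single y d) (tM (snd z) v)"
      unfolding Els[OF single(1) zv]
      using cl[OF single(1) zv] U by (simp add: cvs_smult_smult mult_ac)
    finally show ?case
      using single z v zv U
      by (simp add: monoid_alg_bilinear Eadd[OF ks[OF zy] km[OF ks[OF z] single(2)] v]
          Eadd[OF ks[OF single(1)] single(2) zv] cvs_smult_add Ecl ks)
  qed
  \<comment> \<open>Induction over the set of factors of \<open>\<F>\<close> that have been multiplied so far.\<close>
  have main: "(\<forall>v\<in>carrier M. ?E (finprod ?R (twist_factor n) S) v = b a (tM (?d S) v)) \<and>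
      Poly_Mapping.keys (finprod ?R (twist_factor n) S) \<subseteq> carrier (TT n)"
    if "finite S" "S \<subseteq> twist_pairs n" for S
    using that
  proof induct
    case empty
    have o: "(1\<^sub>m n, 1\<^sub>m n) \<in> carrier (TT n)" using one_T by (simp add: TT_simps)
    have "linext U (\<lambda>z. b (tA (fst z) a) (tM (snd z) v)) (Poly_Mapping.single (1\<^sub>m n, 1\<^sub>m n) 1) = b a v"
      if v: "v \<in> carrier M" for v
      using Els[OF o v, of 1] bilin_closed[OF b aD(2) v] U
      by (simp add: torus_rep_one[OF tA aD(2)] torus_rep_one[OF tM v] cvs_one_smult)
    moreover have "?d {} = 1\<^sub>m n" by (simp add: dmat_one)
    ultimately show ?case using o by (simp add: TT_simps T_group_simps torus_rep_one[OF tM])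
  next
    case (insert p S)
    obtain i j where p: "p = (i, j)" and i: "i < n" and j: "j < n" using insert by (auto simp: twist_pairs_def)
    let ?G = "finprod ?R (twist_factor n) S"
    have G: "Poly_Mapping.keys ?G \<subseteq> carrier (TT n)" and EG: "\<And>v. v \<in> carrier M \<Longrightarrow> ?E ?G v = b a (tM (?d S) v)"
      using insert by auto
    have fp: "finprod ?R (twist_factor n) (insert p S) = twist_factor n p \<otimes>\<^bsub>?R\<^esub> ?G"
    proof (rule R.finprod_insert)
      show "twist_factor n \<in> S \<rightarrow> carrier ?R" using keys_twist_factor insert(4) by (intro funcsetI) auto
      show "twist_factor n p \<in> carrier ?R" using keys_twist_factor insert(4) by simp
    qed (use insert in simp_all)
    have dS: "?d S \<in> sign_diag n" by (rule sign_diagI) (rule prod_flip)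
    note tj = sign_diag_t[of n j]
    have z: "(1\<^sub>m n, 1\<^sub>m n) \<in> carrier (TT n)" "(t_refl n i, 1\<^sub>m n) \<in> carrier (TT n)"
      "(1\<^sub>m n, t_refl n j) \<in> carrier (TT n)" "(t_refl n i, t_refl n j) \<in> carrier (TT n)"
      using one_T t_T i j by (simp_all add: TT_simps)
    have tf: "twist_factor n p = Poly_Mapping.single (1\<^sub>m n, 1\<^sub>m n) (1/2) + (Poly_Mapping.single (t_refl n i, 1\<^sub>m n) (1/2)
        + (Poly_Mapping.single (1\<^sub>m n, t_refl n j) (1/2) + Poly_Mapping.single (t_refl n i, t_refl n j) (- (1/2))))"
      by (simp add: twist_factor_def p single_uminus add.assoc)
    have "?E (twist_factor n p \<otimes>\<^bsub>?R\<^esub> ?G) v = b a (tM (?d (insert p S)) v)" if v: "v \<in> carrier M" for v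
    proof -
      have tv: "tM (t_refl n j) v \<in> carrier M" by (rule torus_rep_closed[OF tM tj v])
      define X0 where "X0 = b a (tM (?d S) v)"
      define X1 where "X1 = b a (tM (?d S) (tM (t_refl n j) v))"
      have X: "X0 \<in> carrier U" "X1 \<in> carrier U"
        unfolding X0_def X1_def
        by (intro bilin_closed[OF b aD(2)] torus_rep_closed[OF tM dS] v tv)+
      define w where "w = wt \<alpha> (t_refl n i)"
      have w: "w = (if i \<in> \<alpha> then - 1 else 1)" unfolding w_def by (rule wt_t[OF aD(1) i])
      note kz = km[OF ks G]
      have cl4: "?E (Poly_Mapping.single z c \<otimes>\<^bsub>?R\<^esub> ?G) v = (c * wt \<alpha> (fst z)) \<odot>\<^bsub>U\<^esub> b a (tM (?d S) (tM (snd z) v))"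
        if "z \<in> carrier (TT n)" for z c
        using Es[OF that G v, of c] EG[OF torus_rep_closed[OF tM _ v], of "snd z"] TT_sign_diag[OF that] by simp
      have "?E (twist_factor n p \<otimes>\<^bsub>?R\<^esub> ?G) v =
         (1/2) \<odot>\<^bsub>U\<^esub> X0 \<oplus>\<^bsub>U\<^esub> ((1/2 * w) \<odot>\<^bsub>U\<^esub> X0 \<oplus>\<^bsub>U\<^esub> ((1/2) \<odot>\<^bsub>U\<^esub> X1 \<oplus>\<^bsub>U\<^esub> (- (1/2) * w) \<odot>\<^bsub>U\<^esub> X1))"
        unfolding tf monoid_alg_l_distr
          Eadd[OF kz[OF z(1)] kadd[OF kz[OF z(2)] kadd[OF kz[OF z(3)] kz[OF z(4)]]] v]
          Eadd[OF kz[OF z(2)] kadd[OF kz[OF z(3)] kz[OF z(4)]] v] Eadd[OF kz[OF z(3)] kz[OF z(4)] v]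
          cl4[OF z(1)] cl4[OF z(2)] cl4[OF z(3)] cl4[OF z(4)]
        by (simp add: wt_one[OF aD(1)] torus_rep_one[OF tM v] X0_def X1_def w_def)
      also have "\<dots> = (if i \<in> \<alpha> then X1 else X0)"
      proof (cases "i \<in> \<alpha>")
        case True
        then have "w = - 1" using w by simp
        then have "(1/2) \<odot>\<^bsub>U\<^esub> X0 \<oplus>\<^bsub>U\<^esub> ((1/2 * w) \<odot>\<^bsub>U\<^esub> X0 \<oplus>\<^bsub>U\<^esub> ((1/2) \<odot>\<^bsub>U\<^esub> X1 \<oplus>\<^bsub>U\<^esub> (- (1/2) * w) \<odot>\<^bsub>U\<^esub> X1)) =
           ((1/2) + (- (1/2))) \<odot>\<^bsub>U\<^esub> X0 \<oplus>\<^bsub>U\<^esub> ((1/2) + (1/2)) \<odot>\<^bsub>U\<^esub> X1"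
          using X U by (simp only: cvs_add_smult cvs_assoc cvs_closed) simp
        then show ?thesis using True X U by (simp add: cvs_simps)
      next
        case False
        then have "w = 1" using w by simp
        then have "(1/2) \<odot>\<^bsub>U\<^esub> X0 \<oplus>\<^bsub>U\<^esub> ((1/2 * w) \<odot>\<^bsub>U\<^esub> X0 \<oplus>\<^bsub>U\<^esub> ((1/2) \<odot>\<^bsub>U\<^esub> X1 \<oplus>\<^bsub>U\<^esub> (- (1/2) * w) \<odot>\<^bsub>U\<^esub> X1)) =
           ((1/2) + (1/2)) \<odot>\<^bsub>U\<^esub> X0 \<oplus>\<^bsub>U\<^esub> ((1/2) + (- (1/2))) \<odot>\<^bsub>U\<^esub> X1"
          using X U by (simp only: cvs_add_smult cvs_assoc cvs_closed) simp
        then show ?thesis using False X U by (simp add: cvs_simps)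
      qed
      also have "\<dots> = b a (tM (?d (insert p S)) v)"
      proof (cases "i \<in> \<alpha>")
        case True
        have "?d (insert p S) = ?d S * t_refl n j"
          unfolding dmat_t dmat_mult by (rule dmat_cong) (use insert(1,2) True p in \<open>auto simp: flip_def\<close>)
        then show ?thesis using True torus_rep_mult[OF tM dS tj v] by (simp add: X1_def)
      next
        case False
        have "?d (insert p S) = ?d S"
          by (rule dmat_cong) (use insert(1,2) False p in \<open>auto simp: flip_def\<close>)
        then show ?thesis using False by (simp add: X0_def)
      qed
      finally show ?thesis .
    qed
    moreover have "Poly_Mapping.keys (twist_factor n p \<otimes>\<^bsub>?R\<^esub> ?G) \<subseteq> carrier (TT n)"
      by (rule km[OF keys_twist_factor G]) (use insert in auto)
    ultimately show ?case unfolding fp by blast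
  qed
  show "twisted n tA tM U b a v = b a (tM (twist_elt n \<alpha>) v)"
    unfolding twisted_def twist_finprod twist_elt_def
    using main[OF finite_twist_pairs order_refl] v by blast
qed

lemma keys_twist: "Poly_Mapping.keys (twist n) \<subseteq> carrier (TT n)"
proof -
  interpret comm_monoid "monoid_alg (TT n)" by (rule comm_monoid_monoid_alg[OF comm_monoid_T_T])
  have "twist n \<in> carrier (monoid_alg (TT n))"
    unfolding twist_finprod by (rule finprod_closed) (use keys_twist_factor in auto)
  then show ?thesis by simp
qed

lemma bilin_cong:
  assumes g: "bilin A M U g" and A: "cvs A" and M: "cvs M"
    and eq: "\<And>a v. a \<in> carrier A \<Longrightarrow> v \<in> carrier M \<Longrightarrow> g' a v = g a v"
  shows "bilin A M U g'"
  by (rule bilinI)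
    (simp_all add: eq cvs_closed A M bilin_closed[OF g] lin_add[OF bilin_lin_l[OF g]] lin_add[OF bilin_lin_r[OF g]]
      lin_smult[OF bilin_lin_l[OF g]] lin_smult[OF bilin_lin_r[OF g]])

lemma bilin_linext:
  assumes U: "cvs U" and A: "cvs A" and M: "cvs M" and F: "Poly_Mapping.keys F \<subseteq> S" and g: "\<And>z. z \<in> S \<Longrightarrow> bilin A M U (g z)"
  shows "bilin A M U (\<lambda>a v. linext U (\<lambda>z. g z a v) F)"
  using F
proof (induct rule: poly_mapping_keys_induct)
  case zero
  show ?case by (rule bilinI) (use U in \<open>simp_all add: cvs_simps\<close>)
next
  case (single z c F)
  note gz = g[OF single(1)]
  have cl: "g y a v \<in> carrier U" if "y \<in> S" "a \<in> carrier A" "v \<in> carrier M" for y a v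
    by (rule bilin_closed[OF g[OF that(1)] that(2,3)])
  have e: "linext U (\<lambda>y. g y a v) (Poly_Mapping.single z c + F) =
      c \<odot>\<^bsub>U\<^esub> g z a v \<oplus>\<^bsub>U\<^esub> linext U (\<lambda>y. g y a v) F" if av: "a \<in> carrier A" "v \<in> carrier M" for a v
  proof -
    have "linext U (\<lambda>y. g y a v) (Poly_Mapping.single z c) = c \<odot>\<^bsub>U\<^esub> g z a v"
      by (rule linext_single[OF U, of "\<lambda>y. g y a v"]) (rule cl[OF single(1) av])
    moreover have "linext U (\<lambda>y. g y a v) (Poly_Mapping.single z c + F) =
       linext U (\<lambda>y. g y a v) (Poly_Mapping.single z c) \<oplus>\<^bsub>U\<^esub> linext U (\<lambda>y. g y a v) F"
      by (rule linext_add[OF U]) (use single(1,2) cl av in \<open>auto split: if_splits\<close>)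
    ultimately show ?thesis by simp
  qed
  have G: "bilin A M U (\<lambda>a v. c \<odot>\<^bsub>U\<^esub> g z a v \<oplus>\<^bsub>U\<^esub> linext U (\<lambda>y. g y a v) F)"
    by (rule bilinI)
      (simp_all add: U cvs_simps cvs_ac bilin_closed[OF gz] bilin_closed[OF single(3)]
        lin_add[OF bilin_lin_l[OF gz]] lin_add[OF bilin_lin_r[OF gz]] lin_smult[OF bilin_lin_l[OF gz]]
        lin_smult[OF bilin_lin_r[OF gz]] lin_add[OF bilin_lin_l[OF single(3)]] lin_add[OF bilin_lin_r[OF single(3)]]
        lin_smult[OF bilin_lin_l[OF single(3)]] lin_smult[OF bilin_lin_r[OF single(3)]] mult.commute)
  show ?case by (rule bilin_cong[OF G A M e])
qed

lemma bilin_twisted: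
  assumes tA: "torus_rep n A tA" and tM: "torus_rep n M tM" and U: "cvs U" and b: "bilin A M U b"
  shows "bilin A M U (twisted n tA tM U b)"
proof -
  have "bilin A M U (\<lambda>a v. linext U (\<lambda>z. b (tA (fst z) a) (tM (snd z) v)) (twist n))"
    by (rule bilin_linext[OF U torus_rep_cvs[OF tA] torus_rep_cvs[OF tM] keys_twist], rule bilin_comp[OF b _ _ lin_ident])
      (use TT_sign_diag torus_rep_lin[OF tA] torus_rep_lin[OF tM] in auto)
  then show ?thesis by (simp only: twisted_def[abs_def])
qed

section \<open>Twisted modules\<close>

text \<open>
  An algebra \<open>A\<close> on which the torus acts by automorphisms and which is spanned by homogeneous elements,
  an algebra \<open>A'\<close> isomorphic by \<open>\<phi>\<close> to the twist of \<open>A\<close>, and subalgebras of both acting on the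
  same space \<open>V\<close>. The operator \<open>\<theta>\<close> with inverse \<open>\<theta>'\<close> is the freedom in comparing the two copies of
  \<open>V\<close> inside the two tensor products.
\<close>

locale twisted_tensor =
  L: tensor_product A V \<Gamma> + R: tensor_product A' V \<Gamma>'
  for A :: "(complex, 'a) module" and V :: "(complex, 'v) module" and \<Gamma> and A' :: "(complex, 'b) module" and \<Gamma>' +
  fixes n :: nat and tA :: "complex mat \<Rightarrow> 'a \<Rightarrow> 'a" and tV :: "complex mat \<Rightarrow> 'v \<Rightarrow> 'v"
    and \<phi> :: "'b \<Rightarrow> 'a" and \<theta> \<theta>' :: "'v \<Rightarrow> 'v"
  assumes tA: "torus_rep n A tA"
    and tA_mult: "\<And>h a b. h \<in> sign_diag n \<Longrightarrow> a \<in> carrier A \<Longrightarrow> b \<in> carrier A \<Longrightarrow> tA h (a \<otimes>\<^bsub>A\<^esub> b) = tA h a \<otimes>\<^bsub>A\<^esub> tA h b"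
    and tA_one: "\<And>h. h \<in> sign_diag n \<Longrightarrow> tA h \<one>\<^bsub>A\<^esub> = \<one>\<^bsub>A\<^esub>"
    and tV: "torus_rep n V tV"
    and t\<Gamma>: "\<And>h. h \<in> sign_diag n \<Longrightarrow> \<forall>(b, \<beta>)\<in>\<Gamma>. balanced A V (\<lambda>a v. L.tens (tA h a) (tV h v)) b \<beta>"
    and span: "carrier A \<subseteq> lspan A {a. \<exists>\<alpha>. weight_vec n A tA \<alpha> a}"
    and \<phi>: "\<phi> \<in> alg_iso A' (twisted_alg n A tA)"
    and \<theta>: "lin V V \<theta>" and \<theta>': "lin V V \<theta>'"
    and \<theta>\<theta>': "\<And>v. v \<in> carrier V \<Longrightarrow> \<theta> (\<theta>' v) = v" and \<theta>'\<theta>: "\<And>v. v \<in> carrier V \<Longrightarrow> \<theta>' (\<theta> v) = v"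
begin

abbreviation "act \<equiv> tensor_act A V L.\<Theta>"
abbreviation "act' \<equiv> tensor_act A' V R.\<Theta>"
abbreviation "tM h \<equiv> tensor_map A V L.\<Theta> (tA h) (tV h)"
abbreviation "tmult \<equiv> twisted n tA tA A (monoid.mult A)"
abbreviation "tact \<equiv> twisted n tA tM L.M act"
abbreviation "H \<equiv> {a. \<exists>\<alpha>. weight_vec n A tA \<alpha> a}"
definition "\<psi> = inv_into (carrier A') \<phi>"

lemmas A_cvs = calg_cvs[OF L.A]
lemmas V_cvs = L.V

lemma H_closed: "H \<subseteq> carrier A"
  by (auto simp: weight_vec_def)

lemma tens_tens: "h \<in> sign_diag n \<Longrightarrow> bilin A V L.M (\<lambda>a v. L.tens (tA h a) (tV h v))"
  by (rule bilin_comp[OF L.bilin_tens torus_rep_lin[OF tA] torus_rep_lin[OF tV] lin_ident])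

lemma tM: "h \<in> sign_diag n \<Longrightarrow> lin L.M L.M (tM h)"
  "h \<in> sign_diag n \<Longrightarrow> a \<in> carrier A \<Longrightarrow> v \<in> carrier V \<Longrightarrow> tM h (L.tens a v) = L.tens (tA h a) (tV h v)"
proof -
  assume h: "h \<in> sign_diag n"
  note t = L.tensor_map[OF torus_rep_closed[OF tA h] torus_rep_closed[OF tV h] tens_tens[OF h] t\<Gamma>[OF h]]
  show "lin L.M L.M (tM h)" by (rule t(1))
  show "a \<in> carrier A \<Longrightarrow> v \<in> carrier V \<Longrightarrow> tM h (L.tens a v) = L.tens (tA h a) (tV h v)" by (rule t(2))
qed

lemma torus_rep_tM: "torus_rep n L.M tM"
  unfolding torus_rep_def
proof (intro conjI ballI)
  show "cvs L.M" by (rule L.cvs_M)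
  show "lin L.M L.M (tM h)" if "h \<in> sign_diag n" for h by (rule tM(1)[OF that])
  show "tM (h * k) m = tM h (tM k m)" if h: "h \<in> sign_diag n" and k: "k \<in> sign_diag n" and m: "m \<in> carrier L.M" for h k m
    by (rule L.lin_eq_on_tens[OF L.cvs_M tM(1)[OF sign_diag_mult[OF h k]] lin_comp[OF tM(1)[OF k] tM(1)[OF h]]
          order_refl L.carrier_A_lspan _ m])
      (simp add: tM(2) h k sign_diag_mult torus_rep_closed[OF tA] torus_rep_closed[OF tV]
        torus_rep_mult[OF tA] torus_rep_mult[OF tV])
  show "tM (1\<^sub>m n) m = m" if m: "m \<in> carrier L.M" for m
    by (rule L.lin_eq_on_tens[OF L.cvs_M tM(1)[OF sign_diag_one] lin_ident order_refl L.carrier_A_lspan _ m])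
      (simp add: tM(2) sign_diag_one torus_rep_one[OF tA] torus_rep_one[OF tV])
qed

lemma tM_act:
  assumes h: "h \<in> sign_diag n" and a: "a \<in> carrier A" and m: "m \<in> carrier L.M"
  shows "tM h (act a m) = act (tA h a) (tM h m)"
  by (rule L.lin_eq_on_tens[OF L.cvs_M lin_comp[OF L.tensor_act(1)[OF a] tM(1)[OF h]]
        lin_comp[OF tM(1)[OF h] L.tensor_act(1)[OF torus_rep_closed[OF tA h a]]] order_refl L.carrier_A_lspan _ m])
    (simp add: tM(2) h a L.tensor_act(2) calg_mult[OF L.A] tA_mult torus_rep_closed[OF tA] torus_rep_closed[OF tV])

lemma weight_vec_mult: "weight_vec n A tA \<alpha> a \<Longrightarrow> weight_vec n A tA \<beta> b \<Longrightarrow> weight_vec n A tA (symdiff \<alpha> \<beta>) (a \<otimes>\<^bsub>A\<^esub> b)"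
  by (rule weight_vec_product[OF L.A]) (rule tA_mult)

lemma weight_vec_one: "weight_vec n A tA {} \<one>\<^bsub>A\<^esub>"
  by (rule weight_vec_unit[OF L.A]) (rule tA_one)

lemma weight_vec_smult: "weight_vec n A tA \<alpha> a \<Longrightarrow> weight_vec n A tA \<alpha> (c \<odot>\<^bsub>A\<^esub> a)"
  by (simp add: weight_vec_def cvs_smult[OF A_cvs] lin_smult[OF torus_rep_lin[OF tA]] cvs_smult_smult[OF A_cvs] mult.commute)

lemma weight_vec_tA: "weight_vec n A tA \<alpha> a \<Longrightarrow> h \<in> sign_diag n \<Longrightarrow> weight_vec n A tA \<alpha> (tA h a)"
  by (simp add: weight_vecD(3) weight_vec_smult)

lemma bilin_mult: "bilin A A A (monoid.mult A)"
  by (rule bilinI) (simp_all add: L.A calg_closed calg_l_distr calg_r_distr calg_smult_l calg_smult_r)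

lemma \<phi>_props: "lin A' A \<phi>" "bij_betw \<phi> (carrier A') (carrier A)" "\<phi> \<one>\<^bsub>A'\<^esub> = \<one>\<^bsub>A\<^esub>"
  "a \<in> carrier A' \<Longrightarrow> b \<in> carrier A' \<Longrightarrow> \<phi> (a \<otimes>\<^bsub>A'\<^esub> b) = tmult (\<phi> a) (\<phi> b)"
  using \<phi> unfolding alg_iso_def ring_iso_def Ring.ring_hom_def lin_def
  by (auto simp: twisted_alg_simps Pi_iff)

lemma \<psi>_closed: "a \<in> carrier A \<Longrightarrow> \<psi> a \<in> carrier A'" and \<phi>\<psi>: "a \<in> carrier A \<Longrightarrow> \<phi> (\<psi> a) = a"
  and \<psi>\<phi>: "b \<in> carrier A' \<Longrightarrow> \<psi> (\<phi> b) = b"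
  using \<phi>_props(2) unfolding \<psi>_def bij_betw_def
  by (auto simp: inv_into_into f_inv_into_f)

lemma \<psi>_lin: "lin A A' \<psi>"
proof (rule linI)
  have inj: "a = b" if "\<phi> a = \<phi> b" "a \<in> carrier A'" "b \<in> carrier A'" for a b
    using \<phi>_props(2) that by (auto simp: bij_betw_def inj_on_def)
  show "\<psi> (a \<oplus>\<^bsub>A\<^esub> b) = \<psi> a \<oplus>\<^bsub>A'\<^esub> \<psi> b" if "a \<in> carrier A" "b \<in> carrier A" for a b
    by (rule inj)
      (simp_all add: that \<psi>_closed \<phi>\<psi> lin_add[OF \<phi>_props(1)] calg_closed[OF L.A] calg_closed[OF R.A])
  show "\<psi> (c \<odot>\<^bsub>A\<^esub> a) = c \<odot>\<^bsub>A'\<^esub> \<psi> a" if "a \<in> carrier A" for c a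
    by (rule inj)
      (simp_all add: that \<psi>_closed \<phi>\<psi> lin_smult[OF \<phi>_props(1)] calg_closed[OF L.A] calg_closed[OF R.A])
qed (rule \<psi>_closed)

lemma tmult_weight_vec:
  "weight_vec n A tA \<alpha> a \<Longrightarrow> b \<in> carrier A \<Longrightarrow> tmult a b = a \<otimes>\<^bsub>A\<^esub> tA (twist_elt n \<alpha>) b"
  by (rule twisted_weight_vec[OF tA tA A_cvs bilin_mult])

text \<open>
  Decompose \<open>a\<close> into homogeneous elements; the torus fixes \<open>b\<close>.
\<close>

lemma tmult_invariant:
  assumes a: "a \<in> carrier A" and b: "weight_vec n A tA {} b"
  shows "tmult a b = a \<otimes>\<^bsub>A\<^esub> b"
proof (rule lin_eq_on_lspan[OF A_cvs A_cvs bilin_lin_l[OF bilin_twisted[OF tA tA A_cvs bilin_mult] weight_vecD(2)[OF b]]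
      L.lin_mult_r[OF weight_vecD(2)[OF b]] H_closed _ subsetD[OF span a]])
  fix a assume "a \<in> H"
  then obtain \<alpha> where a: "weight_vec n A tA \<alpha> a" by blast
  have "tA (twist_elt n \<alpha>) b = b"
    using weight_vecD(3)[OF b twist_elt_sign_diag] weight_vecD(2)[OF b] by (simp add: wt_def cvs_one_smult[OF A_cvs])
  then show "tmult a b = a \<otimes>\<^bsub>A\<^esub> b" by (simp add: tmult_weight_vec[OF a weight_vecD(2)[OF b]])
qed

lemma tmult_closed: "a \<in> carrier A \<Longrightarrow> b \<in> carrier A \<Longrightarrow> tmult a b \<in> carrier A"
  by (rule bilin_closed[OF bilin_twisted[OF tA tA A_cvs bilin_mult]])

lemma \<psi>_tmult: "a \<in> carrier A \<Longrightarrow> b \<in> carrier A \<Longrightarrow> \<psi> (tmult a b) = \<psi> a \<otimes>\<^bsub>A'\<^esub> \<psi> b"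
  using \<phi>_props(4)[of "\<psi> a" "\<psi> b"] \<psi>\<phi>[of "\<psi> a \<otimes>\<^bsub>A'\<^esub> \<psi> b"]
  by (simp add: \<psi>_closed \<phi>\<psi> calg_mult[OF R.A])

lemma tact_weight_vec:
  "weight_vec n A tA \<alpha> a \<Longrightarrow> m \<in> carrier L.M \<Longrightarrow> tact a m = act a (tM (twist_elt n \<alpha>) m)"
  by (rule twisted_weight_vec[OF tA torus_rep_tM L.cvs_M L.bilin_tensor_act])

lemma bilin_tact: "bilin A L.M L.M tact"
  by (rule bilin_twisted[OF tA torus_rep_tM L.cvs_M L.bilin_tensor_act])

text \<open>
  For homogeneous \<open>a\<close> and \<open>b\<close> of weights \<open>\<alpha>\<close> and \<open>\<beta>\<close> both sides equal
  \<open>a (t\<^sub>\<alpha> \<rhd> b) (t\<^sub>\<alpha> t\<^sub>\<beta> m)\<close>, and homogeneous elements span.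
\<close>

lemma tact_tmult:
  assumes a: "a \<in> carrier A" and b: "b \<in> carrier A" and m: "m \<in> carrier L.M"
  shows "tact (tmult a b) m = tact a (tact b m)"
proof -
  note te = twist_elt_sign_diag
  note bt = bilin_twisted[OF tA tA A_cvs bilin_mult]
  have hom: "tact (tmult a b) m = tact a (tact b m)" if a: "weight_vec n A tA \<alpha> a" and b: "weight_vec n A tA \<beta> b" for a b \<alpha> \<beta>
  proof -
    have tb: "weight_vec n A tA \<beta> (tA (twist_elt n \<alpha>) b)" by (rule weight_vec_tA[OF b te])
    have tm: "tM (twist_elt n \<beta>) m \<in> carrier L.M" by (rule torus_rep_closed[OF torus_rep_tM te m])
    have "tact (tmult a b) m = act (a \<otimes>\<^bsub>A\<^esub> tA (twist_elt n \<alpha>) b) (tM (twist_elt n \<alpha> * twist_elt n \<beta>) m)"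
      unfolding tmult_weight_vec[OF a weight_vecD(2)[OF b]] tact_weight_vec[OF weight_vec_mult[OF a tb] m]
        twist_elt_symdiff ..
    also have "\<dots> = act a (act (tA (twist_elt n \<alpha>) b) (tM (twist_elt n \<alpha>) (tM (twist_elt n \<beta>) m)))"
      unfolding torus_rep_mult[OF torus_rep_tM te te m]
      by (rule L.tensor_act_mult[OF weight_vecD(2)[OF a] weight_vecD(2)[OF tb] torus_rep_closed[OF torus_rep_tM te tm]])
    also have "\<dots> = act a (tM (twist_elt n \<alpha>) (act b (tM (twist_elt n \<beta>) m)))"
      unfolding tM_act[OF te weight_vecD(2)[OF b] tm] ..
    also have "\<dots> = tact a (tact b m)"
      unfolding tact_weight_vec[OF b m]
      by (rule tact_weight_vec[OF a, symmetric]) (rule lin_closed[OF L.tensor_act(1)[OF weight_vecD(2)[OF b]] tm])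
    finally show ?thesis .
  qed
  have 1: "tact (tmult a b) m = tact a (tact b m)" if a: "a \<in> H" for a
  proof -
    have ac: "a \<in> carrier A" using a H_closed by blast
    show ?thesis
      by (rule lin_eq_on_lspan[OF A_cvs L.cvs_M
            lin_comp[OF bilin_lin_r[OF bt ac] bilin_lin_l[OF bilin_tact m]]
            lin_comp[OF bilin_lin_l[OF bilin_tact m] bilin_lin_r[OF bilin_tact ac]] H_closed _ subsetD[OF span b]])
        (use hom a in blast)
  qed
  have tbm: "tact b m \<in> carrier L.M" by (rule bilin_closed[OF bilin_tact b m])
  show ?thesis
    by (rule lin_eq_on_lspan[OF A_cvs L.cvs_M
          lin_comp[OF bilin_lin_l[OF bt b] bilin_lin_l[OF bilin_tact m]] bilin_lin_l[OF bilin_tact tbm] H_closed 1 subsetD[OF span a]])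
qed

lemma tact_one: "m \<in> carrier L.M \<Longrightarrow> tact \<one>\<^bsub>A\<^esub> m = m"
  unfolding tact_weight_vec[OF weight_vec_one] twist_elt_empty torus_rep_one[OF torus_rep_tM]
  by (rule L.tensor_act_one)

lemma alg_module_tact: "alg_module A' L.M (\<lambda>a. tact (\<phi> a))"
  unfolding alg_module_iff
  using bilin_comp[OF bilin_tact \<phi>_props(1) lin_ident lin_ident] lin_closed[OF \<phi>_props(1)]
  by (simp add: L.cvs_M \<phi>_props(3,4) tact_tmult tact_one)

abbreviation "\<Xi>\<^sub>0 \<equiv> twisted n tA tV R.M (\<lambda>a v. R.tens (\<psi> a) (\<theta>' v))"
definition "\<Psi>\<^sub>0 a v = tact (\<phi> a) (L.tens \<one>\<^bsub>A\<^esub> (\<theta> v))"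

text \<open>
  The map \<open>\<Xi>\<^sub>0\<close> sends \<open>(a, v)\<close> with \<open>a\<close> of weight \<open>\<alpha>\<close> to \<open>\<psi> a \<otimes> \<theta>' t\<^sub>\<alpha> v\<close>. Writing it as a
  twisted bilinear map makes it bilinear on all of \<open>A\<close> at once.
\<close>

lemma bilin_\<Xi>: "bilin A V R.M (\<lambda>a v. R.tens (\<psi> a) (\<theta>' v))"
  by (rule bilin_comp[OF R.bilin_tens \<psi>_lin \<theta>' lin_ident])

lemma bilin_\<Xi>\<^sub>0: "bilin A V R.M \<Xi>\<^sub>0"
  by (rule bilin_twisted[OF tA tV R.cvs_M bilin_\<Xi>])

lemma \<Xi>\<^sub>0_weight_vec: "weight_vec n A tA \<alpha> a \<Longrightarrow> v \<in> carrier V \<Longrightarrow>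
    \<Xi>\<^sub>0 a v = R.tens (\<psi> a) (\<theta>' (tV (twist_elt n \<alpha>) v))"
  by (rule twisted_weight_vec[OF tA tV R.cvs_M bilin_\<Xi>])

lemma bilin_\<Psi>\<^sub>0: "bilin A' V L.M \<Psi>\<^sub>0"
  unfolding \<Psi>\<^sub>0_def[abs_def]
  by (rule bilin_comp[OF bilin_tact \<phi>_props(1) lin_comp[OF \<theta> bilin_lin_r[OF L.bilin_tens calg_one[OF L.A]]] lin_ident])

lemma \<Psi>\<^sub>0_weight_vec:
  assumes a: "weight_vec n A tA \<alpha> a" and v: "v \<in> carrier V"
  shows "\<Psi>\<^sub>0 (\<psi> a) v = L.tens a (tV (twist_elt n \<alpha>) (\<theta> v))"
  unfolding \<Psi>\<^sub>0_def \<phi>\<psi>[OF weight_vecD(2)[OF a]]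
    tact_weight_vec[OF a L.tens_closed[OF calg_one[OF L.A] lin_closed[OF \<theta> v]]]
    tM(2)[OF twist_elt_sign_diag calg_one[OF L.A] lin_closed[OF \<theta> v]] tA_one[OF twist_elt_sign_diag]
    L.tensor_act(2)[OF weight_vecD(2)[OF a] calg_one[OF L.A] torus_rep_closed[OF tV twist_elt_sign_diag lin_closed[OF \<theta> v]]]
    calg_r_one[OF L.A weight_vecD(2)[OF a]] ..

text \<open>
  Take \<open>a\<close> of weight \<open>\<alpha>\<close> and let \<open>\<omega> = wt \<gamma> t\<^sub>\<alpha>\<close>. Then \<open>\<psi> (a b) = \<omega> \<psi> a \<psi> b\<close>, so that
  \<open>\<Xi>\<^sub>0 (a b) v = \<omega> \<psi> a \<psi> b \<otimes> \<theta>' t\<^sub>\<gamma> t\<^sub>\<alpha> v\<close>. Moving \<open>\<psi> b\<close> across the tensor sign turns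
  it into \<open>\<beta>'\<close>, which the relation \<open>rel\<close> converts to \<open>\<omega> \<psi> a \<otimes> \<theta>' \<beta> t\<^sub>\<alpha> v\<close>. Since \<open>\<beta>\<close> is itself
  homogeneous of weight \<open>\<gamma>\<close>, exchanging it with \<open>t\<^sub>\<alpha>\<close> absorbs \<open>\<omega>\<close>, and the result is \<open>\<Xi>\<^sub>0 a (\<beta> v)\<close>.
  For \<open>\<Psi>\<^sub>0\<close> the same relation is read backwards.
\<close>

lemma homogeneous_balanced:
  assumes b: "weight_vec n A tA \<gamma> b"
    and \<beta>: "\<And>v. v \<in> carrier V \<Longrightarrow> \<beta> v \<in> carrier V"
    and bal: "balanced A V L.tens b \<beta>" and bal': "balanced A' V R.tens (\<psi> b) \<beta>'"
    and rel: "\<And>v. v \<in> carrier V \<Longrightarrow> \<beta>' (\<theta>' (tV (twist_elt n \<gamma>) v)) = \<theta>' (\<beta> v)"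
    and equiv: "\<And>h v. h \<in> sign_diag n \<Longrightarrow> v \<in> carrier V \<Longrightarrow> tV h (\<beta> v) = wt \<gamma> h \<odot>\<^bsub>V\<^esub> \<beta> (tV h v)"
  shows "balanced A V \<Xi>\<^sub>0 b \<beta>" and "balanced A' V \<Psi>\<^sub>0 (\<psi> b) \<beta>'"
proof -
  note te = twist_elt_sign_diag and bc = weight_vecD(2)[OF b]
  note tVc = torus_rep_closed[OF tV te] and \<theta>'c = lin_closed[OF \<theta>'] and \<theta>c = lin_closed[OF \<theta>]
  show "balanced A V \<Xi>\<^sub>0 b \<beta>" unfolding balanced_def
  proof (intro ballI)
    fix a v assume a: "a \<in> carrier A" and v: "v \<in> carrier V"
    show "\<Xi>\<^sub>0 (a \<otimes>\<^bsub>A\<^esub> b) v = \<Xi>\<^sub>0 a (\<beta> v)"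
    proof (rule lin_eq_on_lspan[OF A_cvs R.cvs_M lin_comp[OF L.lin_mult_r[OF bc] bilin_lin_l[OF bilin_\<Xi>\<^sub>0 v]]
          bilin_lin_l[OF bilin_\<Xi>\<^sub>0 \<beta>[OF v]] H_closed _ subsetD[OF span a]])
      fix a assume "a \<in> H"
      then obtain \<alpha> where a: "weight_vec n A tA \<alpha> a" by blast
      note ac = weight_vecD(2)[OF a]
      let ?w = "wt \<gamma> (twist_elt n \<alpha>)"
      have w2: "?w * ?w = 1" by (rule wt_sq[OF weight_vecD(1)[OF b] te])
      have tbv: "tV (twist_elt n \<alpha>) v \<in> carrier V" by (rule tVc[OF v])
      have "tmult a b = ?w \<odot>\<^bsub>A\<^esub> (a \<otimes>\<^bsub>A\<^esub> b)"
        unfolding tmult_weight_vec[OF a bc] weight_vecD(3)[OF b te] by (rule calg_smult_r[OF L.A ac bc])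
      then have "?w \<odot>\<^bsub>A\<^esub> tmult a b = a \<otimes>\<^bsub>A\<^esub> b"
        using w2 calg_mult[OF L.A ac bc] A_cvs by (simp add: cvs_smult_smult cvs_one_smult)
      then have \<psi>ab: "\<psi> (a \<otimes>\<^bsub>A\<^esub> b) = ?w \<odot>\<^bsub>A'\<^esub> (\<psi> a \<otimes>\<^bsub>A'\<^esub> \<psi> b)"
        using lin_smult[OF \<psi>_lin tmult_closed[OF ac bc], of ?w] \<psi>_tmult[OF ac bc] by simp
      have "\<Xi>\<^sub>0 (a \<otimes>\<^bsub>A\<^esub> b) v = R.tens (?w \<odot>\<^bsub>A'\<^esub> (\<psi> a \<otimes>\<^bsub>A'\<^esub> \<psi> b)) (\<theta>' (tV (twist_elt n \<gamma>) (tV (twist_elt n \<alpha>) v)))"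
        unfolding \<Xi>\<^sub>0_weight_vec[OF weight_vec_mult[OF a b] v] \<psi>ab twist_elt_symdiff
          torus_rep_mult[OF tV te te v] torus_rep_comm[OF tV te te v] ..
      also have "\<dots> = ?w \<odot>\<^bsub>R.M\<^esub> R.tens (\<psi> a \<otimes>\<^bsub>A'\<^esub> \<psi> b) (\<theta>' (tV (twist_elt n \<gamma>) (tV (twist_elt n \<alpha>) v)))"
        by (rule lin_smult[OF bilin_lin_l[OF R.bilin_tens]])
          (simp_all add: \<theta>'c tVc tbv calg_mult[OF R.A] \<psi>_closed ac bc)
      also have "\<dots> = ?w \<odot>\<^bsub>R.M\<^esub> R.tens (\<psi> a) (\<theta>' (\<beta> (tV (twist_elt n \<alpha>) v)))"
        using bal' \<psi>_closed[OF ac] \<theta>'c[OF tVc[OF tbv]] unfolding balanced_def by (simp add: rel[OF tbv])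
      also have "\<dots> = R.tens (\<psi> a) (\<theta>' (?w \<odot>\<^bsub>V\<^esub> \<beta> (tV (twist_elt n \<alpha>) v)))"
        using lin_smult[OF bilin_lin_r[OF bilin_\<Xi> ac] \<beta>[OF tbv], of ?w] by simp
      also have "\<dots> = \<Xi>\<^sub>0 a (\<beta> v)"
        unfolding equiv[OF te v, symmetric] \<Xi>\<^sub>0_weight_vec[OF a \<beta>[OF v]] ..
      finally show "\<Xi>\<^sub>0 (a \<otimes>\<^bsub>A\<^esub> b) v = \<Xi>\<^sub>0 a (\<beta> v)" .
    qed
  qed
  show "balanced A' V \<Psi>\<^sub>0 (\<psi> b) \<beta>'" unfolding balanced_def
  proof (intro ballI)
    fix a' v assume a': "a' \<in> carrier A'" and v: "v \<in> carrier V"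
    let ?t = "twist_elt n \<gamma>"
    have ttv: "tV ?t (\<theta> v) \<in> carrier V" by (rule tVc[OF \<theta>c[OF v]])
    have "\<theta>' (tV ?t (tV ?t (\<theta> v))) = v"
      using torus_rep_invol[OF tV te \<theta>c[OF v]] \<theta>'\<theta>[OF v] by simp
    then have \<beta>'v: "\<beta>' v = \<theta>' (\<beta> (tV ?t (\<theta> v)))" using rel[OF ttv] by simp
    have o: "L.tens \<one>\<^bsub>A\<^esub> (\<theta> v) \<in> carrier L.M" by (rule L.tens_closed[OF calg_one[OF L.A] \<theta>c[OF v]])
    have "\<Psi>\<^sub>0 (a' \<otimes>\<^bsub>A'\<^esub> \<psi> b) v = tact (\<phi> a') (tact b (L.tens \<one>\<^bsub>A\<^esub> (\<theta> v)))"
      unfolding \<Psi>\<^sub>0_def \<phi>_props(4)[OF a' \<psi>_closed[OF bc]] \<phi>\<psi>[OF bc]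
      by (rule tact_tmult[OF lin_closed[OF \<phi>_props(1) a'] bc o])
    also have "tact b (L.tens \<one>\<^bsub>A\<^esub> (\<theta> v)) = L.tens b (tV ?t (\<theta> v))"
      using \<Psi>\<^sub>0_weight_vec[OF b v] unfolding \<Psi>\<^sub>0_def \<phi>\<psi>[OF bc] .
    also have "\<dots> = L.tens \<one>\<^bsub>A\<^esub> (\<beta> (tV ?t (\<theta> v)))"
      using bal calg_one[OF L.A] ttv calg_l_one[OF L.A bc] unfolding balanced_def by metis
    also have "\<beta> (tV ?t (\<theta> v)) = \<theta> (\<beta>' v)" unfolding \<beta>'v \<theta>\<theta>'[OF \<beta>[OF ttv]] ..
    finally show "\<Psi>\<^sub>0 (a' \<otimes>\<^bsub>A'\<^esub> \<psi> b) v = \<Psi>\<^sub>0 a' (\<beta>' v)" unfolding \<Psi>\<^sub>0_def .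
  qed
qed

text \<open>
  On homogeneous \<open>a\<close> the two maps are \<open>a \<otimes> v \<mapsto> \<psi> a \<otimes> \<theta>' t\<^sub>\<alpha> v\<close> and
  \<open>\<psi> a \<otimes> v \<mapsto> a \<otimes> t\<^sub>\<alpha> \<theta> v\<close>. They are inverse to each other as \<open>t\<^sub>\<alpha>\<close> is an involution.
  Equivariance on homogeneous elements comes down to \<open>t\<^sub>\<alpha> t\<^sub>\<beta> t\<^sub>\<alpha> = t\<^sub>\<beta>\<close>.
\<close>

theorem twisted_tensor_isomorphic:
  assumes \<Xi>: "\<forall>(b, \<beta>)\<in>\<Gamma>. balanced A V \<Xi>\<^sub>0 b \<beta>" and \<Psi>: "\<forall>(b, \<beta>)\<in>\<Gamma>'. balanced A' V \<Psi>\<^sub>0 b \<beta>"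
  shows "alg_module_isomorphic A' L.M (\<lambda>a. tact (\<phi> a)) R.M act'"
proof -
  let ?f = "L.lift R.M \<Xi>\<^sub>0" and ?g = "R.lift L.M \<Psi>\<^sub>0"
  note f = L.lift[OF R.cvs_M bilin_\<Xi>\<^sub>0 \<Xi>] and g = R.lift[OF L.cvs_M bilin_\<Psi>\<^sub>0 \<Psi>]
  note te = twist_elt_sign_diag
  note tVc = torus_rep_closed[OF tV te] and \<theta>'c = lin_closed[OF \<theta>'] and \<theta>c = lin_closed[OF \<theta>]
  have ft: "?f (L.tens a v) = R.tens (\<psi> a) (\<theta>' (tV (twist_elt n \<alpha>) v))"
    if "weight_vec n A tA \<alpha> a" "v \<in> carrier V" for \<alpha> a v
    using f(2)[OF weight_vecD(2)[OF that(1)] that(2)] \<Xi>\<^sub>0_weight_vec[OF that] by simp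
  have gt: "?g (R.tens (\<psi> a) v) = L.tens a (tV (twist_elt n \<alpha>) (\<theta> v))"
    if "weight_vec n A tA \<alpha> a" "v \<in> carrier V" for \<alpha> a v
    using g(2)[OF \<psi>_closed[OF weight_vecD(2)[OF that(1)]] that(2)] \<Psi>\<^sub>0_weight_vec[OF that] by simp
  have \<psi>H: "\<psi> ` H \<subseteq> carrier A'" "carrier A' \<subseteq> lspan A' (\<psi> ` H)"
  proof -
    show "\<psi> ` H \<subseteq> carrier A'" using \<psi>_closed H_closed by blast
    show "carrier A' \<subseteq> lspan A' (\<psi> ` H)"
    proof
      fix a' assume a': "a' \<in> carrier A'"
      have "\<phi> a' \<in> lspan A H" using span lin_closed[OF \<phi>_props(1) a'] by blast
      then have "\<psi> (\<phi> a') \<in> lspan A' (\<psi> ` H)" by (rule lin_lspan[OF A_cvs calg_cvs[OF R.A] \<psi>_lin H_closed])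
      then show "a' \<in> lspan A' (\<psi> ` H)" using \<psi>\<phi>[OF a'] by simp
    qed
  qed
  have gf: "?g (?f m) = m" if m: "m \<in> carrier L.M" for m
  proof (rule L.lin_eq_on_tens[OF L.cvs_M lin_comp[OF f(1) g(1)] lin_ident H_closed span _ m])
    fix a v assume "a \<in> H" and v: "v \<in> carrier V"
    then obtain \<alpha> where a: "weight_vec n A tA \<alpha> a" by blast
    show "?g (?f (L.tens a v)) = L.tens a v"
      unfolding ft[OF a v] gt[OF a \<theta>'c[OF tVc[OF v]]] \<theta>\<theta>'[OF tVc[OF v]] torus_rep_invol[OF tV te v] ..
  qed
  have fg: "?f (?g m) = m" if m: "m \<in> carrier R.M" for m
  proof (rule R.lin_eq_on_tens[OF R.cvs_M lin_comp[OF g(1) f(1)] lin_ident \<psi>H _ m])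
    fix a' v assume "a' \<in> \<psi> ` H" and v: "v \<in> carrier V"
    then obtain a \<alpha> where a: "weight_vec n A tA \<alpha> a" and a': "a' = \<psi> a" by blast
    show "?f (?g (R.tens a' v)) = R.tens a' v"
      unfolding a' gt[OF a v] ft[OF a tVc[OF \<theta>c[OF v]]] torus_rep_invol[OF tV te \<theta>c[OF v]] \<theta>'\<theta>[OF v] ..
  qed
  have bij: "bij_betw ?f (carrier L.M) (carrier R.M)"
    by (rule bij_betw_byWitness[of _ ?g]) (use gf fg lin_closed[OF f(1)] lin_closed[OF g(1)] in auto)
  have equivariant: "?f (tact a m) = act' (\<psi> a) (?f m)" if a: "a \<in> carrier A" and m: "m \<in> carrier L.M" for a m
  proof (rule lin_eq_on_lspan[OF A_cvs R.cvs_M lin_comp[OF bilin_lin_l[OF bilin_tact m] f(1)]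
        lin_comp[OF \<psi>_lin bilin_lin_l[OF R.bilin_tensor_act lin_closed[OF f(1) m]]] H_closed _ subsetD[OF span a]])
    fix a assume "a \<in> H"
    then obtain \<alpha> where a: "weight_vec n A tA \<alpha> a" by blast
    note ac = weight_vecD(2)[OF a]
    show "?f (tact a m) = act' (\<psi> a) (?f m)"
    proof (rule L.lin_eq_on_tens[OF R.cvs_M lin_comp[OF bilin_lin_r[OF bilin_tact ac] f(1)]
          lin_comp[OF f(1) R.tensor_act(1)[OF \<psi>_closed[OF ac]]] H_closed span _ m])
      fix b v assume "b \<in> H" and v: "v \<in> carrier V"
      then obtain \<beta> where b: "weight_vec n A tA \<beta> b" by blast
      note bc = weight_vecD(2)[OF b]
      let ?s = "twist_elt n \<alpha>" and ?t = "twist_elt n \<beta>"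
      have tb: "weight_vec n A tA \<beta> (tA ?s b)" by (rule weight_vec_tA[OF b te])
      have "tact a (L.tens b v) = L.tens (a \<otimes>\<^bsub>A\<^esub> tA ?s b) (tV ?s v)"
        unfolding tact_weight_vec[OF a L.tens_closed[OF bc v]] tM(2)[OF te bc v]
        by (rule L.tensor_act(2)[OF ac weight_vecD(2)[OF tb] tVc[OF v]])
      then have "?f (tact a (L.tens b v)) = R.tens (\<psi> (a \<otimes>\<^bsub>A\<^esub> tA ?s b)) (\<theta>' (tV (?s * ?t) (tV ?s v)))"
        using ft[OF weight_vec_mult[OF a tb] tVc[OF v]] by (simp add: twist_elt_symdiff)
      also have "tV (?s * ?t) (tV ?s v) = tV ?t v"
        unfolding torus_rep_mult[OF tV te te tVc[OF v]] torus_rep_comm[OF tV te[of n \<beta>] te[of n \<alpha>] v]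
          torus_rep_invol[OF tV te tVc[OF v]] ..
      also have "\<psi> (a \<otimes>\<^bsub>A\<^esub> tA ?s b) = \<psi> a \<otimes>\<^bsub>A'\<^esub> \<psi> b"
        unfolding tmult_weight_vec[OF a bc, symmetric] by (rule \<psi>_tmult[OF ac bc])
      also have "R.tens (\<psi> a \<otimes>\<^bsub>A'\<^esub> \<psi> b) (\<theta>' (tV ?t v)) = act' (\<psi> a) (?f (L.tens b v))"
        unfolding ft[OF b v]
        by (rule R.tensor_act(2)[OF \<psi>_closed[OF ac] \<psi>_closed[OF bc] \<theta>'c[OF tVc[OF v]], symmetric])
      finally show "?f (tact a (L.tens b v)) = act' (\<psi> a) (?f (L.tens b v))" .
    qed
  qed
  show ?thesis
    unfolding alg_module_isomorphic_def linear_map_iff_lin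
  proof (intro conjI exI[of _ ?f] ballI)
    show "?f (tact (\<phi> a) m) = act' a (?f m)" if "a \<in> carrier A'" "m \<in> carrier L.M" for a m
      using equivariant[OF lin_closed[OF \<phi>_props(1) that(1)] that(2)] \<psi>\<phi>[OF that(1)] by simp
  qed (fact alg_module_tact R.alg_module_tensor_act L.cvs_M R.cvs_M f(1) bij)+
qed

end

section \<open>Reflections\<close>

lemma s_refl_mono: "i \<noteq> j \<Longrightarrow> s_refl n i j \<epsilon> =
    mono_mat n (Transposition.transpose i j) (\<lambda>b. if b = i then inverse \<epsilon> else if b = j then \<epsilon> else 1)"
  unfolding s_refl_def mono_mat_def by (rule cong_mat) (auto simp: Transposition.transpose_def)

lemma sigma_refl_mono: "i \<noteq> j \<Longrightarrow> sigma_refl n i j \<epsilon> =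
    mono_mat n (Transposition.transpose i j) (\<lambda>b. if b = i then inverse \<epsilon> else if b = j then - \<epsilon> else 1)"
  unfolding sigma_refl_def mono_mat_def by (rule cong_mat) (auto simp: Transposition.transpose_def)

lemma roots_of_unity_2: "roots_of_unity 2 = {1, - 1}"
  by (auto simp: roots_of_unity_def power2_eq_1_iff)

lemma prod_two:
  fixes x y :: complex and n :: nat
  assumes "i < n" "j < n" "i \<noteq> j"
  shows "(\<Prod>b<n. if b = i then x else if b = j then y else 1) = x * y"
proof -
  have "(\<Prod>b<n. if b = i then x else if b = j then y else 1) =
      (\<Prod>b\<in>{i, j}. if b = i then x else if b = j then y else 1)"
    by (rule prod.mono_neutral_right) (use assms in auto)
  then show ?thesis using assms by simp
qed

lemma transpose_permutes: "i < n \<Longrightarrow> j < n \<Longrightarrow> Transposition.transpose i j permutes {..<n}"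
  by (rule permutes_swap_id) auto

lemma s_refl_W:
  assumes "i < n" "j < n" "i \<noteq> j" "\<epsilon> = 1 \<or> \<epsilon> = - 1" "p \<in> {1, 2}"
  shows "s_refl n i j \<epsilon> \<in> Gmpn 2 p n"
proof -
  let ?s = "\<lambda>b. if b = i then inverse \<epsilon> else if b = j then \<epsilon> else 1"
  have s: "?s \<in> sign_vec n" using assms(4) by (auto simp: sign_vec_def)
  note t = transpose_permutes[OF assms(1,2)]
  have B: "s_refl n i j \<epsilon> \<in> Gmpn 2 1 n"
    unfolding s_refl_mono[OF assms(3)] by (rule mono_mat_monomial[OF t s])
  have "entry_prod n (s_refl n i j \<epsilon>) = 1"
    unfolding s_refl_mono[OF assms(3)] entry_prod_monom[OF t s] prod_two[OF assms(1-3)] using assms(4) by auto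
  then have "s_refl n i j \<epsilon> \<in> Gmpn 2 2 n" unfolding Gmpn_2 using B by blast
  then show ?thesis using B assms(5) by blast
qed

text \<open>
  The transposition has sign \<open>- 1\<close> and so does the product of the entries.
\<close>

lemma sigma_refl_mu:
  assumes "i < n" "j < n" "i \<noteq> j" "\<epsilon> = 1 \<or> \<epsilon> = - 1" "p \<in> {1, 2}"
  shows "sigma_refl n i j \<epsilon> \<in> mu p n"
proof -
  let ?s = "\<lambda>b. if b = i then inverse \<epsilon> else if b = j then - \<epsilon> else 1"
  have s: "?s \<in> sign_vec n" using assms(4) by (auto simp: sign_vec_def)
  note t = transpose_permutes[OF assms(1,2)]
  have B: "sigma_refl n i j \<epsilon> \<in> Gmpn 2 1 n"
    unfolding sigma_refl_mono[OF assms(3)] by (rule mono_mat_monomial[OF t s])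
  have "Determinant.det (sigma_refl n i j \<epsilon>) = 1"
    unfolding sigma_refl_mono[OF assms(3)] det_monom[OF t] prod_two[OF assms(1-3)]
    using assms(3,4) by (auto simp: sign_swap_id)
  then show ?thesis using B by (simp add: mu_def)
qed

lemma t_refl_B: "t_refl n i \<in> Gmpn 2 1 n"
  using sign_diag_B sign_diag_t by blast

text \<open>
  Conjugation by signs changes the parameter \<open>\<epsilon>\<close> of a reflection by the product of the two signs involved.
\<close>

lemma conj_s_refl:
  assumes h: "h \<in> sign_diag n" and ij: "i < n" "j < n" "i \<noteq> j"
  shows "h * s_refl n i j \<epsilon> * h = s_refl n i j (h $$ (i, i) * h $$ (j, j) * \<epsilon>)"
proof -
  obtain d where hd: "h = dmat n d" and d: "\<And>i. i < n \<Longrightarrow> d i = 1 \<or> d i = - 1" using h by (auto simp: sign_diag_def)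
  note t = transpose_permutes[OF ij(1,2)]
  have id: "id permutes {..<n}" by (rule permutes_id)
  have dd: "d b * d b = 1" if "b < n" for b using d[OF that] by auto
  have inv: "inverse (d i) = d i" "inverse (d j) = d j" using d[OF ij(1)] d[OF ij(2)] by auto
  show ?thesis
    unfolding hd s_refl_mono[OF ij(3)] dmat_monom mono_mat_mult[OF t] mono_mat_mult[OF id]
    by (rule mono_mat_cong) (use ij dd inv in \<open>auto simp: Transposition.transpose_def mult_ac\<close>)
qed

lemma s_refl_adjacent_mult:
  assumes i: "Suc i < n"
  defines "s \<equiv> s_refl n i (Suc i) 1" and "sb \<equiv> s_refl n i (Suc i) (- 1)"
    and "t \<equiv> t_refl n i" and "t' \<equiv> t_refl n (Suc i)"
  shows "t * s = s * t'" and "t' * s = s * t" and "sb = s * (t * t')"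
    and "sigma_refl n i (Suc i) 1 = s * t'"
proof -
  note tr = transpose_permutes[of i n "Suc i"]
  have p: "Transposition.transpose i (Suc i) permutes {..<n}" by (rule tr) (use i in auto)
  have id: "id permutes {..<n}" by (rule permutes_id)
  have ne: "i \<noteq> Suc i" by simp
  note u = s_def sb_def t_def t'_def s_refl_mono[OF ne] sigma_refl_mono[OF ne] dmat_t dmat_monom
    mono_mat_mult[OF p] mono_mat_mult[OF id]
  show "t * s = s * t'" "t' * s = s * t" "sb = s * (t * t')" "sigma_refl n i (Suc i) 1 = s * t'"
    unfolding u comp_id id_comp by (rule mono_mat_cong; auto simp: Transposition.transpose_def)+
qed

lemma s_refl_t_commute:
  assumes i: "Suc i < n" and k: "k \<noteq> i" "k \<noteq> Suc i" and e: "\<epsilon> = 1 \<or> \<epsilon> = - 1"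
  shows "t_refl n k * s_refl n i (Suc i) \<epsilon> = s_refl n i (Suc i) \<epsilon> * t_refl n k"
proof -
  have p: "Transposition.transpose i (Suc i) permutes {..<n}" by (rule transpose_permutes) (use i in auto)
  have id: "id permutes {..<n}" by (rule permutes_id)
  have ne: "i \<noteq> Suc i" by simp
  show ?thesis
    unfolding s_refl_mono[OF ne] dmat_t dmat_monom mono_mat_mult[OF p] mono_mat_mult[OF id]
    by (rule mono_mat_cong) (use k in \<open>auto simp: Transposition.transpose_def\<close>)
qed

text \<open>
  For a diagonal matrix the determinant is the product of the entries.
\<close>

lemma diagonal_W_mu: "p \<in> {1, 2} \<Longrightarrow> Gmpn 2 p n \<inter> sign_diag n = mu p n \<inter> sign_diag n"
proof -
  assume p: "p \<in> {1, 2}"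
  have "entry_prod n h = Determinant.det h" if hs: "h \<in> sign_diag n" for h
  proof -
    obtain d where h: "h = mono_mat n id d" and d: "d \<in> sign_vec n"
      using hs by (auto simp: sign_diag_def sign_vec_def dmat_monom)
    show ?thesis unfolding h entry_prod_monom[OF permutes_id d] det_monom[OF permutes_id] by simp
  qed
  then have "Gmpn 2 2 n \<inter> sign_diag n = mu 2 n \<inter> sign_diag n" by (auto simp: Gmpn_2 mu_def)
  moreover have "Gmpn 2 1 n \<inter> sign_diag n = mu 1 n \<inter> sign_diag n" by (simp add: mu_def)
  ultimately show ?thesis using p by blast
qed

lemma sign_diag_diagonal: "h \<in> sign_diag n \<Longrightarrow> diagonal_mat h"
  by (auto simp: sign_diag_def diagonal_mat_def)

section \<open>The defining relations\<close>

lemma keys_diff_le: "Poly_Mapping.keys F \<subseteq> L \<Longrightarrow> Poly_Mapping.keys G \<subseteq> L \<Longrightarrow> Poly_Mapping.keys (F - G) \<subseteq> L"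
  for F G :: "'w \<Rightarrow>\<^sub>0 complex"
  using keys_diff[of F G] by blast

lemma keys_add_le: "Poly_Mapping.keys F \<subseteq> L \<Longrightarrow> Poly_Mapping.keys G \<subseteq> L \<Longrightarrow> Poly_Mapping.keys (F + G) \<subseteq> L"
  for F G :: "'w \<Rightarrow>\<^sub>0 complex"
  using keys_add[of F G] by blast

lemma keys_sum_le: "(\<And>i. i \<in> I \<Longrightarrow> Poly_Mapping.keys (f i) \<subseteq> L) \<Longrightarrow> Poly_Mapping.keys (sum f I) \<subseteq> L"
  for f :: "'i \<Rightarrow> 'w \<Rightarrow>\<^sub>0 complex"
  using keys_sum[of f I] by blast

lemma keys_single_le: "w \<in> L \<Longrightarrow> Poly_Mapping.keys (Poly_Mapping.single w c) \<subseteq> L" for c :: complex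
  by simp

lemmas keys_le = keys_diff_le keys_add_le keys_sum_le keys_single_le

lemma gens_iff [simp]: "X_gen i \<in> gens n K \<longleftrightarrow> i < n" "Y_gen i \<in> gens n K \<longleftrightarrow> i < n" "G_gen g \<in> gens n K \<longleftrightarrow> g \<in> K"
  by (auto simp: gens_def)

lemma group_relators_keys:
  assumes K: "monomial_group n K" and r: "r \<in> group_relators n K"
  shows "Poly_Mapping.keys r \<subseteq> lists (gens n K)"
  using r monomial_group.K_mult[OF K] monomial_group.K_one[OF K]
  unfolding group_relators_def
  by (elim UnE CollectE exE conjE insertE emptyE; hypsubst) (intro keys_le; simp)+

lemma presentation_rca:
  assumes p: "p \<in> {1, 2}" shows "presentation (gens n (Gmpn 2 p n)) (rca_relators p n c1 cm1)"
proof
  fix r assume r: "r \<in> rca_relators p n c1 cm1"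
  have s: "\<epsilon> \<in> roots_of_unity 2 \<Longrightarrow> i < n \<Longrightarrow> j < n \<Longrightarrow> i \<noteq> j \<Longrightarrow> s_refl n i j \<epsilon> \<in> Gmpn 2 p n" for i j \<epsilon>
    using s_refl_W[OF _ _ _ _ p, of i n j \<epsilon>] by (simp add: roots_of_unity_2)
  have k0: "Poly_Mapping.keys (if p = 1 then Poly_Mapping.single [G_gen (t_refl n i)] cm1 else 0) \<subseteq> lists (gens n (Gmpn 2 p n))" for i
    using t_refl_B[of n i] by simp
  from r show "Poly_Mapping.keys r \<subseteq> lists (gens n (Gmpn 2 p n))"
    using group_relators_keys[OF monomial_group_W[OF p]]
    unfolding rca_relators_def
    by (elim UnE CollectE exE conjE; (hypsubst, intro keys_le k0)?) (simp_all add: s)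
qed

lemma presentation_nbca:
  assumes p: "p \<in> {1, 2}" shows "presentation (gens n (mu p n)) (nbca_relators p n c1 cm1)"
proof
  fix r assume r: "r \<in> nbca_relators p n c1 cm1"
  have s: "\<epsilon> \<in> roots_of_unity 2 \<Longrightarrow> i < n \<Longrightarrow> j < n \<Longrightarrow> i \<noteq> j \<Longrightarrow> sigma_refl n i j \<epsilon> \<in> mu p n" for i j \<epsilon>
    using sigma_refl_mu[OF _ _ _ _ p, of i n j \<epsilon>] by (simp add: roots_of_unity_2)
  have k0: "Poly_Mapping.keys (if p = 1 then Poly_Mapping.single [G_gen (t_refl n i)] cm1 else 0) \<subseteq> lists (gens n (mu p n))" for i
    using t_refl_B[of n i] by (simp add: mu_def)
  from r show "Poly_Mapping.keys r \<subseteq> lists (gens n (mu p n))"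
    using group_relators_keys[OF monomial_group_mu[OF p]]
    unfolding nbca_relators_def
    by (elim UnE CollectE exE conjE; (hypsubst, intro keys_le k0)?) (simp_all add: s)
qed

context presentation
begin

lemma free_ext_eqI:
  assumes B: "calg B" and f: "f ` S \<subseteq> carrier B"
    and F: "Poly_Mapping.keys F \<subseteq> lists S" and G: "Poly_Mapping.keys G \<subseteq> lists S"
    and z: "free_ext B f (F - G) = \<zero>\<^bsub>B\<^esub>"
  shows "free_ext B f F = free_ext B f G"
proof -
  have k: "Poly_Mapping.keys (F - G) \<subseteq> lists S" by (rule keys_diff_le[OF F G])
  note l = alg_hom_lin[OF alg_hom_free_ext[OF B f]]
  have "free_ext B f ((F - G) \<oplus>\<^bsub>free_alg S\<^esub> G) = free_ext B f (F - G) \<oplus>\<^bsub>B\<^esub> free_ext B f G"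
    by (rule lin_add[OF l]) (use k G in simp_all)
  then show ?thesis
    unfolding z using lin_closed[OF l, of G] G calg_cvs[OF B] by (simp add: cvs_lzero)
qed

lemma relation_eq:
  assumes "F - G \<in> R" "Poly_Mapping.keys F \<subseteq> lists S" "Poly_Mapping.keys G \<subseteq> lists S"
  shows "free_ext P gen F = free_ext P gen G"
  by (rule free_ext_eqI[OF calg_P gen_image assms(2,3) relation[OF assms(1)]])

lemma free_ext_gen_word1: "s \<in> S \<Longrightarrow> free_ext P gen (word [s]) = gen s"
  using free_ext_word[OF calg_P gen_image, of "[s]" 1] gen_closed[of s] calg_P calg_cvs[OF calg_P]
  by (simp add: calg_r_one cvs_one_smult)

lemma free_ext_gen_word2: "s \<in> S \<Longrightarrow> s' \<in> S \<Longrightarrow> free_ext P gen (word [s, s']) = gen s \<otimes>\<^bsub>P\<^esub> gen s'"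
  using free_ext_word[OF calg_P gen_image, of "[s, s']" 1] gen_closed[of s] gen_closed[of s'] calg_P calg_cvs[OF calg_P]
  by (simp add: calg_r_one cvs_one_smult calg_mult)

end

lemma gen_group_mult:
  assumes P: "presentation (gens n K) R" and sub: "group_relators n K \<subseteq> R" and K: "monomial_group n K"
    and g: "g \<in> K" "h \<in> K"
  shows "presented_gen (gens n K) R (G_gen g) \<otimes>\<^bsub>presented (gens n K) R\<^esub> presented_gen (gens n K) R (G_gen h) =
    presented_gen (gens n K) R (G_gen (g * h))"
proof -
  interpret presentation "gens n K" R by (rule P)
  have "word [G_gen g, G_gen h] - word [G_gen (g * h)] \<in> R"
    using sub g unfolding group_relators_def by blast
  then have "free_ext P gen (word [G_gen g, G_gen h]) = free_ext P gen (word [G_gen (g * h)])"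
    by (rule relation_eq) (use g monomial_group.K_mult[OF K] in simp_all)
  then show ?thesis using g monomial_group.K_mult[OF K] by (simp add: free_ext_gen_word1 free_ext_gen_word2)
qed

section \<open>The torus action on words and relations\<close>

text \<open>
  On generators an element of the torus acts by a substitution \<open>conj_gen\<close> followed by a scalar
  \<open>scale_gen\<close>. As \<open>h\<close> is an involution, \<open>h * g * h\<close> is the conjugate of \<open>g\<close>.
\<close>

fun conj_gen :: "complex mat \<Rightarrow> gen \<Rightarrow> gen" where
  "conj_gen h (X_gen j) = X_gen j"
| "conj_gen h (Y_gen j) = Y_gen j"
| "conj_gen h (G_gen g) = G_gen (h * g * h)"

fun scale_gen :: "complex mat \<Rightarrow> gen \<Rightarrow> complex" where
  "scale_gen h (X_gen j) = h $$ (j, j)"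
| "scale_gen h (Y_gen j) = h $$ (j, j)"
| "scale_gen h (G_gen g) = 1"

text \<open>
  The resulting automorphism of the free algebra.
\<close>

definition torus_words :: "complex mat \<Rightarrow> (gen list \<Rightarrow>\<^sub>0 complex) \<Rightarrow> (gen list \<Rightarrow>\<^sub>0 complex)" where
  "torus_words h F = (\<Sum>w\<in>Poly_Mapping.keys F.
     Poly_Mapping.single (map (conj_gen h) w) (Poly_Mapping.lookup F w * prod_list (map (scale_gen h) w)))"

lemma torus_words_superset: "finite S \<Longrightarrow> Poly_Mapping.keys F \<subseteq> S \<Longrightarrow> torus_words h F = (\<Sum>w\<in>S.
     Poly_Mapping.single (map (conj_gen h) w) (Poly_Mapping.lookup F w * prod_list (map (scale_gen h) w)))"
  unfolding torus_words_def by (rule sum.mono_neutral_left) (auto simp: in_keys_iff)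

lemma torus_words_add: "torus_words h (F + G) = torus_words h F + torus_words h G"
proof -
  let ?S = "Poly_Mapping.keys F \<union> Poly_Mapping.keys G"
  have "Poly_Mapping.keys (F + G) \<subseteq> ?S" by (rule keys_add)
  then show ?thesis
    by (simp add: torus_words_superset[of ?S] lookup_add single_add sum.distrib distrib_right)
qed

lemma torus_words_single: "torus_words h (Poly_Mapping.single w c) =
    Poly_Mapping.single (map (conj_gen h) w) (c * prod_list (map (scale_gen h) w))"
  by (subst torus_words_superset[of "{w}"]) auto

lemma torus_words_0: "torus_words h 0 = 0"
  by (simp add: torus_words_def)

lemma torus_words_diff: "torus_words h (F - G) = torus_words h F - torus_words h G"
  using torus_words_add[of h "F - G" G] by (simp add: algebra_simps)

lemma torus_words_sum: "torus_words h (sum f I) = (\<Sum>i\<in>I. torus_words h (f i))"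
  by (induct I rule: infinite_finite_induct) (simp_all add: torus_words_0 torus_words_add)

lemmas torus_words_simps = torus_words_add torus_words_diff torus_words_sum torus_words_0 torus_words_single

lemma pscale_diff: "pscale c (F - G) = pscale c F - pscale c G"
  by (rule poly_mapping_eqI) (simp add: lookup_pscale lookup_minus algebra_simps)

lemmas pscale_simps = pscale_add pscale_diff pscale_sum pscale_single pscale_zero

lemma sum_roots_of_unity_2: "(\<Sum>\<epsilon>\<in>roots_of_unity 2. f \<epsilon>) = f 1 + f (- 1)" for f :: "complex \<Rightarrow> 'm::comm_monoid_add"
  by (simp add: roots_of_unity_2)

lemma conj_index:
  assumes h: "h \<in> sign_diag n" and g: "g \<in> carrier_mat n n" and ij: "i < n" "j < n"
  shows "(h * g * h) $$ (i, j) = h $$ (i, i) * g $$ (i, j) * h $$ (j, j)"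
proof -
  obtain d where hd: "h = dmat n d" using h by (auto simp: sign_diag_def)
  show ?thesis unfolding hd using g ij by (simp add: dmat_mult_mat mat_mult_dmat)
qed

lemma conj_W:
  assumes p: "p \<in> {1, 2}" and h: "h \<in> sign_diag n" and g: "g \<in> Gmpn 2 p n"
  shows "h * g * h \<in> Gmpn 2 p n"
proof -
  have hB: "h \<in> Gmpn 2 1 n" using sign_diag_B h by blast
  have gB: "g \<in> Gmpn 2 1 n" using monomial_group.K_B[OF monomial_group_W[OF p]] g by blast
  have B: "h * g * h \<in> Gmpn 2 1 n" by (intro B_mult hB gB)
  show ?thesis
  proof (cases "p = 1")
    case False
    then have p2: "p = 2" using p by simp
    have "entry_prod n (h * h) = 1" unfolding sign_diag_sq[OF h] by (rule entry_prod_one)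
    then have "entry_prod n h * entry_prod n h = 1" using entry_prod_mult[OF hB hB] by simp
    moreover have "entry_prod n g = 1" using g by (simp add: p2 Gmpn_2)
    ultimately have "entry_prod n (h * g * h) = 1"
      using entry_prod_mult[OF B_mult[OF hB gB] hB] entry_prod_mult[OF hB gB] by simp
    then show ?thesis using B unfolding p2 Gmpn_2 by simp
  qed (use B in simp)
qed

text \<open>
  The defining relations are permuted up to scalars. In the commutation relation of \<open>y\<^sub>i\<close> and \<open>x\<^sub>j\<close>
  with \<open>i \<noteq> j\<close> the left-hand side is scaled by \<open>h\<^sub>i h\<^sub>j\<close>, and on the right the same sign arises because
  conjugation exchanges the two reflections if \<open>h\<^sub>i h\<^sub>j = - 1\<close>, while the coefficients are \<open>\<epsilon>\<close>.
\<close>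

lemma torus_words_relator:
  assumes p: "p \<in> {1, 2}" and h: "h \<in> sign_diag n" and r: "r \<in> rca_relators p n c1 cm1"
  shows "\<exists>c r'. r' \<in> rca_relators p n c1 cm1 \<and> torus_words h r = pscale c r'"
proof -
  let ?W = "Gmpn 2 p n"
  interpret W: monomial_group n ?W by (rule monomial_group_W[OF p])
  interpret B: monomial_group n "Gmpn 2 1 n" by (rule monomial_group_B)
  note hc = sign_diag_carrier[OF h]
  have hB: "h \<in> Gmpn 2 1 n" using sign_diag_B h by blast
  note conj_W = conj_W[OF p h]
  have hh: "h * (h * g) = g" if "g \<in> carrier_mat n n" for g
    using that hc sign_diag_sq[OF h] by (simp add: assoc_mult_mat[symmetric, of _ n n _ n _ n])
  have conj_mult: "(h * g * h) * (h * k * h) = h * (g * k) * h" if "g \<in> carrier_mat n n" "k \<in> carrier_mat n n" for g k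
    using that hc by (simp add: assoc_mult_mat[of _ n n _ n _ n] hh)
  have conj_one: "h * 1\<^sub>m n * h = 1\<^sub>m n" using hc sign_diag_sq[OF h] by simp
  have hsq: "h $$ (i, i) * h $$ (i, i) = 1" if "i < n" for i by (rule sign_diag_index_sq[OF h that])
  have hpm: "h $$ (i, i) = 1 \<or> h $$ (i, i) = - 1" if "i < n" for i by (rule sign_diag_index[OF h that])
  have inv_conj: "inv\<^bsub>mat_group n ?W\<^esub> (h * g * h) = h * (inv\<^bsub>mat_group n ?W\<^esub> g) * h"
    and inv_W: "inv\<^bsub>mat_group n ?W\<^esub> g \<in> ?W" if g: "g \<in> ?W" for g
  proof -
    obtain k where k: "k \<in> ?W" "k * g = 1\<^sub>m n" using W.K_inverse[OF g] by blast
    have ig: "inv\<^bsub>mat_group n ?W\<^esub> g = k" by (rule W.inv_mat_group[OF g k])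
    show "inv\<^bsub>mat_group n ?W\<^esub> g \<in> ?W" using ig k by simp
    show "inv\<^bsub>mat_group n ?W\<^esub> (h * g * h) = h * (inv\<^bsub>mat_group n ?W\<^esub> g) * h" unfolding ig
      by (rule W.inv_mat_group[OF conj_W[OF g] conj_W[OF k(1)]])
        (simp add: conj_mult[OF W.K_carrier[OF k(1)] W.K_carrier[OF g]] k(2) conj_one)
  qed
  have sgl: "(\<Sum>\<epsilon>\<in>roots_of_unity 2. Poly_Mapping.single [G_gen (h * s_refl n i j \<epsilon> * h)] (f \<epsilon>)) =
      (\<Sum>\<epsilon>\<in>roots_of_unity 2. Poly_Mapping.single [G_gen (s_refl n i j \<epsilon>)] (f (h $$ (i, i) * h $$ (j, j) * \<epsilon>)))"
    if "i < n" "j < n" "i \<noteq> j" for i j and f :: "complex \<Rightarrow> complex"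
    unfolding sum_roots_of_unity_2 conj_s_refl[OF h that]
    using hpm[OF that(1)] hpm[OF that(2)] by (auto simp: add.commute)
  have ht: "h * t_refl n i * h = t_refl n i" for i
    using sign_diag_comm[OF h sign_diag_t[of n i]] sign_diag_sq[OF h] hc sign_diag_carrier[OF sign_diag_t[of n i]]
    by (simp add: assoc_mult_mat[of _ n n _ n _ n])
  let ?R = "rca_relators p n c1 cm1"
  have R: "word [G_gen g, G_gen k] - word [G_gen (g * k)] \<in> ?R"
    "word [G_gen (1\<^sub>m n)] - word [] \<in> ?R"
    "i < n \<Longrightarrow> word [G_gen g, X_gen i] - (\<Sum>k<n. Poly_Mapping.single [X_gen k, G_gen g] (g $$ (k, i))) \<in> ?R"
    "i < n \<Longrightarrow> word [G_gen g, Y_gen i]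
        - (\<Sum>k<n. Poly_Mapping.single [Y_gen k, G_gen g] ((inv\<^bsub>mat_group n ?W\<^esub> g) $$ (i, k))) \<in> ?R"
    if "g \<in> ?W" "k \<in> ?W" for g k i
    unfolding rca_relators_def group_relators_def using that by blast+
  have unit: ?thesis if "torus_words h r = pscale c r'" "r' \<in> ?R" for c r' using that by blast
  from r[unfolded rca_relators_def group_relators_def] show ?thesis
  proof (elim UnE CollectE exE conjE, goal_cases)
    case (1 g k)
    then have "torus_words h r = pscale 1 (word [G_gen (h * g * h), G_gen (h * k * h)] - word [G_gen ((h * g * h) * (h * k * h))])"
      using W.K_carrier by (simp add: torus_words_simps pscale_1 conj_mult)
    then show ?case by (rule unit) (rule R(1)[OF conj_W[OF 1(2)] conj_W[OF 1(3)]])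
  next
    case 2
    then have "torus_words h r = pscale 1 (word [G_gen (1\<^sub>m n)] - word [])"
      by (simp add: torus_words_simps pscale_1 conj_one)
    then show ?case by (rule unit) (rule R(2)[OF W.K_one W.K_one])
  next
    case (3 g i)
    have gc: "g \<in> carrier_mat n n" using W.K_carrier 3 by blast
    have e: "h $$ (i, i) * (h * g * h) $$ (k, i) = g $$ (k, i) * h $$ (k, k)" if "k < n" for k
      unfolding conj_index[OF h gc that 3(3)] using hpm[OF 3(3)] by auto
    have "torus_words h r = pscale (h $$ (i, i)) (word [G_gen (h * g * h), X_gen i] -
        (\<Sum>k<n. Poly_Mapping.single [X_gen k, G_gen (h * g * h)] ((h * g * h) $$ (k, i))))"
      unfolding 3(1) using e by (simp add: torus_words_simps pscale_simps cong: sum.cong_simp)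
    then show ?case by (rule unit) (rule R(3)[OF conj_W[OF 3(2)] W.K_one 3(3)])
  next
    case (4 g i)
    have gc: "inv\<^bsub>mat_group n ?W\<^esub> g \<in> carrier_mat n n" using W.K_carrier inv_W 4 by blast
    have e: "h $$ (i, i) * (inv\<^bsub>mat_group n ?W\<^esub> (h * g * h)) $$ (i, k) =
        (inv\<^bsub>mat_group n ?W\<^esub> g) $$ (i, k) * h $$ (k, k)" if "k < n" for k
      unfolding inv_conj[OF 4(2)] conj_index[OF h gc 4(3) that] using hpm[OF 4(3)] by auto
    have "torus_words h r = pscale (h $$ (i, i)) (word [G_gen (h * g * h), Y_gen i] -
        (\<Sum>k<n. Poly_Mapping.single [Y_gen k, G_gen (h * g * h)] ((inv\<^bsub>mat_group n ?W\<^esub> (h * g * h)) $$ (i, k))))"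
      unfolding 4(1) using e by (simp add: torus_words_simps pscale_simps cong: sum.cong_simp)
    then show ?case by (rule unit) (rule R(4)[OF conj_W[OF 4(2)] W.K_one 4(3)])
  next
    case (5 i j)
    have "torus_words h r = pscale (h $$ (i, i) * h $$ (j, j)) (word [X_gen i, X_gen j] - word [X_gen j, X_gen i])"
      unfolding 5(1) by (simp add: torus_words_simps pscale_simps mult_ac)
    then show ?case by (rule unit) (rule r[unfolded 5(1)])
  next
    case (6 i j)
    have "torus_words h r = pscale (h $$ (i, i) * h $$ (j, j)) (word [Y_gen i, Y_gen j] - word [Y_gen j, Y_gen i])"
      unfolding 6(1) by (simp add: torus_words_simps pscale_simps mult_ac)
    then show ?case by (rule unit) (rule r[unfolded 6(1)])
  next
    case (7 i j)
    have "torus_words h r = pscale (h $$ (i, i) * h $$ (j, j)) (word [Y_gen i, X_gen j] - word [X_gen j, Y_gen i]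
        - (\<Sum>\<epsilon>\<in>roots_of_unity 2. Poly_Mapping.single [G_gen (s_refl n i j \<epsilon>)] (c1 * \<epsilon>)))"
      unfolding 7(1) using sgl[OF 7(2-4), of "\<lambda>\<epsilon>. c1 * \<epsilon>"]
      by (simp add: torus_words_simps pscale_simps mult_ac)
    then show ?case by (rule unit) (rule r[unfolded 7(1)])
  next
    case (8 i)
    have "(\<Sum>j\<in>{..<n} - {i}. \<Sum>\<epsilon>\<in>roots_of_unity 2. Poly_Mapping.single [G_gen (h * s_refl n i j \<epsilon> * h)] c1) =
       (\<Sum>j\<in>{..<n} - {i}. \<Sum>\<epsilon>\<in>roots_of_unity 2. Poly_Mapping.single [G_gen (s_refl n i j \<epsilon>)] c1)"
      by (rule sum.cong[OF refl]) (use sgl[of i _ "\<lambda>_. c1"] 8(2) in auto)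
    then have "torus_words h r = pscale 1 r"
      unfolding 8(1) using hsq[OF 8(2)] by (simp add: torus_words_simps pscale_1 ht mult_ac)
    then show ?case by (rule unit) (rule r)
  qed
qed

section \<open>The grading of the rational Cherednik algebra\<close>

locale rational_cherednik =
  fixes p n :: nat and c1 cm1 :: complex
  assumes p: "p \<in> {1, 2}"
begin

abbreviation "W \<equiv> Gmpn 2 p n"
abbreviation "\<H> \<equiv> rca p n c1 cm1"
abbreviation "\<iota> \<equiv> rca_gen p n c1 cm1"
abbreviation "T\<H> \<equiv> T_on_rca p n c1 cm1"

sublocale P: presentation "gens n W" "rca_relators p n c1 cm1"
  rewrites "presented (gens n W) (rca_relators p n c1 cm1) = \<H>"
    and "presented_gen (gens n W) (rca_relators p n c1 cm1) = \<iota>"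
  by (simp_all add: presentation_rca[OF p] rca_def rca_gen_def)

sublocale W: monomial_group n W
  by (rule monomial_group_W[OF p])

lemma \<iota>_closed: "s \<in> gens n W \<Longrightarrow> \<iota> s \<in> carrier \<H>"
  by (rule P.gen_closed)

lemmas \<H>_cvs = calg_cvs[OF P.calg_P]

lemma group_mult: "g \<in> W \<Longrightarrow> h \<in> W \<Longrightarrow> \<iota> (G_gen g) \<otimes>\<^bsub>\<H>\<^esub> \<iota> (G_gen h) = \<iota> (G_gen (g * h))"
  using gen_group_mult[OF presentation_rca[OF p] _ monomial_group_W[OF p], of n c1 cm1 g h]
  by (simp_all add: rca_relators_def rca_def rca_gen_def Un_assoc)

lemma conj_gen_closed: "h \<in> sign_diag n \<Longrightarrow> s \<in> gens n W \<Longrightarrow> conj_gen h s \<in> gens n W"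
  by (cases s) (simp_all add: conj_W[OF p])

lemma T_on_gen_scale:
  assumes h: "h \<in> sign_diag n" and s: "s \<in> gens n W"
  shows "T_on_gen p n c1 cm1 h s = scale_gen h s \<odot>\<^bsub>\<H>\<^esub> \<iota> (conj_gen h s)"
  using s conj_gen_closed[OF h s]
  by (cases s) (simp_all add: sign_diag_inv[OF h] cvs_one_smult[OF \<H>_cvs] \<iota>_closed)

lemma T_on_gen_closed: "h \<in> sign_diag n \<Longrightarrow> T_on_gen p n c1 cm1 h ` gens n W \<subseteq> carrier \<H>"
  by (auto simp: T_on_gen_scale \<iota>_closed conj_gen_closed cvs_smult[OF \<H>_cvs])

text \<open>
  Evaluating a word at the transformed generators is the same as transforming the word first.
\<close>

lemma free_ext_T_on_gen:
  assumes h: "h \<in> sign_diag n" and F: "Poly_Mapping.keys F \<subseteq> lists (gens n W)"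
  shows "free_ext \<H> (T_on_gen p n c1 cm1 h) F = free_ext \<H> \<iota> (torus_words h F) \<and>
     Poly_Mapping.keys (torus_words h F) \<subseteq> lists (gens n W)"
  using F
proof (induct rule: poly_mapping_keys_induct)
  case zero
  show ?case using \<H>_cvs by (simp add: torus_words_0 free_ext_linext)
next
  case (single w c F)
  note T = T_on_gen_closed[OF h] and \<iota> = P.gen_image
  note lT = alg_hom_lin[OF alg_hom_free_ext[OF P.calg_P T]] and l\<iota> = alg_hom_lin[OF alg_hom_free_ext[OF P.calg_P \<iota>]]
  have ml: "map (conj_gen h) w \<in> lists (gens n W)" if "w \<in> lists (gens n W)" for w
    using that conj_gen_closed[OF h] by (induct w) auto
  have ec: "word_eval \<H> \<iota> w \<in> carrier \<H>" if "w \<in> lists (gens n W)" for w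
    by (rule word_eval_closed[OF P.calg_P \<iota> that])
  have we: "word_eval \<H> (T_on_gen p n c1 cm1 h) w =
      prod_list (map (scale_gen h) w) \<odot>\<^bsub>\<H>\<^esub> word_eval \<H> \<iota> (map (conj_gen h) w)" if "w \<in> lists (gens n W)" for w
    using that
  proof (induct w)
    case Nil
    then show ?case by (simp add: cvs_one_smult[OF \<H>_cvs] calg_one[OF P.calg_P])
  next
    case (Cons s w)
    note s = Cons(1) and w = Cons(2)
    note cs = \<iota>_closed[OF conj_gen_closed[OF h s]] and cw = ec[OF ml[OF w]]
    show ?case using Cons(3) cs cw
      by (simp add: T_on_gen_scale[OF h s] calg_smult_l[OF P.calg_P] calg_smult_r[OF P.calg_P]
          cvs_smult[OF \<H>_cvs] calg_mult[OF P.calg_P] cvs_smult_smult[OF \<H>_cvs] mult.commute)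
  qed
  have 1: "free_ext \<H> (T_on_gen p n c1 cm1 h) (Poly_Mapping.single w c) =
      free_ext \<H> \<iota> (torus_words h (Poly_Mapping.single w c))"
    unfolding torus_words_single free_ext_word[OF P.calg_P T single(1)] free_ext_word[OF P.calg_P \<iota> ml[OF single(1)]]
      we[OF single(1)] by (rule cvs_smult_smult[OF \<H>_cvs ec[OF ml[OF single(1)]]])
  have k: "Poly_Mapping.keys (torus_words h (Poly_Mapping.single w c)) \<subseteq> lists (gens n W)"
    unfolding torus_words_single by (rule keys_single_le[OF ml[OF single(1)]])
  have "free_ext \<H> (T_on_gen p n c1 cm1 h) (Poly_Mapping.single w c + F) =
      free_ext \<H> (T_on_gen p n c1 cm1 h) (Poly_Mapping.single w c) \<oplus>\<^bsub>\<H>\<^esub> free_ext \<H> (T_on_gen p n c1 cm1 h) F"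
    using lin_add[OF lT, of "Poly_Mapping.single w c" F] single(1,2) by simp
  also have "\<dots> = free_ext \<H> \<iota> (torus_words h (Poly_Mapping.single w c)) \<oplus>\<^bsub>\<H>\<^esub> free_ext \<H> \<iota> (torus_words h F)"
    using 1 single(3) by simp
  also have "\<dots> = free_ext \<H> \<iota> (torus_words h (Poly_Mapping.single w c + F))"
    using lin_add[OF l\<iota>, of "torus_words h (Poly_Mapping.single w c)" "torus_words h F"] k single(3)
    by (simp add: torus_words_add)
  finally show ?case using keys_add_le[OF k conjunct2[OF single(3)]] by (simp add: torus_words_add)
qed

text \<open>
  The automorphism of the free algebra descends, because it sends relators to multiples of relators.
\<close>

lemma T\<H>_hom:
  assumes h: "h \<in> sign_diag n"
  shows "alg_hom \<H> \<H> (T\<H> h)" and "s \<in> gens n W \<Longrightarrow> T\<H> h (\<iota> s) = scale_gen h s \<odot>\<^bsub>\<H>\<^esub> \<iota> (conj_gen h s)"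
proof -
  have rel: "free_ext \<H> (T_on_gen p n c1 cm1 h) r = \<zero>\<^bsub>\<H>\<^esub>" if r: "r \<in> rca_relators p n c1 cm1" for r
  proof -
    obtain c r' where r': "r' \<in> rca_relators p n c1 cm1" and e: "torus_words h r = pscale c r'"
      using torus_words_relator[OF p h r] by blast
    have "free_ext \<H> \<iota> (c \<odot>\<^bsub>free_alg (gens n W)\<^esub> r') = c \<odot>\<^bsub>\<H>\<^esub> free_ext \<H> \<iota> r'"
      by (rule lin_smult[OF alg_hom_lin[OF alg_hom_free_ext[OF P.calg_P P.gen_image]]]) (use P.R[OF r'] in simp)
    then show ?thesis
      using free_ext_T_on_gen[OF h P.R[OF r]] P.relation[OF r'] \<H>_cvs by (simp add: e cvs_smult_zero)
  qed
  note t = P.presented_hom[OF P.calg_P T_on_gen_closed[OF h] rel]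
  show "alg_hom \<H> \<H> (T\<H> h)" unfolding T_on_rca_def by (rule t(1))
  show "s \<in> gens n W \<Longrightarrow> T\<H> h (\<iota> s) = scale_gen h s \<odot>\<^bsub>\<H>\<^esub> \<iota> (conj_gen h s)"
    unfolding T_on_rca_def using t(2)[of s] T_on_gen_scale[OF h] by simp
qed

lemma hom_eq:
  "alg_hom \<H> B f \<Longrightarrow> alg_hom \<H> B g \<Longrightarrow> (\<And>s. s \<in> gens n W \<Longrightarrow> f (\<iota> s) = g (\<iota> s)) \<Longrightarrow> a \<in> carrier \<H> \<Longrightarrow> f a = g a"
  by (rule alg_hom_eq_on_agen[OF P.calg_P P.gen_image _ _ _ P.carrier_agen]) auto

lemma conj_gen_mult:
  assumes h: "h \<in> sign_diag n" and k: "k \<in> sign_diag n" and s: "s \<in> gens n W"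
  shows "conj_gen (h * k) s = conj_gen h (conj_gen k s)" "scale_gen (h * k) s = scale_gen h s * scale_gen k s"
proof -
  note c = sign_diag_carrier[OF h] sign_diag_carrier[OF k]
  show "conj_gen (h * k) s = conj_gen h (conj_gen k s)"
  proof (cases s)
    case (G_gen g)
    then have g: "g \<in> carrier_mat n n" using s W.K_carrier by simp
    have "(h * k) * g * (h * k) = (h * k) * g * (k * h)" using sign_diag_comm[OF h k] by simp
    also have "\<dots> = h * (k * g * k) * h" using c g by (simp add: assoc_mult_mat[of _ n n _ n _ n])
    finally show ?thesis using G_gen by simp
  qed simp_all
  obtain d e where "h = dmat n d" "k = dmat n e" using h k by (auto simp: sign_diag_def)
  then show "scale_gen (h * k) s = scale_gen h s * scale_gen k s"
    using s by (cases s) (simp_all add: dmat_mult)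
qed

lemma torus_rep_T\<H>: "torus_rep n \<H> T\<H>"
  unfolding torus_rep_def
proof (intro conjI ballI)
  show "cvs \<H>" by (rule \<H>_cvs)
  show "lin \<H> \<H> (T\<H> h)" if "h \<in> sign_diag n" for h by (rule alg_hom_lin[OF T\<H>_hom(1)[OF that]])
  show "T\<H> (h * k) a = T\<H> h (T\<H> k a)" if h: "h \<in> sign_diag n" and k: "k \<in> sign_diag n" and a: "a \<in> carrier \<H>" for h k a
  proof (rule hom_eq[OF T\<H>_hom(1)[OF sign_diag_mult[OF h k]] alg_hom_comp[OF T\<H>_hom(1)[OF k] T\<H>_hom(1)[OF h]] _ a])
    fix s assume s: "s \<in> gens n W"
    note cs = conj_gen_closed[OF k s]
    have "T\<H> h (T\<H> k (\<iota> s)) = scale_gen k s \<odot>\<^bsub>\<H>\<^esub> (scale_gen h (conj_gen k s) \<odot>\<^bsub>\<H>\<^esub> \<iota> (conj_gen h (conj_gen k s)))"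
      unfolding T\<H>_hom(2)[OF k s] lin_smult[OF alg_hom_lin[OF T\<H>_hom(1)[OF h]] \<iota>_closed[OF cs]] T\<H>_hom(2)[OF h cs] ..
    also have "scale_gen h (conj_gen k s) = scale_gen h s" by (cases s) simp_all
    finally show "T\<H> (h * k) (\<iota> s) = T\<H> h (T\<H> k (\<iota> s))"
      unfolding T\<H>_hom(2)[OF sign_diag_mult[OF h k] s] conj_gen_mult[OF h k s]
      using \<iota>_closed[OF conj_gen_closed[OF h cs]] by (simp add: cvs_smult_smult[OF \<H>_cvs] mult.commute)
  qed
  show "T\<H> (1\<^sub>m n) a = a" if a: "a \<in> carrier \<H>" for a
  proof (rule hom_eq[OF T\<H>_hom(1)[OF sign_diag_one] alg_hom_ident _ a])
    fix s assume s: "s \<in> gens n W"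
    have "conj_gen (1\<^sub>m n) s = s \<and> scale_gen (1\<^sub>m n) s = 1"
    proof (cases s)
      case (G_gen g)
      then have "g \<in> carrier_mat n n" using s W.K_carrier by simp
      then show ?thesis using G_gen by simp
    qed (use s in simp_all)
    then show "T\<H> (1\<^sub>m n) (\<iota> s) = \<iota> s"
      unfolding T\<H>_hom(2)[OF sign_diag_one s] using \<iota>_closed[OF s] by (simp add: cvs_one_smult[OF \<H>_cvs])
  qed
qed

lemma T\<H>_mult: "h \<in> sign_diag n \<Longrightarrow> a \<in> carrier \<H> \<Longrightarrow> b \<in> carrier \<H> \<Longrightarrow> T\<H> h (a \<otimes>\<^bsub>\<H>\<^esub> b) = T\<H> h a \<otimes>\<^bsub>\<H>\<^esub> T\<H> h b"
  by (rule alg_hom_mult[OF T\<H>_hom(1)])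

lemma T\<H>_one: "h \<in> sign_diag n \<Longrightarrow> T\<H> h \<one>\<^bsub>\<H>\<^esub> = \<one>\<^bsub>\<H>\<^esub>"
  by (rule alg_hom_one[OF T\<H>_hom(1)])

text \<open>
  Conjugation by the torus fixes or exchanges the reflections \<open>s\<^sub>i\<^sub>,\<^sub>i\<^sub>+\<^sub>1\<close> with parameters
  \<open>1\<close> and \<open>- 1\<close>. Their half sum (\<open>\<eta> = 1\<close>) and half difference (\<open>\<eta> = - 1\<close>) are therefore homogeneous.
\<close>

definition half_sum :: "complex \<Rightarrow> nat \<Rightarrow> pres" where
  "half_sum \<eta> i = (1/2) \<odot>\<^bsub>\<H>\<^esub> \<iota> (G_gen (s_refl n i (Suc i) (- 1))) \<oplus>\<^bsub>\<H>\<^esub> (\<eta>/2) \<odot>\<^bsub>\<H>\<^esub> \<iota> (G_gen (s_refl n i (Suc i) 1))"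

lemma s_refl_closed: "Suc i < n \<Longrightarrow> \<epsilon> = 1 \<or> \<epsilon> = - 1 \<Longrightarrow> s_refl n i (Suc i) \<epsilon> \<in> W"
  by (rule s_refl_W) (use p in auto)

lemma weight_vec_X: "i < n \<Longrightarrow> weight_vec n \<H> T\<H> {i} (\<iota> (X_gen i))"
  and weight_vec_Y: "i < n \<Longrightarrow> weight_vec n \<H> T\<H> {i} (\<iota> (Y_gen i))"
  by (simp_all add: weight_vec_def \<iota>_closed T\<H>_hom(2) wt_def)

text \<open>
  Diagonal elements commute with the torus.
\<close>

lemma weight_vec_diag:
  assumes g: "g \<in> W" "g \<in> sign_diag n" shows "weight_vec n \<H> T\<H> {} (\<iota> (G_gen g))"
proof -
  have "h * g * h = g" if h: "h \<in> sign_diag n" for h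
  proof -
    have "h * g * h = g * (h * h)"
      unfolding sign_diag_comm[OF h g(2)]
      by (rule assoc_mult_mat) (use sign_diag_carrier[OF h] sign_diag_carrier[OF g(2)] in auto)
    then show ?thesis using sign_diag_sq[OF h] sign_diag_carrier[OF g(2)] by simp
  qed
  then show ?thesis
    using g by (simp add: weight_vec_def \<iota>_closed T\<H>_hom(2) wt_def)
qed

lemma T\<H>_s:
  assumes i: "Suc i < n" and h: "h \<in> sign_diag n" and e: "\<epsilon> = 1 \<or> \<epsilon> = - 1"
  shows "T\<H> h (\<iota> (G_gen (s_refl n i (Suc i) \<epsilon>))) = \<iota> (G_gen (s_refl n i (Suc i) (h $$ (i, i) * h $$ (Suc i, Suc i) * \<epsilon>)))"
proof -
  have "h $$ (i, i) * h $$ (Suc i, Suc i) * \<epsilon> = 1 \<or> h $$ (i, i) * h $$ (Suc i, Suc i) * \<epsilon> = - 1"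
    using sign_diag_index[OF h, of i] sign_diag_index[OF h i] i e by auto
  then show ?thesis
    using T\<H>_hom(2)[OF h, of "G_gen (s_refl n i (Suc i) \<epsilon>)"] s_refl_closed[OF i e]
      s_refl_closed[OF i, of "h $$ (i, i) * h $$ (Suc i, Suc i) * \<epsilon>"] conj_s_refl[OF h, of i "Suc i" \<epsilon>] i
    by (simp add: cvs_one_smult[OF \<H>_cvs] \<iota>_closed)
qed

lemma weight_vec_half_sum:
  assumes i: "Suc i < n" and \<eta>: "\<eta> = 1 \<and> \<gamma> = {} \<or> \<eta> = - 1 \<and> \<gamma> = {i, Suc i}"
  shows "weight_vec n \<H> T\<H> \<gamma> (half_sum \<eta> i)"
  unfolding weight_vec_def
proof (intro conjI ballI)
  let ?s = "\<lambda>\<epsilon>. \<iota> (G_gen (s_refl n i (Suc i) \<epsilon>))"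
  have s: "?s 1 \<in> carrier \<H>" "?s (- 1) \<in> carrier \<H>"
    using s_refl_closed[OF i] by (simp_all add: \<iota>_closed)
  show "half_sum \<eta> i \<in> carrier \<H>" unfolding half_sum_def using s \<H>_cvs by (simp add: cvs_closed)
  show "\<gamma> \<subseteq> {..<n}" using \<eta> i by auto
  fix h assume h: "h \<in> sign_diag n"
  let ?e = "h $$ (i, i) * h $$ (Suc i, Suc i)"
  have e: "?e = 1 \<or> ?e = - 1"
    using sign_diag_index[OF h, of i] sign_diag_index[OF h i] i by auto
  have w: "wt \<gamma> h = (if \<eta> = 1 then 1 else ?e)" using \<eta> by (auto simp: wt_def)
  have "T\<H> h (half_sum \<eta> i) = (1/2) \<odot>\<^bsub>\<H>\<^esub> ?s (?e * (- 1)) \<oplus>\<^bsub>\<H>\<^esub> (\<eta>/2) \<odot>\<^bsub>\<H>\<^esub> ?s (?e * 1)"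
    unfolding half_sum_def
    using s T\<H>_s[OF i h, of 1] T\<H>_s[OF i h, of "- 1"] alg_hom_lin[OF T\<H>_hom(1)[OF h]]
    by (simp add: lin_add[of \<H> \<H>] lin_smult[of \<H> \<H>] cvs_closed \<H>_cvs)
  also have "\<dots> = wt \<gamma> h \<odot>\<^bsub>\<H>\<^esub> half_sum \<eta> i"
    unfolding w half_sum_def using e
  proof (elim disjE)
    assume 1: "?e = 1"
    show "(1/2) \<odot>\<^bsub>\<H>\<^esub> ?s (?e * (- 1)) \<oplus>\<^bsub>\<H>\<^esub> (\<eta>/2) \<odot>\<^bsub>\<H>\<^esub> ?s (?e * 1) =
      (if \<eta> = 1 then 1 else ?e) \<odot>\<^bsub>\<H>\<^esub> ((1/2) \<odot>\<^bsub>\<H>\<^esub> ?s (- 1) \<oplus>\<^bsub>\<H>\<^esub> (\<eta>/2) \<odot>\<^bsub>\<H>\<^esub> ?s 1)"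
      unfolding 1 using s \<H>_cvs by (simp add: cvs_simps)
  next
    assume 1: "?e = - 1"
    show "(1/2) \<odot>\<^bsub>\<H>\<^esub> ?s (?e * (- 1)) \<oplus>\<^bsub>\<H>\<^esub> (\<eta>/2) \<odot>\<^bsub>\<H>\<^esub> ?s (?e * 1) =
      (if \<eta> = 1 then 1 else ?e) \<odot>\<^bsub>\<H>\<^esub> ((1/2) \<odot>\<^bsub>\<H>\<^esub> ?s (- 1) \<oplus>\<^bsub>\<H>\<^esub> (\<eta>/2) \<odot>\<^bsub>\<H>\<^esub> ?s 1)"
      unfolding 1 using s \<H>_cvs \<eta> cvs_comm[OF \<H>_cvs]
      by (auto simp: cvs_simps)
  qed
  finally show "T\<H> h (half_sum \<eta> i) = wt \<gamma> h \<odot>\<^bsub>\<H>\<^esub> half_sum \<eta> i" .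
qed

lemma s_bar_half_sums:
  assumes i: "Suc i < n"
  shows "\<iota> (G_gen (s_refl n i (Suc i) (- 1))) = half_sum 1 i \<oplus>\<^bsub>\<H>\<^esub> half_sum (- 1) i"
proof -
  let ?s = "\<lambda>\<epsilon>. \<iota> (G_gen (s_refl n i (Suc i) \<epsilon>))"
  have s: "?s 1 \<in> carrier \<H>" "?s (- 1) \<in> carrier \<H>"
    using s_refl_closed[OF i] by (simp_all add: \<iota>_closed)
  note c = cvs_smult[OF \<H>_cvs]
  have "half_sum 1 i \<oplus>\<^bsub>\<H>\<^esub> half_sum (- 1) i =
     ((1/2) \<odot>\<^bsub>\<H>\<^esub> ?s (- 1) \<oplus>\<^bsub>\<H>\<^esub> (1/2) \<odot>\<^bsub>\<H>\<^esub> ?s (- 1)) \<oplus>\<^bsub>\<H>\<^esub> ((1/2) \<odot>\<^bsub>\<H>\<^esub> ?s 1 \<oplus>\<^bsub>\<H>\<^esub> (- 1/2) \<odot>\<^bsub>\<H>\<^esub> ?s 1)"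
    unfolding half_sum_def using s \<H>_cvs by (simp add: cvs_ac c cvs_add)
  also have "\<dots> = (1/2 + 1/2) \<odot>\<^bsub>\<H>\<^esub> ?s (- 1) \<oplus>\<^bsub>\<H>\<^esub> (1/2 + - 1/2) \<odot>\<^bsub>\<H>\<^esub> ?s 1"
    unfolding cvs_add_smult[OF \<H>_cvs s(1)] cvs_add_smult[OF \<H>_cvs s(2)] ..
  finally show ?thesis using s \<H>_cvs by (simp add: cvs_simps)
qed

text \<open>
  Products of homogeneous elements are homogeneous, so it suffices that generators are sums of homogeneous
  ones. For the group this needs only the diagonal elements and the reflections with parameter \<open>- 1\<close>, which
  are sums of the two elements \<open>half_sum\<close>.
\<close>

lemma weight_span: "carrier \<H> \<subseteq> lspan \<H> {a. \<exists>\<alpha>. weight_vec n \<H> T\<H> \<alpha> a}" (is "_ \<subseteq> lspan \<H> ?H")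
proof
  fix a assume a: "a \<in> carrier \<H>"
  have H: "?H \<subseteq> carrier \<H>" by (auto simp: weight_vec_def)
  have mult: "g \<otimes>\<^bsub>\<H>\<^esub> h \<in> lspan \<H> ?H" if gh: "g \<in> ?H" "h \<in> ?H" for g h
  proof -
    from gh obtain \<alpha> \<beta> where ab: "weight_vec n \<H> T\<H> \<alpha> g" "weight_vec n \<H> T\<H> \<beta> h" by blast
    have "weight_vec n \<H> T\<H> (symdiff \<alpha> \<beta>) (g \<otimes>\<^bsub>\<H>\<^esub> h)"
      by (rule weight_vec_product[OF P.calg_P T\<H>_mult ab])
    then show ?thesis by (blast intro: lspan.base)
  qed
  have one: "\<one>\<^bsub>\<H>\<^esub> \<in> lspan \<H> ?H"
  proof -
    have "weight_vec n \<H> T\<H> {} \<one>\<^bsub>\<H>\<^esub>" by (rule weight_vec_unit[OF P.calg_P]) (rule T\<H>_one)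
    then show ?thesis by (blast intro: lspan.base)
  qed
  have G: "W \<subseteq> {g. \<iota> (G_gen g) \<in> lspan \<H> ?H}"
  proof (rule W.monomial_group_generated)
    fix i assume i: "Suc i < n"
    let ?v = "\<lambda>b. if b = i then inverse (- 1) else if b = Suc i then - 1 else (1::complex)"
    have "\<iota> (G_gen (s_refl n i (Suc i) (- 1))) \<in> lspan \<H> ?H"
      unfolding s_bar_half_sums[OF i]
      using weight_vec_half_sum[OF i, of 1] weight_vec_half_sum[OF i, of "- 1"]
      by (intro lspan.add lspan.base) blast+
    moreover have "s_refl n i (Suc i) (- 1) = mono_mat n (Transposition.transpose i (Suc i)) ?v"
      by (rule s_refl_mono) simp
    moreover have "?v \<in> sign_vec n" by (simp add: sign_vec_def)
    ultimately show "\<exists>s\<in>sign_vec n. mono_mat n (Transposition.transpose i (Suc i)) s \<in> {g. \<iota> (G_gen g) \<in> lspan \<H> ?H} \<inter> W"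
      using s_refl_closed[OF i, of "- 1"] by (intro bexI[of _ ?v]) auto
  next
    fix g h assume "g \<in> {g. \<iota> (G_gen g) \<in> lspan \<H> ?H}" "h \<in> {g. \<iota> (G_gen g) \<in> lspan \<H> ?H}" "g \<in> W" "h \<in> W"
    then show "g * h \<in> {g. \<iota> (G_gen g) \<in> lspan \<H> ?H}"
      using lspan_mult[OF P.calg_P H mult, of "\<iota> (G_gen g)" "\<iota> (G_gen h)"] group_mult[of g h] by simp
  next
    show "W \<inter> sign_diag n \<subseteq> {g. \<iota> (G_gen g) \<in> lspan \<H> ?H}"
      using weight_vec_diag by (blast intro: lspan.base)
  qed
  have gens: "\<iota> ` gens n W \<subseteq> lspan \<H> ?H"
  proof
    fix x assume "x \<in> \<iota> ` gens n W"
    then obtain s where s: "s \<in> gens n W" "x = \<iota> s" by blast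
    then show "x \<in> lspan \<H> ?H"
    proof (cases s)
      case (X_gen i)
      then have "weight_vec n \<H> T\<H> {i} x" using s weight_vec_X by simp
      then show ?thesis by (blast intro: lspan.base)
    next
      case (Y_gen i)
      then have "weight_vec n \<H> T\<H> {i} x" using s weight_vec_Y by simp
      then show ?thesis by (blast intro: lspan.base)
    next
      case (G_gen g)
      then show ?thesis using G s by auto
    qed
  qed
  show "a \<in> lspan \<H> ?H"
    by (rule agen_lspan[OF P.calg_P H _ one gens P.carrier_agen[OF a]]) (rule mult)
qed

end

section \<open>The intertwiner on the group algebra\<close>

abbreviation GA :: "nat \<Rightarrow> (complex, complex mat \<Rightarrow>\<^sub>0 complex) module" where
  "GA n \<equiv> monoid_alg (B_group n)"

lemma calg_GA: "calg (GA n)"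
  by (rule calg_monoid_alg) (use group_B_group in \<open>simp add: Group.group_def\<close>)

lemma GA_single_mult: "Poly_Mapping.single g a \<otimes>\<^bsub>GA n\<^esub> Poly_Mapping.single h b = Poly_Mapping.single (g * h) (a * b)"
  by (simp add: monoid_alg_single_mult B_group_simps)

lemmas GA_bilinear = monoid_alg_l_distr monoid_alg_r_distr monoid_alg_zero_mult monoid_alg_smult_l monoid_alg_smult_r GA_single_mult

lemma GA_carrier: "F \<in> carrier (GA n) \<longleftrightarrow> Poly_Mapping.keys F \<subseteq> Gmpn 2 1 n"
  by (simp add: B_group_simps)

lemma GA_commute:
  assumes "Poly_Mapping.keys F \<subseteq> K" "Poly_Mapping.keys G \<subseteq> L"
    and "\<And>g h. g \<in> K \<Longrightarrow> h \<in> L \<Longrightarrow> g * h = h * g"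
  shows "F \<otimes>\<^bsub>GA n\<^esub> G = G \<otimes>\<^bsub>GA n\<^esub> F"
  using assms(1)
proof (induct rule: poly_mapping_keys_induct)
  case (single g c F)
  have "Poly_Mapping.single g c \<otimes>\<^bsub>GA n\<^esub> G = G \<otimes>\<^bsub>GA n\<^esub> Poly_Mapping.single g c"
    using assms(2) by (induct rule: poly_mapping_keys_induct)
      (simp_all add: GA_bilinear assms(3)[OF single(1)] mult.commute)
  then show ?case using single by (simp add: GA_bilinear)
qed (simp add: GA_bilinear)

text \<open>
  This element of \<open>\<complex>T\<close> acts by \<open>1\<close> and by \<open>\<zeta>\<^sup>k\<close> on the eigenspaces of \<open>t\<^sub>k\<close> for the eigenvalues
  \<open>1\<close> and \<open>- 1\<close>.
\<close>

definition eigen_elt :: "nat \<Rightarrow> complex \<Rightarrow> nat \<Rightarrow> (complex mat \<Rightarrow>\<^sub>0 complex)" where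
  "eigen_elt n \<zeta> k = Poly_Mapping.single (1\<^sub>m n) ((1 + \<zeta> ^ k) / 2) + Poly_Mapping.single (t_refl n k) ((1 - \<zeta> ^ k) / 2)"

text \<open>
  For \<open>\<zeta> = - \<i>\<close> and \<open>k = n\<close> this is the element \<open>\<theta>\<close> that compares the two actions on \<open>\<tau>\<close>; its inverse
  belongs to \<open>\<zeta> = \<i>\<close>.
\<close>

primrec twist_prod :: "nat \<Rightarrow> complex \<Rightarrow> nat \<Rightarrow> (complex mat \<Rightarrow>\<^sub>0 complex)" where
  "twist_prod n \<zeta> 0 = Poly_Mapping.single (1\<^sub>m n) 1"
| "twist_prod n \<zeta> (Suc k) = twist_prod n \<zeta> k \<otimes>\<^bsub>GA n\<^esub> eigen_elt n \<zeta> k"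

lemma keys_eigen_elt: "Poly_Mapping.keys (eigen_elt n \<zeta> k) \<subseteq> sign_diag n"
  unfolding eigen_elt_def by (intro keys_le sign_diag_one sign_diag_t)

lemma keys_mult_sign_diag:
  assumes "Poly_Mapping.keys F \<subseteq> sign_diag n" "Poly_Mapping.keys G \<subseteq> sign_diag n"
  shows "Poly_Mapping.keys (F \<otimes>\<^bsub>GA n\<^esub> G) \<subseteq> sign_diag n"
  unfolding monoid_alg_mult
  by (intro keys_le) (use assms in \<open>auto simp: B_group_simps intro: sign_diag_mult\<close>)

lemma keys_twist_prod: "Poly_Mapping.keys (twist_prod n \<zeta> k) \<subseteq> sign_diag n"
proof (induct k)
  case 0
  show ?case unfolding twist_prod.simps by (intro keys_le sign_diag_one)
next
  case (Suc k)
  then show ?case unfolding twist_prod.simps by (rule keys_mult_sign_diag[OF _ keys_eigen_elt])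
qed

lemma sign_diag_GA: "Poly_Mapping.keys F \<subseteq> sign_diag n \<Longrightarrow> F \<in> carrier (GA n)"
  unfolding GA_carrier using sign_diag_B by blast

lemmas eigen_elt_GA = sign_diag_GA[OF keys_eigen_elt]
lemmas twist_prod_GA = sign_diag_GA[OF keys_twist_prod]

lemma diag_GA_commute:
  "Poly_Mapping.keys F \<subseteq> sign_diag n \<Longrightarrow> Poly_Mapping.keys G \<subseteq> sign_diag n \<Longrightarrow> F \<otimes>\<^bsub>GA n\<^esub> G = G \<otimes>\<^bsub>GA n\<^esub> F"
  by (rule GA_commute) (auto intro: sign_diag_comm)

lemma t_sq: "t_refl n k * t_refl n k = 1\<^sub>m n"
  by (rule sign_diag_sq[OF sign_diag_t])

lemma t_carrier: "t_refl n k \<in> carrier_mat n n"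
  by (rule sign_diag_carrier[OF sign_diag_t])

lemma eigen_elt_inverse:
  assumes "\<zeta> * \<zeta>' = 1"
  shows "eigen_elt n \<zeta> k \<otimes>\<^bsub>GA n\<^esub> eigen_elt n \<zeta>' k = Poly_Mapping.single (1\<^sub>m n) 1"
proof -
  have z: "\<zeta> ^ k * \<zeta>' ^ k = 1" using assms by (simp add: power_mult_distrib[symmetric])
  let ?a = "(1 + \<zeta> ^ k) / 2" and ?b = "(1 - \<zeta> ^ k) / 2" and ?a' = "(1 + \<zeta>' ^ k) / 2" and ?b' = "(1 - \<zeta>' ^ k) / 2"
  have "eigen_elt n \<zeta> k \<otimes>\<^bsub>GA n\<^esub> eigen_elt n \<zeta>' k =
      Poly_Mapping.single (1\<^sub>m n) (?a * ?a' + ?b * ?b') + Poly_Mapping.single (t_refl n k) (?a * ?b' + ?b * ?a')"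
    using t_carrier[of n k] by (simp add: eigen_elt_def GA_bilinear t_sq single_add add_ac)
  moreover have "?a * ?a' + ?b * ?b' = 1" using z by (simp add: field_simps)
  moreover have "?a * ?b' + ?b * ?a' = 0" using z by (simp add: field_simps)
  ultimately show ?thesis by simp
qed

lemma twist_prod_inverse:
  assumes "\<zeta> * \<zeta>' = 1"
  shows "twist_prod n \<zeta> k \<otimes>\<^bsub>GA n\<^esub> twist_prod n \<zeta>' k = Poly_Mapping.single (1\<^sub>m n) 1"
proof (induct k)
  case 0
  show ?case by (simp add: GA_bilinear)
next
  case (Suc k)
  let ?F = "twist_prod n \<zeta> k" and ?F' = "twist_prod n \<zeta>' k" and ?e = "eigen_elt n \<zeta> k" and ?e' = "eigen_elt n \<zeta>' k"
  note c = twist_prod_GA[of n \<zeta> k] twist_prod_GA[of n \<zeta>' k] eigen_elt_GA[of n \<zeta> k] eigen_elt_GA[of n \<zeta>' k]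
  note m = calg_mult[OF calg_GA] and as = calg_assoc[OF calg_GA]
  have "(?F \<otimes>\<^bsub>GA n\<^esub> ?e) \<otimes>\<^bsub>GA n\<^esub> (?F' \<otimes>\<^bsub>GA n\<^esub> ?e') = ?F \<otimes>\<^bsub>GA n\<^esub> ((?e \<otimes>\<^bsub>GA n\<^esub> ?F') \<otimes>\<^bsub>GA n\<^esub> ?e')"
    by (simp only: as c m)
  also have "?e \<otimes>\<^bsub>GA n\<^esub> ?F' = ?F' \<otimes>\<^bsub>GA n\<^esub> ?e" by (rule diag_GA_commute[OF keys_eigen_elt keys_twist_prod])
  also have "?F \<otimes>\<^bsub>GA n\<^esub> ((?F' \<otimes>\<^bsub>GA n\<^esub> ?e) \<otimes>\<^bsub>GA n\<^esub> ?e') = (?F \<otimes>\<^bsub>GA n\<^esub> ?F') \<otimes>\<^bsub>GA n\<^esub> (?e \<otimes>\<^bsub>GA n\<^esub> ?e')"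
    by (simp only: as c m)
  also have "\<dots> = Poly_Mapping.single (1\<^sub>m n) 1"
    unfolding Suc eigen_elt_inverse[OF assms] by (simp add: GA_bilinear)
  finally show ?case by simp
qed

text \<open>
  The homogeneous components of a reflection, this time in the group algebra.
\<close>

definition refl_elt :: "nat \<Rightarrow> complex \<Rightarrow> nat \<Rightarrow> (complex mat \<Rightarrow>\<^sub>0 complex)" where
  "refl_elt n \<eta> i = Poly_Mapping.single (s_refl n i (Suc i) (- 1)) (1/2) + Poly_Mapping.single (s_refl n i (Suc i) 1) (\<eta>/2)"

lemma refl_elt_GA: "Suc i < n \<Longrightarrow> refl_elt n \<eta> i \<in> carrier (GA n)"
  unfolding refl_elt_def GA_carrier by (intro keys_le s_refl_W) auto

lemma refl_elt_eigen_elt_commute: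
  assumes i: "Suc i < n" and k: "k \<noteq> i" "k \<noteq> Suc i"
  shows "refl_elt n \<eta> i \<otimes>\<^bsub>GA n\<^esub> eigen_elt n \<zeta> k = eigen_elt n \<zeta> k \<otimes>\<^bsub>GA n\<^esub> refl_elt n \<eta> i"
proof -
  have c: "s_refl n i (Suc i) \<epsilon> \<in> carrier_mat n n" for \<epsilon> by (simp add: s_refl_def)
  show ?thesis
    unfolding refl_elt_def eigen_elt_def
    using s_refl_t_commute[OF i k, of 1] s_refl_t_commute[OF i k, of "- 1"] c[of 1] c[of "- 1"]
    by (simp add: GA_bilinear add_ac mult.commute)
qed

text \<open>
  Up to a reflection and a sign, \<open>refl_elt n \<eta> i\<close> is the projection to the part on which \<open>t\<^sub>i t\<^sub>i\<^sub>+\<^sub>1 = \<eta>\<close>.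
  For \<open>\<eta> = 1\<close> the two eigenvalues agree and exchanging them does not change the value of \<open>Q\<close>. For
  \<open>\<eta> = - 1\<close> and \<open>\<zeta> = \<i>\<close> the eigenvalue \<open>- 1\<close> sits in place \<open>i\<close> or \<open>i + 1\<close>, where \<open>Q\<close> has the
  values \<open>\<zeta>\<^sup>i\<close> and \<open>\<zeta>\<^sup>i \<i>\<close>. The exchange multiplies this value by \<open>\<i>\<close> in the first case and by
  \<open>- \<i>\<close> in the second, that is, by \<open>- \<i>\<close> times the original eigenvalue of \<open>t\<^sub>i\<close>.
\<close>

lemma refl_elt_eigen_pair:
  fixes n i :: nat and \<zeta> :: complex
  assumes i: "Suc i < n"
  defines "Q \<equiv> eigen_elt n \<zeta> i \<otimes>\<^bsub>GA n\<^esub> eigen_elt n \<zeta> (Suc i)"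
  shows "refl_elt n 1 i \<otimes>\<^bsub>GA n\<^esub> Q = Q \<otimes>\<^bsub>GA n\<^esub> refl_elt n 1 i"
    and "\<zeta> = \<i> \<Longrightarrow> pscale (- \<i>) (refl_elt n (- 1) i \<otimes>\<^bsub>GA n\<^esub> (Q \<otimes>\<^bsub>GA n\<^esub> grp (t_refl n i))) = Q \<otimes>\<^bsub>GA n\<^esub> refl_elt n (- 1) i"
proof -
  define s where "s = s_refl n i (Suc i) 1"
  define sb where "sb = s_refl n i (Suc i) (- 1)"
  define t where "t = t_refl n i"
  define t' where "t' = t_refl n (Suc i)"
  have c: "s \<in> carrier_mat n n" "sb \<in> carrier_mat n n" "t \<in> carrier_mat n n" "t' \<in> carrier_mat n n"
    by (simp_all add: s_def sb_def t_def t'_def t_carrier) (simp_all add: s_refl_def)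
  note as = assoc_mult_mat[of _ n n _ n _ n]
  have r: "t * s = s * t'" "t' * s = s * t" "sb = s * (t * t')"
    using s_refl_adjacent_mult[OF i] by (simp_all add: s_def sb_def t_def t'_def)
  have q: "t * t = 1\<^sub>m n" "t' * t' = 1\<^sub>m n" "t' * t = t * t'"
    using t_sq sign_diag_comm[OF sign_diag_t sign_diag_t] by (simp_all add: t_def t'_def)
  have cc: "t * t' \<in> carrier_mat n n" using c by auto
  have tt: "t * (t * t') = t'" "t' * (t * t') = t" "(t * t') * (t * t') = 1\<^sub>m n"
  proof -
    show 1: "t * (t * t') = t'" using c q(1) as[of t t t'] by simp
    have "t' * (t * t') = (t' * t) * t'" using c as[of t' t t'] by simp
    also have "\<dots> = t * (t' * t')" unfolding q(3) using c as[of t t' t'] by simp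
    finally show 2: "t' * (t * t') = t" using q(2) c by simp
    have "(t * t') * (t * t') = t * (t' * (t * t'))" using c cc as[of t t' "t * t'"] by simp
    then show "(t * t') * (t * t') = 1\<^sub>m n" unfolding 2 q(1) .
  qed
  have L: "sb * t = s * t'" "sb * t' = s * t" "sb * (t * t') = s"
  proof -
    have "sb * t = s * (t' * (t * t) * 1\<^sub>m n)"
      unfolding r(3) using c cc q as[of s "t * t'" t] as[of t t' t] as[of t' t t] tt by simp
    then show "sb * t = s * t'" using c q by simp
    show "sb * t' = s * t"
      unfolding r(3) using c cc q as[of s "t * t'" t'] as[of t t' t'] by simp
    show "sb * (t * t') = s"
      unfolding r(3) using c cc tt(3) as[of s "t * t'" "t * t'"] by simp
  qed
  have R: "t * sb = s * t" "t' * sb = s * t'" "(t * t') * s = sb" "(t * t') * sb = s"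
  proof -
    have "t * sb = s * t' * (t * t')" unfolding r(3) using c cc as[of t s "t * t'"] r(1) by simp
    also have "\<dots> = s * t" using c cc as[of s t' "t * t'"] tt(2) by simp
    finally show 1: "t * sb = s * t" .
    have "t' * sb = s * t * (t * t')" unfolding r(3) using c cc as[of t' s "t * t'"] r(2) by simp
    also have "\<dots> = s * t'" using c cc as[of s t "t * t'"] tt(1) by simp
    finally show 2: "t' * sb = s * t'" .
    have "(t * t') * s = t * s * t" using c as[of t t' s] as[of t s t] r(2) by simp
    also have "\<dots> = s * (t' * t)" unfolding r(1) using c as[of s t' t] by simp
    finally show 3: "(t * t') * s = sb" unfolding r(3) q(3) .
    have "(t * t') * sb = t * (s * t')" using c as[of t t' sb] 2 by simp
    also have "\<dots> = s * t' * t'" using c as[of t s t'] r(1) by simp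
    finally show "(t * t') * sb = s" using c as[of s t' t'] q(2) by simp
  qed
  have X: "s * t * t = s" "s * t' * t = sb" "sb * t = s * t'"
    using c q as[of s t t] as[of s t' t] r(3) L(1) by simp_all
  \<comment> \<open>All products are expanded in the basis \<open>1\<close>, \<open>t\<close>, \<open>t'\<close>, \<open>t t'\<close> of the diagonal part and the basis
    \<open>s\<close>, \<open>s t\<close>, \<open>s t'\<close>, \<open>s t t'\<close> of its translate by \<open>s\<close>.\<close>
  let ?Q = "\<lambda>x0 x1 x2 x3. Poly_Mapping.single (1\<^sub>m n) x0 + Poly_Mapping.single t x1 + Poly_Mapping.single t' x2
     + Poly_Mapping.single (t * t') x3 :: complex mat \<Rightarrow>\<^sub>0 complex"
  let ?G = "\<lambda>x0 x1 x2 x3. Poly_Mapping.single s x0 + Poly_Mapping.single (s * t) x1 + Poly_Mapping.single (s * t') x2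
     + Poly_Mapping.single sb x3 :: complex mat \<Rightarrow>\<^sub>0 complex"
  let ?u = "\<lambda>\<eta>. Poly_Mapping.single sb (1/2) + Poly_Mapping.single s (\<eta>/2) :: complex mat \<Rightarrow>\<^sub>0 complex"
  have uQ: "?u \<eta> \<otimes>\<^bsub>GA n\<^esub> ?Q x0 x1 x2 x3 = ?G (x3/2 + \<eta> * x0/2) (x2/2 + \<eta> * x1/2) (x1/2 + \<eta> * x2/2) (x0/2 + \<eta> * x3/2)" for \<eta> x0 x1 x2 x3
    using c cc by (simp add: GA_bilinear L r(3)[symmetric] single_add add_ac)
  have Qu: "?Q x0 x1 x2 x3 \<otimes>\<^bsub>GA n\<^esub> ?u \<eta> = ?G (x3/2 + \<eta> * x0/2) (x1/2 + \<eta> * x2/2) (x2/2 + \<eta> * x1/2) (x0/2 + \<eta> * x3/2)" for \<eta> x0 x1 x2 x3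
    using c cc by (simp add: GA_bilinear R r(1,2) single_add add_ac mult.commute)
  have Gt: "?G x0 x1 x2 x3 \<otimes>\<^bsub>GA n\<^esub> grp t = ?G x1 x0 x3 x2" for x0 x1 x2 x3
    using c cc by (simp add: GA_bilinear X add_ac)
  have pG: "pscale y (?G x0 x1 x2 x3) = ?G (y * x0) (y * x1) (y * x2) (y * x3)" for y x0 x1 x2 x3
    by (simp add: pscale_simps)
  define z where "z = \<zeta> ^ i"
  let ?a = "(1 + z) / 2" and ?b = "(1 - z) / 2" and ?a' = "(1 + \<zeta> * z) / 2" and ?b' = "(1 - \<zeta> * z) / 2"
  have Q: "Q = ?Q (?a * ?a') (?b * ?a') (?a * ?b') (?b * ?b')"
    unfolding Q_def eigen_elt_def t_def[symmetric] t'_def[symmetric] power_Suc z_def[symmetric]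
    using c by (simp add: GA_bilinear add_ac mult.commute)
  have u: "refl_elt n \<eta> i = ?u \<eta>" for \<eta> by (simp add: refl_elt_def s_def sb_def)
  show "refl_elt n 1 i \<otimes>\<^bsub>GA n\<^esub> Q = Q \<otimes>\<^bsub>GA n\<^esub> refl_elt n 1 i"
    unfolding Q u uQ Qu by (simp add: add.commute)
  assume \<zeta>: "\<zeta> = \<i>"
  have uc: "?u (- 1) \<in> carrier (GA n)" using refl_elt_GA[OF i, of "- 1"] unfolding u .
  have Qc: "Q \<in> carrier (GA n)" unfolding Q_def by (intro calg_mult[OF calg_GA] eigen_elt_GA)
  have tc: "grp t \<in> carrier (GA n)" by (rule sign_diag_GA) (simp add: t_def sign_diag_t)
  have co: "- \<i> * (?a * ?b' / 2 + - 1 * (?b * ?a') / 2) = ?b * ?b' / 2 + - 1 * (?a * ?a') / 2"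
    "- \<i> * (?b * ?b' / 2 + - 1 * (?a * ?a') / 2) = ?b * ?a' / 2 + - 1 * (?a * ?b') / 2"
    "- \<i> * (?a * ?a' / 2 + - 1 * (?b * ?b') / 2) = ?a * ?b' / 2 + - 1 * (?b * ?a') / 2"
    "- \<i> * (?b * ?a' / 2 + - 1 * (?a * ?b') / 2) = ?a * ?a' / 2 + - 1 * (?b * ?b') / 2"
    unfolding \<zeta> by (simp_all add: field_simps)
  have "pscale (- \<i>) (?u (- 1) \<otimes>\<^bsub>GA n\<^esub> (Q \<otimes>\<^bsub>GA n\<^esub> grp t)) = pscale (- \<i>) ((?u (- 1) \<otimes>\<^bsub>GA n\<^esub> Q) \<otimes>\<^bsub>GA n\<^esub> grp t)"
    by (simp only: calg_assoc[OF calg_GA uc Qc tc])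
  also have "\<dots> = Q \<otimes>\<^bsub>GA n\<^esub> ?u (- 1)"
    unfolding Q uQ Qu Gt pG co ..
  finally show "pscale (- \<i>) (refl_elt n (- 1) i \<otimes>\<^bsub>GA n\<^esub> (Q \<otimes>\<^bsub>GA n\<^esub> grp (t_refl n i))) = Q \<otimes>\<^bsub>GA n\<^esub> refl_elt n (- 1) i"
    unfolding u t_def .
qed

text \<open>
  Only the factors with indices \<open>i\<close> and \<open>i + 1\<close> fail to commute with a reflection in these two
  coordinates, and those are treated in \<open>refl_elt_eigen_pair\<close>.
\<close>

lemma refl_elt_twist_prod:
  assumes i: "Suc i < n" and k: "Suc (Suc i) \<le> k"
  shows "refl_elt n 1 i \<otimes>\<^bsub>GA n\<^esub> twist_prod n \<zeta> k = twist_prod n \<zeta> k \<otimes>\<^bsub>GA n\<^esub> refl_elt n 1 i"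
    and "pscale (- \<i>) (refl_elt n (- 1) i \<otimes>\<^bsub>GA n\<^esub> (twist_prod n \<i> k \<otimes>\<^bsub>GA n\<^esub> grp (t_refl n i))) = twist_prod n \<i> k \<otimes>\<^bsub>GA n\<^esub> refl_elt n (- 1) i"
proof -
  note uc = refl_elt_GA[OF i] and Fc = twist_prod_GA and ec = eigen_elt_GA
  note m = calg_mult[OF calg_GA] and as = calg_assoc[OF calg_GA]
  have tk: "Poly_Mapping.keys (grp (t_refl n i)) \<subseteq> sign_diag n" by (simp add: sign_diag_t)
  note tc = sign_diag_GA[OF tk]
  have small: "refl_elt n \<eta> i \<otimes>\<^bsub>GA n\<^esub> twist_prod n \<zeta> j = twist_prod n \<zeta> j \<otimes>\<^bsub>GA n\<^esub> refl_elt n \<eta> i"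
    if "j \<le> i" for \<eta> \<zeta> j
    using that
  proof (induct j)
    case 0
    show ?case using uc[of \<eta>] calg_l_one[OF calg_GA uc] calg_r_one[OF calg_GA uc] by (simp add: B_group_simps)
  next
    case (Suc j)
    have "refl_elt n \<eta> i \<otimes>\<^bsub>GA n\<^esub> twist_prod n \<zeta> (Suc j) = (refl_elt n \<eta> i \<otimes>\<^bsub>GA n\<^esub> twist_prod n \<zeta> j) \<otimes>\<^bsub>GA n\<^esub> eigen_elt n \<zeta> j"
      by (simp only: twist_prod.simps as uc Fc ec)
    also have "\<dots> = twist_prod n \<zeta> j \<otimes>\<^bsub>GA n\<^esub> (refl_elt n \<eta> i \<otimes>\<^bsub>GA n\<^esub> eigen_elt n \<zeta> j)"
      using Suc by (simp only: as uc Fc ec)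
    also have "refl_elt n \<eta> i \<otimes>\<^bsub>GA n\<^esub> eigen_elt n \<zeta> j = eigen_elt n \<zeta> j \<otimes>\<^bsub>GA n\<^esub> refl_elt n \<eta> i"
      by (rule refl_elt_eigen_elt_commute[OF i]) (use Suc in auto)
    finally show ?case by (simp only: twist_prod.simps as uc Fc ec)
  qed
  have F2: "twist_prod n \<zeta> (Suc (Suc i)) = twist_prod n \<zeta> i \<otimes>\<^bsub>GA n\<^esub> (eigen_elt n \<zeta> i \<otimes>\<^bsub>GA n\<^esub> eigen_elt n \<zeta> (Suc i))" for \<zeta>
    by (simp only: twist_prod.simps as Fc ec)
  let ?q = "\<lambda>\<zeta>. eigen_elt n \<zeta> i \<otimes>\<^bsub>GA n\<^esub> eigen_elt n \<zeta> (Suc i)"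
  have qc: "?q \<zeta> \<in> carrier (GA n)" for \<zeta> by (intro m ec)
  show "refl_elt n 1 i \<otimes>\<^bsub>GA n\<^esub> twist_prod n \<zeta> k = twist_prod n \<zeta> k \<otimes>\<^bsub>GA n\<^esub> refl_elt n 1 i"
    using k
  proof (induct k rule: dec_induct)
    case base
    have "refl_elt n 1 i \<otimes>\<^bsub>GA n\<^esub> twist_prod n \<zeta> (Suc (Suc i)) = (refl_elt n 1 i \<otimes>\<^bsub>GA n\<^esub> twist_prod n \<zeta> i) \<otimes>\<^bsub>GA n\<^esub> ?q \<zeta>"
      by (simp only: F2 as uc Fc qc)
    also have "\<dots> = twist_prod n \<zeta> i \<otimes>\<^bsub>GA n\<^esub> (refl_elt n 1 i \<otimes>\<^bsub>GA n\<^esub> ?q \<zeta>)"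
      unfolding small[OF order_refl] by (simp only: as uc Fc qc)
    also have "\<dots> = twist_prod n \<zeta> (Suc (Suc i)) \<otimes>\<^bsub>GA n\<^esub> refl_elt n 1 i"
      unfolding refl_elt_eigen_pair(1)[OF i] F2 by (rule as[OF Fc qc uc, symmetric])
    finally show ?case .
  next
    case (step k)
    have "refl_elt n 1 i \<otimes>\<^bsub>GA n\<^esub> twist_prod n \<zeta> (Suc k) = (refl_elt n 1 i \<otimes>\<^bsub>GA n\<^esub> twist_prod n \<zeta> k) \<otimes>\<^bsub>GA n\<^esub> eigen_elt n \<zeta> k"
      by (simp only: twist_prod.simps as uc Fc ec)
    also have "\<dots> = twist_prod n \<zeta> k \<otimes>\<^bsub>GA n\<^esub> (refl_elt n 1 i \<otimes>\<^bsub>GA n\<^esub> eigen_elt n \<zeta> k)"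
      unfolding step(3) by (rule as[OF Fc uc ec])
    also have "refl_elt n 1 i \<otimes>\<^bsub>GA n\<^esub> eigen_elt n \<zeta> k = eigen_elt n \<zeta> k \<otimes>\<^bsub>GA n\<^esub> refl_elt n 1 i"
      by (rule refl_elt_eigen_elt_commute[OF i]) (use step in auto)
    finally show ?case by (simp only: twist_prod.simps as uc Fc ec)
  qed
  let ?w = "refl_elt n (- 1) i" and ?t = "grp (t_refl n i)"
  show "pscale (- \<i>) (?w \<otimes>\<^bsub>GA n\<^esub> (twist_prod n \<i> k \<otimes>\<^bsub>GA n\<^esub> ?t)) = twist_prod n \<i> k \<otimes>\<^bsub>GA n\<^esub> ?w"
    using k
  proof (induct k rule: dec_induct)
    case base
    have "?w \<otimes>\<^bsub>GA n\<^esub> (twist_prod n \<i> (Suc (Suc i)) \<otimes>\<^bsub>GA n\<^esub> ?t) = (?w \<otimes>\<^bsub>GA n\<^esub> twist_prod n \<i> i) \<otimes>\<^bsub>GA n\<^esub> (?q \<i> \<otimes>\<^bsub>GA n\<^esub> ?t)"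
      by (simp only: F2 as uc Fc qc tc m)
    also have "\<dots> = twist_prod n \<i> i \<otimes>\<^bsub>GA n\<^esub> (?w \<otimes>\<^bsub>GA n\<^esub> (?q \<i> \<otimes>\<^bsub>GA n\<^esub> ?t))"
      unfolding small[OF order_refl] by (simp only: as uc Fc qc tc m)
    finally have "pscale (- \<i>) (?w \<otimes>\<^bsub>GA n\<^esub> (twist_prod n \<i> (Suc (Suc i)) \<otimes>\<^bsub>GA n\<^esub> ?t)) =
        twist_prod n \<i> i \<otimes>\<^bsub>GA n\<^esub> pscale (- \<i>) (?w \<otimes>\<^bsub>GA n\<^esub> (?q \<i> \<otimes>\<^bsub>GA n\<^esub> ?t))"
      by (simp only: monoid_alg_smult_r)
    then show ?case
      unfolding refl_elt_eigen_pair(2)[OF i refl] F2 by (simp only: as uc Fc qc)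
  next
    case (step k)
    have et: "eigen_elt n \<i> k \<otimes>\<^bsub>GA n\<^esub> ?t = ?t \<otimes>\<^bsub>GA n\<^esub> eigen_elt n \<i> k"
      by (rule diag_GA_commute[OF keys_eigen_elt tk])
    have "twist_prod n \<i> (Suc k) \<otimes>\<^bsub>GA n\<^esub> ?t = (twist_prod n \<i> k \<otimes>\<^bsub>GA n\<^esub> ?t) \<otimes>\<^bsub>GA n\<^esub> eigen_elt n \<i> k"
      by (simp only: twist_prod.simps as Fc ec tc et)
    then have "?w \<otimes>\<^bsub>GA n\<^esub> (twist_prod n \<i> (Suc k) \<otimes>\<^bsub>GA n\<^esub> ?t) =
        (?w \<otimes>\<^bsub>GA n\<^esub> (twist_prod n \<i> k \<otimes>\<^bsub>GA n\<^esub> ?t)) \<otimes>\<^bsub>GA n\<^esub> eigen_elt n \<i> k"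
      by (simp only: as uc Fc ec tc m)
    then have "pscale (- \<i>) (?w \<otimes>\<^bsub>GA n\<^esub> (twist_prod n \<i> (Suc k) \<otimes>\<^bsub>GA n\<^esub> ?t)) =
        pscale (- \<i>) (?w \<otimes>\<^bsub>GA n\<^esub> (twist_prod n \<i> k \<otimes>\<^bsub>GA n\<^esub> ?t)) \<otimes>\<^bsub>GA n\<^esub> eigen_elt n \<i> k"
      by (simp only: monoid_alg_smult_l)
    then have "pscale (- \<i>) (?w \<otimes>\<^bsub>GA n\<^esub> (twist_prod n \<i> (Suc k) \<otimes>\<^bsub>GA n\<^esub> ?t)) =
        (twist_prod n \<i> k \<otimes>\<^bsub>GA n\<^esub> ?w) \<otimes>\<^bsub>GA n\<^esub> eigen_elt n \<i> k"
      unfolding step(3) .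
    also have "\<dots> = twist_prod n \<i> k \<otimes>\<^bsub>GA n\<^esub> (?w \<otimes>\<^bsub>GA n\<^esub> eigen_elt n \<i> k)" by (rule as[OF Fc uc ec])
    also have "?w \<otimes>\<^bsub>GA n\<^esub> eigen_elt n \<i> k = eigen_elt n \<i> k \<otimes>\<^bsub>GA n\<^esub> ?w"
      by (rule refl_elt_eigen_elt_commute[OF i]) (use step in auto)
    finally show ?case by (simp only: twist_prod.simps as uc Fc ec)
  qed
qed

text \<open>
  The weights agree with those of the elements \<open>half_sum\<close> of the Cherednik algebra.
\<close>

lemma refl_elt_torus:
  assumes i: "Suc i < n" and h: "h \<in> sign_diag n" and \<eta>: "\<eta> = 1 \<and> \<gamma> = {} \<or> \<eta> = - 1 \<and> \<gamma> = {i, Suc i}"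
  shows "grp h \<otimes>\<^bsub>GA n\<^esub> refl_elt n \<eta> i = pscale (wt \<gamma> h) (refl_elt n \<eta> i \<otimes>\<^bsub>GA n\<^esub> grp h)"
proof -
  let ?s = "s_refl n i (Suc i)"
  let ?e = "h $$ (i, i) * h $$ (Suc i, Suc i)"
  have e: "?e = 1 \<or> ?e = - 1"
    using sign_diag_index[OF h, of i] sign_diag_index[OF h i] i by auto
  have w: "wt \<gamma> h = (if \<eta> = 1 then 1 else ?e)" using \<eta> by (auto simp: wt_def)
  have c: "?s \<epsilon> \<in> carrier_mat n n" for \<epsilon> by (simp add: s_refl_def)
  note hc = sign_diag_carrier[OF h]
  have hs: "h * ?s \<epsilon> = ?s (?e * \<epsilon>) * h" for \<epsilon>
  proof -
    have "?s (?e * \<epsilon>) * h = (h * ?s \<epsilon> * h) * h" using conj_s_refl[OF h, of i "Suc i" \<epsilon>] i by simp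
    also have "\<dots> = h * ?s \<epsilon> * (h * h)" using assoc_mult_mat[of "h * ?s \<epsilon>" n n h n h n] hc c[of \<epsilon>] by simp
    also have "\<dots> = h * ?s \<epsilon>" unfolding sign_diag_sq[OF h] using hc c[of \<epsilon>] by simp
    finally show ?thesis by simp
  qed
  show ?thesis
    unfolding refl_elt_def w using hs[of 1] hs[of "- 1"] e \<eta>
    by (elim disjE; simp add: GA_bilinear pscale_simps add.commute)
qed

section \<open>Twisted standard modules\<close>

(* Otherwise the group Gmpn 2 1 n is rewritten to a form that no longer matches the facts about it. *)
declare One_nat_def [simp del]

text \<open>
  The module \<open>\<tau>\<close>, the isomorphism \<open>\<phi>\<close> and the automorphism \<open>J\<close> by their values on generators, with an
  action \<open>\<rho>\<close> of all of \<open>\<complex>B\<^sub>n\<close> that supplies the action of the torus on \<open>\<tau>\<close>.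
\<close>

locale cherednik_twist = rational_cherednik p n c1 cm1 for p n c1 cm1 +
  fixes cb1 cbm1 :: complex and V :: "(complex, 'v) module"
    and \<tau> \<rho> :: "(complex mat \<Rightarrow>\<^sub>0 complex) \<Rightarrow> 'v \<Rightarrow> 'v"
    and J :: "(complex mat \<Rightarrow>\<^sub>0 complex) \<Rightarrow> (complex mat \<Rightarrow>\<^sub>0 complex)"
    and \<phi> :: "pres \<Rightarrow> pres"
  assumes \<tau>: "alg_module (monoid_alg (mat_group n (Gmpn 2 p n))) V \<tau>"
    and \<rho>: "alg_module (monoid_alg (B_group n)) V \<rho>"
    and \<rho>_extends: "\<forall>a\<in>carrier (monoid_alg (mat_group n (Gmpn 2 p n))). \<forall>v\<in>carrier V. \<rho> a v = \<tau> a v"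
    and J: "J \<in> alg_iso (monoid_alg (B_group n)) (monoid_alg (B_group n))"
    and J_t: "\<forall>i<n. J (grp (t_refl n i)) = grp (t_refl n i)"
    and J_s: "\<forall>i. Suc i < n \<longrightarrow>
           J (grp (s_refl n i (Suc i) 1)) =
             grp (s_refl n i (Suc i) 1) \<otimes>\<^bsub>monoid_alg (B_group n)\<^esub>
             (Poly_Mapping.single (t_refl n i) ((1 - \<i>) / 2)
              + Poly_Mapping.single (t_refl n (Suc i)) ((1 + \<i>) / 2))"
    and \<phi>: "\<phi> \<in> alg_iso (nbca p n cb1 cbm1) (rca_twisted p n c1 cm1)"
    and \<phi>_\<sigma>: "\<forall>i. Suc i < n \<longrightarrow>
           \<phi> (nbca_gen p n cb1 cbm1 (G_gen (sigma_refl n i (Suc i) 1)))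
             = rca_gen p n c1 cm1 (G_gen (s_refl n i (Suc i) (- 1)))"
    and \<phi>_diag: "\<forall>g\<in>mu p n. diagonal_mat g \<longrightarrow>
           \<phi> (nbca_gen p n cb1 cbm1 (G_gen g)) = rca_gen p n c1 cm1 (G_gen g)"
    and \<phi>_x: "\<forall>j<n. \<phi> (nbca_gen p n cb1 cbm1 (X_gen j)) = rca_gen p n c1 cm1 (X_gen j)"
begin

abbreviation "\<mu>W \<equiv> mu p n"
abbreviation "\<N> \<equiv> nbca p n cb1 cbm1"
abbreviation "\<kappa> \<equiv> nbca_gen p n cb1 cbm1"

sublocale N: presentation "gens n \<mu>W" "nbca_relators p n cb1 cbm1"
  rewrites "presented (gens n \<mu>W) (nbca_relators p n cb1 cbm1) = \<N>"
    and "presented_gen (gens n \<mu>W) (nbca_relators p n cb1 cbm1) = \<kappa>"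
  by (simp_all add: presentation_nbca[OF p] nbca_def nbca_gen_def)

sublocale \<mu>W: monomial_group n \<mu>W
  by (rule monomial_group_mu[OF p])

lemma \<kappa>_closed: "s \<in> gens n \<mu>W \<Longrightarrow> \<kappa> s \<in> carrier \<N>"
  by (rule N.gen_closed)

lemma N_group_mult: "g \<in> \<mu>W \<Longrightarrow> h \<in> \<mu>W \<Longrightarrow> \<kappa> (G_gen g) \<otimes>\<^bsub>\<N>\<^esub> \<kappa> (G_gen h) = \<kappa> (G_gen (g * h))"
  using gen_group_mult[OF presentation_nbca[OF p] _ monomial_group_mu[OF p], of n cb1 cbm1 g h]
  by (simp_all add: nbca_relators_def nbca_def nbca_gen_def Un_assoc)

lemma V_cvs: "cvs V" and \<rho>_bilin: "bilin (GA n) V V \<rho>"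
  and \<rho>_mult: "F \<in> carrier (GA n) \<Longrightarrow> G \<in> carrier (GA n) \<Longrightarrow> v \<in> carrier V \<Longrightarrow> \<rho> (F \<otimes>\<^bsub>GA n\<^esub> G) v = \<rho> F (\<rho> G v)"
  and \<rho>_one: "v \<in> carrier V \<Longrightarrow> \<rho> (grp (1\<^sub>m n)) v = v"
  using \<rho> unfolding alg_module_iff by (auto simp: B_group_simps)

lemma \<rho>_lin: "F \<in> carrier (GA n) \<Longrightarrow> lin V V (\<rho> F)"
  by (rule bilin_lin_r[OF \<rho>_bilin])

lemma \<rho>_closed: "F \<in> carrier (GA n) \<Longrightarrow> v \<in> carrier V \<Longrightarrow> \<rho> F v \<in> carrier V"
  by (rule bilin_closed[OF \<rho>_bilin])

lemma \<rho>_add: "F \<in> carrier (GA n) \<Longrightarrow> G \<in> carrier (GA n) \<Longrightarrow> v \<in> carrier V \<Longrightarrow> \<rho> (F + G) v = \<rho> F v \<oplus>\<^bsub>V\<^esub> \<rho> G v"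
  using lin_add[OF bilin_lin_l[OF \<rho>_bilin], of v F G] by simp

lemma \<rho>_pscale: "F \<in> carrier (GA n) \<Longrightarrow> v \<in> carrier V \<Longrightarrow> \<rho> (pscale c F) v = c \<odot>\<^bsub>V\<^esub> \<rho> F v"
  using lin_smult[OF bilin_lin_l[OF \<rho>_bilin], of v F c] by simp

lemma grp_GA: "g \<in> Gmpn 2 1 n \<Longrightarrow> Poly_Mapping.single g c \<in> carrier (GA n)"
  unfolding GA_carrier by (rule keys_single_le)

lemma sign_diag_B': "h \<in> sign_diag n \<Longrightarrow> h \<in> Gmpn 2 1 n"
  using sign_diag_B by blast

lemma W_B: "g \<in> W \<Longrightarrow> g \<in> Gmpn 2 1 n" and \<mu>W_B: "g \<in> \<mu>W \<Longrightarrow> g \<in> Gmpn 2 1 n"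
  using W.K_B \<mu>W.K_B by blast+

lemma \<rho>_group: "g \<in> Gmpn 2 1 n \<Longrightarrow> h \<in> Gmpn 2 1 n \<Longrightarrow> v \<in> carrier V \<Longrightarrow> \<rho> (grp (g * h)) v = \<rho> (grp g) (\<rho> (grp h) v)"
  using \<rho>_mult[OF grp_GA grp_GA, of g h v 1 1] by (simp add: GA_single_mult)

lemma \<tau>_\<rho>: "Poly_Mapping.keys F \<subseteq> W \<Longrightarrow> v \<in> carrier V \<Longrightarrow> \<tau> F v = \<rho> F v"
  using \<rho>_extends by (simp add: W.mat_group_simps)

lemma \<rho>_W: "g \<in> W \<Longrightarrow> v \<in> carrier V \<Longrightarrow> \<rho> (grp g) v \<in> carrier V"
  by (rule \<rho>_closed[OF grp_GA[OF W_B]])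

lemma \<rho>_sign_diag: "h \<in> sign_diag n \<Longrightarrow> v \<in> carrier V \<Longrightarrow> \<rho> (grp h) v \<in> carrier V"
  by (rule \<rho>_closed[OF grp_GA[OF sign_diag_B']])

lemma torus_rep_\<rho>: "torus_rep n V (\<lambda>h. \<rho> (grp h))"
  unfolding torus_rep_def
  using \<rho>_lin[OF grp_GA[OF sign_diag_B']] by (simp add: V_cvs \<rho>_one \<rho>_group sign_diag_B')

subsection \<open>The automorphism \<open>J\<close>\<close>

lemma J_hom: "alg_hom (GA n) (GA n) J"
  using J unfolding alg_iso_def ring_iso_def Ring.ring_hom_def alg_hom_def lin_def by (auto simp: Pi_iff)

lemma J_closed: "F \<in> carrier (GA n) \<Longrightarrow> J F \<in> carrier (GA n)"
  by (rule lin_closed[OF alg_hom_lin[OF J_hom]])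

lemma J_group: "g \<in> Gmpn 2 1 n \<Longrightarrow> h \<in> Gmpn 2 1 n \<Longrightarrow> J (grp (g * h)) = J (grp g) \<otimes>\<^bsub>GA n\<^esub> J (grp h)"
  using alg_hom_mult[OF J_hom grp_GA grp_GA, of g h 1 1] by (simp add: GA_single_mult)

text \<open>
  A diagonal sign matrix is a product of reflections \<open>t\<^sub>i\<close>, which \<open>J\<close> fixes.
\<close>

lemma J_diag:
  assumes "g \<in> sign_diag n" shows "J (grp g) = grp g"
proof -
  obtain d where g: "g = dmat n d" and d: "\<And>i. i < n \<Longrightarrow> d i = 1 \<or> d i = - 1"
    using assms by (auto simp: sign_diag_def)
  let ?d = "\<lambda>I i. if i \<in> I then - 1 else (1 :: complex)"
  have "J (grp (dmat n (?d I))) = grp (dmat n (?d I))" if "finite I" "I \<subseteq> {..<n}" for I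
    using that
  proof induct
    case empty
    have "J (grp (1\<^sub>m n)) = grp (1\<^sub>m n)" using alg_hom_one[OF J_hom] by (simp add: B_group_simps)
    then show ?case by (simp add: dmat_one)
  next
    case (insert i I)
    have e: "dmat n (?d (insert i I)) = t_refl n i * dmat n (?d I)"
      unfolding dmat_t dmat_mult by (rule dmat_cong) (use insert in auto)
    have s: "dmat n (?d I) \<in> Gmpn 2 1 n" by (intro sign_diag_B' sign_diagI) auto
    have "J (grp (dmat n (?d (insert i I)))) = grp (t_refl n i) \<otimes>\<^bsub>GA n\<^esub> grp (dmat n (?d I))"
      unfolding e J_group[OF t_refl_B s] using insert J_t by simp
    then show ?case unfolding e by (simp add: GA_single_mult)
  qed
  from this[of "{i. i < n \<and> d i = - 1}"] have "J (grp (dmat n (?d {i. i < n \<and> d i = - 1}))) = grp (dmat n (?d {i. i < n \<and> d i = - 1}))"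
    by auto
  moreover have "dmat n (?d {i. i < n \<and> d i = - 1}) = g"
    unfolding g by (rule dmat_cong) (use d in auto)
  ultimately show ?thesis by simp
qed

abbreviation "s i \<equiv> s_refl n i (Suc i) 1"
abbreviation "sb i \<equiv> s_refl n i (Suc i) (- 1)"
abbreviation "\<sigma> i \<equiv> sigma_refl n i (Suc i) 1"
abbreviation "\<delta> i \<equiv> t_refl n i * t_refl n (Suc i)"

text \<open>
  The products \<open>\<delta> i\<close> lie in all the groups considered, whereas a single \<open>t\<^sub>i\<close> is missing from
  \<open>D\<^sub>n\<close>. This is why \<open>s\<close>, \<open>sb\<close> and \<open>\<sigma>\<close> are compared by means of \<open>\<delta> i\<close>.
\<close>

lemma refl_facts:
  assumes i: "Suc i < n"
  shows "s i \<in> W" "sb i \<in> W" "\<sigma> i \<in> \<mu>W" "\<delta> i \<in> W" "\<delta> i \<in> \<mu>W" "\<delta> i \<in> sign_diag n"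
    and "sb i = s i * \<delta> i" "sb i * \<delta> i = s i" "\<sigma> i = s i * t_refl n (Suc i)"
proof -
  show 1: "s i \<in> W" "sb i \<in> W" using s_refl_closed[OF i] by simp_all
  show "\<sigma> i \<in> \<mu>W" by (rule sigma_refl_mu) (use i p in auto)
  show d: "\<delta> i \<in> sign_diag n" by (intro sign_diag_mult sign_diag_t)
  show sb: "sb i = s i * \<delta> i" and "\<sigma> i = s i * t_refl n (Suc i)" using s_refl_adjacent_mult[OF i] by simp_all
  note c = W.K_carrier[OF 1(1)] sign_diag_carrier[OF d]
  show sd: "sb i * \<delta> i = s i"
    unfolding sb using assoc_mult_mat[OF c(1) c(2) c(2)] sign_diag_sq[OF d] c by simp
  obtain k where k: "k \<in> W" "k * s i = 1\<^sub>m n" using W.K_inverse[OF 1(1)] by blast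
  have "k * sb i = (k * s i) * \<delta> i" unfolding sb by (rule assoc_mult_mat[symmetric, OF W.K_carrier[OF k(1)] c])
  then have "k * sb i = \<delta> i" unfolding k(2) left_mult_one_mat[OF c(2)] .
  then show "\<delta> i \<in> W" using W.K_mult[OF k(1) 1(2)] by simp
  then show "\<delta> i \<in> \<mu>W" using d diagonal_W_mu[OF p, of n] by blast
qed

lemma J_\<sigma>:
  assumes i: "Suc i < n"
  shows "J (grp (\<sigma> i)) = Poly_Mapping.single (sb i) ((1 - \<i>) / 2) + Poly_Mapping.single (s i) ((1 + \<i>) / 2)"
proof -
  note f = refl_facts[OF i]
  note c = W.K_carrier[OF f(1)] t_carrier[of n i] t_carrier[of n "Suc i"]
  have "J (grp (\<sigma> i)) = J (grp (s i)) \<otimes>\<^bsub>GA n\<^esub> grp (t_refl n (Suc i))"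
    unfolding f(9) J_group[OF W_B[OF f(1)] t_refl_B] using J_t i by simp
  also have "\<dots> = Poly_Mapping.single (s i * t_refl n i * t_refl n (Suc i)) ((1 - \<i>) / 2)
      + Poly_Mapping.single (s i * t_refl n (Suc i) * t_refl n (Suc i)) ((1 + \<i>) / 2)"
    using J_s i by (simp add: GA_bilinear)
  also have "s i * t_refl n i * t_refl n (Suc i) = sb i"
    unfolding f(7) by (rule assoc_mult_mat[OF c])
  also have "s i * t_refl n (Suc i) * t_refl n (Suc i) = s i"
    using assoc_mult_mat[OF c(1,3,3)] c(1) by (simp add: t_sq)
  finally show ?thesis .
qed

lemma J_\<sigma>\<delta>:
  assumes i: "Suc i < n"
  shows "J (grp (\<sigma> i * \<delta> i)) = Poly_Mapping.single (s i) ((1 - \<i>) / 2) + Poly_Mapping.single (sb i) ((1 + \<i>) / 2)"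
proof -
  note f = refl_facts[OF i]
  show ?thesis
    unfolding J_group[OF \<mu>W_B[OF f(3)] \<mu>W_B[OF f(5)]] J_\<sigma>[OF i] J_diag[OF f(6)]
    by (simp add: GA_bilinear f(8) f(7)[symmetric])
qed

lemma monomial_\<sigma>:
  assumes i: "Suc i < n" shows "\<exists>u\<in>sign_vec n. mono_mat n (Transposition.transpose i (Suc i)) u = \<sigma> i"
  by (rule bexI[of _ "\<lambda>b. if b = i then inverse 1 else if b = Suc i then - 1 else 1"])
    (simp_all add: sigma_refl_mono sign_vec_def)

lemma monomial_sb:
  assumes i: "Suc i < n" shows "\<exists>u\<in>sign_vec n. mono_mat n (Transposition.transpose i (Suc i)) u = sb i"
  by (rule bexI[of _ "\<lambda>b. if b = i then inverse (- 1) else if b = Suc i then - 1 else 1"])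
    (simp_all add: s_refl_mono sign_vec_def)

text \<open>
  The automorphism of \<open>\<complex>B\<^sub>n\<close> restricts to a map from \<open>\<complex>\<mu>(W)\<close> to \<open>\<complex>W\<close>, since the image of \<open>\<sigma> i\<close> is
  a combination of two reflections in \<open>W\<close>.
\<close>

lemma J_keys: "g \<in> \<mu>W \<Longrightarrow> Poly_Mapping.keys (J (grp g)) \<subseteq> W"
proof -
  have "\<mu>W \<subseteq> {g. Poly_Mapping.keys (J (grp g)) \<subseteq> W}"
  proof (rule \<mu>W.monomial_group_generated)
    fix i assume i: "Suc i < n"
    note f = refl_facts[OF i]
    have "Poly_Mapping.keys (J (grp (\<sigma> i))) \<subseteq> W"
      unfolding J_\<sigma>[OF i] by (intro keys_le f)
    then show "\<exists>s\<in>sign_vec n. mono_mat n (Transposition.transpose i (Suc i)) s \<in> {g. Poly_Mapping.keys (J (grp g)) \<subseteq> W} \<inter> \<mu>W"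
      using monomial_\<sigma>[OF i] f(3) by (metis IntI mem_Collect_eq)
  next
    fix g h assume "g \<in> {g. Poly_Mapping.keys (J (grp g)) \<subseteq> W}" "h \<in> {g. Poly_Mapping.keys (J (grp g)) \<subseteq> W}"
      and gh: "g \<in> \<mu>W" "h \<in> \<mu>W"
    then have k: "Poly_Mapping.keys (J (grp g)) \<subseteq> W" "Poly_Mapping.keys (J (grp h)) \<subseteq> W" by auto
    have "Poly_Mapping.keys (J (grp g) \<otimes>\<^bsub>GA n\<^esub> J (grp h)) \<subseteq> W"
      unfolding monoid_alg_mult B_group_simps
      by (intro keys_le W.K_mult) (use k in auto)
    then show "g * h \<in> {g. Poly_Mapping.keys (J (grp g)) \<subseteq> W}"
      unfolding J_group[OF \<mu>W_B[OF gh(1)] \<mu>W_B[OF gh(2)], symmetric] by simp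
  next
    show "\<mu>W \<inter> sign_diag n \<subseteq> {g. Poly_Mapping.keys (J (grp g)) \<subseteq> W}"
      using diagonal_W_mu[OF p, of n] J_diag by auto
  qed
  then show "g \<in> \<mu>W \<Longrightarrow> Poly_Mapping.keys (J (grp g)) \<subseteq> W" by blast
qed

subsection \<open>The two standard modules\<close>

definition "\<Gamma> = {(\<iota> (X_gen i), \<lambda>v. \<zero>\<^bsub>V\<^esub>) | i. i < n} \<union> {(\<iota> (G_gen g), \<tau> (grp g)) | g. g \<in> W}"
definition "\<Gamma>' = {(\<kappa> (X_gen i), \<lambda>v. \<zero>\<^bsub>V\<^esub>) | i. i < n} \<union> {(\<kappa> (G_gen g), \<tau> (J (grp g))) | g. g \<in> \<mu>W}"

lemma \<tau>_grp: "g \<in> W \<Longrightarrow> v \<in> carrier V \<Longrightarrow> \<tau> (grp g) v = \<rho> (grp g) v"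
  by (rule \<tau>_\<rho>) (simp_all add: keys_single_le)

lemma \<tau>_J: "g \<in> \<mu>W \<Longrightarrow> v \<in> carrier V \<Longrightarrow> \<tau> (J (grp g)) v = \<rho> (J (grp g)) v"
  by (rule \<tau>_\<rho>[OF J_keys])

sublocale L: tensor_product \<H> V \<Gamma>
proof (rule tensor_product.intro)
  show "calg \<H>" by (rule P.calg_P)
  show "cvs V" by (rule V_cvs)
  fix b \<beta> assume b: "(b, \<beta>) \<in> \<Gamma>"
  then show "b \<in> carrier \<H>" by (auto simp: \<Gamma>_def \<iota>_closed)
  show "\<beta> v \<in> carrier V" if "v \<in> carrier V" for v
    using b that by (auto simp: \<Gamma>_def cvs_zero[OF V_cvs] \<tau>_grp \<rho>_W)
qed

sublocale R: tensor_product \<N> V \<Gamma>'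
proof (rule tensor_product.intro)
  show "calg \<N>" by (rule N.calg_P)
  show "cvs V" by (rule V_cvs)
  fix b \<beta> assume b: "(b, \<beta>) \<in> \<Gamma>'"
  then show "b \<in> carrier \<N>" by (auto simp: \<Gamma>'_def \<kappa>_closed)
  show "\<beta> v \<in> carrier V" if "v \<in> carrier V" for v
    using b that \<rho>_closed[OF J_closed[OF grp_GA[OF \<mu>W_B]]] by (auto simp: \<Gamma>'_def cvs_zero[OF V_cvs] \<tau>_J)
qed

abbreviation "\<theta> \<equiv> \<rho> (twist_prod n (- \<i>) n)"
abbreviation "\<theta>' \<equiv> \<rho> (twist_prod n \<i> n)"

lemma L_bal_X: "i < n \<Longrightarrow> balanced \<H> V L.tens (\<iota> (X_gen i)) (\<lambda>v. \<zero>\<^bsub>V\<^esub>)"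
  and L_bal_G: "g \<in> W \<Longrightarrow> balanced \<H> V L.tens (\<iota> (G_gen g)) (\<rho> (grp g))"
  and R_bal_X: "i < n \<Longrightarrow> balanced \<N> V R.tens (\<kappa> (X_gen i)) (\<lambda>v. \<zero>\<^bsub>V\<^esub>)"
  and R_bal_G: "h \<in> \<mu>W \<Longrightarrow> balanced \<N> V R.tens (\<kappa> (G_gen h)) (\<rho> (J (grp h)))"
proof -
  show "i < n \<Longrightarrow> balanced \<H> V L.tens (\<iota> (X_gen i)) (\<lambda>v. \<zero>\<^bsub>V\<^esub>)"
    by (rule L.tens_balanced[OF subalg_action.base]) (auto simp: \<Gamma>_def)
  show "i < n \<Longrightarrow> balanced \<N> V R.tens (\<kappa> (X_gen i)) (\<lambda>v. \<zero>\<^bsub>V\<^esub>)"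
    by (rule R.tens_balanced[OF subalg_action.base]) (auto simp: \<Gamma>'_def)
  show "balanced \<H> V L.tens (\<iota> (G_gen g)) (\<rho> (grp g))" if g: "g \<in> W"
    by (rule balanced_cong[OF L.tens_balanced[OF subalg_action.base, of _ "\<tau> (grp g)"]])
      (use g in \<open>auto simp: \<Gamma>_def \<tau>_grp\<close>)
  show "balanced \<N> V R.tens (\<kappa> (G_gen h)) (\<rho> (J (grp h)))" if h: "h \<in> \<mu>W"
    by (rule balanced_cong[OF R.tens_balanced[OF subalg_action.base, of _ "\<tau> (J (grp h))"]])
      (use h in \<open>auto simp: \<Gamma>'_def \<tau>_J\<close>)
qed

lemma L_tens_zero: "a \<in> carrier \<H> \<Longrightarrow> L.tens a \<zero>\<^bsub>V\<^esub> = \<zero>\<^bsub>L.M\<^esub>"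
  by (rule lin_zero[OF bilin_lin_r[OF L.bilin_tens] V_cvs L.cvs_M])

text \<open>
  The diagonal action of the torus on \<open>\<H> \<otimes> V\<close> is compatible with the action of the subalgebra, since
  \<open>\<rho>\<close> turns conjugation of a group element into conjugation of its operator.
\<close>

lemma torus_balanced:
  assumes h: "h \<in> sign_diag n"
  shows "\<forall>(b, \<beta>)\<in>\<Gamma>. balanced \<H> V (\<lambda>a v. L.tens (T\<H> h a) (\<rho> (grp h) v)) b \<beta>"
proof -
  note Tc = torus_rep_closed[OF torus_rep_T\<H> h] and \<rho>c = \<rho>_closed[OF grp_GA[OF sign_diag_B'[OF h]]]
  have "balanced \<H> V (\<lambda>a v. L.tens (T\<H> h a) (\<rho> (grp h) v)) (\<iota> (X_gen i)) (\<lambda>v. \<zero>\<^bsub>V\<^esub>)" if i: "i < n" for i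
    unfolding balanced_def
  proof (intro ballI)
    fix a v assume a: "a \<in> carrier \<H>" and v: "v \<in> carrier V"
    have X: "\<iota> (X_gen i) \<in> carrier \<H>" using i by (simp add: \<iota>_closed)
    have "L.tens (T\<H> h (a \<otimes>\<^bsub>\<H>\<^esub> \<iota> (X_gen i))) (\<rho> (grp h) v) =
        h $$ (i, i) \<odot>\<^bsub>L.M\<^esub> L.tens (T\<H> h a \<otimes>\<^bsub>\<H>\<^esub> \<iota> (X_gen i)) (\<rho> (grp h) v)"
      using T\<H>_hom(2)[OF h, of "X_gen i"] i Tc[OF a] X \<rho>c[OF v]
      by (simp add: T\<H>_mult[OF h a X] calg_smult_r[OF P.calg_P] lin_smult[OF bilin_lin_l[OF L.bilin_tens]]
          calg_mult[OF P.calg_P])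
    also have "L.tens (T\<H> h a \<otimes>\<^bsub>\<H>\<^esub> \<iota> (X_gen i)) (\<rho> (grp h) v) = \<zero>\<^bsub>L.M\<^esub>"
      using L_bal_X[OF i] Tc[OF a] \<rho>c[OF v] by (simp add: balanced_def L_tens_zero)
    finally show "L.tens (T\<H> h (a \<otimes>\<^bsub>\<H>\<^esub> \<iota> (X_gen i))) (\<rho> (grp h) v) = L.tens (T\<H> h a) (\<rho> (grp h) \<zero>\<^bsub>V\<^esub>)"
      using lin_zero[OF \<rho>_lin[OF grp_GA[OF sign_diag_B'[OF h]]] V_cvs V_cvs]
      by (simp add: L_tens_zero[OF Tc[OF a]] cvs_smult_zero[OF L.cvs_M])
  qed
  moreover have "balanced \<H> V (\<lambda>a v. L.tens (T\<H> h a) (\<rho> (grp h) v)) (\<iota> (G_gen g)) (\<tau> (grp g))" if g: "g \<in> W" for g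
    unfolding balanced_def
  proof (intro ballI)
    fix a v assume a: "a \<in> carrier \<H>" and v: "v \<in> carrier V"
    have G: "\<iota> (G_gen g) \<in> carrier \<H>" "\<iota> (G_gen (h * g * h)) \<in> carrier \<H>"
      using g conj_W[OF p h g] by (simp_all add: \<iota>_closed)
    have T: "T\<H> h (\<iota> (G_gen g)) = \<iota> (G_gen (h * g * h))"
      using T\<H>_hom(2)[OF h, of "G_gen g"] g G(2) by (simp add: cvs_one_smult[OF \<H>_cvs])
    note hB = sign_diag_B'[OF h] and gB = W_B[OF g]
    have "\<rho> (grp (h * g * h)) (\<rho> (grp h) v) = \<rho> (grp (h * g)) (\<rho> (grp (h * h)) v)"
      using \<rho>_group[OF B_mult[OF hB gB] hB \<rho>c[OF v]] \<rho>_group[OF hB hB v] by simp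
    also have "\<dots> = \<rho> (grp h) (\<rho> (grp g) v)"
      unfolding sign_diag_sq[OF h] \<rho>_one[OF v] by (rule \<rho>_group[OF hB gB v])
    finally have e: "\<rho> (grp (h * g * h)) (\<rho> (grp h) v) = \<rho> (grp h) (\<rho> (grp g) v)" .
    have "L.tens (T\<H> h (a \<otimes>\<^bsub>\<H>\<^esub> \<iota> (G_gen g))) (\<rho> (grp h) v) = L.tens (T\<H> h a \<otimes>\<^bsub>\<H>\<^esub> \<iota> (G_gen (h * g * h))) (\<rho> (grp h) v)"
      unfolding T\<H>_mult[OF h a G(1)] T ..
    also have "\<dots> = L.tens (T\<H> h a) (\<rho> (grp (h * g * h)) (\<rho> (grp h) v))"
      using L_bal_G[OF conj_W[OF p h g]] Tc[OF a] \<rho>c[OF v] by (simp add: balanced_def)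
    finally show "L.tens (T\<H> h (a \<otimes>\<^bsub>\<H>\<^esub> \<iota> (G_gen g))) (\<rho> (grp h) v) = L.tens (T\<H> h a) (\<rho> (grp h) (\<tau> (grp g) v))"
      unfolding e \<tau>_grp[OF g v] .
  qed
  ultimately show ?thesis unfolding \<Gamma>_def by blast
qed

lemma twist_prod_cancel:
  assumes z: "\<zeta> * \<zeta>' = 1" and v: "v \<in> carrier V"
  shows "\<rho> (twist_prod n \<zeta> n) (\<rho> (twist_prod n \<zeta>' n) v) = v"
  using \<rho>_mult[OF twist_prod_GA twist_prod_GA v, of \<zeta> n \<zeta>' n] \<rho>_one[OF v] by (simp only: twist_prod_inverse[OF z])

text \<open>
  The torus is commutative.
\<close>

lemma twist_prod_torus:
  assumes h: "h \<in> sign_diag n" and v: "v \<in> carrier V"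
  shows "\<rho> (twist_prod n \<zeta> n) (\<rho> (grp h) v) = \<rho> (grp h) (\<rho> (twist_prod n \<zeta> n) v)"
proof -
  have k: "Poly_Mapping.keys (grp h) \<subseteq> sign_diag n" using h by simp
  note hc = sign_diag_GA[OF k]
  show ?thesis
    unfolding \<rho>_mult[OF twist_prod_GA hc v, symmetric] \<rho>_mult[OF hc twist_prod_GA v, symmetric]
      diag_GA_commute[OF keys_twist_prod k] ..
qed

sublocale T: twisted_tensor \<H> V \<Gamma> \<N> \<Gamma>' n T\<H> "\<lambda>h. \<rho> (grp h)" \<phi> \<theta> \<theta>'
proof (intro twisted_tensor.intro twisted_tensor_axioms.intro)
  show "tensor_product \<H> V \<Gamma>" by (rule L.tensor_product_axioms)
  show "tensor_product \<N> V \<Gamma>'" by (rule R.tensor_product_axioms)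
  show "torus_rep n \<H> T\<H>" by (rule torus_rep_T\<H>)
  show "T\<H> h (a \<otimes>\<^bsub>\<H>\<^esub> b) = T\<H> h a \<otimes>\<^bsub>\<H>\<^esub> T\<H> h b" if "h \<in> sign_diag n" "a \<in> carrier \<H>" "b \<in> carrier \<H>" for h a b
    using that by (rule T\<H>_mult)
  show "T\<H> h \<one>\<^bsub>\<H>\<^esub> = \<one>\<^bsub>\<H>\<^esub>" if "h \<in> sign_diag n" for h using that by (rule T\<H>_one)
  show "torus_rep n V (\<lambda>h. \<rho> (grp h))" by (rule torus_rep_\<rho>)
  show "\<forall>(b, \<beta>)\<in>\<Gamma>. balanced \<H> V (\<lambda>a v. L.tens (T\<H> h a) (\<rho> (grp h) v)) b \<beta>" if "h \<in> sign_diag n" for h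
    using that by (rule torus_balanced)
  show "carrier \<H> \<subseteq> lspan \<H> {a. \<exists>\<alpha>. weight_vec n \<H> T\<H> \<alpha> a}" by (rule weight_span)
  show "\<phi> \<in> alg_iso \<N> (twisted_alg n \<H> T\<H>)" using \<phi> unfolding rca_twisted_def .
  show "lin V V \<theta>" "lin V V \<theta>'" by (rule \<rho>_lin[OF twist_prod_GA])+
  show "\<theta> (\<theta>' v) = v" "\<theta>' (\<theta> v) = v" if "v \<in> carrier V" for v
    using that by (auto intro!: twist_prod_cancel)
qed

text \<open>
  The preimages under \<open>\<phi>\<close> of the generators are read off from its prescribed values.
\<close>

lemma \<psi>_eq: "b \<in> carrier \<N> \<Longrightarrow> \<phi> b = a \<Longrightarrow> T.\<psi> a = b"
  using T.\<psi>\<phi> by blast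

lemma X_transfer:
  assumes i: "i < n"
  shows "balanced \<H> V T.\<Xi>\<^sub>0 (\<iota> (X_gen i)) (\<lambda>v. \<zero>\<^bsub>V\<^esub>)" and "balanced \<N> V T.\<Psi>\<^sub>0 (\<kappa> (X_gen i)) (\<lambda>v. \<zero>\<^bsub>V\<^esub>)"
proof -
  have \<psi>: "T.\<psi> (\<iota> (X_gen i)) = \<kappa> (X_gen i)"
    by (rule \<psi>_eq) (use i \<phi>_x \<kappa>_closed in auto)
  have z: "\<rho> F \<zero>\<^bsub>V\<^esub> = \<zero>\<^bsub>V\<^esub>" if "F \<in> carrier (GA n)" for F
    by (rule lin_zero[OF \<rho>_lin[OF that] V_cvs V_cvs])
  note h = T.homogeneous_balanced[OF weight_vec_X[OF i], of "\<lambda>v. \<zero>\<^bsub>V\<^esub>" "\<lambda>v. \<zero>\<^bsub>V\<^esub>", unfolded \<psi>, OF _ L_bal_X[OF i] R_bal_X[OF i]]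
  show "balanced \<H> V T.\<Xi>\<^sub>0 (\<iota> (X_gen i)) (\<lambda>v. \<zero>\<^bsub>V\<^esub>)" "balanced \<N> V T.\<Psi>\<^sub>0 (\<kappa> (X_gen i)) (\<lambda>v. \<zero>\<^bsub>V\<^esub>)"
    by - (rule h; simp add: z[OF twist_prod_GA] z[OF grp_GA[OF sign_diag_B']] cvs_simps V_cvs)+
qed

lemma diag_transfer:
  assumes g: "g \<in> W" "g \<in> sign_diag n"
  shows "balanced \<H> V T.\<Xi>\<^sub>0 (\<iota> (G_gen g)) (\<rho> (grp g))" and "balanced \<N> V T.\<Psi>\<^sub>0 (\<kappa> (G_gen g)) (\<rho> (J (grp g)))"
proof -
  have gm: "g \<in> \<mu>W" using g diagonal_W_mu[OF p, of n] by blast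
  have \<psi>: "T.\<psi> (\<iota> (G_gen g)) = \<kappa> (G_gen g)"
    by (rule \<psi>_eq) (use gm \<phi>_diag \<kappa>_closed sign_diag_diagonal[OF g(2)] in auto)
  note bal' = R_bal_G[OF gm, unfolded J_diag[OF g(2)]]
  note gG = grp_GA[OF W_B[OF g(1)], of 1]
  note h = T.homogeneous_balanced[OF weight_vec_diag[OF g], of "\<rho> (grp g)" "\<rho> (grp g)", unfolded \<psi>, OF _ L_bal_G[OF g(1)] bal']
  have eq: "\<rho> (grp h) (\<rho> (grp g) v) = wt {} h \<odot>\<^bsub>V\<^esub> \<rho> (grp g) (\<rho> (grp h) v)" if h: "h \<in> sign_diag n" and v: "v \<in> carrier V" for h v
    using \<rho>_group[OF sign_diag_B'[OF h] W_B[OF g(1)] v] \<rho>_group[OF W_B[OF g(1)] sign_diag_B'[OF h] v]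
      sign_diag_comm[OF h g(2)] \<rho>_sign_diag[OF h \<rho>_W[OF g(1) v]]
    by (simp add: wt_def cvs_one_smult[OF V_cvs])
  have rel: "\<rho> (grp g) (\<theta>' (\<rho> (grp (twist_elt n {})) v)) = \<theta>' (\<rho> (grp g) v)" if v: "v \<in> carrier V" for v
    unfolding twist_elt_empty \<rho>_one[OF v] twist_prod_torus[OF g(2) v] ..
  show "balanced \<H> V T.\<Xi>\<^sub>0 (\<iota> (G_gen g)) (\<rho> (grp g))"
    by (rule h(1)) (simp_all add: rel eq \<rho>_closed[OF gG])
  show "balanced \<N> V T.\<Psi>\<^sub>0 (\<kappa> (G_gen g)) (\<rho> (J (grp g)))"
    unfolding J_diag[OF g(2)] by (rule h(2)) (simp_all add: rel eq \<rho>_closed[OF gG])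
qed

text \<open>
  The value at the reflection with parameter \<open>1\<close> follows from the one with parameter \<open>- 1\<close>, because they
  differ by the factor \<open>\<delta> i\<close>, which is invariant, and so its twisted product is the ordinary one.
\<close>

lemma \<psi>_refl:
  assumes i: "Suc i < n"
  shows "T.\<psi> (\<iota> (G_gen (sb i))) = \<kappa> (G_gen (\<sigma> i))" and "T.\<psi> (\<iota> (G_gen (s i))) = \<kappa> (G_gen (\<sigma> i * \<delta> i))"
proof -
  note f = refl_facts[OF i]
  have c: "\<kappa> (G_gen (\<sigma> i)) \<in> carrier \<N>" "\<kappa> (G_gen (\<delta> i)) \<in> carrier \<N>" "\<kappa> (G_gen (\<sigma> i * \<delta> i)) \<in> carrier \<N>"
    using f \<mu>W.K_mult by (simp_all add: \<kappa>_closed)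
  show "T.\<psi> (\<iota> (G_gen (sb i))) = \<kappa> (G_gen (\<sigma> i))" by (rule \<psi>_eq[OF c(1)]) (use \<phi>_\<sigma> i in blast)
  have d: "\<phi> (\<kappa> (G_gen (\<delta> i))) = \<iota> (G_gen (\<delta> i))" using \<phi>_diag f(5) sign_diag_diagonal[OF f(6)] by blast
  have "\<phi> (\<kappa> (G_gen (\<sigma> i * \<delta> i))) = T.tmult (\<iota> (G_gen (sb i))) (\<iota> (G_gen (\<delta> i)))"
    using T.\<phi>_props(4)[OF c(1,2)] \<phi>_\<sigma> i by (simp add: N_group_mult[OF f(3,5)] d)
  also have "\<dots> = \<iota> (G_gen (sb i)) \<otimes>\<^bsub>\<H>\<^esub> \<iota> (G_gen (\<delta> i))"
    by (rule T.tmult_invariant[OF _ weight_vec_diag[OF f(4,6)]]) (use f(2) in \<open>simp add: \<iota>_closed\<close>)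
  also have "\<dots> = \<iota> (G_gen (s i))" unfolding group_mult[OF f(2,4)] f(8) ..
  finally show "T.\<psi> (\<iota> (G_gen (s i))) = \<kappa> (G_gen (\<sigma> i * \<delta> i))" by (rule \<psi>_eq[OF c(3)])
qed

text \<open>
  In terms of the two homogeneous components, \<open>J (\<sigma> i)\<close> is the component of weight \<open>{}\<close> minus \<open>\<i>\<close>
  times the component of weight \<open>{i, i + 1}\<close>; the scalar \<open>\<chi>\<close> is this coefficient. The relation required
  by \<open>homogeneous_balanced\<close> is then \<open>refl_elt_twist_prod\<close>.
\<close>

lemma half_sum_transfer:
  assumes i: "Suc i < n" and \<eta>: "\<eta> = 1 \<and> \<gamma> = {} \<and> \<chi> = 1 \<or> \<eta> = - 1 \<and> \<gamma> = {i, Suc i} \<and> \<chi> = - \<i>"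
  shows "balanced \<H> V T.\<Xi>\<^sub>0 (half_sum \<eta> i) (\<rho> (refl_elt n \<eta> i))"
    and "balanced \<N> V T.\<Psi>\<^sub>0 (T.\<psi> (half_sum \<eta> i)) (\<lambda>v. \<chi> \<odot>\<^bsub>V\<^esub> \<rho> (refl_elt n \<eta> i) v)"
    and "T.\<psi> (half_sum \<eta> i) = (1/2) \<odot>\<^bsub>\<N>\<^esub> \<kappa> (G_gen (\<sigma> i)) \<oplus>\<^bsub>\<N>\<^esub> (\<eta>/2) \<odot>\<^bsub>\<N>\<^esub> \<kappa> (G_gen (\<sigma> i * \<delta> i))"
proof -
  note f = refl_facts[OF i] and N_cvs = calg_cvs[OF N.calg_P]
  have \<eta>': "\<eta> = 1 \<and> \<gamma> = {} \<or> \<eta> = - 1 \<and> \<gamma> = {i, Suc i}" using \<eta> by auto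
  have sd: "\<sigma> i * \<delta> i \<in> \<mu>W" by (rule \<mu>W.K_mult[OF f(3,5)])
  have c: "\<iota> (G_gen (sb i)) \<in> carrier \<H>" "\<iota> (G_gen (s i)) \<in> carrier \<H>"
    "\<kappa> (G_gen (\<sigma> i)) \<in> carrier \<N>" "\<kappa> (G_gen (\<sigma> i * \<delta> i)) \<in> carrier \<N>"
    using f sd by (simp_all add: \<iota>_closed \<kappa>_closed)
  show \<psi>: "T.\<psi> (half_sum \<eta> i) = (1/2) \<odot>\<^bsub>\<N>\<^esub> \<kappa> (G_gen (\<sigma> i)) \<oplus>\<^bsub>\<N>\<^esub> (\<eta>/2) \<odot>\<^bsub>\<N>\<^esub> \<kappa> (G_gen (\<sigma> i * \<delta> i))"
    unfolding half_sum_def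
    using lin_add[OF T.\<psi>_lin cvs_smult[OF \<H>_cvs c(1), of "1/2"] cvs_smult[OF \<H>_cvs c(2), of "\<eta>/2"]]
      lin_smult[OF T.\<psi>_lin c(1), of "1/2"] lin_smult[OF T.\<psi>_lin c(2), of "\<eta>/2"] \<psi>_refl[OF i] by simp
  note gB = W_B[OF f(2)] W_B[OF f(1)]
  note uG = refl_elt_GA[OF i, of \<eta>]
  have \<rho>u: "\<rho> (refl_elt n \<eta> i) v = (1/2) \<odot>\<^bsub>V\<^esub> \<rho> (grp (sb i)) v \<oplus>\<^bsub>V\<^esub> (\<eta>/2) \<odot>\<^bsub>V\<^esub> \<rho> (grp (s i)) v"
    if v: "v \<in> carrier V" for v
    using \<rho>_add[OF grp_GA[OF gB(1)] grp_GA[OF gB(2)] v, of "1/2" "\<eta>/2"]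
      \<rho>_pscale[OF grp_GA[OF gB(1)] v, of "1/2" 1] \<rho>_pscale[OF grp_GA[OF gB(2)] v, of "\<eta>/2" 1]
    by (simp add: refl_elt_def pscale_single)
  have bal: "balanced \<H> V L.tens (half_sum \<eta> i) (\<rho> (refl_elt n \<eta> i))"
    unfolding half_sum_def
  proof (rule balanced_cong[OF balanced_add[OF P.calg_P L.bilin_tens _ _ _ _
        balanced_smult[OF P.calg_P L.bilin_tens _ _ L_bal_G[OF f(2)]] balanced_smult[OF P.calg_P L.bilin_tens _ _ L_bal_G[OF f(1)]]]])
  qed (simp_all add: c cvs_smult[OF \<H>_cvs] cvs_smult[OF V_cvs] \<rho>_W f(1,2) \<rho>u)
  have JG: "J (grp (\<sigma> i)) \<in> carrier (GA n)" "J (grp (\<sigma> i * \<delta> i)) \<in> carrier (GA n)"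
    using \<mu>W_B[OF f(3)] \<mu>W_B[OF sd] by (simp_all only: J_closed grp_GA)
  have Jsum: "pscale (1/2) (J (grp (\<sigma> i))) + pscale (\<eta>/2) (J (grp (\<sigma> i * \<delta> i))) = pscale \<chi> (refl_elt n \<eta> i)"
  proof -
    have "pscale (1/2) (J (grp (\<sigma> i))) + pscale (\<eta>/2) (J (grp (\<sigma> i * \<delta> i))) =
       Poly_Mapping.single (sb i) (1/2 * ((1 - \<i>) / 2) + \<eta>/2 * ((1 + \<i>) / 2)) +
       Poly_Mapping.single (s i) (1/2 * ((1 + \<i>) / 2) + \<eta>/2 * ((1 - \<i>) / 2))"
      unfolding J_\<sigma>[OF i] J_\<sigma>\<delta>[OF i] by (simp add: pscale_simps single_add add_ac)
    also have "1/2 * ((1 - \<i>) / 2) + \<eta>/2 * ((1 + \<i>) / 2) = \<chi> * (1/2)" using \<eta> by (auto simp: field_simps)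
    also have "1/2 * ((1 + \<i>) / 2) + \<eta>/2 * ((1 - \<i>) / 2) = \<chi> * (\<eta>/2)" using \<eta> by (auto simp: field_simps)
    finally show ?thesis by (simp only: refl_elt_def pscale_simps)
  qed
  have \<rho>J: "(1/2) \<odot>\<^bsub>V\<^esub> \<rho> (J (grp (\<sigma> i))) v \<oplus>\<^bsub>V\<^esub> (\<eta>/2) \<odot>\<^bsub>V\<^esub> \<rho> (J (grp (\<sigma> i * \<delta> i))) v = \<chi> \<odot>\<^bsub>V\<^esub> \<rho> (refl_elt n \<eta> i) v"
    if v: "v \<in> carrier V" for v
  proof -
    have p: "pscale c F \<in> carrier (GA n)" if "F \<in> carrier (GA n)" for c F
      using calg_smult[OF calg_GA that, of c] by simp
    show ?thesis
      unfolding \<rho>_pscale[OF JG(1) v, symmetric] \<rho>_pscale[OF JG(2) v, symmetric]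
        \<rho>_add[OF p[OF JG(1)] p[OF JG(2)] v, symmetric] Jsum \<rho>_pscale[OF uG v] ..
  qed
  have bal': "balanced \<N> V R.tens (T.\<psi> (half_sum \<eta> i)) (\<lambda>v. \<chi> \<odot>\<^bsub>V\<^esub> \<rho> (refl_elt n \<eta> i) v)"
    unfolding \<psi>
  proof (rule balanced_cong[OF balanced_add[OF N.calg_P R.bilin_tens _ _ _ _
        balanced_smult[OF N.calg_P R.bilin_tens _ _ R_bal_G[OF f(3)]] balanced_smult[OF N.calg_P R.bilin_tens _ _ R_bal_G[OF sd]]]])
  qed (simp_all add: c cvs_smult[OF N_cvs] cvs_smult[OF V_cvs] \<rho>_closed[OF JG(1)] \<rho>_closed[OF JG(2)] \<rho>J)
  have rel: "\<chi> \<odot>\<^bsub>V\<^esub> \<rho> (refl_elt n \<eta> i) (\<theta>' (\<rho> (grp (twist_elt n \<gamma>)) v)) = \<theta>' (\<rho> (refl_elt n \<eta> i) v)"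
    if v: "v \<in> carrier V" for v
    using \<eta>
  proof (elim disjE conjE)
    assume e: "\<eta> = 1" "\<gamma> = {}" "\<chi> = 1"
    have u: "refl_elt n 1 i \<in> carrier (GA n)" by (rule refl_elt_GA[OF i])
    have "\<rho> (refl_elt n 1 i) (\<theta>' v) = \<theta>' (\<rho> (refl_elt n 1 i) v)"
      unfolding \<rho>_mult[OF u twist_prod_GA v, symmetric] \<rho>_mult[OF twist_prod_GA u v, symmetric]
        refl_elt_twist_prod(1)[OF i Suc_leI[OF i]] ..
    then show ?thesis
      unfolding e twist_elt_empty \<rho>_one[OF v] using \<rho>_closed[OF twist_prod_GA \<rho>_closed[OF u v]]
      by (simp add: cvs_one_smult[OF V_cvs])
  next
    assume e: "\<eta> = - 1" "\<gamma> = {i, Suc i}" "\<chi> = - \<i>"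
    have u: "refl_elt n (- 1) i \<in> carrier (GA n)" by (rule refl_elt_GA[OF i])
    have t: "grp (t_refl n i) \<in> carrier (GA n)" by (rule grp_GA[OF t_refl_B])
    note m = calg_mult[OF calg_GA]
    have "\<rho> (refl_elt n (- 1) i) (\<theta>' (\<rho> (grp (t_refl n i)) v)) =
        \<rho> (refl_elt n (- 1) i \<otimes>\<^bsub>GA n\<^esub> (twist_prod n \<i> n \<otimes>\<^bsub>GA n\<^esub> grp (t_refl n i))) v"
      unfolding \<rho>_mult[OF u m[OF twist_prod_GA t] v] \<rho>_mult[OF twist_prod_GA t v] ..
    then have "(- \<i>) \<odot>\<^bsub>V\<^esub> \<rho> (refl_elt n (- 1) i) (\<theta>' (\<rho> (grp (t_refl n i)) v)) =
        \<rho> (pscale (- \<i>) (refl_elt n (- 1) i \<otimes>\<^bsub>GA n\<^esub> (twist_prod n \<i> n \<otimes>\<^bsub>GA n\<^esub> grp (t_refl n i)))) v"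
      using \<rho>_pscale[OF m[OF u m[OF twist_prod_GA t]] v, of "- \<i>"] by simp
    also have "\<dots> = \<theta>' (\<rho> (refl_elt n (- 1) i) v)"
      unfolding refl_elt_twist_prod(2)[OF i Suc_leI[OF i]] by (rule \<rho>_mult[OF twist_prod_GA u v])
    finally show ?thesis unfolding e twist_elt_adjacent[OF i] .
  qed
  have equiv: "\<rho> (grp h) (\<rho> (refl_elt n \<eta> i) v) = wt \<gamma> h \<odot>\<^bsub>V\<^esub> \<rho> (refl_elt n \<eta> i) (\<rho> (grp h) v)"
    if h: "h \<in> sign_diag n" and v: "v \<in> carrier V" for h v
  proof -
    note hG = grp_GA[OF sign_diag_B'[OF h], of 1]
    show ?thesis
      unfolding \<rho>_mult[OF hG uG v, symmetric] \<rho>_mult[OF uG hG v, symmetric] refl_elt_torus[OF i h \<eta>']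
      by (rule \<rho>_pscale[OF calg_mult[OF calg_GA uG hG] v])
  qed
  note hb = T.homogeneous_balanced[OF weight_vec_half_sum[OF i \<eta>'] \<rho>_closed[OF uG] bal bal' rel equiv]
  show "balanced \<H> V T.\<Xi>\<^sub>0 (half_sum \<eta> i) (\<rho> (refl_elt n \<eta> i))" by (rule hb(1))
  show "balanced \<N> V T.\<Psi>\<^sub>0 (T.\<psi> (half_sum \<eta> i)) (\<lambda>v. \<chi> \<odot>\<^bsub>V\<^esub> \<rho> (refl_elt n \<eta> i) v)" by (rule hb(2))
qed

lemma half_sum_closed: "Suc i < n \<Longrightarrow> half_sum \<eta> i \<in> carrier \<H>"
  unfolding half_sum_def using refl_facts(1,2)[of i] by (simp add: cvs_closed \<H>_cvs \<iota>_closed)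

lemma sb_transfer:
  assumes i: "Suc i < n"
  shows "balanced \<H> V T.\<Xi>\<^sub>0 (\<iota> (G_gen (sb i))) (\<rho> (grp (sb i)))"
    and "balanced \<N> V T.\<Psi>\<^sub>0 (\<kappa> (G_gen (\<sigma> i))) (\<rho> (J (grp (\<sigma> i))))"
proof -
  note f = refl_facts[OF i] and hc = half_sum_closed[OF i]
  note h1 = half_sum_transfer[OF i, of 1 "{}" 1, simplified] and h2 = half_sum_transfer[OF i, of "- 1" "{i, Suc i}" "- \<i>", simplified]
  note u = refl_elt_GA[OF i]
  have p: "pscale c F \<in> carrier (GA n)" if "F \<in> carrier (GA n)" for c F
    using calg_smult[OF calg_GA that, of c] by simp
  have e1: "refl_elt n 1 i + refl_elt n (- 1) i = grp (sb i)"
  proof -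
    have "refl_elt n 1 i + refl_elt n (- 1) i = Poly_Mapping.single (sb i) (1/2 + 1/2) + Poly_Mapping.single (s i) (1/2 + - 1/2)"
      unfolding refl_elt_def single_add by (simp add: add_ac)
    then show ?thesis by simp
  qed
  have e2: "pscale 1 (refl_elt n 1 i) + pscale (- \<i>) (refl_elt n (- 1) i) = J (grp (\<sigma> i))"
  proof -
    have "pscale 1 (refl_elt n 1 i) + pscale (- \<i>) (refl_elt n (- 1) i) =
       Poly_Mapping.single (sb i) (1/2 + - \<i> * (1/2)) + Poly_Mapping.single (s i) (1/2 + - \<i> * (- 1/2))"
      unfolding refl_elt_def single_add by (simp add: pscale_simps add_ac)
    also have "1/2 + - \<i> * (1/2) = (1 - \<i>) / 2" by (simp add: field_simps)
    also have "1/2 + - \<i> * (- 1/2) = (1 + \<i>) / 2" by (simp add: field_simps)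
    finally show ?thesis unfolding J_\<sigma>[OF i] .
  qed
  show "balanced \<H> V T.\<Xi>\<^sub>0 (\<iota> (G_gen (sb i))) (\<rho> (grp (sb i)))"
    unfolding s_bar_half_sums[OF i]
    by (rule balanced_cong[OF balanced_add[OF P.calg_P T.bilin_\<Xi>\<^sub>0 hc hc _ _ h1(1) h2(1)]])
      (simp_all add: \<rho>_closed[OF u] \<rho>_add[OF u u, symmetric] e1)
  have \<psi>: "\<kappa> (G_gen (\<sigma> i)) = T.\<psi> (half_sum 1 i) \<oplus>\<^bsub>\<N>\<^esub> T.\<psi> (half_sum (- 1) i)"
    unfolding \<psi>_refl(1)[OF i, symmetric] s_bar_half_sums[OF i] by (rule lin_add[OF T.\<psi>_lin hc hc])
  have b1: "balanced \<N> V T.\<Psi>\<^sub>0 (T.\<psi> (half_sum 1 i)) (\<lambda>v. 1 \<odot>\<^bsub>V\<^esub> \<rho> (refl_elt n 1 i) v)"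
    and b2: "balanced \<N> V T.\<Psi>\<^sub>0 (T.\<psi> (half_sum (- 1) i)) (\<lambda>v. (- \<i>) \<odot>\<^bsub>V\<^esub> \<rho> (refl_elt n (- 1) i) v)"
    using half_sum_transfer(2)[OF i, of 1 "{}" 1] half_sum_transfer(2)[OF i, of "- 1" "{i, Suc i}" "- \<i>"] by auto
  show "balanced \<N> V T.\<Psi>\<^sub>0 (\<kappa> (G_gen (\<sigma> i))) (\<rho> (J (grp (\<sigma> i))))"
    unfolding \<psi>
  proof (rule balanced_cong[OF balanced_add[OF N.calg_P T.bilin_\<Psi>\<^sub>0 T.\<psi>_closed[OF hc] T.\<psi>_closed[OF hc] _ _ b1 b2]])
    fix v assume v: "v \<in> carrier V"
    show "1 \<odot>\<^bsub>V\<^esub> \<rho> (refl_elt n 1 i) v \<oplus>\<^bsub>V\<^esub> (- \<i>) \<odot>\<^bsub>V\<^esub> \<rho> (refl_elt n (- 1) i) v = \<rho> (J (grp (\<sigma> i))) v"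
      unfolding \<rho>_pscale[OF u v, symmetric] \<rho>_add[OF p[OF u] p[OF u] v, symmetric] e2 ..
  qed (simp_all add: cvs_smult[OF V_cvs] \<rho>_closed[OF u])
qed

text \<open>
  Balancedness is multiplicative, so it spreads from the diagonal elements and the adjacent reflections
  to the whole group.
\<close>

lemma G_transfer: "g \<in> W \<Longrightarrow> balanced \<H> V T.\<Xi>\<^sub>0 (\<iota> (G_gen g)) (\<rho> (grp g))"
  and G_transfer': "h \<in> \<mu>W \<Longrightarrow> balanced \<N> V T.\<Psi>\<^sub>0 (\<kappa> (G_gen h)) (\<rho> (J (grp h)))"
proof -
  let ?Z = "{g. balanced \<H> V T.\<Xi>\<^sub>0 (\<iota> (G_gen g)) (\<rho> (grp g))}"
  have "W \<subseteq> ?Z"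
  proof (rule W.monomial_group_generated)
    show "\<exists>s\<in>sign_vec n. mono_mat n (Transposition.transpose i (Suc i)) s \<in> ?Z \<inter> W" if i: "Suc i < n" for i
      using monomial_sb[OF i] sb_transfer(1)[OF i] refl_facts(2)[OF i] by (metis (no_types, lifting) IntI mem_Collect_eq)
    show "W \<inter> sign_diag n \<subseteq> ?Z" using diag_transfer(1) by blast
    fix g h assume z: "g \<in> ?Z" "h \<in> ?Z" and g: "g \<in> W" and h: "h \<in> W"
    have "balanced \<H> V T.\<Xi>\<^sub>0 (\<iota> (G_gen (g * h))) (\<rho> (grp (g * h)))"
      unfolding group_mult[OF g h, symmetric]
      by (rule balanced_cong[OF balanced_mult[OF P.calg_P, of _ _ V "\<rho> (grp h)" _ "\<rho> (grp g)"]])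
        (use z g h in \<open>simp_all add: \<iota>_closed \<rho>_W W_B \<rho>_group\<close>)
    then show "g * h \<in> ?Z" by simp
  qed
  then show "g \<in> W \<Longrightarrow> balanced \<H> V T.\<Xi>\<^sub>0 (\<iota> (G_gen g)) (\<rho> (grp g))" by blast
  let ?Z' = "{g. balanced \<N> V T.\<Psi>\<^sub>0 (\<kappa> (G_gen g)) (\<rho> (J (grp g)))}"
  have "\<mu>W \<subseteq> ?Z'"
  proof (rule \<mu>W.monomial_group_generated)
    show "\<exists>s\<in>sign_vec n. mono_mat n (Transposition.transpose i (Suc i)) s \<in> ?Z' \<inter> \<mu>W" if i: "Suc i < n" for i
      using monomial_\<sigma>[OF i] sb_transfer(2)[OF i] refl_facts(3)[OF i] by (metis (no_types, lifting) IntI mem_Collect_eq)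
    show "\<mu>W \<inter> sign_diag n \<subseteq> ?Z'" using diag_transfer(2) diagonal_W_mu[OF p, of n] by blast
    fix g h assume z: "g \<in> ?Z'" "h \<in> ?Z'" and g: "g \<in> \<mu>W" and h: "h \<in> \<mu>W"
    note c = J_closed[OF grp_GA[OF \<mu>W_B[OF g]], of 1] J_closed[OF grp_GA[OF \<mu>W_B[OF h]], of 1]
    have "balanced \<N> V T.\<Psi>\<^sub>0 (\<kappa> (G_gen (g * h))) (\<rho> (J (grp (g * h))))"
      unfolding N_group_mult[OF g h, symmetric]
      by (rule balanced_cong[OF balanced_mult[OF N.calg_P, of _ _ V "\<rho> (J (grp h))" _ "\<rho> (J (grp g))"]])
        (use z g h in \<open>simp_all add: \<kappa>_closed \<rho>_closed[OF c(2)] J_group \<mu>W_B \<rho>_mult[OF c]\<close>)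
    then show "g * h \<in> ?Z'" by simp
  qed
  then show "h \<in> \<mu>W \<Longrightarrow> balanced \<N> V T.\<Psi>\<^sub>0 (\<kappa> (G_gen h)) (\<rho> (J (grp h)))" by blast
qed

lemma standard_modules_isomorphic:
  "alg_module_isomorphic \<N> L.M (\<lambda>a. T.tact (\<phi> a)) R.M T.act'"
proof (rule T.twisted_tensor_isomorphic)
  show "\<forall>(b, \<beta>)\<in>\<Gamma>. balanced \<H> V T.\<Xi>\<^sub>0 b \<beta>"
    using X_transfer(1) balanced_cong[OF G_transfer \<tau>_grp[symmetric]] unfolding \<Gamma>_def by auto
  show "\<forall>(b, \<beta>)\<in>\<Gamma>'. balanced \<N> V T.\<Psi>\<^sub>0 b \<beta>"
    using X_transfer(2) balanced_cong[OF G_transfer' \<tau>_J[symmetric]] unfolding \<Gamma>'_def by auto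
qed

end

theorem proposition4p6:
  fixes n p :: nat
    and c1 cm1 cb1 cbm1 :: complex
    and V :: "(complex, 'v) module"
    and \<tau> \<rho> :: "(complex mat \<Rightarrow>\<^sub>0 complex) \<Rightarrow> 'v \<Rightarrow> 'v"
    and J :: "(complex mat \<Rightarrow>\<^sub>0 complex) \<Rightarrow> (complex mat \<Rightarrow>\<^sub>0 complex)"
    and \<phi> :: "pres \<Rightarrow> pres"
  assumes n: "n \<ge> 1" and p: "p \<in> {1, 2}"
    and c1: "c1 = - cb1" and cm1: "p = 1 \<Longrightarrow> cm1 = - cbm1"
    (* tau is a simple module over W = G(2,p,n); rho is tau itself if p = 1, and one of the
       extensions of tau to B_n if p = 2 *)
    and \<tau>: "simple_alg_module (monoid_alg (mat_group n (Gmpn 2 p n))) V \<tau>"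
    and \<rho>: "alg_module (monoid_alg (B_group n)) V \<rho>"
    and \<rho>_extends: "\<forall>a\<in>carrier (monoid_alg (mat_group n (Gmpn 2 p n))). \<forall>v\<in>carrier V. \<rho> a v = \<tau> a v"
    and bipartition: "p = 2 \<Longrightarrow> \<exists>a b \<alpha> \<beta>. a + b = n \<and> is_partition a \<alpha> \<and> is_partition b \<beta> \<and>
           \<alpha> \<noteq> \<beta> \<and> has_character (B_group n) V \<rho> (B_char a b \<alpha> \<beta>)"
    and J: "J \<in> alg_iso (monoid_alg (B_group n)) (monoid_alg (B_group n))"
    and J_t: "\<forall>i<n. J (grp (t_refl n i)) = grp (t_refl n i)"
    and J_s: "\<forall>i. Suc i < n \<longrightarrow>
           J (grp (s_refl n i (Suc i) 1)) =
             grp (s_refl n i (Suc i) 1) \<otimes>\<^bsub>monoid_alg (B_group n)\<^esub>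
             (Poly_Mapping.single (t_refl n i) ((1 - \<i>) / 2)
              + Poly_Mapping.single (t_refl n (Suc i)) ((1 + \<i>) / 2))"
    and \<phi>: "\<phi> \<in> alg_iso (nbca p n cb1 cbm1) (rca_twisted p n c1 cm1)"
    and \<phi>_\<sigma>: "\<forall>i. Suc i < n \<longrightarrow>
           \<phi> (nbca_gen p n cb1 cbm1 (G_gen (sigma_refl n i (Suc i) 1)))
             = rca_gen p n c1 cm1 (G_gen (s_refl n i (Suc i) (- 1)))"
    and \<phi>_diag: "\<forall>g\<in>mu p n. diagonal_mat g \<longrightarrow>
           \<phi> (nbca_gen p n cb1 cbm1 (G_gen g)) = rca_gen p n c1 cm1 (G_gen g)"
    and \<phi>_x: "\<forall>j<n. \<phi> (nbca_gen p n cb1 cbm1 (X_gen j)) = rca_gen p n c1 cm1 (X_gen j)"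
    and \<phi>_y: "\<forall>j<n. \<phi> (nbca_gen p n cb1 cbm1 (Y_gen j)) = rca_gen p n c1 cm1 (Y_gen j)"
  shows "alg_module_isomorphic (nbca p n cb1 cbm1)
           (rca_std p n c1 cm1 V \<tau>)
           (\<lambda>a. twisted_act n (T_on_rca p n c1 cm1)
                  (rca_std p n c1 cm1 V \<tau>) (T_on_rca_std p n c1 cm1 V \<tau> \<rho>)
                  (rca_std_act p n c1 cm1 V \<tau>) (\<phi> a))
           (nbca_std p n cb1 cbm1 V (\<lambda>a. \<tau> (J a)))
           (nbca_std_act p n cb1 cbm1 V (\<lambda>a. \<tau> (J a)))"

proof -
  have \<tau>': "alg_module (monoid_alg (mat_group n (Gmpn 2 p n))) V \<tau>"
    using \<tau> unfolding simple_alg_module_def by blast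
  interpret C: cherednik_twist p n c1 cm1 cb1 cbm1 V \<tau> \<rho> J \<phi>
    by (intro cherednik_twist.intro rational_cherednik.intro cherednik_twist_axioms.intro
        p \<tau>' \<rho> \<rho>_extends J J_t J_s \<phi> \<phi>_\<sigma> \<phi>_diag \<phi>_x)
  have T: "T_on_rca_std p n c1 cm1 V \<tau> \<rho> =
      (\<lambda>h. tensor_map (rca p n c1 cm1) V (subalg_action (rca p n c1 cm1) V C.\<Gamma>) (C.T\<H> h) (\<rho> (grp h)))"
    by (simp add: fun_eq_iff T_on_rca_std_def rca_std_action_def std_action_def C.\<Gamma>_def)
  show ?thesis
    using C.standard_modules_isomorphic
    unfolding T rca_std_def rca_std_act_def nbca_std_def nbca_std_act_def rca_std_action_def
      nbca_std_action_def std_action_def C.\<Gamma>_def C.\<Gamma>'_def twisted_act_twisted .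
qed

end
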